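(* Let $d\ge 1$ and let $\sigma:\mathbb{R}\to\mathbb{R}$ be an activation function. Suppose that the coefficients $A,c$, the source $f$ and $\sigma$ satisfy Assumptions (Coeff), (Act), (Barron-Coeff), (Mult) and (Deriv) stated in the context, and let $u^*\in H^1(\mathbb{R}^d)$ be the unique weak solution of $-\nabla\cdot(A\nabla u)+cu=f$ on $\mathbb{R}^d$. Then for any $\epsilon\in(0,1/2)$ there exists $u\in\mathcal{B}^1_R(\mathbb{R}^d)$ with $$R\le \gamma_1\left(\frac1\epsilon\right)^{\gamma_2}\quad\text{and}\quad \|u\|_{\mathcal{B}^1_R(\mathbb{R}^d)}\le \beta_1\left(\frac d\epsilon\right)^{\beta_2|\ln\epsilon|}$$ such that $\|u-u^*\|_{H^1(\mathbb{R}^d)}\le\epsilon$. Here $\gamma_1,\gamma_2,\beta_1,\beta_2$ depend only on $\|f\|_{H^{-1}(\mathbb{R}^d)}$ and on the constants in Assumptions (Coeff), (Barron-Coeff), (Mult), (Deriv), i.e. on $a_{\min},a_{\max},c_{\min},c_{\max}$, $R_A,R_c,R_f,\ell_A,\ell_c,\ell_f$, $R_m,\ell_m$, $R_{d,1},R_{d,2},\ell_{d,1},\ell_{d,2}$. Furthermore, if $\sigma=\cos$, then $\|u-u^*\|_{H^1(\mathbb{R}^d)}\le\epsilon$ can be achieved with $R\le\gamma_1'|\ln\epsilon|$ and $\|u\|_{\mathcal{B}^1_R(\mathbb{R}^d)}\le\beta_1' d^{\beta_2'|\ln\epsilon|}$, where $\gamma_1',\beta_1',\beta_2'$ depend only on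 $\|f\|_{H^{-1}(\mathbb{R}^d)}$ and on the constants in Assumptions (Coeff) and (Barron-Coeff), i.e. on $a_{\min},a_{\max},c_{\min},c_{\max}$, $R_A,R_c,R_f,\ell_A,\ell_c,\ell_f$.
   Context: Notation: $\|v\|$ is the Euclidean norm of a vector, $\|M\|$ the operator norm of a matrix, $\overline{B}^d_R=\{x\in\mathbb{R}^d:\|x\|\le R\}$ (with $\overline{B}^d_{+\infty}=\mathbb{R}^d$). $H^{-1}(\mathbb{R}^d)$ is the dual of $H^1(\mathbb{R}^d)$ with the dual norm. Barron norm and space (relative to a fixed activation $\sigma$): for $\Omega\subset\mathbb{R}^n$, $R\in[0,+\infty]$, $p\in[1,+\infty]$ and $g:\Omega\to\mathbb{R}$, $$\|g\|_{\mathcal{B}^p_R(\Omega)}=\inf_\rho\left(\int|a|^p\,\rho(da,dw,db)\right)^{1/p},$$ the infimum being over probability measures $\rho$ on $\mathbb{R}\times\mathbb{R}^n\times\mathbb{R}$ supported on $\mathbb{R}\times\overline{B}^n_R\times\mathbb{R}$ with $g(x)=\int a\,\sigma(w^\top x+b)\,\rho(da,dw,db)$ for all $x\in\Omega$ (for $p=\infty$ the quantity is the $\rho$-essential supremum of $|a|$; the infimum of the empty set is $+\infty$). $\mathcal{B}^p_R(\Omega)=\{g:\|g\|_{\mathcal{B}^p_R(\Omega)}<\infty\}$. Assumption (Coeff): $A(x)=(A_{ij}(x))_{1\le i,j\le d}$ is symmetric with $\|A(x)\|\le a_{\max}<\infty$ and, for some $a_{\min}>0$, $\xi^\top A(x)\xi\ge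 a_{\min}\|\xi\|^2$ for all $x,\xi\in\mathbb{R}^d$; $0<c_{\min}\le c(x)\le c_{\max}<\infty$; and $f\in L^2(\mathbb{R}^d)$. Under this assumption there is a unique weak solution $u^*\in H^1(\mathbb{R}^d)$, i.e. $\int A\nabla u^*\cdot\nabla v\,dx+\int cu^*v\,dx=\int fv\,dx$ for all $v\in H^1(\mathbb{R}^d)$. Assumption (Act): $\sigma$ is smooth with $C_0:=\sup|\sigma|<\infty$, $C_1:=\sup|\sigma'|<\infty$ and $\sup|\sigma''|<\infty$. Assumption (Barron-Coeff): for some $R_A,R_c,R_f\in(0,+\infty)$, $\ell_A:=\max_{1\le i,j\le d}\|A_{ij}\|_{\mathcal{B}^1_{R_A}(\mathbb{R}^d)}<\infty$, $\ell_c:=\|c\|_{\mathcal{B}^1_{R_c}(\mathbb{R}^d)}<\infty$, $\ell_f:=\|f\|_{\mathcal{B}^1_{R_f}(\mathbb{R}^d)}<\infty$. Assumption (Mult): the function $h:\mathbb{R}^2\to\mathbb{R}$, $h(y_1,y_2)=\sigma(y_1)\sigma(y_2)$, satisfies $\ell_m:=\|h\|_{\mathcal{B}^1_{R_m}(\mathbb{R}^2)}<\infty$ for some $R_m\in(0,+\infty)$. Assumption (Deriv): $\ell_{d,1}:=\|\sigma'\|_{\mathcal{B}^1_{R_{d,1}}(\mathbb{R})}<\infty$ and $\ell_{d,2}:=\|\sigma''\|_{\mathcal{B}^1_{R_{d,2}}(\mathbb{R})}<\infty$ for some $R_{d,1},R_{d,2}\in(0,+\infty)$ (the subscript $d$ here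 is a label, not the dimension). *)

theory Defs
  imports "HOL-Probability.Probability"
begin

section \<open>Euclidean space of variable dimension\<close>

text \<open>
  The constants in the theorem are uniform in the dimension \<open>d\<close>, so \<open>d\<close> has to be a term and not a
  type: a point of \<open>\<real>\<^sup>d\<close> is a function \<open>nat \<Rightarrow> real\<close> whose coordinates are those with index \<open>< d\<close>
  and which is \<open>undefined\<close> elsewhere. Functions on \<open>\<real>\<^sup>d\<close> are HOL functions on \<open>nat \<Rightarrow> real\<close> of
  which only the values on \<open>euclid d\<close> matter. On \<open>euclid d\<close> the product topology
  of \<open>nat \<Rightarrow> real\<close> is the usual topology of \<open>\<real>\<^sup>d\<close>.
\<close>

type_synonym vec = "nat \<Rightarrow> real"

abbreviation euclid :: "nat \<Rightarrow> vec set" where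
  "euclid d \<equiv> {..<d} \<rightarrow>\<^sub>E UNIV"

definition leb :: "nat \<Rightarrow> vec measure" where
  "leb d = (\<Pi>\<^sub>M i\<in>{..<d}. lborel)"

abbreviation vnorm :: "nat \<Rightarrow> vec \<Rightarrow> real" where
  "vnorm d x \<equiv> L2_set x {..<d}"

definition vdot :: "nat \<Rightarrow> vec \<Rightarrow> vec \<Rightarrow> real" where
  "vdot d x y = (\<Sum>i<d. x i * y i)"

definition mat_vec :: "nat \<Rightarrow> (nat \<Rightarrow> nat \<Rightarrow> real) \<Rightarrow> vec \<Rightarrow> vec" where
  "mat_vec d M x = (\<lambda>i\<in>{..<d}. \<Sum>j<d. M i j * x j)"

definition op_norm :: "nat \<Rightarrow> (nat \<Rightarrow> nat \<Rightarrow> real) \<Rightarrow> real" where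
  "op_norm d M = (SUP x\<in>{x\<in>euclid d. vnorm d x \<le> 1}. vnorm d (mat_vec d M x))"


section \<open>Sobolev spaces\<close>

definition partial :: "nat \<Rightarrow> (vec \<Rightarrow> real) \<Rightarrow> vec \<Rightarrow> real" where
  "partial i \<phi> x = deriv (\<lambda>t. \<phi> (x(i := t))) (x i)"

text \<open>
  Smoothness: all iterated partial derivatives exist and are continuous. The multi-index \<open>is\<close>
  is the list of the successive directions of differentiation.
\<close>

definition smooth :: "nat \<Rightarrow> (vec \<Rightarrow> real) \<Rightarrow> bool" where
  "smooth d \<phi> \<longleftrightarrow> (\<forall>is\<in>lists {..<d}.
     continuous_on (euclid d) (foldr partial is \<phi>) \<and>
     (\<forall>i<d. \<forall>x\<in>euclid d. (\<lambda>t. foldr partial is \<phi> (x(i := t))) differentiable (at (x i))))"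

text \<open>Compact support is expressed as vanishing outside a ball.\<close>

definition test_fun :: "nat \<Rightarrow> (vec \<Rightarrow> real) set" where
  "test_fun d = {\<phi>. smooth d \<phi> \<and> (\<exists>r. \<forall>x\<in>euclid d. vnorm d x > r \<longrightarrow> \<phi> x = 0)}"

definition L2 :: "nat \<Rightarrow> (vec \<Rightarrow> real) set" where
  "L2 d = {v \<in> borel_measurable (leb d). integrable (leb d) (\<lambda>x. (v x)\<^sup>2)}"

text \<open>\<open>g\<close> is a weak \<open>i\<close>-th partial derivative of \<open>v\<close>; used for \<open>v, g \<in> L2 d\<close> only.\<close>

definition weak_partial :: "nat \<Rightarrow> nat \<Rightarrow> (vec \<Rightarrow> real) \<Rightarrow> (vec \<Rightarrow> real) \<Rightarrow> bool" where
  "weak_partial d i v g \<longleftrightarrow> (\<forall>\<phi>\<in>test_fun d.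
     (\<integral>x. v x * partial i \<phi> x \<partial>leb d) = - (\<integral>x. g x * \<phi> x \<partial>leb d))"

definition H1 :: "nat \<Rightarrow> (vec \<Rightarrow> real) set" where
  "H1 d = {v \<in> L2 d. \<forall>i<d. \<exists>g\<in>L2 d. weak_partial d i v g}"

text \<open>
  A representative of the weak derivative, which is unique up to a null set; everything below
  uses it under an integral only.
\<close>

definition wpartial :: "nat \<Rightarrow> nat \<Rightarrow> (vec \<Rightarrow> real) \<Rightarrow> vec \<Rightarrow> real" where
  "wpartial d i v = (SOME g. g \<in> L2 d \<and> weak_partial d i v g)"

definition H1_norm :: "nat \<Rightarrow> (vec \<Rightarrow> real) \<Rightarrow> real" where
  "H1_norm d v = sqrt ((\<integral>x. (v x)\<^sup>2 \<partial>leb d) + (\<Sum>i<d. \<integral>x. (wpartial d i v x)\<^sup>2 \<partial>leb d))"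

text \<open>
  Dual norm of the functional \<open>v \<mapsto> \<integral> f v\<close> on \<open>H1\<close>. For \<open>f \<in> L2 d\<close> the supremum is over a
  nonempty set bounded by the \<open>L2\<close>-norm of \<open>f\<close>.
\<close>

definition Hminus1_norm :: "nat \<Rightarrow> (vec \<Rightarrow> real) \<Rightarrow> real" where
  "Hminus1_norm d f = (SUP v\<in>{v\<in>H1 d. H1_norm d v \<le> 1}. \<bar>\<integral>x. f x * v x \<partial>leb d\<bar>)"

definition weak_solution ::
  "nat \<Rightarrow> (vec \<Rightarrow> nat \<Rightarrow> nat \<Rightarrow> real) \<Rightarrow> (vec \<Rightarrow> real) \<Rightarrow> (vec \<Rightarrow> real) \<Rightarrow> (vec \<Rightarrow> real) \<Rightarrow> bool"
where
  "weak_solution d A c f u \<longleftrightarrow> u \<in> H1 d \<and> (\<forall>v\<in>H1 d.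
     (\<integral>x. vdot d (mat_vec d (A x) (\<lambda>j. wpartial d j u x)) (\<lambda>i. wpartial d i v x) \<partial>leb d)
       + (\<integral>x. c x * u x * v x \<partial>leb d)
     = (\<integral>x. f x * v x \<partial>leb d))"


section \<open>Barron spaces\<close>

text \<open>
  The probability measures that represent \<open>g\<close> on \<open>\<Omega> \<subseteq> \<real>\<^sup>n\<close>. As the closed ball is a closed set,
  being supported on it means giving full measure to it. Representability includes
  convergence of the integral, since the Bochner integral is total.
\<close>

definition barron_reps ::
  "(real \<Rightarrow> real) \<Rightarrow> ennreal \<Rightarrow> nat \<Rightarrow> vec set \<Rightarrow> (vec \<Rightarrow> real) \<Rightarrow> (real \<times> vec \<times> real) measure set"
where
  "barron_reps \<sigma> R n \<Omega> g = {\<rho>. prob_space \<rho> \<and>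
     sets \<rho> = sets (borel \<Otimes>\<^sub>M (\<Pi>\<^sub>M i\<in>{..<n}. borel) \<Otimes>\<^sub>M borel) \<and>
     (AE (a, w, b) in \<rho>. ennreal (vnorm n w) \<le> R) \<and>
     (\<forall>x\<in>\<Omega>. integrable \<rho> (\<lambda>(a, w, b). a * \<sigma> (vdot n w x + b)) \<and>
            g x = (\<integral>(a, w, b). a * \<sigma> (vdot n w x + b) \<partial>\<rho>))}"

text \<open>The \<open>L\<^sup>p(\<rho>)\<close>-norm of the outer weight \<open>a\<close>, for \<open>1 \<le> p \<le> \<infinity>\<close>.\<close>

definition weight_norm :: "ennreal \<Rightarrow> (real \<times> vec \<times> real) measure \<Rightarrow> ennreal" where
  "weight_norm p \<rho> =
     (if p = \<infinity> then esssup \<rho> (\<lambda>(a, w, b). ennreal \<bar>a\<bar>)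
      else let I = (\<integral>\<^sup>+ (a, w, b). ennreal (\<bar>a\<bar> powr enn2real p) \<partial>\<rho>)
           in if I = \<infinity> then \<infinity> else ennreal (enn2real I powr (1 / enn2real p)))"

lemma weight_norm_1: "weight_norm 1 \<rho> = (\<integral>\<^sup>+ (a, w, b). ennreal \<bar>a\<bar> \<partial>\<rho>)"
  by (simp add: weight_norm_def Let_def ennreal_enn2real_if)

definition barron_norm ::
  "(real \<Rightarrow> real) \<Rightarrow> ennreal \<Rightarrow> ennreal \<Rightarrow> nat \<Rightarrow> vec set \<Rightarrow> (vec \<Rightarrow> real) \<Rightarrow> ennreal"
where
  "barron_norm \<sigma> p R n \<Omega> g = (INF \<rho>\<in>barron_reps \<sigma> R n \<Omega> g. weight_norm p \<rho>)"

definition barron_space ::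
  "(real \<Rightarrow> real) \<Rightarrow> ennreal \<Rightarrow> ennreal \<Rightarrow> nat \<Rightarrow> vec set \<Rightarrow> (vec \<Rightarrow> real) set"
where
  "barron_space \<sigma> p R n \<Omega> = {g. barron_norm \<sigma> p R n \<Omega> g < \<infinity>}"


section \<open>Assumptions\<close>

text \<open>
  Hypotheses of the form \<open>0 \<le> l \<and> barron_norm \<dots> = ennreal l\<close> say that the norm is
  finite and that \<open>l\<close> is its value.
\<close>

definition Coeff ::
  "nat \<Rightarrow> (vec \<Rightarrow> nat \<Rightarrow> nat \<Rightarrow> real) \<Rightarrow> (vec \<Rightarrow> real) \<Rightarrow> (vec \<Rightarrow> real) \<Rightarrow>
   real \<Rightarrow> real \<Rightarrow> real \<Rightarrow> real \<Rightarrow> bool"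
where
  "Coeff d A c f amin amax cmin cmax \<longleftrightarrow>
     (\<forall>x\<in>euclid d. \<forall>i<d. \<forall>j<d. A x i j = A x j i) \<and>
     (\<forall>x\<in>euclid d. op_norm d (A x) \<le> amax) \<and>
     0 < amin \<and>
     (\<forall>x\<in>euclid d. \<forall>\<xi>\<in>euclid d. vdot d \<xi> (mat_vec d (A x) \<xi>) \<ge> amin * (vnorm d \<xi>)\<^sup>2) \<and>
     0 < cmin \<and>
     (\<forall>x\<in>euclid d. cmin \<le> c x \<and> c x \<le> cmax) \<and>
     f \<in> L2 d"

definition Act :: "(real \<Rightarrow> real) \<Rightarrow> bool" where
  "Act \<sigma> \<longleftrightarrow>
     (\<forall>k x. (deriv ^^ k) \<sigma> differentiable (at x)) \<and>
     bounded (range \<sigma>) \<and> bounded (range (deriv \<sigma>)) \<and> bounded (range (deriv (deriv \<sigma>)))"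

definition Barron_Coeff ::
  "(real \<Rightarrow> real) \<Rightarrow> nat \<Rightarrow> (vec \<Rightarrow> nat \<Rightarrow> nat \<Rightarrow> real) \<Rightarrow> (vec \<Rightarrow> real) \<Rightarrow> (vec \<Rightarrow> real) \<Rightarrow>
   real \<Rightarrow> real \<Rightarrow> real \<Rightarrow> real \<Rightarrow> real \<Rightarrow> real \<Rightarrow> bool"
where
  "Barron_Coeff \<sigma> d A c f RA Rc Rf lA lc lf \<longleftrightarrow>
     0 < RA \<and> 0 < Rc \<and> 0 < Rf \<and> 0 \<le> lA \<and> 0 \<le> lc \<and> 0 \<le> lf \<and>
     Max ((\<lambda>(i, j). barron_norm \<sigma> 1 (ennreal RA) d (euclid d) (\<lambda>x. A x i j)) ` ({..<d} \<times> {..<d}))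
       = ennreal lA \<and>
     barron_norm \<sigma> 1 (ennreal Rc) d (euclid d) c = ennreal lc \<and>
     barron_norm \<sigma> 1 (ennreal Rf) d (euclid d) f = ennreal lf"

text \<open>A function on \<open>\<real>\<^sup>2\<close> has the arguments \<open>y 0, y 1\<close>, a function on \<open>\<real>\<close> the argument \<open>y 0\<close>.\<close>

definition Mult :: "(real \<Rightarrow> real) \<Rightarrow> real \<Rightarrow> real \<Rightarrow> bool" where
  "Mult \<sigma> Rm lm \<longleftrightarrow> 0 < Rm \<and> 0 \<le> lm \<and>
     barron_norm \<sigma> 1 (ennreal Rm) 2 (euclid 2) (\<lambda>y. \<sigma> (y 0) * \<sigma> (y 1)) = ennreal lm"

definition Deriv :: "(real \<Rightarrow> real) \<Rightarrow> real \<Rightarrow> real \<Rightarrow> real \<Rightarrow> real \<Rightarrow> bool" where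
  "Deriv \<sigma> Rd1 Rd2 ld1 ld2 \<longleftrightarrow> 0 < Rd1 \<and> 0 < Rd2 \<and> 0 \<le> ld1 \<and> 0 \<le> ld2 \<and>
     barron_norm \<sigma> 1 (ennreal Rd1) 1 (euclid 1) (\<lambda>y. deriv \<sigma> (y 0)) = ennreal ld1 \<and>
     barron_norm \<sigma> 1 (ennreal Rd2) 1 (euclid 1) (\<lambda>y. deriv (deriv \<sigma>) (y 0)) = ennreal ld2"

end

theory Submission
  imports Defs "HOL-Real_Asymp.Real_Asymp"
begin

text \<open>
  With \<open>m = min amin cmin\<close>, \<open>M\<close> a bound of the bilinear form and \<open>P = (1 - \<Delta>)\<^sup>-\<^sup>1\<close>, the iteration
  \<open>u \<mapsto> u - m / M\<^sup>2 \<cdot> P (c u - \<nabla> \<cdot> (A \<nabla> u) - f)\<close> started at \<open>0\<close> contracts the \<open>H1\<close>-distance to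
  \<open>us\<close> by a factor independent of the dimension, so \<open>O (\<bar>ln \<epsilon>\<bar>)\<close> steps suffice. All iterates are
  Barron functions: products and derivatives of the activation are Barron by hypothesis, and on a ridge
  function \<open>P\<close> is an average over shifts along the ridge with a Laplace distribution. Barron functions
  need not decay, so that \<open>P g\<close> lies in \<open>H1\<close> is derived from an energy estimate with an integrable
  weight that is removed in the limit.

  For the cosine, \<open>P\<close> multiplies a wave of frequency \<open>W\<close> by \<open>1 / (1 + \<bar>W\<bar>\<^sup>2)\<close>, which absorbs the
  derivatives; one step therefore multiplies the norm only by a constant times \<open>d\<^sup>2\<close>. If \<open>d = 1\<close> the norm
  has to stay bounded as \<open>\<epsilon>\<close> tends to \<open>0\<close>: the iterate is multiplied by a slowly varying band-limited
  taper, whereupon its Fourier transform is a function, and Plancherel's inequality bounds the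
  \<open>L1\<close>-norm of the latter by the \<open>H1\<close>-norm.
\<close>

section \<open>Smooth functions of one variable\<close>

text \<open>If \<open>e\<close> is the error and \<open>L\<close> the elliptic operator, a step maps
  \<open>e\<close> to \<open>e - \<alpha> P L e\<close>. In the H1 inner product \<open>P L\<close>
  is coercive with constant \<open>m\<close> and has norm at most \<open>M\<close>, so the squared
  norm is multiplied by at most \<open>1 - 2 \<alpha> m + \<alpha>^2 M^2\<close>, which is least at
  \<open>\<alpha> = m / M^2\<close>. Without \<open>P\<close> the operator would be unbounded and no
  step size would work. The bounds have the shape of a recursion. In general a product or a
  derivative multiplies the radius by a constant, so after \<open>T\<close> steps it is a power
  \<open>K^T\<close>, and each step multiplies the norm by \<open>d^2\<close> and the square of the
  radius; the resulting \<open>T^2\<close> in the exponent becomes a power of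
  \<open>d / \<epsilon>\<close> with exponent of order \<open>|ln \<epsilon>|\<close>. For the
  cosine the radius of the iterate stays out of the growth factor, leaving \<open>(E d^2)^T\<close>.
  The constant \<open>E\<close> is bounded by a power of \<open>d\<close> unless
  \<open>d = 1\<close>, where the claimed bound is constant although the iteration still yields
  \<open>E^T\<close>. The constants are fixed before dimension and coefficients, hence computed from
  the given numbers alone. Barron norms are infima, so each given norm is enlarged by 1 to obtain a
  representation.\<close>

definition smooth1 :: "(real \<Rightarrow> real) \<Rightarrow> bool" where
  "smooth1 f \<longleftrightarrow> (\<forall>k x. (deriv ^^ k) f differentiable (at x))"

text \<open>Iterated derivatives rarely have a usable closed form, but a class of differentiable
  functions that \<open>deriv\<close> does not leave contains them all. Smoothness proofs thereby
  reduce to finding such a class.\<close>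

lemma smooth1_coinduct:
  assumes "f \<in> S" and "\<And>g x. g \<in> S \<Longrightarrow> g differentiable (at x)" and "\<And>g. g \<in> S \<Longrightarrow> deriv g \<in> S"
  shows "smooth1 f"
proof -
  have "(deriv ^^ k) f \<in> S" for k
    by (induction k) (use assms in auto)
  then show ?thesis
    using assms(2) by (auto simp: smooth1_def)
qed

lemma smooth1_differentiable: "smooth1 f \<Longrightarrow> f differentiable (at x)"
  unfolding smooth1_def by (metis funpow_0)

lemma smooth1_deriv: "smooth1 f \<Longrightarrow> smooth1 (deriv f)"
  unfolding smooth1_def by (metis comp_apply funpow_Suc_right)

lemma smooth1_DERIV: "smooth1 f \<Longrightarrow> (f has_real_derivative deriv f x) (at x)"
  using smooth1_differentiable DERIV_deriv_iff_real_differentiable by blast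

lemma smooth1_continuous: "smooth1 f \<Longrightarrow> continuous_on S f"
  by (meson DERIV_isCont continuous_at_imp_continuous_on smooth1_DERIV)

lemma smooth1_const: "smooth1 (\<lambda>x. c)"
  by (rule smooth1_coinduct[where S = "range (\<lambda>c x. c)"]) auto

text \<open>By Leibniz's rule products of smooth functions are not closed under
  \<open>deriv\<close>, whereas finite sums of such products are. Sums and products are therefore
  treated in one coinduction.\<close>

inductive_set alg1 :: "(real \<Rightarrow> real) set" where
  prod: "smooth1 f \<Longrightarrow> smooth1 g \<Longrightarrow> (\<lambda>x. f x * g x) \<in> alg1"
| add: "f \<in> alg1 \<Longrightarrow> g \<in> alg1 \<Longrightarrow> (\<lambda>x. f x + g x) \<in> alg1"

lemma alg1_deriv: "f \<in> alg1 \<Longrightarrow> (\<forall>x. f differentiable (at x)) \<and> deriv f \<in> alg1"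
proof (induction rule: alg1.induct)
  case (prod f g)
  have *: "((\<lambda>x. f x * g x) has_real_derivative (deriv f x * g x + deriv g x * f x)) (at x)" for x
    by (intro derivative_intros DERIV_mult smooth1_DERIV prod)
  have "deriv (\<lambda>x. f x * g x) = (\<lambda>x. deriv f x * g x + deriv g x * f x)"
    using * DERIV_imp_deriv by blast
  moreover have "(\<lambda>x. deriv f x * g x + deriv g x * f x) \<in> alg1"
    by (rule alg1.add[OF alg1.prod alg1.prod]; intro smooth1_deriv prod)
  ultimately show ?case
    using * real_differentiable_def by fastforce
next
  case (add f g)
  have *: "((\<lambda>x. f x + g x) has_real_derivative (deriv f x + deriv g x)) (at x)" for x
    using add.IH by (intro derivative_intros) (auto simp: DERIV_deriv_iff_real_differentiable)
  have "deriv (\<lambda>x. f x + g x) = (\<lambda>x. deriv f x + deriv g x)"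
    using * DERIV_imp_deriv by blast
  moreover have "(\<lambda>x. deriv f x + deriv g x) \<in> alg1"
    using add by (intro alg1.intros) auto
  ultimately show ?case
    using * real_differentiable_def by fastforce
qed

lemma alg1_smooth1: "f \<in> alg1 \<Longrightarrow> smooth1 f"
  by (rule smooth1_coinduct) (auto dest: alg1_deriv)

lemma smooth1_mult: "smooth1 f \<Longrightarrow> smooth1 g \<Longrightarrow> smooth1 (\<lambda>x. f x * g x)"
  by (rule alg1_smooth1[OF alg1.prod])

lemma smooth1_add:
  assumes "smooth1 f" "smooth1 g" shows "smooth1 (\<lambda>x. f x + g x)"
proof -
  have "(\<lambda>x. f x * 1 + g x * 1) \<in> alg1"
    by (rule alg1.add[OF alg1.prod alg1.prod]; intro assms smooth1_const)
  then show ?thesis using alg1_smooth1 by simp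
qed

lemma smooth1_affine:
  assumes "smooth1 f" shows "smooth1 (\<lambda>x. f (p * x + q))"
proof (rule smooth1_coinduct[where S = "{\<lambda>x. c * g (p * x + q) | c g. smooth1 g}"])
  show "(\<lambda>x. f (p * x + q)) \<in> {\<lambda>x. c * g (p * x + q) | c g. smooth1 g}"
    using assms by (intro CollectI exI[of _ 1] exI[of _ f]) auto
next
  fix h x assume "h \<in> {\<lambda>x. c * g (p * x + q) | c g. smooth1 g}"
  then obtain c g where h: "h = (\<lambda>x. c * g (p * x + q))" and g: "smooth1 g" by blast
  have *: "(h has_real_derivative (c * p) * deriv g (p * x + q)) (at x)" for x
    unfolding h
    by (rule DERIV_chain'[of "\<lambda>x. p * x + q" p x UNIV "\<lambda>y. c * g y" "c * deriv g (p*x+q)", THEN DERIV_cong])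
       (auto intro!: derivative_eq_intros smooth1_DERIV g)
  then show "h differentiable (at x)" using real_differentiable_def by blast
  have "deriv h = (\<lambda>x. (c * p) * deriv g (p * x + q))" using * DERIV_imp_deriv by blast
  then show "deriv h \<in> {\<lambda>x. c * g (p * x + q) | c g. smooth1 g}"
    using smooth1_deriv[OF g] by blast
qed

text \<open>The quotient rule raises the power of the denominator, so the invariant class consists
  of smooth numerators over all powers \<open>g ^ Suc k\<close>.\<close>

lemma smooth1_divide:
  assumes f: "smooth1 f" and g: "smooth1 g" and nz: "\<And>x. g x \<noteq> 0"
  shows "smooth1 (\<lambda>x. f x / g x)"
proof (rule smooth1_coinduct[where S = "{\<lambda>x. h x / g x ^ Suc k | h k. smooth1 h}"])
  show "(\<lambda>x. f x / g x) \<in> {\<lambda>x. h x / g x ^ Suc k | h k. smooth1 h}"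
    using f by (intro CollectI exI[of _ f] exI[of _ 0]) auto
next
  fix u x assume "u \<in> {\<lambda>x. h x / g x ^ Suc k | h k. smooth1 h}"
  then obtain h k where u: "u = (\<lambda>x. h x / g x ^ Suc k)" and h: "smooth1 h" by blast
  define h' where "h' = (\<lambda>x. deriv h x * g x + (- real (Suc k)) * (h x * deriv g x))"
  have *: "(u has_real_derivative h' x / g x ^ Suc (Suc k)) (at x)" for x
    unfolding u h'_def
    by (rule derivative_eq_intros smooth1_DERIV[OF h] smooth1_DERIV[OF g] refl | simp add: nz)+
       (simp add: nz divide_simps, simp add: algebra_simps)
  then show "u differentiable (at x)" using real_differentiable_def by blast
  have "deriv u = (\<lambda>x. h' x / g x ^ Suc (Suc k))" using * DERIV_imp_deriv by blast
  moreover have "smooth1 h'"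
    unfolding h'_def by (intro smooth1_add smooth1_mult smooth1_deriv h g smooth1_const)
  ultimately show "deriv u \<in> {\<lambda>x. h x / g x ^ Suc k | h k. smooth1 h}"
    by blast
qed

section \<open>A smooth step and a cutoff built from the flat function exp(-1/x)\<close>

definition flat :: "real poly \<Rightarrow> real \<Rightarrow> real" where
  "flat p x = (if x > 0 then poly p (1 / x) * exp (- (1 / x)) else 0)"

lemma poly_exp_tendsto_0: "((\<lambda>y::real. y ^ k * (poly p y * exp (- y))) \<longlongrightarrow> 0) at_top"
proof (induction p arbitrary: k)
  case (pCons a p)
  have "((\<lambda>y. a * (y ^ k / exp y) + y ^ Suc k * (poly p y * exp (- y))) \<longlongrightarrow> a * 0 + 0) at_top"
    by (intro tendsto_intros pCons.IH tendsto_power_div_exp_0)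
  then show ?case
    by (simp add: exp_minus field_simps)
qed simp

lemma flat_tendsto_0: "(flat p \<longlongrightarrow> 0) (at 0)"
proof -
  have "((\<lambda>x. poly p (1 / x) * exp (- (1 / x))) \<longlongrightarrow> 0) (at_right 0)"
    using filterlim_compose[OF poly_exp_tendsto_0[of 0 p] filterlim_inverse_at_top_right]
    by (simp add: inverse_eq_divide)
  then have "(flat p \<longlongrightarrow> 0) (at_right 0)"
    by (rule Lim_transform_eventually)
       (auto simp: flat_def eventually_at_right_less intro: eventually_mono[OF eventually_at_right_less])
  moreover have "(flat p \<longlongrightarrow> 0) (at_left 0)"
    by (rule Lim_transform_eventually[OF tendsto_const])
       (auto simp: flat_def eventually_at_filter)
  ultimately show ?thesis
    using filterlim_split_at by blast
qed

text \<open>With \<open>y = 1 / x\<close> the chain rule gives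
  \<open>y^2 (p - p')(y) exp (- y)\<close>, and \<open>[:0,0,1:]\<close> is the polynomial
  \<open>y^2\<close>. Carrying an arbitrary polynomial closes the family under
  differentiation.\<close>

lemma flat_DERIV:
  "(flat p has_real_derivative flat ([:0,0,1:] * (p - pderiv p)) x) (at x)"
proof -
  consider "x > 0" | "x = 0" | "x < 0" by linarith
  then show ?thesis
  proof cases
    case 1
    have "((\<lambda>x. poly p (1 / x) * exp (- (1 / x))) has_real_derivative
        flat ([:0,0,1:] * (p - pderiv p)) x) (at x)"
      using 1 by (auto intro!: derivative_eq_intros DERIV_chain'[OF _ poly_DERIV] simp: flat_def field_simps power2_eq_square)
    then show ?thesis
      by (rule has_field_derivative_transform_within_open[where S = "{0<..}"])
         (use 1 in \<open>auto simp: flat_def\<close>)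
  next
    case 2
    \<comment> \<open>A zero coefficient in front multiplies the polynomial by \<open>1 / x\<close>,
      so this is the limit of the difference quotient of \<open>flat p\<close> at 0.\<close>
    have "((\<lambda>y. flat (pCons 0 p) y) \<longlongrightarrow> 0) (at 0)"
      by (rule flat_tendsto_0)
    then have "((\<lambda>y. (flat p y - flat p 0) / (y - 0)) \<longlongrightarrow> 0) (at 0)"
      by (rule Lim_transform_eventually) (auto simp: flat_def eventually_at_filter)
    then show ?thesis
      using 2 by (simp add: has_field_derivative_iff flat_def)
  next
    case 3
    have "((\<lambda>x. 0) has_real_derivative flat ([:0,0,1:] * (p - pderiv p)) x) (at x)"
      using 3 by (auto simp: flat_def)
    then show ?thesis
      by (rule has_field_derivative_transform_within_open[where S = "{..<0}"])
         (use 3 in \<open>auto simp: flat_def\<close>)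
  qed
qed

lemma smooth1_flat: "smooth1 (flat p)"
proof (rule smooth1_coinduct[where S = "range flat"])
  fix g x assume "g \<in> range flat"
  then obtain p where g: "g = flat p" by blast
  show "g differentiable (at x)"
    unfolding g using flat_DERIV real_differentiable_def by blast
  have "deriv g = flat ([:0,0,1:] * (p - pderiv p))"
    unfolding g using flat_DERIV DERIV_imp_deriv by blast
  then show "deriv g \<in> range flat" by blast
qed simp

definition sstep :: "real \<Rightarrow> real" where
  "sstep x = flat 1 x / (flat 1 x + flat 1 (1 - x))"

lemma flat_one_pos: "x > 0 \<Longrightarrow> flat 1 x > 0" and flat_one_0: "x \<le> 0 \<Longrightarrow> flat 1 x = 0"
  and flat_one_nonneg: "flat 1 x \<ge> 0"
  by (auto simp: flat_def)

text \<open>\<open>x\<close> and \<open>1 - x\<close> cannot both be nonpositive, so one of the two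
  flat functions is positive.\<close>

lemma sstep_denom_pos: "flat 1 x + flat 1 (1 - x) > 0"
  using flat_one_pos[of x] flat_one_pos[of "1 - x"] flat_one_nonneg[of x] flat_one_nonneg[of "1 - x"]
  by (cases "x > 0") linarith+

lemma smooth1_sstep: "smooth1 sstep"
proof -
  have "smooth1 (\<lambda>x. flat 1 ((-1) * x + 1))"
    by (rule smooth1_affine[OF smooth1_flat])
  then have "smooth1 (\<lambda>x. flat 1 x / (flat 1 x + flat 1 (1 - x)))"
    using sstep_denom_pos
    by (intro smooth1_divide smooth1_flat smooth1_add) (auto simp: less_imp_neq[symmetric])
  then show ?thesis unfolding sstep_def[abs_def] .
qed

lemma sstep_0: "x \<le> 0 \<Longrightarrow> sstep x = 0"
  by (simp add: sstep_def flat_one_0)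

lemma sstep_1: "x \<ge> 1 \<Longrightarrow> sstep x = 1"
  using flat_one_pos[of x] by (simp add: sstep_def flat_one_0)

lemma sstep_bounds: "0 \<le> sstep x" "sstep x \<le> 1"
  using sstep_denom_pos[of x] flat_one_nonneg[of x] flat_one_nonneg[of "1 - x"]
  by (auto simp: sstep_def field_simps)

definition cutoff :: "real \<Rightarrow> real" where
  "cutoff x = sstep (x + 2) * sstep (2 - x)"

lemma smooth1_cutoff: "smooth1 cutoff"
proof -
  have "smooth1 (\<lambda>x. sstep (1 * x + 2) * sstep ((-1) * x + 2))"
    by (rule smooth1_mult[OF smooth1_affine smooth1_affine]; rule smooth1_sstep)
  then show ?thesis by (simp add: cutoff_def[abs_def])
qed

lemma cutoff_bounds: "0 \<le> cutoff x" "cutoff x \<le> 1"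
  unfolding cutoff_def by (auto intro!: mult_nonneg_nonneg mult_le_one sstep_bounds)

lemma cutoff_1: "\<bar>x\<bar> \<le> 1 \<Longrightarrow> cutoff x = 1"
  by (simp add: cutoff_def sstep_1)

lemma cutoff_0: "\<bar>x\<bar> \<ge> 2 \<Longrightarrow> cutoff x = 0"
  by (auto simp: cutoff_def sstep_0 abs_if split: if_splits)

lemma deriv_cutoff_bounded: "\<exists>C. \<forall>x. \<bar>deriv cutoff x\<bar> \<le> C"
proof -
  have "compact (deriv cutoff ` {-3..3})"
    by (intro compact_continuous_image smooth1_continuous smooth1_deriv smooth1_cutoff) simp
  then obtain C where C: "\<And>x. x \<in> {-3..3} \<Longrightarrow> \<bar>deriv cutoff x\<bar> \<le> C"
    by (metis bounded_iff compact_imp_bounded imageI real_norm_def)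
  have "deriv cutoff x = 0" if "x \<notin> {-3..3}" for x
  proof -
    have "((\<lambda>x. 0) has_real_derivative 0) (at x)" by simp
    then have "(cutoff has_real_derivative 0) (at x)"
      by (rule has_field_derivative_transform_within_open[where S = "{..<-2} \<union> {2<..}"])
         (use that in \<open>auto simp: cutoff_0\<close>)
    then show ?thesis by (rule DERIV_imp_deriv)
  qed
  then have "\<bar>deriv cutoff x\<bar> \<le> max C 0" for x
    using C[of x] by (cases "x \<in> {-3..3}") auto
  then show ?thesis by blast
qed

section \<open>Smooth functions of several variables\<close>

lemma euclid_upd: "x \<in> euclid d \<Longrightarrow> i < d \<Longrightarrow> x(i := t) \<in> euclid d"
  by (auto simp: PiE_def extensional_def)

lemma partial_DERIV:
  "((\<lambda>t. \<phi> (x(i := t))) has_real_derivative D) (at (x i)) \<Longrightarrow> partial i \<phi> x = D"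
  unfolding partial_def by (rule DERIV_imp_deriv)

lemma partial_cong:
  assumes "x \<in> euclid d" "i < d" "\<And>y. y \<in> euclid d \<Longrightarrow> \<phi> y = \<psi> y"
  shows "partial i \<phi> x = partial i \<psi> x"
  using assms by (simp add: partial_def euclid_upd)

text \<open>Functions are controlled on \<open>euclid d\<close> only, and \<open>partial\<close> may
  produce anything off this set. Closure of \<open>S\<close> is therefore asked up to equality on
  \<open>euclid d\<close>.\<close>

lemma smooth_coinduct:
  assumes "\<phi> \<in> S"
    and "\<And>\<psi>. \<psi> \<in> S \<Longrightarrow> continuous_on (euclid d) \<psi>"
    and diff: "\<And>\<psi> i x. \<psi> \<in> S \<Longrightarrow> i < d \<Longrightarrow> x \<in> euclid d \<Longrightarrow> (\<lambda>t. \<psi> (x(i := t))) differentiable (at (x i))"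
    and part: "\<And>\<psi> i. \<psi> \<in> S \<Longrightarrow> i < d \<Longrightarrow> \<exists>\<eta>\<in>S. \<forall>x\<in>euclid d. partial i \<psi> x = \<eta> x"
  shows "smooth d \<phi>"
proof -
  have *: "\<exists>\<eta>\<in>S. \<forall>x\<in>euclid d. foldr partial ks \<phi> x = \<eta> x" if "ks \<in> lists {..<d}" for ks
    using that
  proof (induction ks)
    case (Cons i ks)
    then obtain \<eta> where \<eta>: "\<eta> \<in> S" "\<forall>x\<in>euclid d. foldr partial ks \<phi> x = \<eta> x" by auto
    from Cons have i: "i < d" by auto
    obtain \<xi> where \<xi>: "\<xi> \<in> S" "\<forall>x\<in>euclid d. partial i \<eta> x = \<xi> x" using part[OF \<eta>(1) i] by blast
    have "foldr partial (i # ks) \<phi> x = \<xi> x" if "x \<in> euclid d" for x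
      using partial_cong[OF that i, of "foldr partial ks \<phi>" \<eta>] \<eta> \<xi> that by auto
    then show ?case using \<xi> by blast
  qed (use assms(1) in auto)
  show ?thesis
    unfolding smooth_def
  proof (intro ballI conjI allI impI)
    fix ks assume ks: "ks \<in> lists {..<d}"
    obtain \<eta> where \<eta>: "\<eta> \<in> S" "\<forall>x\<in>euclid d. foldr partial ks \<phi> x = \<eta> x" using *[OF ks] by blast
    show "continuous_on (euclid d) (foldr partial ks \<phi>)"
      by (rule iffD2[OF continuous_on_cong[OF refl] assms(2)[OF \<eta>(1)]]) (simp add: \<eta>(2))
    fix i x assume i: "i < d" "x \<in> euclid d"
    have "(\<lambda>t. foldr partial ks \<phi> (x(i := t))) = (\<lambda>t. \<eta> (x(i := t)))"
      by (rule ext, rule bspec[OF \<eta>(2)], rule euclid_upd[OF i(2,1)])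
    with diff[OF \<eta>(1) i]
    show "(\<lambda>t. foldr partial ks \<phi> (x(i := t))) differentiable (at (x i))"
      by simp
  qed
qed

lemma smooth_continuous: "smooth d \<phi> \<Longrightarrow> continuous_on (euclid d) \<phi>"
  using bspec[OF iffD1[OF smooth_def], of d \<phi> "[]"] by simp

lemma smooth_differentiable:
  assumes "smooth d \<phi>" "i < d" "x \<in> euclid d"
  shows "(\<lambda>t. \<phi> (x(i := t))) differentiable (at s)"
proof -
  have y: "x(i := s) \<in> euclid d" by (rule euclid_upd[OF assms(3,2)])
  have "\<forall>i<d. \<forall>x\<in>euclid d. (\<lambda>t. \<phi> (x(i := t))) differentiable (at (x i))"
    using bspec[OF assms(1)[unfolded smooth_def], of "[]"] by simp
  from this[rule_format, OF assms(2) y]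
  show ?thesis by simp
qed

lemma smooth_partial:
  assumes "smooth d \<phi>" "i < d" shows "smooth d (partial i \<phi>)"
  unfolding smooth_def
proof
  fix ks assume "ks \<in> lists {..<d}"
  then have *: "ks @ [i] \<in> lists {..<d}" using assms by auto
  show "continuous_on (euclid d) (foldr partial ks (partial i \<phi>)) \<and>
        (\<forall>ia<d. \<forall>x\<in>euclid d. (\<lambda>t. foldr partial ks (partial i \<phi>) (x(ia := t))) differentiable at (x ia))"
    using bspec[OF assms(1)[unfolded smooth_def] *] by simp
qed

lemma smooth_DERIV:
  assumes "smooth d \<phi>" "i < d" "x \<in> euclid d"
  shows "((\<lambda>t. \<phi> (x(i := t))) has_real_derivative partial i \<phi> (x(i := s))) (at s)"
  using smooth_differentiable[OF assms, of s]
  by (simp add: partial_def DERIV_deriv_iff_real_differentiable)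

lemma smooth_DERIV_at:
  assumes "smooth d \<phi>" "i < d" "x \<in> euclid d"
  shows "((\<lambda>t. \<phi> (x(i := t))) has_real_derivative partial i \<phi> x) (at (x i))"
  using smooth_DERIV[OF assms, of "x i"] by simp

lemma smooth_cong:
  assumes "smooth d \<phi>" "\<And>x. x \<in> euclid d \<Longrightarrow> \<phi> x = \<psi> x"
  shows "smooth d \<psi>"
proof (rule smooth_coinduct[where S = "{\<psi>. \<exists>\<phi>. smooth d \<phi> \<and> (\<forall>x\<in>euclid d. \<psi> x = \<phi> x)}"])
  show "\<psi> \<in> {\<psi>. \<exists>\<phi>. smooth d \<phi> \<and> (\<forall>x\<in>euclid d. \<psi> x = \<phi> x)}" using assms by force
next
  fix \<psi> assume "\<psi> \<in> {\<psi>. \<exists>\<phi>. smooth d \<phi> \<and> (\<forall>x\<in>euclid d. \<psi> x = \<phi> x)}"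
  then obtain \<phi> where \<phi>: "smooth d \<phi>" "\<And>x. x\<in>euclid d \<Longrightarrow> \<psi> x = \<phi> x" by auto
  show "continuous_on (euclid d) \<psi>"
    by (rule iffD2[OF continuous_on_cong[OF refl] smooth_continuous[OF \<phi>(1)]]) (simp add: \<phi>(2))
  fix i assume i: "i < d"
  { fix x assume x: "x \<in> euclid d"
    show "(\<lambda>t. \<psi> (x(i := t))) differentiable at (x i)"
      using smooth_differentiable[OF \<phi>(1) i x] \<phi>(2) euclid_upd[OF x i] by simp }
  show "\<exists>\<eta>\<in>{\<psi>. \<exists>\<phi>. smooth d \<phi> \<and> (\<forall>x\<in>euclid d. \<psi> x = \<phi> x)}. \<forall>x\<in>euclid d. partial i \<psi> x = \<eta> x"
    using smooth_partial[OF \<phi>(1) i] partial_cong[OF _ i, of _ \<psi> \<phi>] \<phi>(2) by (intro bexI[of _ "partial i \<phi>"]) auto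
qed

text \<open>The analogue of \<open>alg1\<close> in several variables, closed under partial
  derivatives up to equality on \<open>euclid d\<close>.\<close>

inductive_set alg :: "nat \<Rightarrow> (vec \<Rightarrow> real) set" for d where
  prod: "smooth d f \<Longrightarrow> smooth d g \<Longrightarrow> (\<lambda>x. f x * g x) \<in> alg d"
| add: "f \<in> alg d \<Longrightarrow> g \<in> alg d \<Longrightarrow> (\<lambda>x. f x + g x) \<in> alg d"

lemma alg_partial:
  "f \<in> alg d \<Longrightarrow> continuous_on (euclid d) f \<and> (\<forall>i<d. \<exists>\<eta>. \<eta> \<in> alg d \<and> (\<forall>x\<in>euclid d.
     ((\<lambda>t. f (x(i := t))) has_real_derivative \<eta> x) (at (x i))))"
proof (induction rule: alg.induct)
  case (prod f g)
  have "((\<lambda>t. f (x(i := t)) * g (x(i := t))) has_real_derivative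
           (partial i f x * g x + partial i g x * f x)) (at (x i))"
    if "i < d" "x \<in> euclid d" for i x
    using DERIV_mult[OF smooth_DERIV_at[OF prod(1) that] smooth_DERIV_at[OF prod(2) that]]
    by simp
  moreover have "(\<lambda>x. partial i f x * g x + partial i g x * f x) \<in> alg d" if "i < d" for i
    using that by (intro alg.add[OF alg.prod alg.prod] smooth_partial prod)
  moreover have "continuous_on (euclid d) (\<lambda>x. f x * g x)"
    by (intro continuous_intros smooth_continuous prod)
  ultimately show ?case
    by blast
next
  case (add f g)
  have "\<exists>\<eta>. \<eta> \<in> alg d \<and> (\<forall>x\<in>euclid d. ((\<lambda>t. f (x(i := t)) + g (x(i := t))) has_real_derivative \<eta> x) (at (x i)))"
    if i: "i < d" for i
  proof -
    from add.IH(1) i obtain \<eta> where 1: "\<eta> \<in> alg d"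
      "\<And>x. x\<in>euclid d \<Longrightarrow> ((\<lambda>t. f (x(i := t))) has_real_derivative \<eta> x) (at (x i))"
      by blast
    from add.IH(2) i obtain \<xi> where 2: "\<xi> \<in> alg d"
      "\<And>x. x\<in>euclid d \<Longrightarrow> ((\<lambda>t. g (x(i := t))) has_real_derivative \<xi> x) (at (x i))"
      by blast
    show ?thesis
      by (intro exI[of _ "\<lambda>x. \<eta> x + \<xi> x"] conjI ballI DERIV_add 1 2 alg.add)
  qed
  moreover have "continuous_on (euclid d) (\<lambda>x. f x + g x)"
    using add.IH by (intro continuous_on_add) blast+
  ultimately show ?case by blast
qed

lemma alg_smooth: "f \<in> alg d \<Longrightarrow> smooth d f"
proof (rule smooth_coinduct[where S = "alg d"])
  fix \<psi> i assume *: "\<psi> \<in> alg d" "i < d"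
  then obtain \<eta> where \<eta>: "\<eta> \<in> alg d"
    "\<And>x. x\<in>euclid d \<Longrightarrow> ((\<lambda>t. \<psi> (x(i := t))) has_real_derivative \<eta> x) (at (x i))"
    using alg_partial[OF *(1)] by blast
  show "\<exists>\<eta>\<in>alg d. \<forall>x\<in>euclid d. partial i \<psi> x = \<eta> x"
    using \<eta> partial_DERIV by blast
  show "(\<lambda>t. \<psi> (x(i := t))) differentiable at (x i)" if "x \<in> euclid d" for x
    using \<eta>(2)[OF that] real_differentiable_def by blast
qed (auto dest: alg_partial)

lemma smooth_mult: "smooth d f \<Longrightarrow> smooth d g \<Longrightarrow> smooth d (\<lambda>x. f x * g x)"
  by (rule alg_smooth[OF alg.prod])

lemma smooth_coord:
  assumes "smooth1 h" "i < d" shows "smooth d (\<lambda>x. h (x i))"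
proof (rule smooth_coinduct[where S = "{\<lambda>x. h (x i) | h. smooth1 h}"])
  fix \<psi> :: "vec \<Rightarrow> real" assume "\<psi> \<in> {\<lambda>x. h (x i) | h. smooth1 h}"
  then obtain h where \<psi>: "\<psi> = (\<lambda>x. h (x i))" and h: "smooth1 h" by blast
  show "continuous_on (euclid d) \<psi>"
    unfolding \<psi> by (rule continuous_on_compose2[OF smooth1_continuous[OF h, of UNIV]])
       (auto intro!: continuous_on_subset[OF continuous_on_product_coordinates])
  fix j :: nat assume "j < d"
  have *: "((\<lambda>t. \<psi> (x(j := t))) has_real_derivative (if j = i then deriv h (x i) else 0)) (at (x j))" for x
    using smooth1_DERIV[OF h] by (auto simp: \<psi>)
  show "(\<lambda>t. \<psi> (x(j := t))) differentiable at (x j)" for x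
    using * real_differentiable_def by blast
  have "(\<lambda>x. if j = i then deriv h (x i) else 0) \<in> {\<lambda>x. h (x i) | h. smooth1 h}"
  proof (cases "j = i")
    case True then show ?thesis using smooth1_deriv[OF h] by auto
  next
    case False then show ?thesis using smooth1_const[of 0] by auto
  qed
  then show "\<exists>\<eta>\<in>{\<lambda>x. h (x i) | h. smooth1 h}. \<forall>x\<in>euclid d. partial j \<psi> x = \<eta> x"
    by (rule bexI[rotated]) (intro ballI partial_DERIV *)
qed (use assms in auto)

lemma smooth_const: "smooth d (\<lambda>x. c)"
proof (rule smooth_coinduct[where S = "range (\<lambda>c x. c)"])
  fix \<psi> :: "vec \<Rightarrow> real" and i assume "\<psi> \<in> range (\<lambda>c x. c)"
  then obtain c where c: "\<psi> = (\<lambda>x. c)" by auto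
  show "continuous_on (euclid d) \<psi>" unfolding c by (rule continuous_on_const)
  have *: "((\<lambda>t. \<psi> (x(i := t))) has_real_derivative 0) (at (x i))" for x
    unfolding c by (rule DERIV_const)
  show "(\<lambda>t. \<psi> (x(i := t))) differentiable at (x i)" for x
    using * real_differentiable_def by blast
  show "\<exists>\<eta>\<in>range (\<lambda>c x. c). \<forall>x\<in>euclid d. partial i \<psi> x = \<eta> x"
    by (rule bexI[of _ "\<lambda>x. 0"]) (intro ballI partial_DERIV *, rule rangeI)
qed (rule rangeI)

lemma smooth_add:
  assumes f: "smooth d f" and g: "smooth d g" shows "smooth d (\<lambda>x. f x + g x)"
  using alg_smooth[OF alg.add[OF alg.prod[OF f smooth_const[of d 1]] alg.prod[OF g smooth_const[of d 1]]]]
  by simp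

lemma smooth_cmult: "smooth d f \<Longrightarrow> smooth d (\<lambda>x. c * f x)"
  by (rule smooth_mult[OF smooth_const])

lemma smooth_sum:
  assumes "\<And>i. i \<in> I \<Longrightarrow> smooth d (f i)"
  shows "smooth d (\<lambda>x. \<Sum>i\<in>I. f i x)"
  using assms
proof (induction I rule: infinite_finite_induct)
  case (insert i I)
  then have "smooth d (\<lambda>x. f i x + (\<Sum>i\<in>I. f i x))"
    by (intro smooth_add) blast+
  then show ?case using insert by simp
qed (simp_all add: smooth_const)

lemma smooth_prod:
  assumes "\<And>i. i \<in> I \<Longrightarrow> smooth d (f i)"
  shows "smooth d (\<lambda>x. \<Prod>i\<in>I. f i x)"
  using assms
proof (induction I rule: infinite_finite_induct)
  case (insert i I)
  then have "smooth d (\<lambda>x. f i x * (\<Prod>i\<in>I. f i x))"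
    by (intro smooth_mult) blast+
  then show ?case using insert by simp
qed (simp_all add: smooth_const)

lemma partial_mult:
  assumes "smooth d f" "smooth d g" "i < d" "x \<in> euclid d"
  shows "partial i (\<lambda>x. f x * g x) x = partial i f x * g x + f x * partial i g x"
  using DERIV_mult[OF smooth_DERIV_at[OF assms(1,3,4)] smooth_DERIV_at[OF assms(2,3,4)]]
  by (intro partial_DERIV) (simp add: mult.commute)

lemma partial_add:
  assumes "smooth d f" "smooth d g" "i < d" "x \<in> euclid d"
  shows "partial i (\<lambda>x. f x + g x) x = partial i f x + partial i g x"
  by (intro partial_DERIV DERIV_add smooth_DERIV_at[OF assms(1,3,4)] smooth_DERIV_at[OF assms(2,3,4)])

lemma partial_cmult:
  assumes "smooth d f" "i < d" "x \<in> euclid d"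
  shows "partial i (\<lambda>x. c * f x) x = c * partial i f x"
  by (intro partial_DERIV DERIV_cmult smooth_DERIV_at[OF assms])

lemma partial_sum:
  assumes "\<And>j. j \<in> I \<Longrightarrow> smooth d (f j)" "i < d" "x \<in> euclid d"
  shows "partial i (\<lambda>x. \<Sum>j\<in>I. f j x) x = (\<Sum>j\<in>I. partial i (f j) x)"
  by (intro partial_DERIV DERIV_sum smooth_DERIV_at[OF assms])

section \<open>Lebesgue measure on the product space\<close>

global_interpretation lebp: product_sigma_finite "\<lambda>_::nat. lborel :: real measure"
  by standard

lemma sigma_finite_leb: "sigma_finite_measure (leb d)"
  unfolding leb_def by (rule lebp.sigma_finite) simp

lemma space_leb: "space (leb d) = euclid d"
  by (simp add: leb_def space_PiM)

lemma sets_leb: "sets (leb d) = sets (\<Pi>\<^sub>M i\<in>{..<d}. borel)"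
  unfolding leb_def by (rule sets_PiM_cong) auto

lemma leb_component [measurable]: "i < d \<Longrightarrow> (\<lambda>x. x i) \<in> borel_measurable (leb d)"
  unfolding leb_def using measurable_component_singleton[of i "{..<d}" "\<lambda>_. lborel"] by simp

text \<open>Composition with a retraction onto \<open>euclid d\<close> extends \<open>f\<close>
  continuously to all of \<open>nat \<Rightarrow> real\<close>, where the Borel sets are those of
  the countable product sigma-algebra; on \<open>euclid d\<close> nothing has changed.\<close>

lemma continuous_leb_measurable:
  assumes "continuous_on (euclid d) f" shows "(f :: vec \<Rightarrow> real) \<in> borel_measurable (leb d)"
proof -
  define r :: "vec \<Rightarrow> vec" where "r = (\<lambda>x. \<lambda>i\<in>{..<d}. x i)"
  have "continuous_on UNIV r"
    unfolding r_def
  proof (rule continuous_on_coordinatewise_then_product)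
    fix i show "continuous_on UNIV (\<lambda>x::vec. (\<lambda>i\<in>{..<d}. x i) i)"
      by (cases "i < d") (auto intro!: continuous_intros)
  qed
  then have "continuous_on UNIV (f \<circ> r)"
    by (rule continuous_on_compose[OF _ continuous_on_subset[OF assms]])
       (auto simp: r_def extensional_def split: if_splits)
  then have "f \<circ> r \<in> borel_measurable borel"
    by (rule borel_measurable_continuous_onI)
  then have 1: "f \<circ> r \<in> borel_measurable (PiM UNIV (\<lambda>_. borel))"
    using measurable_cong_sets[OF sets_PiM_equal_borel refl] by blast
  \<comment> \<open>Coordinates from \<open>d\<close> on are constantly \<open>undefined\<close> on
    the space of \<open>leb d\<close>, so the inclusion into the full product is measurable.\<close>
  have 2: "(\<lambda>x i. x i) \<in> leb d \<rightarrow>\<^sub>M PiM UNIV (\<lambda>_. borel :: real measure)"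
  proof (rule measurable_PiM_single')
    fix i :: nat
    show "(\<lambda>x. x i) \<in> borel_measurable (leb d)"
    proof (cases "i < d")
      case False
      then have "\<And>x. x \<in> space (leb d) \<Longrightarrow> x i = undefined"
        by (auto simp: space_leb PiE_def extensional_def)
      then show ?thesis by (subst measurable_cong[of _ _ "\<lambda>_. undefined"]) auto
    qed simp
  qed auto
  have 3: "(f \<circ> r) \<circ> (\<lambda>x i. x i) \<in> borel_measurable (leb d)"
    by (rule measurable_comp[OF 2 1])
  have "((f \<circ> r) \<circ> (\<lambda>x i. x i)) x = f x" if "x \<in> space (leb d)" for x
  proof -
    have "r x = x" using that by (auto simp: r_def space_leb PiE_def extensional_def)
    then show ?thesis by simp
  qed
  then show ?thesis using 3 measurable_cong by blast
qed

lemma smooth_measurable: "smooth d f \<Longrightarrow> f \<in> borel_measurable (leb d)"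
  by (intro continuous_leb_measurable smooth_continuous)

text \<open>Inside the full product the cube has the factor \<open>{undefined}\<close> at every
  index from \<open>d\<close> on, so Tychonoff's theorem applies.\<close>

lemma compact_cube: "compact (({..<d} \<rightarrow>\<^sub>E {-B..B}) :: vec set)"
proof -
  have "({..<d} \<rightarrow>\<^sub>E {-B..B}) = PiE UNIV (\<lambda>i. if i < d then {-B..B} else {undefined :: real})"
  proof (rule set_eqI)
    fix x :: vec
    have "x \<in> ({..<d} \<rightarrow>\<^sub>E {-B..B}) \<longleftrightarrow> (\<forall>i. if i < d then x i \<in> {-B..B} else x i = undefined)"
      by (auto simp: PiE_iff extensional_def)
    then show "x \<in> ({..<d} \<rightarrow>\<^sub>E {-B..B}) \<longleftrightarrow> x \<in> PiE UNIV (\<lambda>i. if i < d then {-B..B} else {undefined :: real})"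
      by (simp add: PiE_UNIV_domain Pi_iff)
  qed
  moreover have "compactin (product_topology (\<lambda>i::nat. euclidean) UNIV)
      (PiE UNIV (\<lambda>i. if i < d then {-B..B} else {undefined :: real}))"
    unfolding compactin_PiE by auto
  ultimately show ?thesis
    by (simp add: euclidean_product_topology)
qed

lemma emeasure_cube: "emeasure (leb d) ({..<d} \<rightarrow>\<^sub>E {-B..B}) < \<infinity>"
  unfolding leb_def by (subst lebp.emeasure_PiM) (auto simp: power_eq_top_ennreal less_top[symmetric] emeasure_lborel_Icc_eq)

lemma cube_sets: "({..<d} \<rightarrow>\<^sub>E {-B..B}) \<in> sets (leb d)"
  unfolding leb_def by (intro sets_PiM_I_finite) auto

lemma abs_component_le_vnorm: "i < d \<Longrightarrow> \<bar>x i\<bar> \<le> vnorm d x"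
  using member_le_L2_set[of "{..<d}" i "\<lambda>i. \<bar>x i\<bar>"] by (simp add: L2_set_def)

lemma vnorm_le_cube: "(\<And>i. i < d \<Longrightarrow> \<bar>x i\<bar> \<le> B) \<Longrightarrow> vnorm d x \<le> real d * B"
  using L2_set_le_sum_abs[of x "{..<d}"] sum_mono[of "{..<d}" "\<lambda>i. \<bar>x i\<bar>" "\<lambda>_. B"]
  by (auto intro: order_trans)

lemma compact_support_bounded:
  assumes "continuous_on (euclid d) f" "\<And>x. x \<in> euclid d \<Longrightarrow> vnorm d x > r \<Longrightarrow> f x = (0::real)"
  obtains C where "\<And>x. x \<in> euclid d \<Longrightarrow> \<bar>f x\<bar> \<le> C * indicator ({..<d} \<rightarrow>\<^sub>E {-\<bar>r\<bar>..\<bar>r\<bar>}) x" "C \<ge> 0"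
proof -
  let ?K = "({..<d} \<rightarrow>\<^sub>E {-\<bar>r\<bar>..\<bar>r\<bar>}) :: vec set"
  have "compact (f ` ?K)"
    by (intro compact_continuous_image continuous_on_subset[OF assms(1)] compact_cube) auto
  then obtain C where C: "\<And>x. x \<in> ?K \<Longrightarrow> \<bar>f x\<bar> \<le> C"
    by (metis bounded_iff compact_imp_bounded imageI real_norm_def)
  have "\<bar>f x\<bar> \<le> max C 0 * indicator ?K x" if "x \<in> euclid d" for x
  proof (cases "x \<in> ?K")
    case True then show ?thesis using C[OF True] by simp
  next
    case False
    have "\<exists>i<d. \<not> \<bar>x i\<bar> \<le> \<bar>r\<bar>"
    proof (rule ccontr)
      assume "\<not> ?thesis"
      then have "\<And>i. i < d \<Longrightarrow> x i \<in> {-\<bar>r\<bar>..\<bar>r\<bar>}" by (auto simp: abs_le_iff minus_le_iff)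
      then have "x \<in> ?K" using that by (simp add: PiE_iff)
      with False show False ..
    qed
    then obtain i where "i < d" "\<bar>x i\<bar> > \<bar>r\<bar>" by auto
    then have "vnorm d x > r" using abs_component_le_vnorm[of i d x] by simp
    then show ?thesis using assms(2) that by simp
  qed
  then show ?thesis using that[of "max C 0"] by simp
qed

lemma compact_support_integrable:
  assumes "continuous_on (euclid d) f" "\<And>x. x \<in> euclid d \<Longrightarrow> vnorm d x > r \<Longrightarrow> f x = (0::real)"
  shows "integrable (leb d) f"
proof -
  obtain C where C: "\<And>x. x \<in> euclid d \<Longrightarrow> \<bar>f x\<bar> \<le> C * indicator ({..<d} \<rightarrow>\<^sub>E {-\<bar>r\<bar>..\<bar>r\<bar>}) x" "C \<ge> 0"
    using compact_support_bounded[OF assms] by blast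
  have 1: "integrable (leb d) (\<lambda>x. C * indicator ({..<d} \<rightarrow>\<^sub>E {-\<bar>r\<bar>..\<bar>r\<bar>}) x)"
    by (intro integrable_mult_right integrable_real_indicator cube_sets emeasure_cube)
  show ?thesis
    by (rule Bochner_Integration.integrable_bound[OF 1 continuous_leb_measurable[OF assms(1)]])
       (use C in \<open>auto simp: space_leb intro!: AE_I2\<close>)
qed

section \<open>Integration by parts along one coordinate\<close>

lemma integral_DERIV_zero:
  fixes h :: "real \<Rightarrow> real"
  assumes "\<And>t. (h has_real_derivative h' t) (at t)" "continuous_on UNIV h'"
    and "(h \<longlongrightarrow> 0) at_top" "(h \<longlongrightarrow> 0) at_bot"
  shows "(\<integral>t. h' t \<partial>lborel) = 0"
\<comment> \<open>If \<open>h'\<close> is not integrable, its Bochner integral is 0 by convention.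
  Hence every slice can be treated alike when Fubini's theorem is applied below.\<close>
proof (cases "integrable lborel h'")
  case True
  have "(\<lambda>n. \<integral>t. h' t * indicator {-real n..real n} t \<partial>lborel) \<longlonglongrightarrow> (\<integral>t. h' t \<partial>lborel)"
  proof (rule integral_dominated_convergence[where w = "\<lambda>t. \<bar>h' t\<bar>"])
    show "AE t in lborel. (\<lambda>n. h' t * indicator {-real n..real n} t) \<longlonglongrightarrow> h' t"
    proof (rule AE_I2)
      fix t :: real
      obtain N where N: "\<bar>t\<bar> \<le> real N" using real_arch_simple by blast
      have "eventually (\<lambda>n. h' t * indicator {-real n..real n} t = h' t) sequentially"
        using eventually_ge_at_top[of N] by eventually_elim (use N in \<open>auto simp: indicator_def\<close>)
      then show "(\<lambda>n. h' t * indicator {-real n..real n} t) \<longlonglongrightarrow> h' t"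
        using tendsto_eventually by fastforce
    qed
  qed (use True in \<open>auto simp: indicator_def\<close>)
  moreover have "(\<integral>t. h' t * indicator {-real n..real n} t \<partial>lborel) = h (real n) - h (- real n)" for n
    using assms(1,2) by (intro integral_FTC_Icc_real) (auto simp: continuous_on_eq_continuous_at)
  moreover have "(\<lambda>n. h (real n) - h (- real n)) \<longlonglongrightarrow> 0 - 0"
    by (intro tendsto_diff filterlim_compose[OF assms(3)] filterlim_compose[OF assms(4)]
        filterlim_real_sequentially filterlim_compose[OF filterlim_uminus_at_bot_at_top])
  ultimately show ?thesis using LIMSEQ_unique by auto
qed (simp add: not_integrable_integral_eq)

lemma continuous_line: "continuous_on S (\<lambda>t. (x::vec)(i := t))"
proof (rule continuous_on_coordinatewise_then_product)
  fix j show "continuous_on S (\<lambda>t. (x(i := t)) j)"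
    by (cases "j = i") (auto intro!: continuous_intros)
qed

lemma integral_partial_zero:
  assumes G: "smooth d G" and i: "i < d" and int: "integrable (leb d) (partial i G)"
    and lim: "\<And>x. x \<in> euclid d \<Longrightarrow> ((\<lambda>t. G (x(i := t))) \<longlongrightarrow> 0) at_top"
             "\<And>x. x \<in> euclid d \<Longrightarrow> ((\<lambda>t. G (x(i := t))) \<longlongrightarrow> 0) at_bot"
  shows "(\<integral>x. partial i G x \<partial>leb d) = 0"
proof -
  let ?I = "{..<d} - {i}"
  have I: "insert i ?I = {..<d}" using i by auto
  have "(\<integral>x. partial i G x \<partial>leb d) = (\<integral>x. (\<integral>t. partial i G (x(i := t)) \<partial>lborel) \<partial>(\<Pi>\<^sub>M i\<in>?I. lborel))"
    using lebp.product_integral_insert[of ?I i "partial i G"] int i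
    by (simp add: leb_def insert_absorb)
  also have "\<dots> = (\<integral>x. 0 \<partial>(\<Pi>\<^sub>M i\<in>?I. lborel :: real measure))"
  proof (rule Bochner_Integration.integral_cong[OF refl])
    \<comment> \<open>A point of the product over the remaining indices is \<open>undefined\<close>
      at \<open>i\<close>. Giving this coordinate a value puts the point into
      \<open>euclid d\<close>, and the slice does not depend on the value.\<close>
    fix x assume "x \<in> space (\<Pi>\<^sub>M i\<in>?I. lborel :: real measure)"
    then have x: "x(i := 0) \<in> euclid d" using i
      by (auto simp: space_PiM PiE_iff extensional_def)
    have "((\<lambda>t. G ((x(i := 0))(i := t))) has_real_derivative partial i G ((x(i := 0))(i := t))) (at t)" for t
      by (rule smooth_DERIV[OF G i x])
    moreover have "continuous_on UNIV (\<lambda>t. partial i G ((x(i := 0))(i := t)))"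
      by (rule continuous_on_compose2[OF smooth_continuous[OF smooth_partial[OF G i]] continuous_line])
         (use euclid_upd[OF x i] in auto)
    ultimately have "(\<integral>t. partial i G ((x(i := 0))(i := t)) \<partial>lborel) = 0"
      by (rule integral_DERIV_zero) (rule lim[OF x])+
    then show "(\<integral>t. partial i G (x(i := t)) \<partial>lborel) = 0" by simp
  qed
  finally show ?thesis by simp
qed

text \<open>The complement of a closed ball is open along coordinate lines, so \<open>\<phi>\<close>
  vanishes in a neighbourhood of \<open>x i\<close> on the line and not just at the point.\<close>

lemma supp_partial:
  assumes \<phi>: "\<And>x. x \<in> euclid d \<Longrightarrow> vnorm d x > r \<Longrightarrow> \<phi> x = 0" and x: "x \<in> euclid d" "vnorm d x > r" and i: "i < d"
  shows "partial i \<phi> x = 0"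
proof (rule partial_DERIV)
  have "continuous_on UNIV (\<lambda>t. vnorm d (x(i := t)))"
    unfolding L2_set_def
    by (intro continuous_intros continuous_on_product_then_coordinatewise[OF continuous_line])
  then have "open {t. r < vnorm d (x(i := t))}"
    by (intro open_Collect_less) (auto intro: continuous_intros)
  moreover have "x i \<in> {t. r < vnorm d (x(i := t))}" using x by simp
  moreover have "((\<lambda>t. 0) has_real_derivative 0) (at (x i))" by simp
  ultimately show "((\<lambda>t. \<phi> (x(i := t))) has_real_derivative 0) (at (x i))"
    using has_field_derivative_transform_within_open[of "\<lambda>t. 0" 0 "x i" "{t. r < vnorm d (x(i := t))}" "\<lambda>t. \<phi> (x(i := t))"]
      \<phi>[OF euclid_upd[OF x(1) i]] by simp
qed

lemma supp_line_tendsto: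
  assumes \<phi>: "\<And>x. x \<in> euclid d \<Longrightarrow> vnorm d x > r \<Longrightarrow> \<phi> x = (0::real)" and x: "x \<in> euclid d" and i: "i < d"
  shows "((\<lambda>t. \<phi> (x(i := t))) \<longlongrightarrow> 0) at_top" "((\<lambda>t. \<phi> (x(i := t))) \<longlongrightarrow> 0) at_bot"
proof -
  have *: "\<phi> (x(i := t)) = 0" if "\<bar>t\<bar> > r" for t
    using abs_component_le_vnorm[OF i, of "x(i := t)"] that \<phi>[OF euclid_upd[OF x i]] by simp
  show "((\<lambda>t. \<phi> (x(i := t))) \<longlongrightarrow> 0) at_top"
    by (rule tendsto_eventually, rule eventually_mono[OF eventually_gt_at_top[of "\<bar>r\<bar>"]]) (auto intro: *)
  show "((\<lambda>t. \<phi> (x(i := t))) \<longlongrightarrow> 0) at_bot"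
    by (rule tendsto_eventually, rule eventually_mono[OF eventually_at_bot_dense[THEN iffD2, of "\<lambda>t. t < -\<bar>r\<bar>"]]) (auto intro: *)
qed

lemma test_funE:
  assumes "\<phi> \<in> test_fun d"
  obtains r where "smooth d \<phi>" "\<And>x. x \<in> euclid d \<Longrightarrow> vnorm d x > r \<Longrightarrow> \<phi> x = 0"
  using assms by (auto simp: test_fun_def)

lemma test_fun_cubeI:
  assumes "smooth d \<phi>" "\<And>x i. x \<in> euclid d \<Longrightarrow> i < d \<Longrightarrow> \<bar>x i\<bar> > B \<Longrightarrow> \<phi> x = 0"
  shows "\<phi> \<in> test_fun d"
proof -
  have "\<phi> x = 0" if "x \<in> euclid d" "vnorm d x > real d * B" for x
    using vnorm_le_cube[of d x B] assms(2)[OF that(1)] that(2) by fastforce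
  then show ?thesis using assms(1) by (auto simp: test_fun_def)
qed

text \<open>The product \<open>v \<phi>\<close> vanishes outside a ball, so its partial derivative
  integrates to 0; Leibniz's rule does the rest.\<close>

lemma smooth_weak_partial:
  assumes v: "smooth d v" and i: "i < d"
  shows "weak_partial d i v (partial i v)"
  unfolding weak_partial_def
proof
  fix \<phi> assume "\<phi> \<in> test_fun d"
  then obtain r where \<phi>: "smooth d \<phi>" and r: "\<And>x. x \<in> euclid d \<Longrightarrow> vnorm d x > r \<Longrightarrow> \<phi> x = 0"
    using test_funE by metis
  have i1: "integrable (leb d) (\<lambda>x. v x * partial i \<phi> x)"
    using supp_partial[OF r _ _ i]
    by (intro compact_support_integrable[of d _ r] smooth_continuous smooth_mult smooth_partial v \<phi> i) auto
  have i2: "integrable (leb d) (\<lambda>x. partial i v x * \<phi> x)"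
    using r by (intro compact_support_integrable[of d _ r] smooth_continuous smooth_mult smooth_partial v \<phi> i) auto
  have eq: "partial i (\<lambda>x. v x * \<phi> x) x = partial i v x * \<phi> x + v x * partial i \<phi> x" if "x \<in> space (leb d)" for x
    using that by (intro partial_mult[OF v \<phi> i]) (simp add: space_leb)
  have "integrable (leb d) (partial i (\<lambda>x. v x * \<phi> x))"
    by (subst Bochner_Integration.integrable_cong[OF refl eq]) (auto intro: Bochner_Integration.integrable_add[OF i2 i1])
  moreover have "\<And>x. x \<in> euclid d \<Longrightarrow> vnorm d x > r \<Longrightarrow> v x * \<phi> x = 0" using r by simp
  note supp_line_tendsto[OF this _ i]
  ultimately have "(\<integral>x. partial i (\<lambda>x. v x * \<phi> x) x \<partial>leb d) = 0"
    by (intro integral_partial_zero[OF smooth_mult[OF v \<phi>] i]) auto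
  then have "(\<integral>x. partial i v x * \<phi> x + v x * partial i \<phi> x \<partial>leb d) = 0"
    by (subst (asm) Bochner_Integration.integral_cong[OF refl eq])
  then show "(\<integral>x. v x * partial i \<phi> x \<partial>leb d) = - (\<integral>x. partial i v x * \<phi> x \<partial>leb d)"
    using i1 i2 by simp
qed

section \<open>Square integrable functions and weak derivatives\<close>

lemma L2_measurable [measurable_dest]: "f \<in> L2 d \<Longrightarrow> f \<in> borel_measurable (leb d)"
  and L2_integrable_sq: "f \<in> L2 d \<Longrightarrow> integrable (leb d) (\<lambda>x. (f x)\<^sup>2)"
  by (auto simp: L2_def)

lemma abs_mult_le_sq: "\<bar>a * b\<bar> \<le> a\<^sup>2 + (b::real)\<^sup>2"
proof -
  have "2 * \<bar>a * b\<bar> \<le> a\<^sup>2 + b\<^sup>2"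
    using sum_squares_bound[of "\<bar>a\<bar>" "\<bar>b\<bar>"] by (simp add: abs_mult)
  then show ?thesis using abs_ge_zero[of "a * b"] by linarith
qed

lemma L2_mult_integrable:
  assumes f[measurable]: "f \<in> L2 d" and g[measurable]: "g \<in> L2 d"
  shows "integrable (leb d) (\<lambda>x. f x * g x)"
proof (rule Bochner_Integration.integrable_bound)
  show "integrable (leb d) (\<lambda>x. (f x)\<^sup>2 + (g x)\<^sup>2)"
    using f g by (intro Bochner_Integration.integrable_add L2_integrable_sq)
  show "(\<lambda>x. f x * g x) \<in> borel_measurable (leb d)"
    using f g by (auto simp: L2_def)
qed (use abs_mult_le_sq in auto)

lemma L2_add:
  assumes "f \<in> L2 d" "g \<in> L2 d" shows "(\<lambda>x. f x + g x) \<in> L2 d"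
proof -
  have "integrable (leb d) (\<lambda>x. (f x)\<^sup>2 + (g x)\<^sup>2 + 2 * (f x * g x))"
    using assms by (intro Bochner_Integration.integrable_add L2_integrable_sq integrable_mult_right L2_mult_integrable)
  then show ?thesis using assms by (auto simp: L2_def power2_sum mult.assoc)
qed

lemma L2_cmult: "f \<in> L2 d \<Longrightarrow> (\<lambda>x. c * f x) \<in> L2 d"
  by (auto simp: L2_def power_mult_distrib)

lemma L2_uminus: "f \<in> L2 d \<Longrightarrow> (\<lambda>x. - f x) \<in> L2 d"
  using L2_cmult[of f d "-1"] by simp

lemma L2_diff: "f \<in> L2 d \<Longrightarrow> g \<in> L2 d \<Longrightarrow> (\<lambda>x. f x - g x) \<in> L2 d"
  using L2_add[of f d "\<lambda>x. - g x"] L2_uminus by simp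

lemma L2_zero: "(\<lambda>x. 0) \<in> L2 d"
  by (auto simp: L2_def)

lemma L2_sum: "(\<And>i. i \<in> I \<Longrightarrow> f i \<in> L2 d) \<Longrightarrow> (\<lambda>x. \<Sum>i\<in>I. f i x) \<in> L2 d"
  by (induction I rule: infinite_finite_induct) (auto simp: L2_zero L2_add)

lemma L2_bounded_mult:
  assumes g: "g \<in> L2 d" and [measurable]: "b \<in> borel_measurable (leb d)"
    and b: "\<And>x. x \<in> euclid d \<Longrightarrow> \<bar>b x\<bar> \<le> C"
  shows "(\<lambda>x. b x * g x) \<in> L2 d"
proof -
  have [measurable]: "g \<in> borel_measurable (leb d)" using g by (rule L2_measurable)
  have "integrable (leb d) (\<lambda>x. (b x * g x)\<^sup>2)"
  proof (rule Bochner_Integration.integrable_bound)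
    show "integrable (leb d) (\<lambda>x. C\<^sup>2 * (g x)\<^sup>2)"
      by (intro integrable_mult_right L2_integrable_sq g)
    have "(b x * g x)\<^sup>2 \<le> C\<^sup>2 * (g x)\<^sup>2" if "x \<in> euclid d" for x
    proof -
      have "(b x)\<^sup>2 \<le> C\<^sup>2" using b[OF that] power_mono[of "\<bar>b x\<bar>" C 2] by simp
      then show ?thesis by (simp add: power_mult_distrib mult_right_mono)
    qed
    then show "AE x in leb d. norm ((b x * g x)\<^sup>2) \<le> norm (C\<^sup>2 * (g x)\<^sup>2)"
      by (intro AE_I2) (auto simp: space_leb)
  qed measurable
  then show ?thesis by (simp add: L2_def)
qed

lemma continuous_compact_support_L2:
  assumes "continuous_on (euclid d) f" "\<And>x. x \<in> euclid d \<Longrightarrow> vnorm d x > r \<Longrightarrow> f x = (0::real)"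
  shows "f \<in> L2 d"
  unfolding L2_def using assms
  by (auto intro!: continuous_leb_measurable compact_support_integrable[of d _ r] continuous_intros)

lemma test_fun_L2:
  assumes "\<phi> \<in> test_fun d" shows "\<phi> \<in> L2 d" and "i < d \<Longrightarrow> partial i \<phi> \<in> L2 d"
proof -
  from assms obtain r where \<phi>: "smooth d \<phi>" and r: "\<And>x. x \<in> euclid d \<Longrightarrow> vnorm d x > r \<Longrightarrow> \<phi> x = 0"
    using test_funE by metis
  show "\<phi> \<in> L2 d" by (rule continuous_compact_support_L2[OF smooth_continuous[OF \<phi>] r])
  show "partial i \<phi> \<in> L2 d" if i: "i < d"
    by (rule continuous_compact_support_L2[OF smooth_continuous[OF smooth_partial[OF \<phi> i]] supp_partial[OF r _ _ i]])
qed

section \<open>The fundamental lemma of the calculus of variations\<close>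

definition boxbump :: "nat \<Rightarrow> vec \<Rightarrow> vec \<Rightarrow> nat \<Rightarrow> vec \<Rightarrow> real" where
  "boxbump d a b n x = (\<Prod>i<d. sstep (real n * (x i - a i)) * sstep (real n * (b i - x i)))"

lemma smooth1_boxbump: "smooth1 (\<lambda>t. sstep (real n * (t - a)) * sstep (real n * (b - t)))"
proof -
  have "smooth1 (\<lambda>t. sstep (real n * t + (- real n * a)) * sstep ((- real n) * t + real n * b))"
    by (rule smooth1_mult[OF smooth1_affine smooth1_affine]; rule smooth1_sstep)
  then show ?thesis by (simp add: algebra_simps)
qed

lemma boxbump_test_fun: "boxbump d a b n \<in> test_fun d"
proof (rule test_fun_cubeI[where B = "\<Sum>i<d. \<bar>a i\<bar> + \<bar>b i\<bar>"])
  show "smooth d (boxbump d a b n)"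
    unfolding boxbump_def[abs_def] by (intro smooth_prod smooth_coord smooth1_boxbump) auto
  fix x i assume x: "x \<in> euclid d" and i: "i < d" and big: "\<bar>x i\<bar> > (\<Sum>i<d. \<bar>a i\<bar> + \<bar>b i\<bar>)"
  have "(\<Sum>i<d. \<bar>a i\<bar> + \<bar>b i\<bar>) \<ge> \<bar>a i\<bar> + \<bar>b i\<bar>"
    using i by (intro member_le_sum[of i "{..<d}" "\<lambda>i. \<bar>a i\<bar> + \<bar>b i\<bar>"]) auto
  with big have "x i \<le> a i \<or> b i \<le> x i" by (auto simp: abs_if split: if_splits)
  then have "sstep (real n * (x i - a i)) * sstep (real n * (b i - x i)) = 0"
    by (auto simp: sstep_0 mult_nonneg_nonpos)
  then show "boxbump d a b n x = 0" unfolding boxbump_def using i by (intro prod_zero) auto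
qed

lemma boxbump_bounds: "0 \<le> boxbump d a b n x" "boxbump d a b n x \<le> 1"
  unfolding boxbump_def by (auto intro!: prod_nonneg prod_le_1 mult_nonneg_nonneg mult_le_one sstep_bounds)

lemma boxbump_tendsto:
  assumes "x \<in> euclid d"
  shows "(\<lambda>n. boxbump d a b n x) \<longlonglongrightarrow> indicator (PiE {..<d} (\<lambda>i. {a i<..<b i})) x"
proof -
  have "(\<lambda>n. sstep (real n * s)) \<longlonglongrightarrow> (if s > 0 then 1 else 0)" for s :: real
  proof (cases "s > 0")
    case True
    have "eventually (\<lambda>n. sstep (real n * s) = 1) sequentially"
      using eventually_ge_at_top[of "nat \<lceil>1 / s\<rceil>"]
    proof eventually_elim
      case (elim n)
      then have "1 / s \<le> real n" by linarith
      then show ?case using True by (intro sstep_1) (simp add: field_simps)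
    qed
    then show ?thesis using True tendsto_eventually by fastforce
  qed (auto simp: sstep_0 mult_nonneg_nonpos)
  note * = this
  have "(\<lambda>n. boxbump d a b n x) \<longlonglongrightarrow> (\<Prod>i<d. (if x i - a i > 0 then 1 else 0) * (if b i - x i > 0 then 1 else 0))"
    unfolding boxbump_def by (intro tendsto_intros *)
  also have "(\<Prod>i<d. (if x i - a i > 0 then 1 else 0) * (if b i - x i > 0 then 1 else (0::real)))
      = indicator (PiE {..<d} (\<lambda>i. {a i<..<b i})) x"
    using assms by (auto simp: indicator_def PiE_iff intro!: prod.neutral) 
  finally show ?thesis .
qed

text \<open>Each set \<open>y < x i\<close> is a countable union of bounded open boxes, which makes
  the coordinates measurable for the boxes. Boxes are the generator of choice because their
  indicators are limits of test functions.\<close>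

lemma open_boxes_generate:
  "sets (leb d) = sigma_sets (euclid d) (range (\<lambda>(a, b). PiE {..<d} (\<lambda>i. {a i<..<b i :: real})))"
  (is "_ = sigma_sets _ ?E")
proof
  have E: "?E \<subseteq> Pow (euclid d)" by auto
  have "?E \<subseteq> sets (leb d)" unfolding leb_def by (auto intro!: sets_PiM_I_finite)
  then show "sigma_sets (euclid d) ?E \<subseteq> sets (leb d)"
    using sets.sigma_sets_subset[of ?E "leb d"] by (simp add: space_leb)
  define N where "N = sigma (euclid d) ?E"
  have spN: "space N = euclid d" and seN: "sets N = sigma_sets (euclid d) ?E"
    using E by (simp_all add: N_def)
  have comp: "(\<lambda>x. x i) \<in> borel_measurable N" if i: "i < d" for i
  proof (rule borel_measurableI_greater)
    fix y :: real
    have "{x \<in> space N. y < x i} = (\<Union>n::nat. PiE {..<d} (\<lambda>j. {(if j = i then y else - real n)<..<real n}))"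
    proof (intro equalityI subsetI)
      fix x assume x: "x \<in> {x \<in> space N. y < x i}"
      obtain n :: nat where n: "real n > (\<Sum>j<d. \<bar>x j\<bar>)" using reals_Archimedean2 by blast
      have "\<bar>x j\<bar> < real n" if "j < d" for j
        using member_le_sum[of j "{..<d}" "\<lambda>j. \<bar>x j\<bar>"] that n by simp
      then have "- real n < x j \<and> x j < real n" if "j < d" for j using that by (simp add: abs_less_iff minus_less_iff)
      then have "x \<in> PiE {..<d} (\<lambda>j. {(if j = i then y else - real n)<..<real n})"
        using x by (auto simp: spN PiE_iff)
      then show "x \<in> (\<Union>n::nat. PiE {..<d} (\<lambda>j. {(if j = i then y else - real n)<..<real n}))" by blast
    next
      fix x assume "x \<in> (\<Union>n::nat. PiE {..<d} (\<lambda>j. {(if j = i then y else - real n)<..<real n}))"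
      then obtain n :: nat where n: "x \<in> PiE {..<d} (\<lambda>j. {(if j = i then y else - real n)<..<real n})" by blast
      then show "x \<in> {x \<in> space N. y < x i}"
        using i PiE_mem[OF n, of i] by (auto simp: spN PiE_iff)
    qed
    also have "\<dots> \<in> sets N"
      unfolding seN by (intro sigma_sets.Union sigma_sets.Basic) auto
    finally show "{x \<in> space N. y < x i} \<in> sets N" .
  qed
  have "(\<lambda>x i. if i < d then x i else undefined) \<in> N \<rightarrow>\<^sub>M (\<Pi>\<^sub>M i\<in>{..<d}. borel)"
    using measurable_restrict[of "{..<d}" "\<lambda>i x. x i" N "\<lambda>_. borel", OF comp] by (simp add: restrict_def)
  then have id: "(\<lambda>x i. if i < d then x i else undefined) \<in> N \<rightarrow>\<^sub>M leb d"
    using measurable_cong_sets[OF refl sets_leb] by blast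
  show "sets (leb d) \<subseteq> sigma_sets (euclid d) ?E"
  proof
    fix X assume X: "X \<in> sets (leb d)"
    have "(\<lambda>i. if i < d then x i else undefined) = x" if "x \<in> euclid d" for x :: vec
      using that by (auto simp: PiE_iff extensional_def)
    then have "(\<lambda>x i. if i < d then x i else undefined) -` X \<inter> space N = X"
      using sets.sets_into_space[OF X] by (auto simp: spN space_leb)
    then show "X \<in> sigma_sets (euclid d) ?E"
      using measurable_sets[OF id X] by (simp add: seN)
  qed
qed

lemma open_boxes_Int_stable: "Int_stable (range (\<lambda>(a, b). PiE {..<d} (\<lambda>i. {a i<..<b i :: real})))"
proof (rule Int_stableI)
  fix X Y assume "X \<in> range (\<lambda>(a, b). PiE {..<d} (\<lambda>i. {a i<..<b i :: real}))"
    "Y \<in> range (\<lambda>(a, b). PiE {..<d} (\<lambda>i. {a i<..<b i :: real}))"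
  then obtain a b a' b' where X: "X = PiE {..<d} (\<lambda>i. {a i<..<b i})" and Y: "Y = PiE {..<d} (\<lambda>i. {a' i<..<b' i})"
    by auto
  have "X \<inter> Y = PiE {..<d} (\<lambda>i. {max (a i) (a' i)<..<min (b i) (b' i)})"
    unfolding X Y PiE_Int by (rule PiE_cong) (auto simp: set_eq_iff)
  then show "X \<inter> Y \<in> range (\<lambda>(a, b). PiE {..<d} (\<lambda>i. {a i<..<b i :: real}))"
    by (intro image_eqI[of _ _ "(\<lambda>i. max (a i) (a' i), \<lambda>i. min (b i) (b' i))"]) simp_all
qed

lemma nn_integral_pos_neg_eq:
  assumes "integrable M f" "(\<integral>x. f x \<partial>M) = (0::real)"
  shows "(\<integral>\<^sup>+x. ennreal (f x) \<partial>M) = (\<integral>\<^sup>+x. ennreal (- f x) \<partial>M)"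
proof -
  have "(\<integral>\<^sup>+x. ennreal (f x) \<partial>M) < \<infinity>" "(\<integral>\<^sup>+x. ennreal (- f x) \<partial>M) < \<infinity>"
    using assms(1) by (auto simp: real_integrable_def less_top)
  then show ?thesis
    using real_lebesgue_integral_def[OF assms(1)] assms(2)
    by (metis diff_eq_diff_eq eq_iff_diff_eq_0 ennreal_enn2real infinity_ennreal_def)
qed

text \<open>Test functions converge to the indicator of an open box and stay below it, so
  \<open>g\<close> has integral 0 over every box. The measures with the positive and the negative
  part of \<open>g\<close> as densities thus agree on an intersection-stable generator, hence
  everywhere, and densities are unique almost everywhere.\<close>

lemma test_fun_fundamental:
  assumes g: "g \<in> L2 d" and orth: "\<And>\<phi>. \<phi> \<in> test_fun d \<Longrightarrow> (\<integral>x. g x * \<phi> x \<partial>leb d) = 0"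
  shows "AE x in leb d. g x = 0"
proof -
  let ?box = "\<lambda>a b. PiE {..<d} (\<lambda>i. {a i<..<b i :: real})"
  have [measurable]: "g \<in> borel_measurable (leb d)" using g by (rule L2_measurable)
  have bsets[measurable]: "?box a b \<in> sets (leb d)" for a b
    unfolding leb_def by (auto intro!: sets_PiM_I_finite)
  have bfin: "emeasure (leb d) (?box a b) < \<infinity>" for a b
  proof -
    let ?B = "\<Sum>i<d. \<bar>a i\<bar> + \<bar>b i\<bar>"
    have "?box a b \<subseteq> ({..<d} \<rightarrow>\<^sub>E {-?B..?B})"
    proof (rule PiE_mono)
      fix i assume "i \<in> {..<d}"
      then have "\<bar>a i\<bar> + \<bar>b i\<bar> \<le> ?B"
        by (intro member_le_sum[of i "{..<d}" "\<lambda>i. \<bar>a i\<bar> + \<bar>b i\<bar>"]) auto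
      then show "{a i<..<b i} \<subseteq> {-?B..?B}" by (auto simp: abs_if split: if_splits)
    qed
    then show ?thesis
      by (rule order_le_less_trans[OF emeasure_mono[OF _ cube_sets] emeasure_cube])
  qed
  have int1: "integrable (leb d) (\<lambda>x. g x * indicator (?box a b) x)" for a b
  proof (rule Bochner_Integration.integrable_bound)
    show "integrable (leb d) (\<lambda>x. (g x)\<^sup>2 + indicator (?box a b) x)"
      by (intro Bochner_Integration.integrable_add L2_integrable_sq g integrable_real_indicator bsets bfin)
    have "\<bar>y\<bar> \<le> y\<^sup>2 + 1" for y :: real using abs_mult_le_sq[of y 1] by simp
    then show "AE x in leb d. norm (g x * indicator (?box a b) x) \<le> norm ((g x)\<^sup>2 + indicator (?box a b) x)"
      by (intro AE_I2) (auto simp: indicator_def)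
  qed measurable
  have box0: "(\<integral>x. g x * indicator (?box a b) x \<partial>leb d) = 0" for a b
  proof -
    have "(\<lambda>n. \<integral>x. g x * boxbump d a b n x \<partial>leb d) \<longlonglongrightarrow> (\<integral>x. g x * indicator (?box a b) x \<partial>leb d)"
    proof (rule integral_dominated_convergence[where w = "\<lambda>x. \<bar>g x * indicator (?box a b) x\<bar>"])
      show "(\<lambda>x. g x * boxbump d a b n x) \<in> borel_measurable (leb d)" for n
        using test_fun_L2(1)[OF boxbump_test_fun, of d a b n] by (auto dest!: L2_measurable)
      show "integrable (leb d) (\<lambda>x. \<bar>g x * indicator (?box a b) x\<bar>)"
        by (intro integrable_abs int1)
      show "AE x in leb d. (\<lambda>n. g x * boxbump d a b n x) \<longlonglongrightarrow> g x * indicator (?box a b) x"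
        by (intro AE_I2 tendsto_mult tendsto_const boxbump_tendsto) (simp add: space_leb)
      show "AE x in leb d. norm (g x * boxbump d a b n x) \<le> \<bar>g x * indicator (?box a b) x\<bar>" for n
      proof (rule AE_I2)
        fix x assume x: "x \<in> space (leb d)"
        show "norm (g x * boxbump d a b n x) \<le> \<bar>g x * indicator (?box a b) x\<bar>"
        proof (cases "x \<in> ?box a b")
          case True
          then show ?thesis using boxbump_bounds[of d a b n x]
            by (simp add: abs_mult mult_left_le)
        next
          case False
          then obtain i where i: "i < d" "x i \<le> a i \<or> b i \<le> x i"
            using x by (auto simp: space_leb PiE_iff not_less)
          then have "sstep (real n * (x i - a i)) * sstep (real n * (b i - x i)) = 0"
            by (auto simp: sstep_0 mult_nonneg_nonpos)
          then have "boxbump d a b n x = 0" unfolding boxbump_def using i by (intro prod_zero) auto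
          then show ?thesis by simp
        qed
      qed
    qed measurable
    then have "(\<lambda>n. 0) \<longlonglongrightarrow> (\<integral>x. g x * indicator (?box a b) x \<partial>leb d)"
      by (simp only: orth[OF boxbump_test_fun])
    then show ?thesis by (rule LIMSEQ_unique[OF _ tendsto_const])
  qed
  have "density (leb d) (\<lambda>x. ennreal (g x)) = density (leb d) (\<lambda>x. ennreal (- g x))"
  proof (rule measure_eqI_generator_eq[OF open_boxes_Int_stable[of d], where \<Omega> = "euclid d"
        and A = "\<lambda>n. ?box (\<lambda>_. - real n) (\<lambda>_. real n)"])
    have e: "emeasure (density (leb d) (\<lambda>x. ennreal (g x))) (?box a b) = (\<integral>\<^sup>+x. ennreal (g x * indicator (?box a b) x) \<partial>leb d)"
      "emeasure (density (leb d) (\<lambda>x. ennreal (- g x))) (?box a b) = (\<integral>\<^sup>+x. ennreal (- (g x * indicator (?box a b) x)) \<partial>leb d)" for a b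
      by (auto simp: emeasure_density intro!: nn_integral_cong split: split_indicator)
    show "emeasure (density (leb d) (\<lambda>x. ennreal (g x))) X = emeasure (density (leb d) (\<lambda>x. ennreal (- g x))) X"
      if "X \<in> range (\<lambda>(a, b). ?box a b)" for X
      using that nn_integral_pos_neg_eq[OF int1 box0] by (auto simp: e)
    show "emeasure (density (leb d) (\<lambda>x. ennreal (g x))) (?box (\<lambda>_. - real n) (\<lambda>_. real n)) \<noteq> \<infinity>" for n
      using int1 by (auto simp: e real_integrable_def)
    show "(\<Union>n::nat. ?box (\<lambda>_. - real n) (\<lambda>_. real n)) = euclid d"
    proof (intro equalityI subsetI)
      fix x :: vec assume x: "x \<in> euclid d"
      obtain n :: nat where n: "real n > (\<Sum>j<d. \<bar>x j\<bar>)" using reals_Archimedean2 by blast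
      have "\<bar>x j\<bar> < real n" if "j < d" for j
        using member_le_sum[of j "{..<d}" "\<lambda>j. \<bar>x j\<bar>"] that n by simp
      then have "- real n < x j \<and> x j < real n" if "j < d" for j using that by (simp add: abs_less_iff minus_less_iff)
      then have "x \<in> ?box (\<lambda>_. - real n) (\<lambda>_. real n)" using x by (auto simp: PiE_iff)
      then show "x \<in> (\<Union>n::nat. ?box (\<lambda>_. - real n) (\<lambda>_. real n))" by blast
    qed auto
  qed (auto simp: open_boxes_generate)
  then have "AE x in leb d. ennreal (g x) = ennreal (- g x)"
    by (intro sigma_finite_measure.density_unique[OF sigma_finite_leb]) auto
  then show ?thesis
  proof eventually_elim
    \<comment> \<open>\<open>ennreal\<close> sends negative numbers to 0, so one of the two sides is
      0 whatever the sign of \<open>g x\<close>.\<close>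
    case (elim x)
    then show ?case
      by (cases "g x \<ge> 0") (auto simp: ennreal_neg ennreal_eq_0_iff dest!: sym[of _ "ennreal _"])
  qed
qed

lemma weak_partial_unique:
  assumes "g \<in> L2 d" "h \<in> L2 d" "weak_partial d i v g" "weak_partial d i v h"
  shows "AE x in leb d. g x = h x"
proof -
  have "AE x in leb d. g x - h x = 0"
  proof (rule test_fun_fundamental)
    fix \<phi> assume \<phi>: "\<phi> \<in> test_fun d"
    have "(\<integral>x. (g x - h x) * \<phi> x \<partial>leb d) = (\<integral>x. g x * \<phi> x - h x * \<phi> x \<partial>leb d)"
      by (simp add: algebra_simps)
    also have "\<dots> = (\<integral>x. g x * \<phi> x \<partial>leb d) - (\<integral>x. h x * \<phi> x \<partial>leb d)"
      by (intro Bochner_Integration.integral_diff L2_mult_integrable assms test_fun_L2(1) \<phi>)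
    also have "\<dots> = 0" using assms(3,4) \<phi> by (auto simp: weak_partial_def)
    finally show "(\<integral>x. (g x - h x) * \<phi> x \<partial>leb d) = 0" .
  qed (intro L2_diff assms)
  then show ?thesis by eventually_elim simp
qed

text \<open>\<open>H1_rep d v p\<close>: \<open>p\<close> is some choice of the weak gradient of \<open>v\<close>.\<close>

definition H1_rep :: "nat \<Rightarrow> (vec \<Rightarrow> real) \<Rightarrow> (nat \<Rightarrow> vec \<Rightarrow> real) \<Rightarrow> bool" where
  "H1_rep d v p \<longleftrightarrow> v \<in> L2 d \<and> (\<forall>i<d. p i \<in> L2 d \<and> weak_partial d i v (p i))"

lemma H1_rep_H1: "H1_rep d v p \<Longrightarrow> v \<in> H1 d"
  by (auto simp: H1_rep_def H1_def)

lemma H1_rep_wpartial: "v \<in> H1 d \<Longrightarrow> H1_rep d v (\<lambda>i. wpartial d i v)"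
proof -
  assume v: "v \<in> H1 d"
  have "wpartial d i v \<in> L2 d \<and> weak_partial d i v (wpartial d i v)" if "i < d" for i
  proof -
    have "\<exists>g. g \<in> L2 d \<and> weak_partial d i v g" using v that by (auto simp: H1_def)
    then show ?thesis unfolding wpartial_def by (rule someI_ex)
  qed
  then show ?thesis using v by (simp add: H1_rep_def H1_def)
qed

lemma wpartial_AE:
  assumes "H1_rep d v p" "i < d" shows "AE x in leb d. wpartial d i v x = p i x"
  using H1_rep_wpartial[OF H1_rep_H1[OF assms(1)]] assms weak_partial_unique[of "wpartial d i v" d "p i" i v]
  by (simp add: H1_rep_def)

lemma H1_norm_rep:
  assumes "H1_rep d v p"
  shows "H1_norm d v = sqrt ((\<integral>x. (v x)\<^sup>2 \<partial>leb d) + (\<Sum>i<d. \<integral>x. (p i x)\<^sup>2 \<partial>leb d))"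
proof -
  have "(\<integral>x. (wpartial d i v x)\<^sup>2 \<partial>leb d) = (\<integral>x. (p i x)\<^sup>2 \<partial>leb d)" if "i < d" for i
    using wpartial_AE[OF assms that] assms H1_rep_wpartial[OF H1_rep_H1[OF assms]] that
    by (intro integral_cong_AE) (auto simp: H1_rep_def dest!: L2_measurable)
  then show ?thesis by (simp add: H1_norm_def)
qed

lemma weak_partial_lin:
  assumes "v \<in> L2 d" "w \<in> L2 d" "g \<in> L2 d" "h \<in> L2 d" "weak_partial d i v g" "weak_partial d i w h" "i < d"
  shows "weak_partial d i (\<lambda>x. v x + c * w x) (\<lambda>x. g x + c * h x)"
  unfolding weak_partial_def
proof
  fix \<phi> assume \<phi>: "\<phi> \<in> test_fun d"
  have "(\<integral>x. (v x + c * w x) * partial i \<phi> x \<partial>leb d) = (\<integral>x. v x * partial i \<phi> x + c * (w x * partial i \<phi> x) \<partial>leb d)"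
    by (simp add: algebra_simps)
  also have "\<dots> = (\<integral>x. v x * partial i \<phi> x \<partial>leb d) + c * (\<integral>x. w x * partial i \<phi> x \<partial>leb d)"
    by (subst Bochner_Integration.integral_add)
       (auto intro!: L2_mult_integrable assms test_fun_L2(1)[OF \<phi>] test_fun_L2(2)[OF \<phi>])
  also have "\<dots> = - ((\<integral>x. g x * \<phi> x \<partial>leb d) + c * (\<integral>x. h x * \<phi> x \<partial>leb d))"
    using assms(5,6) \<phi> by (simp add: weak_partial_def)
  also have "(\<integral>x. g x * \<phi> x \<partial>leb d) + c * (\<integral>x. h x * \<phi> x \<partial>leb d) = (\<integral>x. g x * \<phi> x + c * (h x * \<phi> x) \<partial>leb d)"
    by (subst Bochner_Integration.integral_add)
       (auto intro!: L2_mult_integrable assms test_fun_L2(1)[OF \<phi>] test_fun_L2(2)[OF \<phi>])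
  finally show "(\<integral>x. (v x + c * w x) * partial i \<phi> x \<partial>leb d) = - (\<integral>x. (g x + c * h x) * \<phi> x \<partial>leb d)"
    by (simp add: algebra_simps)
qed

lemma H1_rep_lin:
  assumes "H1_rep d v p" "H1_rep d w q"
  shows "H1_rep d (\<lambda>x. v x + c * w x) (\<lambda>i x. p i x + c * q i x)"
  using assms unfolding H1_rep_def by (auto intro!: weak_partial_lin L2_add L2_cmult)

lemma H1_rep_zero: "H1_rep d (\<lambda>x. 0) (\<lambda>i x. 0)"
  by (auto simp: H1_rep_def L2_zero weak_partial_def)

lemma H1_rep_smooth:
  assumes "smooth d v" "v \<in> L2 d" "\<And>i. i < d \<Longrightarrow> partial i v \<in> L2 d"
  shows "H1_rep d v (\<lambda>i. partial i v)"
  using assms smooth_weak_partial by (auto simp: H1_rep_def)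

section \<open>Divergence theorem against \<open>H1\<close> functions\<close>

text \<open>The summand 0 gives the argument the shape \<open>p * x + q\<close> of
  \<open>smooth1_affine\<close>.\<close>

definition bcut :: "nat \<Rightarrow> nat \<Rightarrow> vec \<Rightarrow> real" where
  "bcut d n x = (\<Prod>i<d. cutoff ((1 / real (Suc n)) * x i + 0))"

lemma smooth_bcut: "smooth d (bcut d n)"
  unfolding bcut_def[abs_def]
  by (rule smooth_prod, rule smooth_coord, rule smooth1_affine[OF smooth1_cutoff]) simp

lemma bcut_bounds: "0 \<le> bcut d n x" "bcut d n x \<le> 1"
  unfolding bcut_def by (auto intro!: prod_nonneg prod_le_1 cutoff_bounds)

lemma bcut_0: "i < d \<Longrightarrow> \<bar>x i\<bar> > 2 * real (Suc n) \<Longrightarrow> bcut d n x = 0"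
proof -
  assume i: "i < d" and x: "\<bar>x i\<bar> > 2 * real (Suc n)"
  have "cutoff ((1 / real (Suc n)) * x i + 0) = 0"
    using x by (intro cutoff_0) (simp add: field_simps abs_mult)
  then show ?thesis unfolding bcut_def using i by (intro prod_zero) auto
qed

lemma bcut_test_fun: "smooth d G \<Longrightarrow> (\<lambda>x. bcut d n x * G x) \<in> test_fun d"
  by (rule test_fun_cubeI[where B = "2 * real (Suc n)"])
     (simp_all add: bcut_0 smooth_mult smooth_bcut)

lemma bcut_tendsto: "(\<lambda>n. bcut d n x) \<longlonglongrightarrow> 1"
proof -
  obtain N :: nat where N: "(\<Sum>i<d. \<bar>x i\<bar>) \<le> real N" using real_arch_simple by blast
  have "bcut d n x = 1" if "n \<ge> N" for n
  proof -
    have "cutoff ((1 / real (Suc n)) * x i + 0) = 1" if i: "i < d" for i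
    proof (rule cutoff_1)
      have "\<bar>x i\<bar> \<le> (\<Sum>i<d. \<bar>x i\<bar>)" using i by (intro member_le_sum) auto
      also have "\<dots> \<le> real (Suc n)" using N \<open>n \<ge> N\<close> by simp
      finally show "\<bar>1 / real (Suc n) * x i + 0\<bar> \<le> 1" by (simp add: abs_mult field_simps)
    qed
    then show ?thesis by (simp add: bcut_def)
  qed
  then have "eventually (\<lambda>n. bcut d n x = 1) sequentially"
    using eventually_sequentially by blast
  then show ?thesis by (rule tendsto_eventually)
qed

lemma partial_prod_coord:
  assumes h: "smooth1 h" and i: "i < d" and x: "x \<in> euclid d"
  shows "partial i (\<lambda>x. \<Prod>j<d. h (x j)) x = deriv h (x i) * (\<Prod>j\<in>{..<d}-{i}. h (x j))"
proof (rule partial_DERIV)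
  have "(\<lambda>t. \<Prod>j<d. h ((x(i := t)) j)) = (\<lambda>t. h t * (\<Prod>j\<in>{..<d}-{i}. h (x j)))"
  proof
    fix t
    have "(\<Prod>j<d. h ((x(i := t)) j)) = h ((x(i := t)) i) * (\<Prod>j\<in>{..<d}-{i}. h ((x(i := t)) j))"
      using i by (intro prod.remove) auto
    also have "(\<Prod>j\<in>{..<d}-{i}. h ((x(i := t)) j)) = (\<Prod>j\<in>{..<d}-{i}. h (x j))"
      by (intro prod.cong) auto
    finally show "(\<Prod>j<d. h ((x(i := t)) j)) = h t * (\<Prod>j\<in>{..<d}-{i}. h (x j))" by simp
  qed
  then show "((\<lambda>t. \<Prod>j<d. h ((x(i := t)) j)) has_real_derivative
      deriv h (x i) * (\<Prod>j\<in>{..<d}-{i}. h (x j))) (at (x i))"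
    using DERIV_cmult_right[OF smooth1_DERIV[OF h]] by simp
qed

text \<open>Stretching the cutoff by \<open>Suc n\<close> divides its slope by \<open>Suc n\<close>,
  and the other factors are at most 1. This decay removes the commutator term in
  \<open>H1_divergence\<close>.\<close>

lemma partial_bcut_bound:
  assumes C: "\<And>t. \<bar>deriv cutoff t\<bar> \<le> C" and i: "i < d" and x: "x \<in> euclid d"
  shows "\<bar>partial i (bcut d n) x\<bar> \<le> C / real (Suc n)"
proof -
  let ?h = "\<lambda>t. cutoff ((1 / real (Suc n)) * t + 0)"
  have h: "smooth1 ?h" by (rule smooth1_affine[OF smooth1_cutoff])
  have dh: "deriv ?h t = deriv cutoff ((1 / real (Suc n)) * t + 0) * (1 / real (Suc n))" for t
    by (rule DERIV_imp_deriv, rule DERIV_chain'[of "\<lambda>t. (1 / real (Suc n)) * t + 0" "1 / real (Suc n)" t UNIV cutoff, THEN DERIV_cong])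
       (auto intro!: derivative_eq_intros smooth1_DERIV smooth1_cutoff)
  have "\<bar>partial i (bcut d n) x\<bar> = \<bar>deriv ?h (x i)\<bar> * \<bar>\<Prod>j\<in>{..<d}-{i}. ?h (x j)\<bar>"
    unfolding bcut_def[abs_def] by (subst partial_prod_coord[OF h i x]) (simp add: abs_mult)
  also have "\<dots> \<le> (C / real (Suc n)) * 1"
  proof (rule mult_mono)
    show "\<bar>deriv ?h (x i)\<bar> \<le> C / real (Suc n)"
      unfolding dh using C[of "(1 / real (Suc n)) * x i + 0"] by (simp add: abs_mult divide_right_mono)
    show "\<bar>\<Prod>j\<in>{..<d}-{i}. ?h (x j)\<bar> \<le> 1"
      unfolding abs_prod using cutoff_bounds by (intro prod_le_1) auto
    show "0 \<le> C / real (Suc n)" using C[of 0] by simp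
  qed simp
  finally show ?thesis by simp
qed

text \<open>Weak derivatives are tested with compactly supported functions only, so \<open>G\<close>
  is cut off by \<open>bcut\<close> and \<open>n\<close> tends to infinity. Square integrability is
  known for the divergence and not for its single terms, which is why the limit is taken after
  summation over \<open>i\<close>.\<close>

lemma H1_divergence:
  assumes rep: "H1_rep d \<phi> p" and G: "\<And>i. i < d \<Longrightarrow> smooth d (G i)" and GL: "\<And>i. i < d \<Longrightarrow> G i \<in> L2 d"
    and DL: "(\<lambda>x. \<Sum>i<d. partial i (G i) x) \<in> L2 d"
  shows "(\<integral>x. \<phi> x * (\<Sum>i<d. partial i (G i) x) \<partial>leb d) = - (\<Sum>i<d. \<integral>x. p i x * G i x \<partial>leb d)"
proof -
  let ?D = "\<lambda>x. \<Sum>i<d. partial i (G i) x"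
  have \<phi>L: "\<phi> \<in> L2 d" and pL: "\<And>i. i < d \<Longrightarrow> p i \<in> L2 d"
    and wp: "\<And>i. i < d \<Longrightarrow> weak_partial d i \<phi> (p i)" using rep by (auto simp: H1_rep_def)
  note m[measurable] = L2_measurable[OF \<phi>L] L2_measurable[OF DL]
  have bm: "bcut d n \<in> borel_measurable (leb d)" for n using smooth_bcut smooth_measurable by blast
  note bm[measurable]
  obtain C where C: "\<And>t. \<bar>deriv cutoff t\<bar> \<le> C" using deriv_cutoff_bounded by blast
  have C0: "C \<ge> 0" using C[of 0] by linarith
  have pbL: "(\<lambda>x. partial i (bcut d n) x * G i x) \<in> L2 d" if i: "i < d" for i n
    using partial_bcut_bound[OF C i]
    by (intro L2_bounded_mult[where C = "C / real (Suc n)"] GL i smooth_measurable smooth_partial smooth_bcut) auto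
  have bDL: "(\<lambda>x. bcut d n x * partial i (G i) x) \<in> L2 d" if i: "i < d" for i n
    using test_fun_L2(1)[OF bcut_test_fun[OF smooth_partial[OF G[OF i] i]]] .
  \<comment> \<open>For fixed \<open>n\<close> each product of \<open>bcut d n\<close> and
    \<open>G i\<close> is a test function; Leibniz's rule adds the term with the gradient of the
    cutoff.\<close>
  have key: "(\<integral>x. \<phi> x * (bcut d n x * ?D x) \<partial>leb d)
      + (\<Sum>i<d. \<integral>x. \<phi> x * (partial i (bcut d n) x * G i x) \<partial>leb d)
      = - (\<Sum>i<d. \<integral>x. p i x * (bcut d n x * G i x) \<partial>leb d)" for n
  proof -
    have 1: "(\<integral>x. \<phi> x * (bcut d n x * partial i (G i) x) \<partial>leb d) + (\<integral>x. \<phi> x * (partial i (bcut d n) x * G i x) \<partial>leb d)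
        = - (\<integral>x. p i x * (bcut d n x * G i x) \<partial>leb d)" if i: "i < d" for i
    proof -
      have "(\<integral>x. \<phi> x * (bcut d n x * partial i (G i) x) \<partial>leb d) + (\<integral>x. \<phi> x * (partial i (bcut d n) x * G i x) \<partial>leb d)
          = (\<integral>x. \<phi> x * (bcut d n x * partial i (G i) x) + \<phi> x * (partial i (bcut d n) x * G i x) \<partial>leb d)"
        by (intro Bochner_Integration.integral_add[symmetric] L2_mult_integrable \<phi>L pbL bDL i)
      also have "\<dots> = (\<integral>x. \<phi> x * partial i (\<lambda>x. bcut d n x * G i x) x \<partial>leb d)"
        by (intro Bochner_Integration.integral_cong refl, subst partial_mult[OF smooth_bcut G[OF i] i])
           (auto simp: space_leb algebra_simps)
      also have "\<dots> = - (\<integral>x. p i x * (bcut d n x * G i x) \<partial>leb d)"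
        using wp[OF i] bcut_test_fun[OF G[OF i], of n] by (simp add: weak_partial_def)
      finally show ?thesis .
    qed
    have "(\<integral>x. \<phi> x * (bcut d n x * ?D x) \<partial>leb d) = (\<integral>x. (\<Sum>i<d. \<phi> x * (bcut d n x * partial i (G i) x)) \<partial>leb d)"
      by (simp add: sum_distrib_left)
    also have "\<dots> = (\<Sum>i<d. \<integral>x. \<phi> x * (bcut d n x * partial i (G i) x) \<partial>leb d)"
      by (intro Bochner_Integration.integral_sum L2_mult_integrable \<phi>L bDL) auto
    finally show ?thesis using 1 by (simp add: sum.distrib[symmetric] sum_negf[symmetric])
  qed
  have l1: "(\<lambda>n. \<integral>x. \<phi> x * (bcut d n x * ?D x) \<partial>leb d) \<longlonglongrightarrow> (\<integral>x. \<phi> x * ?D x \<partial>leb d)"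
  proof (rule integral_dominated_convergence[where w = "\<lambda>x. \<bar>\<phi> x * ?D x\<bar>"])
    show "AE x in leb d. (\<lambda>n. \<phi> x * (bcut d n x * ?D x)) \<longlonglongrightarrow> \<phi> x * ?D x"
      using tendsto_mult[OF tendsto_const[of "\<phi> x" for x] tendsto_mult[OF bcut_tendsto tendsto_const]] by auto
    show "AE x in leb d. norm (\<phi> x * (bcut d n x * ?D x)) \<le> \<bar>\<phi> x * ?D x\<bar>" for n
      using bcut_bounds[of d n] by (intro AE_I2) (auto simp: abs_mult intro!: mult_left_mono mult_left_le_one_le)
  qed (auto intro!: integrable_abs L2_mult_integrable \<phi>L DL)
  have l2: "(\<lambda>n. \<integral>x. p i x * (bcut d n x * G i x) \<partial>leb d) \<longlonglongrightarrow> (\<integral>x. p i x * G i x \<partial>leb d)" if i: "i < d" for i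
  proof (rule integral_dominated_convergence[where w = "\<lambda>x. \<bar>p i x * G i x\<bar>"])
    note [measurable] = L2_measurable[OF pL[OF i]] L2_measurable[OF GL[OF i]]
    show "(\<lambda>x. p i x * G i x) \<in> borel_measurable (leb d)" "(\<lambda>x. p i x * (bcut d n x * G i x)) \<in> borel_measurable (leb d)" for n
      by measurable
    show "AE x in leb d. (\<lambda>n. p i x * (bcut d n x * G i x)) \<longlonglongrightarrow> p i x * G i x"
      using tendsto_mult[OF tendsto_const[of "p i x" for x] tendsto_mult[OF bcut_tendsto tendsto_const]] by auto
    show "AE x in leb d. norm (p i x * (bcut d n x * G i x)) \<le> \<bar>p i x * G i x\<bar>" for n
      using bcut_bounds[of d n] by (intro AE_I2) (auto simp: abs_mult intro!: mult_left_mono mult_left_le_one_le)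
  qed (intro integrable_abs L2_mult_integrable pL GL i)
  \<comment> \<open>The commutator is at most \<open>C / Suc n\<close> times a fixed integral,
    finite because both factors are square integrable.\<close>
  have l3: "(\<lambda>n. \<integral>x. \<phi> x * (partial i (bcut d n) x * G i x) \<partial>leb d) \<longlonglongrightarrow> 0" if i: "i < d" for i
  proof (rule Lim_null_comparison)
    show "(\<lambda>n. C / real (Suc n) * (\<integral>x. \<bar>\<phi> x * G i x\<bar> \<partial>leb d)) \<longlonglongrightarrow> 0"
      using tendsto_mult[OF LIMSEQ_Suc[OF lim_const_over_n[of C]] tendsto_const[of "\<integral>x. \<bar>\<phi> x * G i x\<bar> \<partial>leb d"]] by simp
    have "norm (\<integral>x. \<phi> x * (partial i (bcut d n) x * G i x) \<partial>leb d) \<le> C / real (Suc n) * (\<integral>x. \<bar>\<phi> x * G i x\<bar> \<partial>leb d)" for n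
    proof -
      have "norm (\<integral>x. \<phi> x * (partial i (bcut d n) x * G i x) \<partial>leb d) \<le> (\<integral>x. norm (\<phi> x * (partial i (bcut d n) x * G i x)) \<partial>leb d)"
        by (rule integral_norm_bound)
      also have "\<dots> \<le> (\<integral>x. C / real (Suc n) * \<bar>\<phi> x * G i x\<bar> \<partial>leb d)"
      proof (rule integral_mono)
        show "integrable (leb d) (\<lambda>x. norm (\<phi> x * (partial i (bcut d n) x * G i x)))"
          by (intro integrable_norm L2_mult_integrable \<phi>L pbL i)
        show "integrable (leb d) (\<lambda>x. C / real (Suc n) * \<bar>\<phi> x * G i x\<bar>)"
          by (intro integrable_mult_right integrable_abs L2_mult_integrable \<phi>L GL i)
        fix x assume "x \<in> space (leb d)"
        then have "\<bar>partial i (bcut d n) x\<bar> \<le> C / real (Suc n)"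
          by (intro partial_bcut_bound[OF C i]) (simp add: space_leb)
        then have "\<bar>partial i (bcut d n) x\<bar> * \<bar>\<phi> x * G i x\<bar> \<le> C / real (Suc n) * \<bar>\<phi> x * G i x\<bar>"
          by (rule mult_right_mono) simp
        then show "norm (\<phi> x * (partial i (bcut d n) x * G i x)) \<le> C / real (Suc n) * \<bar>\<phi> x * G i x\<bar>"
          by (simp add: abs_mult mult.left_commute)
      qed
      finally show ?thesis by simp
    qed
    then show "eventually (\<lambda>n. norm (\<integral>x. \<phi> x * (partial i (bcut d n) x * G i x) \<partial>leb d) \<le> C / real (Suc n) * (\<integral>x. \<bar>\<phi> x * G i x\<bar> \<partial>leb d)) sequentially"
      by simp
  qed
  have "(\<lambda>n. (\<integral>x. \<phi> x * (bcut d n x * ?D x) \<partial>leb d)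
      + (\<Sum>i<d. \<integral>x. \<phi> x * (partial i (bcut d n) x * G i x) \<partial>leb d)) \<longlonglongrightarrow> (\<integral>x. \<phi> x * ?D x \<partial>leb d) + (\<Sum>i<d. 0)"
    by (intro tendsto_add l1 tendsto_sum l3) auto
  moreover have "(\<lambda>n. - (\<Sum>i<d. \<integral>x. p i x * (bcut d n x * G i x) \<partial>leb d)) \<longlonglongrightarrow> - (\<Sum>i<d. \<integral>x. p i x * G i x \<partial>leb d)"
    by (intro tendsto_minus tendsto_sum l2) auto
  ultimately show ?thesis
    unfolding key using LIMSEQ_unique by fastforce
qed

section \<open>Weighted energy estimate\<close>

text \<open>A Lorentz profile rather than a cutoff: it is integrable, and its derivative is at most
  \<open>\<delta>\<close> times the function itself, which no nonzero function of compact support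
  satisfies.\<close>

definition wt1 :: "real \<Rightarrow> real \<Rightarrow> real" where
  "wt1 \<delta> t = 1 / (1 + (\<delta> * t)\<^sup>2)"

lemma wt1_pos: "wt1 \<delta> t > 0" and wt1_le_1: "wt1 \<delta> t \<le> 1"
  by (auto simp: wt1_def add_pos_nonneg)

lemma smooth1_id: "smooth1 (\<lambda>x. x)"
proof (rule smooth1_coinduct[where S = "{\<lambda>x. x, \<lambda>x. 1, \<lambda>x. 0}"])
  fix g assume g: "g \<in> {\<lambda>x. x, \<lambda>x. 1, \<lambda>x. 0::real}"
  show "g differentiable at x" for x using g by auto
  have "deriv (\<lambda>x::real. x) = (\<lambda>x. 1)" "deriv (\<lambda>x::real. 1::real) = (\<lambda>x. 0)" "deriv (\<lambda>x::real. 0::real) = (\<lambda>x. 0)"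
    by auto
  then show "deriv g \<in> {\<lambda>x. x, \<lambda>x. 1, \<lambda>x. 0}" using g by auto
qed simp

lemma smooth1_wt1: "smooth1 (wt1 \<delta>)"
proof -
  have "smooth1 (\<lambda>t. 1 / (1 + \<delta>\<^sup>2 * (t * t)))"
    by (rule smooth1_divide[OF smooth1_const smooth1_add[OF smooth1_const smooth1_mult[OF smooth1_const smooth1_mult[OF smooth1_id smooth1_id]]]])
       (metis add_cancel_right_left add_nonneg_eq_0_iff zero_le_one zero_le_mult_iff zero_le_power2 zero_neq_one zero_le_square)
  then show ?thesis by (simp add: wt1_def[abs_def] power_mult_distrib power2_eq_square mult_ac)
qed

lemma deriv_wt1: "deriv (wt1 \<delta>) t = (- 2 * \<delta>\<^sup>2 * t / (1 + (\<delta> * t)\<^sup>2)) * wt1 \<delta> t"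
proof -
  have "1 + (\<delta> * t)\<^sup>2 \<noteq> 0" using add_pos_nonneg[of 1 "(\<delta> * t)\<^sup>2"] by simp
  then show ?thesis unfolding wt1_def[abs_def]
    by (intro DERIV_imp_deriv) (auto intro!: derivative_eq_intros simp: divide_simps power2_eq_square)
qed

text \<open>The inequality \<open>2 |\<delta> t| \<le> 1 + (\<delta> t)^2\<close>, applied to the
  logarithmic derivative of the weight.\<close>

lemma wt1_deriv_factor_bound:
  assumes "(\<delta>::real) \<ge> 0" shows "\<bar>- 2 * \<delta>\<^sup>2 * t / (1 + (\<delta> * t)\<^sup>2)\<bar> \<le> \<delta>"
proof -
  have "2 * \<bar>\<delta> * t\<bar> \<le> 1 + (\<delta> * t)\<^sup>2"
    using sum_squares_bound[of 1 "\<bar>\<delta> * t\<bar>"] by simp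
  then have "\<delta> * (2 * \<bar>\<delta> * t\<bar>) \<le> \<delta> * (1 + (\<delta> * t)\<^sup>2)"
    using assms by (rule mult_left_mono)
  moreover have "1 + (\<delta> * t)\<^sup>2 > 0" using add_pos_nonneg[of 1 "(\<delta> * t)\<^sup>2"] by simp
  ultimately show ?thesis using assms
    by (simp add: abs_mult divide_simps power2_eq_square mult_ac)
qed

lemma integrable_wt1: "\<delta> > 0 \<Longrightarrow> integrable lborel (wt1 \<delta>)"
proof -
  assume \<delta>: "\<delta> > 0"
  have "integrable lborel (\<lambda>x::real. inverse (1 + x\<^sup>2))"
    using integrable_inverse_1_plus_square by (simp add: set_integrable_def)
  then have "integrable lborel (\<lambda>x. inverse (1 + (0 + \<delta> * x)\<^sup>2))"
    using \<delta> by (subst lborel_integrable_real_affine_iff) auto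
  then show ?thesis by (simp add: wt1_def[abs_def] inverse_eq_divide)
qed

definition wt :: "nat \<Rightarrow> real \<Rightarrow> vec \<Rightarrow> real" where
  "wt d \<delta> x = (\<Prod>i<d. wt1 \<delta> (x i))"

lemma smooth_wt: "smooth d (wt d \<delta>)"
  unfolding wt_def[abs_def] by (intro smooth_prod smooth_coord smooth1_wt1) auto

lemma wt_bounds: "0 \<le> wt d \<delta> x" "wt d \<delta> x \<le> 1"
  unfolding wt_def using wt1_pos wt1_le_1 by (auto intro!: prod_nonneg prod_le_1 simp: less_imp_le)

lemma wt_le_wt1: "i < d \<Longrightarrow> wt d \<delta> x \<le> wt1 \<delta> (x i)"
proof -
  assume i: "i < d"
  have "wt d \<delta> x = wt1 \<delta> (x i) * (\<Prod>j\<in>{..<d}-{i}. wt1 \<delta> (x j))"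
    unfolding wt_def using i by (intro prod.remove) auto
  also have "\<dots> \<le> wt1 \<delta> (x i) * 1"
    using wt1_pos wt1_le_1 by (intro mult_left_mono prod_le_1) (auto simp: less_imp_le)
  finally show ?thesis by simp
qed

lemma integrable_wt: "\<delta> > 0 \<Longrightarrow> integrable (leb d) (wt d \<delta>)"
  unfolding leb_def wt_def[abs_def] by (intro lebp.product_integrable_prod integrable_wt1) auto

lemma partial_wt:
  assumes "i < d" "x \<in> euclid d"
  shows "partial i (wt d \<delta>) x = (- 2 * \<delta>\<^sup>2 * x i / (1 + (\<delta> * x i)\<^sup>2)) * wt d \<delta> x"
proof -
  have "wt d \<delta> x = wt1 \<delta> (x i) * (\<Prod>j\<in>{..<d}-{i}. wt1 \<delta> (x j))"
    unfolding wt_def using assms by (intro prod.remove) auto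
  then show ?thesis
    unfolding wt_def[abs_def] partial_prod_coord[OF smooth1_wt1 assms] deriv_wt1
    by (simp add: wt_def)
qed

lemma wt_tendsto: "(\<lambda>n. wt d (1 / real (Suc n)) x) \<longlonglongrightarrow> 1"
proof -
  have "(\<lambda>n. wt1 (1 / real (Suc n)) t) \<longlonglongrightarrow> 1" for t
  proof -
    have "(\<lambda>n. 1 / real (Suc n)) \<longlonglongrightarrow> 0" by (rule LIMSEQ_Suc[OF lim_1_over_n])
    then have "(\<lambda>n. 1 / (1 + (1 / real (Suc n) * t)\<^sup>2)) \<longlonglongrightarrow> 1 / (1 + (0 * t)\<^sup>2)"
      by (intro tendsto_intros) auto
    then show ?thesis unfolding wt1_def by simp
  qed
  then have "(\<lambda>n. wt d (1 / real (Suc n)) x) \<longlonglongrightarrow> (\<Prod>i<d. 1)"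
    unfolding wt_def by (intro tendsto_prod) auto
  then show ?thesis by simp
qed

lemma wt_line_tendsto:
  assumes "\<delta> > 0" "i < d"
  shows "((\<lambda>t. wt d \<delta> (x(i := t))) \<longlongrightarrow> 0) at_top" "((\<lambda>t. wt d \<delta> (x(i := t))) \<longlongrightarrow> 0) at_bot"
proof -
  have b: "norm (wt d \<delta> (x(i := t))) \<le> wt1 \<delta> t" for t
    using wt_le_wt1[OF assms(2), of \<delta> "x(i := t)"] wt_bounds[of d \<delta> "x(i := t)"] by simp
  have "(wt1 \<delta> \<longlongrightarrow> 0) at_top" "(wt1 \<delta> \<longlongrightarrow> 0) at_bot"
    unfolding wt1_def[abs_def] using assms(1) by real_asymp+
  then show "((\<lambda>t. wt d \<delta> (x(i := t))) \<longlongrightarrow> 0) at_top" "((\<lambda>t. wt d \<delta> (x(i := t))) \<longlongrightarrow> 0) at_bot"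
    using b by (auto intro!: Lim_null_comparison[of _ "wt1 \<delta>"] always_eventually)
qed

text \<open>Here \<open>g\<close> stands for the gradient of \<open>v\<close> and \<open>b\<close>
  for the logarithmic gradient of the weight. By Young's inequality the source \<open>f0\<close> and
  the terms with \<open>b\<close> cost a quarter of \<open>v^2\<close> each, and each
  \<open>(g i)^2\<close> loses at most three eighths, so half of either square is left.\<close>

lemma energy_pointwise:
  fixes v f0 :: real and g F b :: "nat \<Rightarrow> real"
  assumes b: "\<And>i. i < d \<Longrightarrow> \<bar>b i\<bar> \<le> \<delta>" and \<delta>: "0 \<le> \<delta>" "real d * \<delta> \<le> 1/4" "\<delta> \<le> 1/4"
  shows "(v\<^sup>2 + (\<Sum>i<d. (g i)\<^sup>2)) / 2 - 2 * (f0\<^sup>2 + (\<Sum>i<d. (F i)\<^sup>2))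
     \<le> v * (v - f0) + (\<Sum>i<d. (g i + F i) * g i + (g i + F i) * v * b i)"
proof -
  have t: "2 * \<bar>a * c\<bar> \<le> a\<^sup>2 + c\<^sup>2" for a c :: real
    using sum_squares_bound[of "\<bar>a\<bar>" "\<bar>c\<bar>"] by (simp add: abs_mult)
  have 1: "(g i)\<^sup>2 / 2 - 2 * (F i)\<^sup>2 - \<delta> * v\<^sup>2 \<le> (g i + F i) * g i + (g i + F i) * v * b i" if i: "i < d" for i
  proof -
    have "\<bar>g i * v * b i\<bar> \<le> \<bar>g i * v\<bar> * \<delta>" unfolding abs_mult[of _ "b i"]
      by (intro mult_left_mono b i) simp
    also have "\<dots> \<le> ((g i)\<^sup>2 + v\<^sup>2) / 2 * \<delta>" using t[of "g i" v] \<delta> by (intro mult_right_mono) auto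
    finally have a1: "\<bar>g i * v * b i\<bar> \<le> ((g i)\<^sup>2 + v\<^sup>2) / 2 * \<delta>" .
    have "\<bar>F i * v * b i\<bar> \<le> \<bar>F i * v\<bar> * \<delta>" unfolding abs_mult[of _ "b i"]
      by (intro mult_left_mono b i) simp
    also have "\<dots> \<le> ((F i)\<^sup>2 + v\<^sup>2) / 2 * \<delta>" using t[of "F i" v] \<delta> by (intro mult_right_mono) auto
    finally have a2: "\<bar>F i * v * b i\<bar> \<le> ((F i)\<^sup>2 + v\<^sup>2) / 2 * \<delta>" .
    have "2 * \<bar>(g i / 2) * F i\<bar> \<le> (g i / 2)\<^sup>2 + (F i)\<^sup>2" by (rule t)
    then have a3: "\<bar>F i * g i\<bar> \<le> (g i)\<^sup>2 / 4 + (F i)\<^sup>2" by (simp add: power_divide abs_mult mult.commute)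
    have a4: "\<delta> * (g i)\<^sup>2 \<le> 1/4 * (g i)\<^sup>2" "\<delta> * (F i)\<^sup>2 \<le> 1/4 * (F i)\<^sup>2"
      using \<delta> by (intro mult_right_mono; simp)+
    have e: "(g i + F i) * g i + (g i + F i) * v * b i = (g i)\<^sup>2 + F i * g i + g i * v * b i + F i * v * b i"
      by (simp add: algebra_simps power2_eq_square)
    have e2: "((g i)\<^sup>2 + v\<^sup>2) / 2 * \<delta> = \<delta> * (g i)\<^sup>2 / 2 + \<delta> * v\<^sup>2 / 2" "((F i)\<^sup>2 + v\<^sup>2) / 2 * \<delta> = \<delta> * (F i)\<^sup>2 / 2 + \<delta> * v\<^sup>2 / 2"
      by (simp_all add: algebra_simps)
    show ?thesis unfolding e using a1 a2 a3 a4 e2 zero_le_power2[of "F i"] zero_le_power2[of "g i"] by linarith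
  qed
  have "2 * \<bar>(v / 2) * f0\<bar> \<le> (v / 2)\<^sup>2 + f0\<^sup>2" by (rule t)
  then have "\<bar>v * f0\<bar> \<le> v\<^sup>2 / 4 + f0\<^sup>2" by (simp add: power_divide abs_mult)
  then have 2: "v * f0 \<le> v\<^sup>2 / 4 + f0\<^sup>2" by (rule order_trans[OF abs_ge_self])
  have "(\<Sum>i<d. (g i)\<^sup>2 / 2 - 2 * (F i)\<^sup>2 - \<delta> * v\<^sup>2) \<le> (\<Sum>i<d. (g i + F i) * g i + (g i + F i) * v * b i)"
    by (intro sum_mono 1) auto
  then have 3: "(\<Sum>i<d. (g i)\<^sup>2) / 2 - 2 * (\<Sum>i<d. (F i)\<^sup>2) - real d * \<delta> * v\<^sup>2
      \<le> (\<Sum>i<d. (g i + F i) * g i + (g i + F i) * v * b i)"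
    by (simp add: sum_subtractf sum_divide_distrib sum_distrib_left mult.assoc)
  have 4: "real d * \<delta> * v\<^sup>2 \<le> 1/4 * v\<^sup>2" using \<delta> by (intro mult_right_mono) auto
  have 5: "v * (v - f0) = v\<^sup>2 - v * f0" by (simp add: algebra_simps power2_eq_square)
  have 6: "(v\<^sup>2 + S) / 2 - 2 * (f0\<^sup>2 + T) \<le> v\<^sup>2 - v * f0 + U"
    if "S / 2 - 2 * T - real d * \<delta> * v\<^sup>2 \<le> U" for S T U
    proof -
    have "(v\<^sup>2 + S) / 2 = v\<^sup>2 / 2 + S / 2" by (simp add: add_divide_distrib)
    moreover have "2 * (f0\<^sup>2 + T) = 2 * f0\<^sup>2 + 2 * T" by simp
    moreover have "0 \<le> f0\<^sup>2" by simp
    ultimately show ?thesis using that 2 4 by linarith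
  qed
  show ?thesis unfolding 5 by (rule 6[OF 3])
qed

definition bddf :: "nat \<Rightarrow> (vec \<Rightarrow> real) \<Rightarrow> bool" where
  "bddf d g \<longleftrightarrow> (\<exists>B. \<forall>x\<in>euclid d. \<bar>g x\<bar> \<le> B)"

lemma bddfI: "(\<And>x. x \<in> euclid d \<Longrightarrow> \<bar>g x\<bar> \<le> B) \<Longrightarrow> bddf d g"
  unfolding bddf_def by blast

lemma bddf_family:
  assumes "\<And>i. i < d \<Longrightarrow> bddf n (g i)"
  obtains B where "B \<ge> 0" "\<And>i x. i < (d::nat) \<Longrightarrow> x \<in> euclid n \<Longrightarrow> \<bar>g i x\<bar> \<le> B"
proof -
  obtain b where b: "\<And>i x. i < d \<Longrightarrow> x \<in> euclid n \<Longrightarrow> \<bar>g i x\<bar> \<le> b i"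
    using assms unfolding bddf_def by metis
  have "\<bar>g i x\<bar> \<le> (\<Sum>i<d. \<bar>b i\<bar>)" if i: "i < d" and x: "x \<in> euclid n" for i x
  proof -
    have "\<bar>b i\<bar> \<le> (\<Sum>i<d. \<bar>b i\<bar>)" using i by (intro member_le_sum) auto
    then show ?thesis using b[OF i x] by linarith
  qed
  then show ?thesis using that[of "\<Sum>i<d. \<bar>b i\<bar>"] by (simp add: sum_nonneg)
qed

text \<open>The field \<open>w v (grad v + F)\<close>, with \<open>w\<close> the weight, has an
  integrable divergence and vanishes at infinity along lines, since \<open>w\<close> does so and the
  other factors are bounded. Its divergence integrates to 0 and is bounded below by
  \<open>energy_pointwise\<close>. The estimate contains neither \<open>B\<close> nor
  \<open>\<delta>\<close>, so the weight can be removed afterwards.\<close>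

lemma weighted_energy:
  assumes v: "smooth d v" and F: "\<And>i. i < d \<Longrightarrow> smooth d (F i)"
    and f0L: "f0 \<in> L2 d" and FL: "\<And>i. i < d \<Longrightarrow> F i \<in> L2 d"
    and bv: "\<And>x. x \<in> euclid d \<Longrightarrow> \<bar>v x\<bar> \<le> B" and bg: "\<And>i x. i < d \<Longrightarrow> x \<in> euclid d \<Longrightarrow> \<bar>partial i v x\<bar> \<le> B"
    and bF: "\<And>i x. i < d \<Longrightarrow> x \<in> euclid d \<Longrightarrow> \<bar>F i x\<bar> \<le> B"
    and bH: "\<And>i x. i < d \<Longrightarrow> x \<in> euclid d \<Longrightarrow> \<bar>partial i (\<lambda>x. partial i v x + F i x) x\<bar> \<le> B"
    and eq: "\<And>x. x \<in> euclid d \<Longrightarrow> (\<Sum>i<d. partial i (\<lambda>x. partial i v x + F i x) x) = v x - f0 x"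
    and \<delta>: "0 < \<delta>" "real d * \<delta> \<le> 1/4" "\<delta> \<le> 1/4"
  shows "integrable (leb d) (\<lambda>x. wt d \<delta> x * ((v x)\<^sup>2 + (\<Sum>i<d. (partial i v x)\<^sup>2)))"
    and "(\<integral>x. wt d \<delta> x * ((v x)\<^sup>2 + (\<Sum>i<d. (partial i v x)\<^sup>2)) \<partial>leb d)
       \<le> 4 * (\<integral>x. (f0 x)\<^sup>2 + (\<Sum>i<d. (F i x)\<^sup>2) \<partial>leb d)"
proof -
  let ?H = "\<lambda>i x. partial i v x + F i x"
  let ?w = "wt d \<delta>"
  define b where "b = (\<lambda>i (x::vec). - 2 * \<delta>\<^sup>2 * x i / (1 + (\<delta> * x i)\<^sup>2))"
  let ?K = "\<lambda>i x. ?H i x * (v x * ?w x)"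
  have B0: "B \<ge> 0" using bv[of "\<lambda>i\<in>{..<d}. 0"] by force
  have bb: "\<bar>b i x\<bar> \<le> \<delta>" for i x unfolding b_def using \<delta>(1) by (intro wt1_deriv_factor_bound) simp
  have Hs: "smooth d (?H i)" if "i < d" for i by (intro smooth_add smooth_partial v F that)
  have Ks: "smooth d (?K i)" if "i < d" for i by (intro smooth_mult Hs v smooth_wt that)
  have wi: "integrable (leb d) ?w" by (rule integrable_wt[OF \<delta>(1)])
  have bH': "\<bar>?H i x\<bar> \<le> 2 * B" if "i < d" "x \<in> euclid d" for i x
    using bg[OF that] bF[OF that] by linarith
  have dK: "partial i (?K i) x = ?w x * (v x * partial i (?H i) x + (?H i x * partial i v x + ?H i x * v x * b i x))"
    if i: "i < d" and x: "x \<in> euclid d" for i x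
  proof -
    have "partial i (?K i) x = partial i (?H i) x * (v x * ?w x) + ?H i x * partial i (\<lambda>x. v x * ?w x) x"
      by (rule partial_mult[OF Hs[OF i] smooth_mult[OF v smooth_wt] i x])
    also have "partial i (\<lambda>x. v x * ?w x) x = partial i v x * ?w x + v x * (b i x * ?w x)"
      unfolding partial_mult[OF v smooth_wt i x] partial_wt[OF i x] b_def ..
    finally show ?thesis by (simp add: algebra_simps)
  qed
  have Kint: "integrable (leb d) (partial i (?K i))" if i: "i < d" for i
  proof (rule Bochner_Integration.integrable_bound)
    show "integrable (leb d) (\<lambda>x. (B * B + (2 * B * B + 2 * B * B * \<delta>)) * ?w x)"
      by (intro integrable_mult_right wi)
    show "partial i (?K i) \<in> borel_measurable (leb d)"
      by (intro smooth_measurable smooth_partial Ks i)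
    show "AE x in leb d. norm (partial i (?K i) x) \<le> norm ((B * B + (2 * B * B + 2 * B * B * \<delta>)) * ?w x)"
    proof (rule AE_I2)
      fix x assume "x \<in> space (leb d)"
      then have x: "x \<in> euclid d" by (simp add: space_leb)
      have "\<bar>v x * partial i (?H i) x\<bar> \<le> B * B"
        unfolding abs_mult using B0 by (intro mult_mono bv bH i x) auto
      moreover have "\<bar>?H i x * partial i v x\<bar> \<le> 2 * B * B"
        unfolding abs_mult using B0 by (intro mult_mono bH' bg i x) auto
      moreover have "\<bar>?H i x * v x * b i x\<bar> \<le> 2 * B * B * \<delta>"
        unfolding abs_mult using B0 \<delta> by (intro mult_mono bH' bv bb i x) auto
      ultimately have "\<bar>v x * partial i (?H i) x + (?H i x * partial i v x + ?H i x * v x * b i x)\<bar>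
          \<le> B * B + (2 * B * B + 2 * B * B * \<delta>)" by linarith
      then show "norm (partial i (?K i) x) \<le> norm ((B * B + (2 * B * B + 2 * B * B * \<delta>)) * ?w x)"
        unfolding dK[OF i x] using wt_bounds[of d \<delta> x] B0 \<delta>
        by (simp add: abs_mult mult.commute mult_left_mono)
    qed
  qed
  have lim: "((\<lambda>t. ?K i (x(i := t))) \<longlongrightarrow> 0) Fi" if i: "i < d" and x: "x \<in> euclid d"
    and w0: "((\<lambda>t. ?w (x(i := t))) \<longlongrightarrow> 0) Fi" for i x Fi
  proof (rule Lim_null_comparison)
    show "((\<lambda>t. 2 * B * B * ?w (x(i := t))) \<longlongrightarrow> 0) Fi"
      using tendsto_mult[OF tendsto_const w0, of "2 * B * B"] by simp
    have "norm (?K i (x(i := t))) \<le> 2 * B * B * ?w (x(i := t))" for t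
    proof -
      have y: "x(i := t) \<in> euclid d" by (rule euclid_upd[OF x i])
      have "\<bar>?H i (x(i := t))\<bar> * (\<bar>v (x(i := t))\<bar> * ?w (x(i := t))) \<le> (2 * B) * (B * ?w (x(i := t)))"
        using B0 wt_bounds[of d \<delta> "x(i := t)"] by (intro mult_mono bH' bv i y) auto
      then show ?thesis using wt_bounds[of d \<delta> "x(i := t)"] by (simp add: abs_mult mult.assoc)
    qed
    then show "eventually (\<lambda>t. norm (?K i (x(i := t))) \<le> 2 * B * B * ?w (x(i := t))) Fi"
      by (intro always_eventually allI)
  qed
  have K0: "(\<integral>x. partial i (?K i) x \<partial>leb d) = 0" if i: "i < d" for i
    using lim[OF i _ wt_line_tendsto(1)[OF \<delta>(1) i]] lim[OF i _ wt_line_tendsto(2)[OF \<delta>(1) i]]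
    by (intro integral_partial_zero[OF Ks[OF i] i Kint[OF i]])
  have S0: "(\<integral>x. (\<Sum>i<d. partial i (?K i) x) \<partial>leb d) = 0"
    using K0 by (subst Bochner_Integration.integral_sum) (auto intro: Kint)
  have Sint: "integrable (leb d) (\<lambda>x. \<Sum>i<d. partial i (?K i) x)"
    by (intro Bochner_Integration.integrable_sum Kint) auto
  let ?Q = "\<lambda>x. (v x)\<^sup>2 + (\<Sum>i<d. (partial i v x)\<^sup>2)"
  let ?P = "\<lambda>x. (f0 x)\<^sup>2 + (\<Sum>i<d. (F i x)\<^sup>2)"
  have Pint: "integrable (leb d) ?P"
    by (intro Bochner_Integration.integrable_add Bochner_Integration.integrable_sum L2_integrable_sq f0L FL) auto
  have wm[measurable]: "?w \<in> borel_measurable (leb d)" by (intro smooth_measurable smooth_wt)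
  have Pm[measurable]: "?P \<in> borel_measurable (leb d)" using Pint by auto
  have wPint: "integrable (leb d) (\<lambda>x. ?w x * ?P x)"
  proof (rule Bochner_Integration.integrable_bound[OF Pint])
    show "AE x in leb d. norm (?w x * ?P x) \<le> norm (?P x)"
      using wt_bounds[of d \<delta>] by (intro AE_I2) (auto simp: abs_mult intro!: mult_left_le_one_le)
  qed measurable
  have Qb: "0 \<le> ?Q x" "?Q x \<le> B\<^sup>2 + real d * B\<^sup>2" if x: "x \<in> euclid d" for x
  proof -
    show "0 \<le> ?Q x" by (intro add_nonneg_nonneg sum_nonneg) auto
    have "(v x)\<^sup>2 \<le> B\<^sup>2" using power_mono[OF bv[OF x] abs_ge_zero, of 2] by simp
    moreover have "(\<Sum>i<d. (partial i v x)\<^sup>2) \<le> (\<Sum>i<d. B\<^sup>2)"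
      using power_mono[OF bg[OF _ x] abs_ge_zero, of _ 2] by (intro sum_mono) simp
    ultimately show "?Q x \<le> B\<^sup>2 + real d * B\<^sup>2" by simp
  qed
  have [measurable]: "v \<in> borel_measurable (leb d)" by (intro smooth_measurable v)
  have gm: "partial i v \<in> borel_measurable (leb d)" if "i < d" for i by (intro smooth_measurable smooth_partial v that)
  have Qm[measurable]: "?Q \<in> borel_measurable (leb d)"
    by (intro borel_measurable_add borel_measurable_sum borel_measurable_power smooth_measurable v smooth_partial) auto
  show Qint: "integrable (leb d) (\<lambda>x. ?w x * ?Q x)"
  proof (rule Bochner_Integration.integrable_bound)
    show "integrable (leb d) (\<lambda>x. (B\<^sup>2 + real d * B\<^sup>2) * ?w x)" by (intro integrable_mult_right wi)
    show "AE x in leb d. norm (?w x * ?Q x) \<le> norm ((B\<^sup>2 + real d * B\<^sup>2) * ?w x)"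
    proof (rule AE_I2)
      fix x assume "x \<in> space (leb d)"
      then have x: "x \<in> euclid d" by (simp add: space_leb)
      have "?Q x * ?w x \<le> (B\<^sup>2 + real d * B\<^sup>2) * ?w x"
        by (rule mult_right_mono[OF Qb(2)[OF x] wt_bounds(1)])
      moreover have "0 \<le> ?w x * ?Q x" by (rule mult_nonneg_nonneg[OF wt_bounds(1) Qb(1)[OF x]])
      ultimately show "norm (?w x * ?Q x) \<le> norm ((B\<^sup>2 + real d * B\<^sup>2) * ?w x)"
        unfolding real_norm_def by (simp only: abs_of_nonneg mult.commute)
    qed
  qed measurable
  have "(\<integral>x. ?w x * ?Q x / 2 - 2 * (?w x * ?P x) \<partial>leb d) \<le> (\<integral>x. (\<Sum>i<d. partial i (?K i) x) \<partial>leb d)"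
  proof (rule integral_mono[OF _ Sint])
    show "integrable (leb d) (\<lambda>x. ?w x * ?Q x / 2 - 2 * (?w x * ?P x))"
      using Qint wPint by (intro Bochner_Integration.integrable_diff integrable_divide integrable_mult_right)
    fix x assume "x \<in> space (leb d)"
    then have x: "x \<in> euclid d" by (simp add: space_leb)
    have "(\<Sum>i<d. partial i (?K i) x) = ?w x * (v x * (\<Sum>i<d. partial i (?H i) x)
        + (\<Sum>i<d. ?H i x * partial i v x + ?H i x * v x * b i x))"
      using dK[OF _ x] by (simp add: sum_distrib_left sum.distrib distrib_left)
    also have "(\<Sum>i<d. partial i (?H i) x) = v x - f0 x" by (rule eq[OF x])
    finally have e: "(\<Sum>i<d. partial i (?K i) x) = ?w x * (v x * (v x - f0 x)
        + (\<Sum>i<d. ?H i x * partial i v x + ?H i x * v x * b i x))" .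
    have "?w x * (?Q x / 2 - 2 * ?P x) \<le> (\<Sum>i<d. partial i (?K i) x)"
      unfolding e using \<delta> bb by (intro mult_left_mono wt_bounds energy_pointwise[where \<delta> = \<delta>]) auto
    then show "?w x * ?Q x / 2 - 2 * (?w x * ?P x) \<le> (\<Sum>i<d. partial i (?K i) x)"
      by (simp add: right_diff_distrib distrib_left mult.left_commute)
  qed
  also have "(\<integral>x. ?w x * ?Q x / 2 - 2 * (?w x * ?P x) \<partial>leb d)
      = (\<integral>x. ?w x * ?Q x \<partial>leb d) / 2 - 2 * (\<integral>x. ?w x * ?P x \<partial>leb d)"
    using Qint wPint by (subst Bochner_Integration.integral_diff) (auto intro!: integrable_divide integrable_mult_right)
  finally have "(\<integral>x. ?w x * ?Q x \<partial>leb d) \<le> 4 * (\<integral>x. ?w x * ?P x \<partial>leb d)" unfolding S0 by linarith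
  also have "(\<integral>x. ?w x * ?P x \<partial>leb d) \<le> (\<integral>x. ?P x \<partial>leb d)"
    using wt_bounds[of d \<delta>]
    by (intro integral_mono wPint Pint mult_left_le_one_le add_nonneg_nonneg sum_nonneg) auto
  finally show "(\<integral>x. ?w x * ?Q x \<partial>leb d) \<le> 4 * (\<integral>x. ?P x \<partial>leb d)" by linarith
qed

text \<open>Fatou's lemma, as the weights tend to 1 under a bound that is uniform in the weight.
  Here a solution known only to be bounded is recognised as a member of H1.\<close>

lemma energy_L2:
  assumes v: "smooth d v" and F: "\<And>i. i < d \<Longrightarrow> smooth d (F i)"
    and f0L: "f0 \<in> L2 d" and FL: "\<And>i. i < d \<Longrightarrow> F i \<in> L2 d"
    and bv: "bddf d v" and bg: "\<And>i. i < d \<Longrightarrow> bddf d (partial i v)"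
    and bF: "\<And>i. i < d \<Longrightarrow> bddf d (F i)"
    and bH: "\<And>i. i < d \<Longrightarrow> bddf d (partial i (\<lambda>x. partial i v x + F i x))"
    and eq: "\<And>x. x \<in> euclid d \<Longrightarrow> (\<Sum>i<d. partial i (\<lambda>x. partial i v x + F i x) x) = v x - f0 x"
  shows "v \<in> L2 d" and "\<And>i. i < d \<Longrightarrow> partial i v \<in> L2 d"
proof -
  obtain B1 where B1: "\<And>x. x \<in> euclid d \<Longrightarrow> \<bar>v x\<bar> \<le> B1" using bv unfolding bddf_def by blast
  obtain B2 where B2: "B2 \<ge> 0" "\<And>i x. i < d \<Longrightarrow> x \<in> euclid d \<Longrightarrow> \<bar>partial i v x\<bar> \<le> B2"
    using bddf_family[of d d "\<lambda>i. partial i v", OF bg] by blast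
  obtain B3 where B3: "B3 \<ge> 0" "\<And>i x. i < d \<Longrightarrow> x \<in> euclid d \<Longrightarrow> \<bar>F i x\<bar> \<le> B3"
    using bddf_family[of d d F, OF bF] by blast
  obtain B4 where B4: "B4 \<ge> 0" "\<And>i x. i < d \<Longrightarrow> x \<in> euclid d \<Longrightarrow> \<bar>partial i (\<lambda>x. partial i v x + F i x) x\<bar> \<le> B4"
    using bddf_family[of d d "\<lambda>i. partial i (\<lambda>x. partial i v x + F i x)", OF bH] by blast
  define B where "B = \<bar>B1\<bar> + B2 + B3 + B4"
  have B: "\<bar>v x\<bar> \<le> B" if "x \<in> euclid d" for x
    unfolding B_def using B1[OF that] B2(1) B3(1) B4(1) by linarith
  have B': "\<bar>partial i v x\<bar> \<le> B" "\<bar>F i x\<bar> \<le> B" "\<bar>partial i (\<lambda>x. partial i v x + F i x) x\<bar> \<le> B"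
    if "i < d" "x \<in> euclid d" for i x
    unfolding B_def using B2(2)[OF that] B3(2)[OF that] B4(2)[OF that] B2(1) B3(1) B4(1) by linarith+
  let ?Q = "\<lambda>x. (v x)\<^sup>2 + (\<Sum>i<d. (partial i v x)\<^sup>2)"
  let ?P = "\<lambda>x. (f0 x)\<^sup>2 + (\<Sum>i<d. (F i x)\<^sup>2)"
  have Q0: "0 \<le> ?Q x" for x by (intro add_nonneg_nonneg sum_nonneg) auto
  \<comment> \<open>The offset keeps \<open>\<delta> n\<close> and \<open>d * \<delta> n\<close>
    below 1/4 from the first index on.\<close>
  define \<delta> where "\<delta> = (\<lambda>n. 1 / real (Suc (n + 4 * Suc d)))"
  have we: "integrable (leb d) (\<lambda>x. wt d (\<delta> n) x * ?Q x)"
    "(\<integral>x. wt d (\<delta> n) x * ?Q x \<partial>leb d) \<le> 4 * (\<integral>x. ?P x \<partial>leb d)" for n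
  proof -
    have d1: "0 < \<delta> n" "real d * \<delta> n \<le> 1/4" "\<delta> n \<le> 1/4" by (auto simp: \<delta>_def field_simps)
    note * = weighted_energy[OF v F f0L FL B B' eq d1]
    show "integrable (leb d) (\<lambda>x. wt d (\<delta> n) x * ?Q x)"
      by (rule *(1))
    show "(\<integral>x. wt d (\<delta> n) x * ?Q x \<partial>leb d) \<le> 4 * (\<integral>x. ?P x \<partial>leb d)"
      by (rule *(2))
  qed
  have vm[measurable]: "v \<in> borel_measurable (leb d)" by (intro smooth_measurable v)
  have gm: "partial i v \<in> borel_measurable (leb d)" if "i < d" for i
    by (intro smooth_measurable smooth_partial v that)
  have Qm[measurable]: "?Q \<in> borel_measurable (leb d)"
    by (intro borel_measurable_add borel_measurable_sum borel_measurable_power smooth_measurable v smooth_partial) auto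
  have wm[measurable]: "wt d (\<delta> n) \<in> borel_measurable (leb d)" for n by (intro smooth_measurable smooth_wt)
  have wl: "(\<lambda>n. wt d (\<delta> n) x) \<longlonglongrightarrow> 1" for x
    unfolding \<delta>_def using LIMSEQ_ignore_initial_segment[OF wt_tendsto] .
  have "(\<integral>\<^sup>+x. ennreal (?Q x) \<partial>leb d) = (\<integral>\<^sup>+x. liminf (\<lambda>n. ennreal (wt d (\<delta> n) x * ?Q x)) \<partial>leb d)"
  proof (rule nn_integral_cong)
    fix x
    have "(\<lambda>n. ennreal (wt d (\<delta> n) x * ?Q x)) \<longlonglongrightarrow> ennreal (1 * ?Q x)"
      by (intro tendsto_ennrealI tendsto_mult wl tendsto_const)
    from lim_imp_Liminf[OF sequentially_bot this]
    show "ennreal (?Q x) = liminf (\<lambda>n. ennreal (wt d (\<delta> n) x * ?Q x))"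
      by (simp only: mult_1)
  qed
  also have "\<dots> \<le> liminf (\<lambda>n. \<integral>\<^sup>+x. ennreal (wt d (\<delta> n) x * ?Q x) \<partial>leb d)"
    by (rule nn_integral_liminf) measurable
  also have "\<dots> \<le> limsup (\<lambda>n. \<integral>\<^sup>+x. ennreal (wt d (\<delta> n) x * ?Q x) \<partial>leb d)"
    by (rule Liminf_le_Limsup) simp
  also have "\<dots> \<le> ennreal (4 * (\<integral>x. ?P x \<partial>leb d))"
  proof (rule Limsup_bounded, rule always_eventually, rule allI)
    fix n
    have "(\<integral>\<^sup>+x. ennreal (wt d (\<delta> n) x * ?Q x) \<partial>leb d) = ennreal (\<integral>x. wt d (\<delta> n) x * ?Q x \<partial>leb d)"
      by (intro nn_integral_eq_integral we AE_I2 mult_nonneg_nonneg wt_bounds Q0)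
    then show "(\<integral>\<^sup>+x. ennreal (wt d (\<delta> n) x * ?Q x) \<partial>leb d) \<le> ennreal (4 * (\<integral>x. ?P x \<partial>leb d))"
      using we(2)[of n] by (simp add: ennreal_leI)
  qed
  finally have "(\<integral>\<^sup>+x. ennreal (?Q x) \<partial>leb d) < \<infinity>"
    by (rule order_le_less_trans) simp
  then have Qi: "integrable (leb d) ?Q"
    using Q0 by (intro integrableI_nonneg) auto
  have "integrable (leb d) (\<lambda>x. (v x)\<^sup>2)"
  proof (rule Bochner_Integration.integrable_bound[OF Qi])
    show "AE x in leb d. norm ((v x)\<^sup>2) \<le> norm (?Q x)"
      using Q0 by (intro AE_I2) (simp add: sum_nonneg)
  qed measurable
  then show "v \<in> L2 d" by (simp add: L2_def)
  fix i assume i: "i < d"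
  have "integrable (leb d) (\<lambda>x. (partial i v x)\<^sup>2)"
  proof (rule Bochner_Integration.integrable_bound[OF Qi])
    show "(\<lambda>x. (partial i v x)\<^sup>2) \<in> borel_measurable (leb d)" using gm[OF i] by measurable
    show "AE x in leb d. norm ((partial i v x)\<^sup>2) \<le> norm (?Q x)"
    proof (rule AE_I2)
      fix x
      have "(partial i v x)\<^sup>2 \<le> (\<Sum>i<d. (partial i v x)\<^sup>2)" using i by (intro member_le_sum) auto
      then show "norm ((partial i v x)\<^sup>2) \<le> norm (?Q x)" using Q0[of x] by (simp add: add_increasing)
    qed
  qed
  then show "partial i v \<in> L2 d" using gm[OF i] by (simp add: L2_def)
qed

section \<open>The preconditioned iteration contracts\<close>

lemma vnorm_cmult: "vnorm n (\<lambda>i. k * u i) = \<bar>k\<bar> * vnorm n u"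
  by (simp add: L2_set_def power_mult_distrib sum_distrib_left[symmetric] real_sqrt_mult)

text \<open>\<open>op_norm\<close> is a supremum of reals and dominates its set only once the set is
  known to be bounded; the sum of all absolute entries is a crude bound that serves this purpose.
  Scaling and the Cauchy-Schwarz inequality follow.\<close>

lemma op_norm_bilinear:
  "\<bar>\<Sum>i<d. (\<Sum>j<d. M i j * \<xi> j) * \<eta> i\<bar> \<le> op_norm d M * vnorm d \<xi> * vnorm d \<eta>"
proof -
  let ?E = "{x\<in>euclid d. vnorm d x \<le> 1}"
  have mv: "vnorm d (mat_vec d M x) = vnorm d (\<lambda>i. \<Sum>j<d. M i j * x j)" for x
    unfolding mat_vec_def by (rule L2_set_cong) auto
  have "bdd_above ((\<lambda>x. vnorm d (mat_vec d M x)) ` ?E)"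
  proof (rule bdd_aboveI2)
    fix x assume x: "x \<in> ?E"
    have "vnorm d (mat_vec d M x) \<le> (\<Sum>i<d. \<bar>\<Sum>j<d. M i j * x j\<bar>)"
      unfolding mv by (rule L2_set_le_sum_abs)
    also have "\<dots> \<le> (\<Sum>i<d. \<Sum>j<d. \<bar>M i j\<bar>)"
    proof (rule sum_mono)
      fix i
      have "\<bar>\<Sum>j<d. M i j * x j\<bar> \<le> (\<Sum>j<d. \<bar>M i j * x j\<bar>)" by (rule sum_abs)
      also have "\<dots> \<le> (\<Sum>j<d. \<bar>M i j\<bar>)"
      proof (rule sum_mono)
        fix j assume "j \<in> {..<d}"
        then have "\<bar>x j\<bar> \<le> 1" using abs_component_le_vnorm[of j d x] x by auto
        then show "\<bar>M i j * x j\<bar> \<le> \<bar>M i j\<bar>" unfolding abs_mult by (rule mult_left_le) simp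
      qed
      finally show "\<bar>\<Sum>j<d. M i j * x j\<bar> \<le> (\<Sum>j<d. \<bar>M i j\<bar>)" .
    qed
    finally show "vnorm d (mat_vec d M x) \<le> (\<Sum>i<d. \<Sum>j<d. \<bar>M i j\<bar>)" .
  qed
  then have up: "vnorm d (\<lambda>i. \<Sum>j<d. M i j * x j) \<le> op_norm d M" if "x \<in> ?E" for x
    unfolding op_norm_def mv[symmetric] by (rule cSUP_upper[OF that])
  have 1: "vnorm d (\<lambda>i. \<Sum>j<d. M i j * \<xi> j) \<le> op_norm d M * vnorm d \<xi>"
  proof (cases "vnorm d \<xi> = 0")
    case True
    then have "\<And>j. j < d \<Longrightarrow> \<xi> j = 0" using abs_component_le_vnorm[of _ d \<xi>] by fastforce
    then show ?thesis using True by (simp add: L2_set_def)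
  next
    case False
    define s where "s = vnorm d \<xi>"
    have s: "s > 0" using False L2_set_nonneg[of \<xi> "{..<d}"] unfolding s_def by linarith
    define x where "x = (\<lambda>j\<in>{..<d}. \<xi> j / s)"
    have "vnorm d x = vnorm d (\<lambda>j. (1 / s) * \<xi> j)" unfolding x_def by (rule L2_set_cong) auto
    also have "\<dots> = (1 / s) * s" unfolding vnorm_cmult using s by (simp add: s_def)
    finally have "vnorm d x = 1" using s by simp
    then have "x \<in> ?E" by (simp add: x_def)
    then have "vnorm d (\<lambda>i. \<Sum>j<d. M i j * x j) \<le> op_norm d M" by (rule up)
    also have "vnorm d (\<lambda>i. \<Sum>j<d. M i j * x j) = vnorm d (\<lambda>i. (1 / s) * (\<Sum>j<d. M i j * \<xi> j))"
      by (rule L2_set_cong) (auto simp: x_def sum_distrib_left)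
    also have "\<dots> = (1 / s) * vnorm d (\<lambda>i. \<Sum>j<d. M i j * \<xi> j)"
      unfolding vnorm_cmult using s by simp
    finally show ?thesis using s unfolding s_def[symmetric] by (simp add: field_simps)
  qed
  have "\<bar>\<Sum>i<d. (\<Sum>j<d. M i j * \<xi> j) * \<eta> i\<bar> \<le> (\<Sum>i<d. \<bar>\<Sum>j<d. M i j * \<xi> j\<bar> * \<bar>\<eta> i\<bar>)"
    using sum_abs[of "\<lambda>i. (\<Sum>j<d. M i j * \<xi> j) * \<eta> i" "{..<d}"] by (simp add: abs_mult)
  also have "\<dots> \<le> vnorm d (\<lambda>i. \<Sum>j<d. M i j * \<xi> j) * vnorm d \<eta>" by (rule L2_set_mult_ineq)
  also have "\<dots> \<le> (op_norm d M * vnorm d \<xi>) * vnorm d \<eta>"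
    by (rule mult_right_mono[OF 1 L2_set_nonneg])
  finally show ?thesis .
qed

text \<open>The squared H1 norm as a single integral and for any choice \<open>p\<close> of the weak
  gradient, so that pointwise inequalities can be integrated directly.\<close>

definition nsq :: "nat \<Rightarrow> (vec \<Rightarrow> real) \<Rightarrow> (nat \<Rightarrow> vec \<Rightarrow> real) \<Rightarrow> real" where
  "nsq d v p = (\<integral>x. (v x)\<^sup>2 + (\<Sum>i<d. (p i x)\<^sup>2) \<partial>leb d)"

lemma H1_rep_integrable:
  assumes "H1_rep d v p" shows "integrable (leb d) (\<lambda>x. (v x)\<^sup>2 + (\<Sum>i<d. (p i x)\<^sup>2))"
  using assms unfolding H1_rep_def
  by (intro Bochner_Integration.integrable_add Bochner_Integration.integrable_sum L2_integrable_sq) auto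

lemma H1_norm_nsq:
  assumes "H1_rep d v p" shows "H1_norm d v = sqrt (nsq d v p)"
proof -
  have "nsq d v p = (\<integral>x. (v x)\<^sup>2 \<partial>leb d) + (\<integral>x. (\<Sum>i<d. (p i x)\<^sup>2) \<partial>leb d)"
    unfolding nsq_def using assms unfolding H1_rep_def
    by (intro Bochner_Integration.integral_add Bochner_Integration.integrable_sum L2_integrable_sq) auto
  also have "(\<integral>x. (\<Sum>i<d. (p i x)\<^sup>2) \<partial>leb d) = (\<Sum>i<d. \<integral>x. (p i x)\<^sup>2 \<partial>leb d)"
    using assms unfolding H1_rep_def by (intro Bochner_Integration.integral_sum L2_integrable_sq) auto
  finally show ?thesis using H1_norm_rep[OF assms] by simp
qed

lemma nsq_nonneg: "nsq d v p \<ge> 0"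
  unfolding nsq_def by (intro integral_nonneg_AE AE_I2 add_nonneg_nonneg sum_nonneg) auto

text \<open>As with \<open>op_norm\<close>, the real supremum in \<open>Hminus1_norm\<close> is an
  upper bound only after boundedness has been established.\<close>

lemma Hminus1_bdd:
  assumes f: "f \<in> L2 d"
  shows "bdd_above ((\<lambda>v. \<bar>\<integral>x. f x * v x \<partial>leb d\<bar>) ` {v\<in>H1 d. H1_norm d v \<le> 1})"
proof (rule bdd_aboveI2)
  fix v assume "v \<in> {v\<in>H1 d. H1_norm d v \<le> 1}"
  then have v: "v \<in> H1 d" and n: "H1_norm d v \<le> 1" by auto
  note rep = H1_rep_wpartial[OF v]
  have vL: "v \<in> L2 d" using rep by (simp add: H1_rep_def)
  have "(\<integral>x. (v x)\<^sup>2 \<partial>leb d) \<le> nsq d v (\<lambda>i. wpartial d i v)"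
    unfolding nsq_def by (intro integral_mono L2_integrable_sq vL H1_rep_integrable rep) (simp add: sum_nonneg)
  also have "\<dots> \<le> 1" using n unfolding H1_norm_nsq[OF rep] by simp
  finally have v1: "(\<integral>x. (v x)\<^sup>2 \<partial>leb d) \<le> 1" .
  have "\<bar>\<integral>x. f x * v x \<partial>leb d\<bar> \<le> (\<integral>x. \<bar>f x * v x\<bar> \<partial>leb d)" by (rule integral_abs_bound)
  also have "\<dots> \<le> (\<integral>x. (f x)\<^sup>2 + (v x)\<^sup>2 \<partial>leb d)"
    by (intro integral_mono integrable_abs L2_mult_integrable Bochner_Integration.integrable_add L2_integrable_sq f vL abs_mult_le_sq)
  also have "\<dots> = (\<integral>x. (f x)\<^sup>2 \<partial>leb d) + (\<integral>x. (v x)\<^sup>2 \<partial>leb d)"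
    by (intro Bochner_Integration.integral_add L2_integrable_sq f vL)
  also have "\<dots> \<le> (\<integral>x. (f x)\<^sup>2 \<partial>leb d) + 1" using v1 by simp
  finally show "\<bar>\<integral>x. f x * v x \<partial>leb d\<bar> \<le> (\<integral>x. (f x)\<^sup>2 \<partial>leb d) + 1" .
qed

text \<open>Smoothness of the coefficients and bounds on the entries of \<open>A\<close> are what
  the Barron hypotheses contribute to the differential equation. Isolating them keeps this part free
  of any activation.\<close>

locale elliptic =
  fixes d :: nat and A :: "vec \<Rightarrow> nat \<Rightarrow> nat \<Rightarrow> real" and c f us :: "vec \<Rightarrow> real"
    and amin amax cmin cmax :: real
  assumes coeff: "Coeff d A c f amin amax cmin cmax"
    and A_smooth: "\<And>i j. i < d \<Longrightarrow> j < d \<Longrightarrow> smooth d (\<lambda>x. A x i j)"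
    and A_bdd: "\<And>i j. i < d \<Longrightarrow> j < d \<Longrightarrow> bddf d (\<lambda>x. A x i j)"
    and c_smooth: "smooth d c" and f_smooth: "smooth d f"
    and sol: "weak_solution d A c f us"
begin

definition "m = min amin cmin"
text \<open>The summand \<open>m\<close> ensures \<open>m \<le> M\<close> without a comparison of
  the given bounds with each other, so the contraction factor is well defined.\<close>

definition "M = \<bar>amax\<bar> + \<bar>cmax\<bar> + m"

lemma m_pos: "m > 0" and mM: "m \<le> M"
  using coeff by (auto simp: Coeff_def m_def M_def)

lemma f_L2: "f \<in> L2 d"
  using coeff by (simp add: Coeff_def)

lemma c_bounds: "x \<in> euclid d \<Longrightarrow> m \<le> c x \<and> \<bar>c x\<bar> \<le> M"
  using coeff m_pos by (fastforce simp: Coeff_def m_def M_def)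

lemma c_L2: "u \<in> L2 d \<Longrightarrow> (\<lambda>x. c x * u x) \<in> L2 d"
  using c_bounds by (intro L2_bounded_mult[where C = M] smooth_measurable c_smooth) auto

definition flux :: "(nat \<Rightarrow> vec \<Rightarrow> real) \<Rightarrow> nat \<Rightarrow> vec \<Rightarrow> real" where
  "flux q i x = (\<Sum>j<d. A x i j * q j x)"

lemma flux_L2:
  assumes q: "\<And>j. j < d \<Longrightarrow> q j \<in> L2 d" and i: "i < d" shows "flux q i \<in> L2 d"
  unfolding flux_def[abs_def]
proof (rule L2_sum)
  fix j assume "j \<in> {..<d}"
  then have j: "j < d" by simp
  obtain B where B: "\<And>x. x \<in> euclid d \<Longrightarrow> \<bar>A x i j\<bar> \<le> B" using A_bdd[OF i j] unfolding bddf_def by blast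
  show "(\<lambda>x. A x i j * q j x) \<in> L2 d"
    by (rule L2_bounded_mult[OF q[OF j] smooth_measurable[OF A_smooth[OF i j]] B])
qed

definition form :: "(vec \<Rightarrow> real) \<Rightarrow> (nat \<Rightarrow> vec \<Rightarrow> real) \<Rightarrow> (vec \<Rightarrow> real) \<Rightarrow> (nat \<Rightarrow> vec \<Rightarrow> real) \<Rightarrow> vec \<Rightarrow> real" where
  "form u q v p x = (\<Sum>i<d. flux q i x * p i x) + c x * u x * v x"

lemma form_integrable:
  assumes "H1_rep d u q" "H1_rep d v p" shows "integrable (leb d) (form u q v p)"
  unfolding form_def[abs_def] using assms unfolding H1_rep_def
  by (intro Bochner_Integration.integrable_add Bochner_Integration.integrable_sum L2_mult_integrable flux_L2 c_L2) auto

lemma form_lower: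
  assumes x: "x \<in> euclid d" shows "m * ((v x)\<^sup>2 + (\<Sum>i<d. (p i x)\<^sup>2)) \<le> form v p v p x"
proof -
  define \<xi> where "\<xi> = (\<lambda>i\<in>{..<d}. p i x)"
  have \<xi>: "\<xi> \<in> euclid d" by (simp add: \<xi>_def)
  have "amin * (vnorm d \<xi>)\<^sup>2 \<le> vdot d \<xi> (mat_vec d (A x) \<xi>)"
    using coeff x \<xi> by (auto simp: Coeff_def)
  also have "vdot d \<xi> (mat_vec d (A x) \<xi>) = (\<Sum>i<d. flux p i x * p i x)"
    by (simp add: vdot_def mat_vec_def \<xi>_def flux_def mult.commute)
  also have "(vnorm d \<xi>)\<^sup>2 = (\<Sum>i<d. (p i x)\<^sup>2)"
    by (simp add: L2_set_def \<xi>_def sum_nonneg)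
  finally have 1: "amin * (\<Sum>i<d. (p i x)\<^sup>2) \<le> (\<Sum>i<d. flux p i x * p i x)" .
  have "m * (\<Sum>i<d. (p i x)\<^sup>2) \<le> amin * (\<Sum>i<d. (p i x)\<^sup>2)"
    by (intro mult_right_mono sum_nonneg) (auto simp: m_def)
  moreover have "m * (v x)\<^sup>2 \<le> c x * (v x)\<^sup>2" using c_bounds[OF x] by (intro mult_right_mono) auto
  ultimately show ?thesis using 1
    by (simp add: form_def distrib_left power2_eq_square mult.assoc)
qed

text \<open>Cauchy-Schwarz and Young, with factor 1/2 on the second argument: when the same function
  is tested with and estimated, this half is absorbed by the left-hand side.\<close>

lemma form_upper:
  assumes x: "x \<in> euclid d"
  shows "form u q v p x \<le> M\<^sup>2 / 2 * ((u x)\<^sup>2 + (\<Sum>i<d. (q i x)\<^sup>2)) + ((v x)\<^sup>2 + (\<Sum>i<d. (p i x)\<^sup>2)) / 2"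
proof -
  have t: "a * b \<le> (a\<^sup>2 + b\<^sup>2) / 2" for a b :: real using sum_squares_bound[of a b] by simp
  have M0: "M \<ge> 0" using m_pos mM by simp
  let ?q = "vnorm d (\<lambda>i. q i x)" and ?p = "vnorm d (\<lambda>i. p i x)"
  have sq: "?q\<^sup>2 = (\<Sum>i<d. (q i x)\<^sup>2)" "?p\<^sup>2 = (\<Sum>i<d. (p i x)\<^sup>2)"
    by (simp_all add: L2_set_def sum_nonneg)
  have "op_norm d (A x) \<le> M" using coeff x m_pos by (fastforce simp: Coeff_def M_def)
  then have "op_norm d (A x) * (?q * ?p) \<le> M * (?q * ?p)" by (intro mult_right_mono) auto
  then have "(\<Sum>i<d. flux q i x * p i x) \<le> (M * ?q) * ?p"
    using op_norm_bilinear[where M = "A x" and d = d and \<xi> = "\<lambda>i. q i x" and \<eta> = "\<lambda>i. p i x"]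
    by (simp add: flux_def mult.assoc)
  also have "\<dots> \<le> ((M * ?q)\<^sup>2 + ?p\<^sup>2) / 2" by (rule t)
  finally have 1: "(\<Sum>i<d. flux q i x * p i x) \<le> (M\<^sup>2 * (\<Sum>i<d. (q i x)\<^sup>2) + (\<Sum>i<d. (p i x)\<^sup>2)) / 2"
    by (simp add: power_mult_distrib sq)
  have "c x * u x * v x \<le> ((c x * u x)\<^sup>2 + (v x)\<^sup>2) / 2" by (rule t)
  also have "(c x * u x)\<^sup>2 \<le> M\<^sup>2 * (u x)\<^sup>2"
  proof -
    have "(c x)\<^sup>2 \<le> M\<^sup>2" using power_mono[of "\<bar>c x\<bar>" M 2] c_bounds[OF x] by simp
    then show ?thesis by (simp add: power_mult_distrib mult_right_mono)
  qed
  finally have 2: "c x * u x * v x \<le> (M\<^sup>2 * (u x)\<^sup>2 + (v x)\<^sup>2) / 2" by simp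
  show ?thesis using 1 2 by (simp add: form_def field_simps)
qed

lemma sol_rep: "H1_rep d us (\<lambda>i. wpartial d i us)"
  using sol by (intro H1_rep_wpartial) (simp add: weak_solution_def)

text \<open>\<open>weak_solution\<close> speaks of the chosen representatives
  \<open>wpartial\<close>. Weak gradients agree almost everywhere, so any representative may take
  their place in the test function.\<close>

lemma sol_eq:
  assumes "H1_rep d \<phi> p"
  shows "(\<integral>x. form us (\<lambda>i. wpartial d i us) \<phi> p x \<partial>leb d) = (\<integral>x. f x * \<phi> x \<partial>leb d)"
proof -
  let ?q = "\<lambda>i. wpartial d i us"
  have \<phi>: "\<phi> \<in> H1 d" using assms by (rule H1_rep_H1)
  note r = H1_rep_wpartial[OF \<phi>]
  have "(\<integral>x. form us ?q \<phi> p x \<partial>leb d) = (\<integral>x. form us ?q \<phi> (\<lambda>i. wpartial d i \<phi>) x \<partial>leb d)"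
  proof (rule integral_cong_AE)
    have "AE x in leb d. \<forall>i\<in>{..<d}. wpartial d i \<phi> x = p i x"
      by (intro AE_finite_allI wpartial_AE[OF assms]) auto
    then show "AE x in leb d. form us ?q \<phi> p x = form us ?q \<phi> (\<lambda>i. wpartial d i \<phi>) x"
      by eventually_elim (simp add: form_def)
  qed (use form_integrable[OF sol_rep assms] form_integrable[OF sol_rep r] in auto)
  also have "\<dots> = (\<integral>x. (\<Sum>i<d. flux ?q i x * wpartial d i \<phi> x) \<partial>leb d) + (\<integral>x. c x * us x * \<phi> x \<partial>leb d)"
    unfolding form_def using sol_rep r unfolding H1_rep_def
    by (intro Bochner_Integration.integral_add Bochner_Integration.integrable_sum L2_mult_integrable flux_L2 c_L2) auto
  also have "(\<lambda>x. \<Sum>i<d. flux ?q i x * wpartial d i \<phi> x)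
      = (\<lambda>x. vdot d (mat_vec d (A x) (\<lambda>j. wpartial d j us x)) (\<lambda>i. wpartial d i \<phi> x))"
    by (simp add: vdot_def mat_vec_def flux_def)
  also have "(\<integral>x. vdot d (mat_vec d (A x) (\<lambda>j. wpartial d j us x)) (\<lambda>i. wpartial d i \<phi> x) \<partial>leb d)
       + (\<integral>x. c x * us x * \<phi> x \<partial>leb d) = (\<integral>x. f x * \<phi> x \<partial>leb d)"
    using sol \<phi> by (simp add: weak_solution_def)
  finally show ?thesis .
qed

text \<open>Testing the equation with \<open>us\<close> itself gives \<open>m N^2 \<le> N F\<close>,
  where \<open>N\<close> is its H1 norm and \<open>F\<close> the dual norm of \<open>f\<close>.
  Through this bound the number of iterations depends on \<open>f\<close> by its dual norm
  only.\<close>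

lemma sol_bound: "H1_norm d us \<le> Hminus1_norm d f / m"
proof -
  let ?q = "\<lambda>i. wpartial d i us"
  let ?N = "H1_norm d us"
  have N: "?N = sqrt (nsq d us ?q)" by (rule H1_norm_nsq[OF sol_rep])
  have N0: "?N \<ge> 0" unfolding N by (simp add: nsq_nonneg)
  show ?thesis
  proof (cases "?N = 0")
    case True
    \<comment> \<open>If \<open>us\<close> has norm 0, what remains is that the dual norm is
      nonnegative; the zero function in the supremum shows it.\<close>
    have "(\<lambda>x. 0) \<in> {v\<in>H1 d. H1_norm d v \<le> 1}"
      using H1_rep_H1[OF H1_rep_zero[of d]] H1_norm_nsq[OF H1_rep_zero[of d]] by (simp add: nsq_def)
    moreover have "bdd_above ((\<lambda>v. \<bar>\<integral>x. f x * v x \<partial>leb d\<bar>) ` {v\<in>H1 d. H1_norm d v \<le> 1})"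
      by (rule Hminus1_bdd[OF f_L2])
    ultimately have "\<bar>\<integral>x. f x * 0 \<partial>leb d\<bar> \<le> Hminus1_norm d f"
      unfolding Hminus1_norm_def by (rule cSUP_upper)
    then show ?thesis using True m_pos by simp
  next
    case False
    then have Np: "?N > 0" using N0 by simp
    have rep: "H1_rep d (\<lambda>x. 0 + (1 / ?N) * us x) (\<lambda>i x. 0 + (1 / ?N) * ?q i x)"
      by (rule H1_rep_lin[OF H1_rep_zero sol_rep])
    have "nsq d (\<lambda>x. 0 + (1 / ?N) * us x) (\<lambda>i x. 0 + (1 / ?N) * ?q i x) = (1 / ?N)\<^sup>2 * nsq d us ?q"
      unfolding nsq_def by (simp add: power_divide sum_divide_distrib[symmetric] add_divide_distrib[symmetric])
    also have "\<dots> = 1" using Np unfolding N by (simp add: power_divide nsq_nonneg)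
    finally have "H1_norm d (\<lambda>x. 0 + (1 / ?N) * us x) = 1" unfolding H1_norm_nsq[OF rep] by simp
    then have "(\<lambda>x. 0 + (1 / ?N) * us x) \<in> {v\<in>H1 d. H1_norm d v \<le> 1}" using H1_rep_H1[OF rep] by simp
    then have "\<bar>\<integral>x. f x * (0 + (1 / ?N) * us x) \<partial>leb d\<bar> \<le> Hminus1_norm d f"
      unfolding Hminus1_norm_def by (rule cSUP_upper[OF _ Hminus1_bdd[OF f_L2]])
    then have 1: "\<bar>\<integral>x. f x * us x \<partial>leb d\<bar> \<le> ?N * Hminus1_norm d f"
      using Np by (simp add: field_simps)
    have "m * ?N\<^sup>2 = (\<integral>x. m * ((us x)\<^sup>2 + (\<Sum>i<d. (?q i x)\<^sup>2)) \<partial>leb d)"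
      unfolding N by (simp add: nsq_nonneg) (simp add: nsq_def)
    also have "\<dots> \<le> (\<integral>x. form us ?q us ?q x \<partial>leb d)"
      by (intro integral_mono integrable_mult_right H1_rep_integrable form_integrable sol_rep form_lower) (simp add: space_leb)
    also have "\<dots> = (\<integral>x. f x * us x \<partial>leb d)" by (rule sol_eq[OF sol_rep])
    also have "\<dots> \<le> ?N * Hminus1_norm d f" using 1 by simp
    finally have "m * ?N \<le> Hminus1_norm d f" using Np by (simp add: power2_eq_square)
    then show ?thesis using m_pos by (simp add: field_simps)
  qed
qed

text \<open>The equation makes \<open>v\<close> the Riesz representative, in H1, of
  \<open>form\<close> applied to the error \<open>u - us\<close>. Coercivity bounds the inner
  product of \<open>v\<close> with the error from below and boundedness bounds the norm of
  \<open>v\<close> from above; expanding the square gives the contraction.\<close>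

lemma step_L2:
  assumes us: "smooth d u" and uL: "u \<in> L2 d" and duL: "\<And>i. i < d \<Longrightarrow> partial i u \<in> L2 d"
    and v: "smooth d v" and bv: "bddf d v" and bg: "\<And>i. i < d \<Longrightarrow> bddf d (partial i v)"
    and bF: "\<And>i. i < d \<Longrightarrow> bddf d (flux (\<lambda>j. partial j u) i)"
    and bH: "\<And>i. i < d \<Longrightarrow> bddf d (partial i (partial i v))"
            "\<And>i. i < d \<Longrightarrow> bddf d (partial i (flux (\<lambda>j. partial j u) i))"
    and eq: "\<And>x. x \<in> euclid d \<Longrightarrow> v x - (\<Sum>i<d. partial i (partial i v) x)
        = c x * u x - f x - (\<Sum>i<d. partial i (flux (\<lambda>j. partial j u) i) x)"
  shows "v \<in> L2 d" "\<And>i. i < d \<Longrightarrow> partial i v \<in> L2 d"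
    and "H1_norm d (\<lambda>x. (u x + (- (m / M\<^sup>2)) * v x) - us x) \<le> sqrt (1 - m\<^sup>2 / M\<^sup>2) * H1_norm d (\<lambda>x. u x - us x)"
proof -
  let ?fl = "flux (\<lambda>j. partial j u)"
  let ?F = "\<lambda>i x. (-1) * ?fl i x"
  let ?f0 = "\<lambda>x. c x * u x - f x"
  have fls: "smooth d (?fl i)" if "i < d" for i
    unfolding flux_def[abs_def] using that by (intro smooth_sum smooth_mult A_smooth smooth_partial us) auto
  have Fs: "smooth d (?F i)" if "i < d" for i by (intro smooth_cmult fls that)
  have flL: "?fl i \<in> L2 d" if "i < d" for i by (intro flux_L2 duL that)
  have FL: "?F i \<in> L2 d" if "i < d" for i by (intro L2_cmult flL that)
  have f0L: "?f0 \<in> L2 d" by (intro L2_diff c_L2 uL f_L2)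
  have dH: "partial i (\<lambda>x. partial i v x + ?F i x) x = partial i (partial i v) x - partial i (?fl i) x"
    if i: "i < d" and x: "x \<in> euclid d" for i x
    using partial_add[OF smooth_partial[OF v i] Fs[OF i] i x] partial_cmult[OF fls[OF i] i x, of "-1"] by simp
  have eq': "(\<Sum>i<d. partial i (\<lambda>x. partial i v x + ?F i x) x) = v x - ?f0 x" if x: "x \<in> euclid d" for x
    using eq[OF x] dH[OF _ x] by (simp add: sum_subtractf)
  have bF': "bddf d (?F i)" if "i < d" for i using bF[OF that] by (simp add: bddf_def)
  have bH': "bddf d (partial i (\<lambda>x. partial i v x + ?F i x))" if i: "i < d" for i
  proof -
    obtain B1 B2 where "\<And>x. x \<in> euclid d \<Longrightarrow> \<bar>partial i (partial i v) x\<bar> \<le> B1"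
      "\<And>x. x \<in> euclid d \<Longrightarrow> \<bar>partial i (?fl i) x\<bar> \<le> B2" using bH[OF i] unfolding bddf_def by blast
    then show ?thesis using dH[OF i] by (intro bddfI[of d _ "B1 + B2"]) (smt (verit))
  qed
  show vL: "v \<in> L2 d" and gL: "\<And>i. i < d \<Longrightarrow> partial i v \<in> L2 d"
    using energy_L2[OF v Fs f0L FL bv bg bF' bH' eq'] by auto
  have vrep: "H1_rep d v (\<lambda>i. partial i v)" by (rule H1_rep_smooth[OF v vL gL])
  have urep: "H1_rep d u (\<lambda>i. partial i u)" by (rule H1_rep_smooth[OF us uL duL])
  let ?q = "\<lambda>i. wpartial d i us"
  define e where "e = (\<lambda>x. u x + (-1) * us x)"
  define p where "p = (\<lambda>i x. partial i u x + (-1) * ?q i x)"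
  have erep: "H1_rep d e p" unfolding e_def p_def by (rule H1_rep_lin[OF urep sol_rep])
  \<comment> \<open>The weak form of the equation of \<open>v\<close> against an arbitrary H1
    function. The source is eliminated by the weak equation of \<open>us\<close>, so that only the
    error appears.\<close>
  have test: "(\<integral>x. \<phi> x * v x + (\<Sum>i<d. r i x * partial i v x) \<partial>leb d) = (\<integral>x. form e p \<phi> r x \<partial>leb d)"
    if rep: "H1_rep d \<phi> r" for \<phi> r
  proof -
    have \<phi>L: "\<phi> \<in> L2 d" and rL: "\<And>i. i < d \<Longrightarrow> r i \<in> L2 d" using rep by (auto simp: H1_rep_def)
    let ?G = "\<lambda>i x. partial i v x + ?F i x"
    have Gs: "smooth d (?G i)" and GL: "?G i \<in> L2 d" if "i < d" for i
      using that by (intro smooth_add smooth_partial v Fs L2_add gL FL; simp)+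
    have DL: "(\<lambda>x. \<Sum>i<d. partial i (?G i) x) \<in> L2 d"
    proof -
      have "(\<lambda>x. v x - ?f0 x) \<in> L2 d" by (intro L2_diff vL f0L)
      moreover have "(\<lambda>x. \<Sum>i<d. partial i (?G i) x) \<in> borel_measurable (leb d)"
        using Gs by (intro borel_measurable_sum smooth_measurable smooth_partial) auto
      moreover have "integrable (leb d) (\<lambda>x. (\<Sum>i<d. partial i (?G i) x)\<^sup>2) = integrable (leb d) (\<lambda>x. (v x - ?f0 x)\<^sup>2)"
        by (intro Bochner_Integration.integrable_cong refl) (simp only: space_leb eq')
      ultimately show ?thesis by (simp add: L2_def)
    qed
    have "(\<integral>x. \<phi> x * (v x - ?f0 x) \<partial>leb d) = (\<integral>x. \<phi> x * (\<Sum>i<d. partial i (?G i) x) \<partial>leb d)"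
      by (intro Bochner_Integration.integral_cong refl) (simp only: space_leb eq')
    also have "\<dots> = - (\<Sum>i<d. \<integral>x. r i x * ?G i x \<partial>leb d)"
      by (rule H1_divergence[OF rep Gs GL DL])
    also have "(\<Sum>i<d. \<integral>x. r i x * ?G i x \<partial>leb d) = (\<integral>x. (\<Sum>i<d. r i x * ?G i x) \<partial>leb d)"
      by (intro Bochner_Integration.integral_sum[symmetric] L2_mult_integrable rL GL) auto
    finally have div: "(\<integral>x. \<phi> x * (v x - ?f0 x) \<partial>leb d) = - (\<integral>x. (\<Sum>i<d. r i x * ?G i x) \<partial>leb d)" .
    have i1: "integrable (leb d) (\<lambda>x. \<phi> x * (v x - ?f0 x))" by (intro L2_mult_integrable L2_diff \<phi>L vL f0L)
    have i2: "integrable (leb d) (\<lambda>x. \<Sum>i<d. r i x * ?G i x)"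
      by (intro Bochner_Integration.integrable_sum L2_mult_integrable rL GL) auto
    have i3: "integrable (leb d) (\<lambda>x. f x * \<phi> x)" by (intro L2_mult_integrable f_L2 \<phi>L)
    have i4: "integrable (leb d) (form u (\<lambda>i. partial i u) \<phi> r)" by (rule form_integrable[OF urep rep])
    have i5: "integrable (leb d) (form us ?q \<phi> r)" by (rule form_integrable[OF sol_rep rep])
    have "(\<integral>x. \<phi> x * v x + (\<Sum>i<d. r i x * partial i v x) \<partial>leb d)
        = (\<integral>x. (\<phi> x * (v x - ?f0 x) + (\<Sum>i<d. r i x * ?G i x)) + (form u (\<lambda>i. partial i u) \<phi> r x - f x * \<phi> x) \<partial>leb d)"
    proof (rule Bochner_Integration.integral_cong[OF refl])
      fix x
      have "(\<Sum>i<d. r i x * ?G i x) = (\<Sum>i<d. r i x * partial i v x) - (\<Sum>i<d. ?fl i x * r i x)"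
        by (simp add: algebra_simps sum_subtractf)
      then show "\<phi> x * v x + (\<Sum>i<d. r i x * partial i v x)
        = (\<phi> x * (v x - ?f0 x) + (\<Sum>i<d. r i x * ?G i x)) + (form u (\<lambda>i. partial i u) \<phi> r x - f x * \<phi> x)"
        by (simp add: form_def algebra_simps)
    qed
    also have "\<dots> = ((\<integral>x. \<phi> x * (v x - ?f0 x) \<partial>leb d) + (\<integral>x. (\<Sum>i<d. r i x * ?G i x) \<partial>leb d))
        + ((\<integral>x. form u (\<lambda>i. partial i u) \<phi> r x \<partial>leb d) - (\<integral>x. f x * \<phi> x \<partial>leb d))"
      using i1 i2 i3 i4 by simp
    also have "\<dots> = (\<integral>x. form u (\<lambda>i. partial i u) \<phi> r x \<partial>leb d) - (\<integral>x. form us ?q \<phi> r x \<partial>leb d)"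
      unfolding div sol_eq[OF rep] by simp
    also have "\<dots> = (\<integral>x. form u (\<lambda>i. partial i u) \<phi> r x - form us ?q \<phi> r x \<partial>leb d)" using i4 i5 by simp
    also have "\<dots> = (\<integral>x. form e p \<phi> r x \<partial>leb d)"
      by (intro Bochner_Integration.integral_cong refl)
         (simp add: form_def e_def p_def flux_def algebra_simps sum_subtractf sum_distrib_left sum_distrib_right)
    finally show ?thesis .
  qed
  \<comment> \<open>\<open>v\<close> is its own test function; the half of its norm coming from
    \<open>form_upper\<close> moves to the left.\<close>
  have vv: "nsq d v (\<lambda>i. partial i v) \<le> M\<^sup>2 * nsq d e p"
  proof -
    have "nsq d v (\<lambda>i. partial i v) = (\<integral>x. form e p v (\<lambda>i. partial i v) x \<partial>leb d)"
      using test[OF vrep] by (simp add: nsq_def power2_eq_square)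
    also have "\<dots> \<le> (\<integral>x. M\<^sup>2 / 2 * ((e x)\<^sup>2 + (\<Sum>i<d. (p i x)\<^sup>2)) + ((v x)\<^sup>2 + (\<Sum>i<d. (partial i v x)\<^sup>2)) / 2 \<partial>leb d)"
      by (intro integral_mono form_upper form_integrable erep vrep Bochner_Integration.integrable_add integrable_mult_right integrable_divide H1_rep_integrable)
         (simp add: space_leb)
    also have "\<dots> = M\<^sup>2 / 2 * nsq d e p + nsq d v (\<lambda>i. partial i v) / 2"
      using H1_rep_integrable[OF erep] H1_rep_integrable[OF vrep] unfolding nsq_def
      by (subst Bochner_Integration.integral_add) (auto intro!: integrable_mult_right integrable_divide)
    finally show ?thesis by simp
  qed
  define \<alpha> where "\<alpha> = m / M\<^sup>2"
  have M0: "M > 0" using m_pos mM by simp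
  have cross: "m * nsq d e p \<le> (\<integral>x. e x * v x + (\<Sum>i<d. p i x * partial i v x) \<partial>leb d)"
  proof -
    have "m * nsq d e p = (\<integral>x. m * ((e x)\<^sup>2 + (\<Sum>i<d. (p i x)\<^sup>2)) \<partial>leb d)" by (simp add: nsq_def)
    also have "\<dots> \<le> (\<integral>x. form e p e p x \<partial>leb d)"
      by (intro integral_mono integrable_mult_right H1_rep_integrable form_integrable erep form_lower) (simp add: space_leb)
    finally show ?thesis unfolding test[OF erep] .
  qed
  have e'rep: "H1_rep d (\<lambda>x. e x + (- \<alpha>) * v x) (\<lambda>i x. p i x + (- \<alpha>) * partial i v x)"
    by (rule H1_rep_lin[OF erep vrep])
  have ci: "integrable (leb d) (\<lambda>x. e x * v x + (\<Sum>i<d. p i x * partial i v x))"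
    using erep vrep unfolding H1_rep_def
    by (intro Bochner_Integration.integrable_add Bochner_Integration.integrable_sum L2_mult_integrable) auto
  have "nsq d (\<lambda>x. e x + (- \<alpha>) * v x) (\<lambda>i x. p i x + (- \<alpha>) * partial i v x)
      = (\<integral>x. (((e x)\<^sup>2 + (\<Sum>i<d. (p i x)\<^sup>2)) - 2 * \<alpha> * (e x * v x + (\<Sum>i<d. p i x * partial i v x)))
          + \<alpha>\<^sup>2 * ((v x)\<^sup>2 + (\<Sum>i<d. (partial i v x)\<^sup>2)) \<partial>leb d)"
    unfolding nsq_def
  proof (rule Bochner_Integration.integral_cong[OF refl])
    fix x
    have sq: "(a + (- \<alpha>) * b)\<^sup>2 = a\<^sup>2 - 2 * \<alpha> * (a * b) + \<alpha>\<^sup>2 * b\<^sup>2" for a b :: real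
      by (simp add: power2_eq_square algebra_simps)
    show "(e x + - \<alpha> * v x)\<^sup>2 + (\<Sum>i<d. (p i x + - \<alpha> * partial i v x)\<^sup>2)
        = (((e x)\<^sup>2 + (\<Sum>i<d. (p i x)\<^sup>2)) - 2 * \<alpha> * (e x * v x + (\<Sum>i<d. p i x * partial i v x)))
          + \<alpha>\<^sup>2 * ((v x)\<^sup>2 + (\<Sum>i<d. (partial i v x)\<^sup>2))"
      unfolding sq by (simp add: sum.distrib sum_subtractf distrib_left sum_distrib_left)
  qed
  also have "\<dots> = (nsq d e p - 2 * \<alpha> * (\<integral>x. e x * v x + (\<Sum>i<d. p i x * partial i v x) \<partial>leb d)) + \<alpha>\<^sup>2 * nsq d v (\<lambda>i. partial i v)"
    unfolding nsq_def using H1_rep_integrable[OF erep] H1_rep_integrable[OF vrep] ci by simp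
  also have "\<dots> \<le> (nsq d e p - 2 * \<alpha> * (m * nsq d e p)) + \<alpha>\<^sup>2 * (M\<^sup>2 * nsq d e p)"
    using M0 m_pos by (intro add_mono diff_mono order_refl mult_left_mono cross vv) (auto simp: \<alpha>_def)
  also have "\<dots> = (1 - m\<^sup>2 / M\<^sup>2) * nsq d e p"
    using M0 by (simp add: \<alpha>_def field_simps power2_eq_square)
  finally have fin: "nsq d (\<lambda>x. e x + (- \<alpha>) * v x) (\<lambda>i x. p i x + (- \<alpha>) * partial i v x) \<le> (1 - m\<^sup>2 / M\<^sup>2) * nsq d e p" .
  have "H1_norm d (\<lambda>x. e x + (- \<alpha>) * v x) \<le> sqrt (1 - m\<^sup>2 / M\<^sup>2) * H1_norm d e"
    unfolding H1_norm_nsq[OF e'rep] H1_norm_nsq[OF erep] real_sqrt_mult[symmetric] using fin by simp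
  moreover have "(\<lambda>x. e x + (- \<alpha>) * v x) = (\<lambda>x. (u x + (- (m / M\<^sup>2)) * v x) - us x)"
    by (auto simp: e_def \<alpha>_def)
  moreover have "e = (\<lambda>x. u x - us x)" by (auto simp: e_def)
  ultimately show "H1_norm d (\<lambda>x. (u x + (- (m / M\<^sup>2)) * v x) - us x) \<le> sqrt (1 - m\<^sup>2 / M\<^sup>2) * H1_norm d (\<lambda>x. u x - us x)"
    by simp
qed

end

declare leb_component [measurable del]

section \<open>Ridge integrals\<close>

text \<open>The parameters are random variables on an arbitrary space and not a law on triples.
  Combining representations then means taking products of spaces; \<open>params_distr\<close>
  returns to a law in the end.\<close>

definition ridge :: "'m measure \<Rightarrow> nat \<Rightarrow> ('m \<Rightarrow> real) \<Rightarrow> ('m \<Rightarrow> vec) \<Rightarrow> ('m \<Rightarrow> real) \<Rightarrow> (real \<Rightarrow> real) \<Rightarrow> vec \<Rightarrow> real" where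
  "ridge M n a w b \<tau> x = (\<integral>m. a m * \<tau> (vdot n (w m) x + b m) \<partial>M)"

text \<open>The bound on \<open>w\<close> holds everywhere and not just almost everywhere, so it can
  be used pointwise under integrals and on products of spaces.\<close>

definition params :: "'m measure \<Rightarrow> nat \<Rightarrow> real \<Rightarrow> ('m \<Rightarrow> real) \<Rightarrow> ('m \<Rightarrow> vec) \<Rightarrow> ('m \<Rightarrow> real) \<Rightarrow> bool" where
  "params M n R a w b \<longleftrightarrow> prob_space M \<and> integrable M a \<and> (\<forall>i<n. (\<lambda>m. w m i) \<in> borel_measurable M) \<and>
     b \<in> borel_measurable M \<and> (\<forall>m\<in>space M. vnorm n (w m) \<le> R)"

definition nice :: "(real \<Rightarrow> real) \<Rightarrow> bool" where
  "nice \<tau> \<longleftrightarrow> continuous_on UNIV \<tau> \<and> bounded (range \<tau>)"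

lemma abs_mult_le: "\<bar>t\<bar> \<le> C \<Longrightarrow> \<bar>a * t\<bar> \<le> C * \<bar>a :: real\<bar>"
  unfolding abs_mult mult.commute[of C] by (rule mult_left_mono) auto

lemma nice_measurable [measurable_dest]: "nice \<tau> \<Longrightarrow> \<tau> \<in> borel_measurable borel"
  unfolding nice_def by (intro borel_measurable_continuous_onI) auto

lemma niceE:
  assumes "nice \<tau>" obtains C where "C \<ge> 0" "\<And>s. \<bar>\<tau> s\<bar> \<le> C"
proof -
  from assms obtain C where "\<And>s. \<bar>\<tau> s\<bar> \<le> C" unfolding nice_def bounded_iff by auto
  then show ?thesis using that[of "\<bar>C\<bar>"] by (meson abs_ge_self abs_ge_zero order_trans)
qed

lemma params_vdot_measurable:
  assumes "params M n R a w b" shows "(\<lambda>m. vdot n (w m) x + b m) \<in> borel_measurable M"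
  using assms unfolding params_def vdot_def by (intro borel_measurable_add borel_measurable_sum borel_measurable_times) auto

lemma ridge_integrable:
  assumes p: "params M n R a w b" and \<tau>: "nice \<tau>"
  shows "integrable M (\<lambda>m. a m * \<tau> (vdot n (w m) x + b m))"
proof -
  obtain C where C: "C \<ge> 0" "\<And>s. \<bar>\<tau> s\<bar> \<le> C" using niceE[OF \<tau>] by blast
  have a: "integrable M a" using p by (simp add: params_def)
  have [measurable]: "a \<in> borel_measurable M" using a by simp
  note [measurable] = params_vdot_measurable[OF p] nice_measurable[OF \<tau>]
  show ?thesis
  proof (rule Bochner_Integration.integrable_bound[OF integrable_mult_right[OF a, of C]])
    show "AE m in M. norm (a m * \<tau> (vdot n (w m) x + b m)) \<le> norm (C * a m)"
      using abs_mult_le[OF C(2)] C(1) by (intro AE_I2) (simp add: abs_mult)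
  qed measurable
qed

lemma ridge_bound:
  assumes p: "params M n R a w b" and \<tau>: "nice \<tau>" and C: "\<And>s. \<bar>\<tau> s\<bar> \<le> C"
  shows "\<bar>ridge M n a w b \<tau> x\<bar> \<le> C * (\<integral>m. \<bar>a m\<bar> \<partial>M)"
proof -
  have a: "integrable M a" using p by (simp add: params_def)
  have "\<bar>ridge M n a w b \<tau> x\<bar> \<le> (\<integral>m. \<bar>a m * \<tau> (vdot n (w m) x + b m)\<bar> \<partial>M)"
    unfolding ridge_def by (rule integral_abs_bound)
  also have "\<dots> \<le> (\<integral>m. C * \<bar>a m\<bar> \<partial>M)"
    by (intro integral_mono integrable_abs ridge_integrable[OF p \<tau>] integrable_mult_right a abs_mult_le C)
  finally show ?thesis by simp
qed

text \<open>Sequences decide continuity here, \<open>x\<close> enters through finitely many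
  coordinates, and a multiple of \<open>|a m|\<close> dominates.\<close>

lemma ridge_continuous:
  assumes p: "params M n R a w b" and \<tau>: "nice \<tau>"
  shows "continuous_on S (ridge M n a w b \<tau>)"
proof (rule continuous_on_sequentiallyI)
  fix u :: "nat \<Rightarrow> vec" and x assume u: "u \<longlonglongrightarrow> x"
  obtain C where C: "C \<ge> 0" "\<And>s. \<bar>\<tau> s\<bar> \<le> C" using niceE[OF \<tau>] by blast
  have a: "integrable M a" using p by (simp add: params_def)
  have uc: "(\<lambda>k. u k i) \<longlonglongrightarrow> x i" for i
  proof -
    have "continuous_on UNIV (\<lambda>y::vec. y i)" by (rule continuous_on_product_coordinates)
    then have "isCont (\<lambda>y::vec. y i) x"
      using continuous_on_eq_continuous_at[OF open_UNIV, of "\<lambda>y::vec. y i"] by blast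
    then show ?thesis using u by (rule isCont_tendsto_compose)
  qed
  show "(\<lambda>k. ridge M n a w b \<tau> (u k)) \<longlonglongrightarrow> ridge M n a w b \<tau> x"
    unfolding ridge_def
  proof (rule integral_dominated_convergence[where w = "\<lambda>m. C * \<bar>a m\<bar>"])
    show "integrable M (\<lambda>m. C * \<bar>a m\<bar>)" by (intro integrable_mult_right integrable_abs a)
    show "AE m in M. (\<lambda>k. a m * \<tau> (vdot n (w m) (u k) + b m)) \<longlonglongrightarrow> a m * \<tau> (vdot n (w m) x + b m)"
    proof (rule AE_I2)
      fix m
      have "(\<lambda>k. vdot n (w m) (u k) + b m) \<longlonglongrightarrow> vdot n (w m) x + b m"
        unfolding vdot_def by (intro tendsto_intros uc)
      moreover have "isCont \<tau> (vdot n (w m) x + b m)"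
        using \<tau> by (simp add: nice_def continuous_on_eq_continuous_at)
      ultimately show "(\<lambda>k. a m * \<tau> (vdot n (w m) (u k) + b m)) \<longlonglongrightarrow> a m * \<tau> (vdot n (w m) x + b m)"
        by (intro tendsto_mult tendsto_const isCont_tendsto_compose[of _ \<tau>])
    qed
    show "AE m in M. norm (a m * \<tau> (vdot n (w m) (u k) + b m)) \<le> C * \<bar>a m\<bar>" for k
      using abs_mult_le[OF C(2)] C(1) by (intro AE_I2) (simp add: abs_mult)
  qed (use ridge_integrable[OF p \<tau>] in auto)
qed

lemma params_component_bound:
  "params M n R a w b \<Longrightarrow> i < n \<Longrightarrow> m \<in> space M \<Longrightarrow> \<bar>w m i\<bar> \<le> R"
  using abs_component_le_vnorm[of i n "w m"] by (fastforce simp: params_def)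

lemma params_R_nonneg: "params M n R a w b \<Longrightarrow> 0 \<le> R"
proof -
  assume p: "params M n R a w b"
  then interpret prob_space M by (simp add: params_def)
  obtain m where "m \<in> space M" using not_empty by blast
  then have "vnorm n (w m) \<le> R" using p by (simp add: params_def)
  then show ?thesis by (rule order_trans[OF L2_set_nonneg])
qed

text \<open>Partial derivatives, and resolvents of cosine waves, multiply the outer weight by a
  bounded factor and leave the inner weights alone.\<close>

lemma params_weight:
  assumes p: "params M n R a w b" and [measurable]: "h \<in> borel_measurable M"
    and h: "\<And>m. m \<in> space M \<Longrightarrow> \<bar>h m\<bar> \<le> K"
  shows "params M n R (\<lambda>m. a m * h m) w b"
    and "(\<integral>m. \<bar>a m * h m\<bar> \<partial>M) \<le> K * (\<integral>m. \<bar>a m\<bar> \<partial>M)"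
proof -
  have a: "integrable M a" using p by (simp add: params_def)
  have [measurable]: "a \<in> borel_measurable M" using a by simp
  have 1: "integrable M (\<lambda>m. a m * h m)"
  proof (rule Bochner_Integration.integrable_bound[OF integrable_mult_right[OF integrable_abs[OF a], of K]])
    show "AE m in M. norm (a m * h m) \<le> norm (K * \<bar>a m\<bar>)"
    proof (rule AE_I2)
      fix m assume "m \<in> space M"
      then have "\<bar>h m\<bar> \<le> \<bar>K\<bar>" using h by force
      then have "\<bar>h m\<bar> * \<bar>a m\<bar> \<le> \<bar>K\<bar> * \<bar>a m\<bar>" by (rule mult_right_mono) simp
      then show "norm (a m * h m) \<le> norm (K * \<bar>a m\<bar>)" by (simp add: abs_mult mult.commute)
    qed
  qed measurable
  then show "params M n R (\<lambda>m. a m * h m) w b" using p by (simp add: params_def)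
  have "(\<integral>m. \<bar>a m * h m\<bar> \<partial>M) \<le> (\<integral>m. K * \<bar>a m\<bar> \<partial>M)"
    by (intro integral_mono integrable_abs 1 integrable_mult_right a abs_mult_le h)
  then show "(\<integral>m. \<bar>a m * h m\<bar> \<partial>M) \<le> K * (\<integral>m. \<bar>a m\<bar> \<partial>M)" by simp
qed

lemma vdot_upd: "i < n \<Longrightarrow> vdot n w (x(i := t)) = vdot n w x + w i * (t - x i)"
proof -
  assume i: "i < n"
  have "vdot n w (x(i := t)) = w i * t + (\<Sum>j\<in>{..<n}-{i}. w j * (x(i := t)) j)"
    unfolding vdot_def using i by (subst sum.remove[of _ i]) auto
  also have "(\<Sum>j\<in>{..<n}-{i}. w j * (x(i := t)) j) = (\<Sum>j\<in>{..<n}-{i}. w j * x j)"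
    by (intro sum.cong) auto
  also have "\<dots> = vdot n w x - w i * x i"
    unfolding vdot_def using i by (subst (2) sum.remove[of _ i]) auto
  finally show ?thesis unfolding right_diff_distrib by linarith
qed

text \<open>Differentiation under the integral sign: \<open>\<tau>\<close> is Lipschitz with the
  bound \<open>C\<close> of its derivative and \<open>|w m i| \<le> R\<close>, so the difference
  quotients are dominated by \<open>R C |a m|\<close>.\<close>

lemma ridge_DERIV:
  assumes p: "params M n R a w b" and \<tau>: "nice \<tau>" and \<tau>': "nice \<tau>'"
    and D: "\<And>s. (\<tau> has_real_derivative \<tau>' s) (at s)" and i: "i < n"
  shows "((\<lambda>t. ridge M n a w b \<tau> (x(i := t))) has_real_derivative ridge M n (\<lambda>m. a m * w m i) w b \<tau>' x) (at (x i))"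
proof -
  obtain C where C: "C \<ge> 0" "\<And>s. \<bar>\<tau>' s\<bar> \<le> C" using niceE[OF \<tau>'] by blast
  have a: "integrable M a" and wm: "(\<lambda>m. w m i) \<in> borel_measurable M" using p i by (auto simp: params_def)
  have R0: "R \<ge> 0" by (rule params_R_nonneg[OF p])
  note wb = params_component_bound[OF p i]
  have p': "params M n R (\<lambda>m. a m * w m i) w b" by (rule params_weight(1)[OF p wm wb])
  let ?z = "\<lambda>m. vdot n (w m) x + b m"
  have lip: "\<bar>\<tau> (z + q) - \<tau> z\<bar> \<le> C * \<bar>q\<bar>" for z q
    using field_differentiable_bound[of UNIV \<tau> \<tau>' C "z + q" z] D C(2) by simp
  have "((\<lambda>h. (ridge M n a w b \<tau> (x(i := x i + h)) - ridge M n a w b \<tau> (x(i := x i))) / h)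
      \<longlongrightarrow> ridge M n (\<lambda>m. a m * w m i) w b \<tau>' x) (at 0)"
    unfolding tendsto_at_iff_sequentially
  proof (intro allI impI)
    fix X :: "nat \<Rightarrow> real" assume X: "\<forall>k. X k \<in> UNIV - {0}" "X \<longlonglongrightarrow> 0"
    have Xn: "X k \<noteq> 0" for k using X by auto
    have eq: "(ridge M n a w b \<tau> (x(i := x i + X k)) - ridge M n a w b \<tau> (x(i := x i))) / X k
        = (\<integral>m. a m * ((\<tau> (?z m + w m i * X k) - \<tau> (?z m)) / X k) \<partial>M)" for k
    proof -
      have 1: "ridge M n a w b \<tau> (x(i := x i + X k)) = (\<integral>m. a m * \<tau> (?z m + w m i * X k) \<partial>M)"
        unfolding ridge_def vdot_upd[OF i] by (simp add: algebra_simps)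
      have 2: "integrable M (\<lambda>m. a m * \<tau> (?z m + w m i * X k))"
        using ridge_integrable[OF p \<tau>, of "x(i := x i + X k)"] unfolding vdot_upd[OF i] by (simp add: algebra_simps)
      have "(\<integral>m. a m * ((\<tau> (?z m + w m i * X k) - \<tau> (?z m)) / X k) \<partial>M)
          = (\<integral>m. (a m * \<tau> (?z m + w m i * X k) - a m * \<tau> (?z m)) / X k \<partial>M)"
        by (simp add: right_diff_distrib)
      also have "\<dots> = ((\<integral>m. a m * \<tau> (?z m + w m i * X k) \<partial>M) - (\<integral>m. a m * \<tau> (?z m) \<partial>M)) / X k"
        using 2 ridge_integrable[OF p \<tau>] by simp
      finally have 3: "(\<integral>m. a m * ((\<tau> (?z m + w m i * X k) - \<tau> (?z m)) / X k) \<partial>M)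
          = ((\<integral>m. a m * \<tau> (?z m + w m i * X k) \<partial>M) - (\<integral>m. a m * \<tau> (?z m) \<partial>M)) / X k" .
      show ?thesis unfolding 1 3 by (simp add: ridge_def)
    qed
    have "(\<lambda>k. \<integral>m. a m * ((\<tau> (?z m + w m i * X k) - \<tau> (?z m)) / X k) \<partial>M) \<longlonglongrightarrow> (\<integral>m. (a m * w m i) * \<tau>' (?z m) \<partial>M)"
    proof (rule integral_dominated_convergence[where w = "\<lambda>m. R * C * \<bar>a m\<bar>"])
      show "integrable M (\<lambda>m. R * C * \<bar>a m\<bar>)" by (intro integrable_mult_right integrable_abs a)
      show "(\<lambda>m. (a m * w m i) * \<tau>' (?z m)) \<in> borel_measurable M"
        using ridge_integrable[OF p' \<tau>'] by auto
      have [measurable]: "a \<in> borel_measurable M" using a by simp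
      note [measurable] = params_vdot_measurable[OF p] nice_measurable[OF \<tau>] wm
      show "(\<lambda>m. a m * ((\<tau> (?z m + w m i * X k) - \<tau> (?z m)) / X k)) \<in> borel_measurable M" for k
        by measurable
      show "AE m in M. (\<lambda>k. a m * ((\<tau> (?z m + w m i * X k) - \<tau> (?z m)) / X k)) \<longlonglongrightarrow> (a m * w m i) * \<tau>' (?z m)"
      proof (rule AE_I2)
        fix m
        have "((\<lambda>h. \<tau> (?z m + w m i * h)) has_real_derivative \<tau>' (?z m + w m i * 0) * w m i) (at 0)"
          by (rule DERIV_chain2[OF D]) (auto intro!: derivative_eq_intros)
        then have "((\<lambda>h. (\<tau> (?z m + w m i * h) - \<tau> (?z m)) / h) \<longlongrightarrow> \<tau>' (?z m) * w m i) (at 0)"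
          by (simp add: DERIV_def)
        then have "(\<lambda>k. (\<tau> (?z m + w m i * X k) - \<tau> (?z m)) / X k) \<longlonglongrightarrow> \<tau>' (?z m) * w m i"
          using X unfolding tendsto_at_iff_sequentially comp_def by blast
        from tendsto_mult[OF tendsto_const[of "a m"] this]
        show "(\<lambda>k. a m * ((\<tau> (?z m + w m i * X k) - \<tau> (?z m)) / X k)) \<longlonglongrightarrow> (a m * w m i) * \<tau>' (?z m)"
          by (simp add: mult_ac)
      qed
      show "AE m in M. norm (a m * ((\<tau> (?z m + w m i * X k) - \<tau> (?z m)) / X k)) \<le> R * C * \<bar>a m\<bar>" for k
      proof (rule AE_I2)
        fix m assume m: "m \<in> space M"
        have "\<bar>\<tau> (?z m + w m i * X k) - \<tau> (?z m)\<bar> \<le> C * \<bar>w m i * X k\<bar>" by (rule lip)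
        also have "\<dots> \<le> C * (R * \<bar>X k\<bar>)" unfolding abs_mult using wb[OF m] C(1) by (intro mult_left_mono mult_right_mono) auto
        finally have "\<bar>(\<tau> (?z m + w m i * X k) - \<tau> (?z m)) / X k\<bar> \<le> R * C"
          using Xn[of k] by (simp add: field_simps)
        then have "\<bar>a m\<bar> * \<bar>(\<tau> (?z m + w m i * X k) - \<tau> (?z m)) / X k\<bar> \<le> \<bar>a m\<bar> * (R * C)" by (rule mult_left_mono) simp
        then show "norm (a m * ((\<tau> (?z m + w m i * X k) - \<tau> (?z m)) / X k)) \<le> R * C * \<bar>a m\<bar>" by (simp add: abs_mult mult.commute)
      qed
    qed
    then show "((\<lambda>h. (ridge M n a w b \<tau> (x(i := x i + h)) - ridge M n a w b \<tau> (x(i := x i))) / h) \<circ> X) \<longlonglongrightarrow> ridge M n (\<lambda>m. a m * w m i) w b \<tau>' x"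
      unfolding comp_def eq by (simp add: ridge_def)
  qed
  then show ?thesis unfolding DERIV_def .
qed

lemma partial_ridge:
  assumes "params M n R a w b" "nice \<tau>" "nice \<tau>'" "\<And>s. (\<tau> has_real_derivative \<tau>' s) (at s)" "i < n"
  shows "partial i (ridge M n a w b \<tau>) x = ridge M n (\<lambda>m. a m * w m i) w b \<tau>' x"
  by (rule partial_DERIV[OF ridge_DERIV[OF assms]])

section \<open>Barron functions\<close>

text \<open>The infimum of \<open>barron_norm\<close> is traded for one representation of weight at
  most \<open>l\<close>. The carrier is fixed to triples because a measure of unspecified type
  cannot be quantified over; \<open>barI\<close> accepts every carrier.\<close>

definition bar :: "(real \<Rightarrow> real) \<Rightarrow> nat \<Rightarrow> real \<Rightarrow> (vec \<Rightarrow> real) \<Rightarrow> real \<Rightarrow> bool" where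
  "bar \<sigma> n R g l \<longleftrightarrow> (\<exists>(M :: (real \<times> vec \<times> real) measure) a w b. params M n R a w b \<and> (\<integral>m. \<bar>a m\<bar> \<partial>M) \<le> l \<and>
     (\<forall>x\<in>euclid n. g x = ridge M n a w b \<sigma> x))"

abbreviation triple :: "nat \<Rightarrow> (real \<times> vec \<times> real) measure" where
  "triple n \<equiv> borel \<Otimes>\<^sub>M (\<Pi>\<^sub>M i\<in>{..<n}. borel) \<Otimes>\<^sub>M borel"

lemma vdot_cong: "(\<And>i. i < n \<Longrightarrow> w i = w' i) \<Longrightarrow> vdot n w x = vdot n w' x"
  unfolding vdot_def by (intro sum.cong) auto

lemma vnorm_cong: "(\<And>i. i < n \<Longrightarrow> w i = w' i) \<Longrightarrow> vnorm n w = vnorm n w'"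
  by (intro L2_set_cong) auto

lemma triple_vnorm_measurable [measurable]: "(\<lambda>y. vnorm n (fst (snd y))) \<in> borel_measurable (triple n)"
proof -
  have "(\<lambda>y. fst (snd y) i) \<in> borel_measurable (triple n)" if "i < n" for i
    using measurable_compose[OF measurable_compose[OF measurable_snd measurable_fst] measurable_component_singleton[of i "{..<n}" "\<lambda>_. borel"]] that by simp
  then show ?thesis unfolding L2_set_def
    by (intro borel_measurable_sqrt[THEN measurable_compose[rotated]] borel_measurable_sum borel_measurable_power) auto
qed

text \<open>Push-forward to the carrier that \<open>barron_reps\<close> prescribes.
  \<open>restrict\<close> puts the inner weights, arbitrary from index \<open>n\<close> on, into the
  finite product.\<close>

lemma params_distr:
  assumes p: "params M n R a w b" and \<sigma>: "nice \<sigma>"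
  defines "T \<equiv> (\<lambda>m. (a m, restrict (w m) {..<n}, b m))"
  shows "T \<in> M \<rightarrow>\<^sub>M triple n" "prob_space (distr M (triple n) T)"
    and "AE y in distr M (triple n) T. vnorm n (fst (snd y)) \<le> R"
    and "integrable (distr M (triple n) T) fst" "(\<integral>y. \<bar>fst y\<bar> \<partial>distr M (triple n) T) = (\<integral>m. \<bar>a m\<bar> \<partial>M)"
    and "(\<integral>y. fst y * \<sigma> (vdot n (fst (snd y)) x + snd (snd y)) \<partial>distr M (triple n) T) = ridge M n a w b \<sigma> x"
    and "integrable (distr M (triple n) T) (\<lambda>y. fst y * \<sigma> (vdot n (fst (snd y)) x + snd (snd y)))"
proof -
  have a: "integrable M a" using p by (simp add: params_def)
  have am[measurable]: "a \<in> borel_measurable M" and bm[measurable]: "b \<in> borel_measurable M"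
    using a p by (auto simp: params_def)
  have wm[measurable]: "(\<lambda>m. restrict (w m) {..<n}) \<in> M \<rightarrow>\<^sub>M (\<Pi>\<^sub>M i\<in>{..<n}. borel)"
    by (rule measurable_restrict) (use p in \<open>auto simp: params_def\<close>)
  show T: "T \<in> M \<rightarrow>\<^sub>M triple n" unfolding T_def by measurable
  show "prob_space (distr M (triple n) T)"
    using p T by (intro prob_space.prob_space_distr) (auto simp: params_def)
  have vn: "vnorm n (restrict (w m) {..<n}) = vnorm n (w m)" for m by (rule vnorm_cong) simp
  have vd: "vdot n (restrict (w m) {..<n}) x = vdot n (w m) x" for m x by (rule vdot_cong) simp
  show "AE y in distr M (triple n) T. vnorm n (fst (snd y)) \<le> R"
  proof (subst AE_distr_iff[OF T])
    show "{y \<in> space (triple n). vnorm n (fst (snd y)) \<le> R} \<in> sets (triple n)" by measurable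
    show "AE m in M. vnorm n (fst (snd (T m))) \<le> R" using p by (intro AE_I2) (auto simp: T_def vn params_def)
  qed
  show "integrable (distr M (triple n) T) fst"
    using a by (subst integrable_distr_eq[OF T]) (auto simp: T_def)
  show "(\<integral>y. \<bar>fst y\<bar> \<partial>distr M (triple n) T) = (\<integral>m. \<bar>a m\<bar> \<partial>M)"
    by (subst integral_distr[OF T]) (auto simp: T_def)
  have vm: "(\<lambda>y. vdot n (fst (snd y)) x) \<in> borel_measurable (triple n)"
    unfolding vdot_def by measurable
  note [measurable] = nice_measurable[OF \<sigma>] vm
  have fm: "(\<lambda>y. fst y * \<sigma> (vdot n (fst (snd y)) x + snd (snd y))) \<in> borel_measurable (triple n)"
    by measurable
  show "(\<integral>y. fst y * \<sigma> (vdot n (fst (snd y)) x + snd (snd y)) \<partial>distr M (triple n) T) = ridge M n a w b \<sigma> x"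
    by (subst integral_distr[OF T fm]) (simp add: T_def vd ridge_def)
  show "integrable (distr M (triple n) T) (\<lambda>y. fst y * \<sigma> (vdot n (fst (snd y)) x + snd (snd y)))"
    using ridge_integrable[OF p \<sigma>] by (subst integrable_distr_eq[OF T fm]) (simp add: T_def vd)
qed

text \<open>A law satisfies the norm bound almost everywhere, whereas \<open>params\<close> asks for
  it everywhere; on the exceptional null set the inner weight becomes 0.\<close>

lemma params_of_triple:
  assumes "prob_space \<rho>" "sets \<rho> = sets (triple n)" "AE y in \<rho>. vnorm n (fst (snd y)) \<le> R" "integrable \<rho> fst" "0 \<le> R"
    and \<sigma>: "nice \<sigma>"
  defines "w \<equiv> (\<lambda>y. if vnorm n (fst (snd y)) \<le> R then fst (snd y) else (\<lambda>_. 0))"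
  shows "params \<rho> n R fst w (\<lambda>y. snd (snd y))"
    and "ridge \<rho> n fst w (\<lambda>y. snd (snd y)) \<sigma> x = (\<integral>y. fst y * \<sigma> (vdot n (fst (snd y)) x + snd (snd y)) \<partial>\<rho>)"
proof -
  note me = measurable_cong_sets[OF assms(2) refl]
  have comp: "(\<lambda>y. fst (snd y) i) \<in> borel_measurable (triple n)" if "i < n" for i
    using measurable_compose[OF measurable_compose[OF measurable_snd measurable_fst] measurable_component_singleton[of i "{..<n}" "\<lambda>_. borel"]] that by simp
  have wm: "(\<lambda>y. w y i) \<in> borel_measurable (triple n)" if i: "i < n" for i
  proof -
    have "(\<lambda>y. if vnorm n (fst (snd y)) \<le> R then fst (snd y) i else 0) \<in> borel_measurable (triple n)"
      using comp[OF i] by measurable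
    moreover have "(\<lambda>y. if vnorm n (fst (snd y)) \<le> R then fst (snd y) i else 0) = (\<lambda>y. w y i)" by (auto simp: w_def)
    ultimately show ?thesis by simp
  qed
  show "params \<rho> n R fst w (\<lambda>y. snd (snd y))"
    unfolding params_def using assms(1,4,5) wm
    by (auto simp: me w_def L2_set_def)
  have vm: "(\<lambda>y. vdot n (fst (snd y)) x) \<in> borel_measurable (triple n)" "(\<lambda>y. vdot n (w y) x) \<in> borel_measurable (triple n)"
    unfolding vdot_def using wm by (intro borel_measurable_sum borel_measurable_times comp; simp)+
  note [measurable] = nice_measurable[OF \<sigma>] vm
  show "ridge \<rho> n fst w (\<lambda>y. snd (snd y)) \<sigma> x = (\<integral>y. fst y * \<sigma> (vdot n (fst (snd y)) x + snd (snd y)) \<partial>\<rho>)"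
    unfolding ridge_def
  proof (rule integral_cong_AE)
    show "AE y in \<rho>. fst y * \<sigma> (vdot n (w y) x + snd (snd y)) = fst y * \<sigma> (vdot n (fst (snd y)) x + snd (snd y))"
      using assms(3) by eventually_elim (simp add: w_def)
  qed (simp_all add: me)
qed

lemma barI:
  assumes p: "params M n R a w b" and \<sigma>: "nice \<sigma>" and l: "(\<integral>m. \<bar>a m\<bar> \<partial>M) \<le> l"
    and g: "\<And>x. x \<in> euclid n \<Longrightarrow> g x = ridge M n a w b \<sigma> x"
  shows "bar \<sigma> n R g l"
proof -
  let ?T = "\<lambda>m. (a m, restrict (w m) {..<n}, b m)"
  let ?\<rho> = "distr M (triple n) ?T"
  note d = params_distr[OF p \<sigma>]
  note t = params_of_triple[OF d(2) _ d(3,4) params_R_nonneg[OF p] \<sigma>]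
  show ?thesis unfolding bar_def
    by (intro exI conjI ballI, rule t(1), simp, simp add: d(5) l, subst t(2), simp, simp add: d(6) g)
qed

lemma barE:
  assumes "bar \<sigma> n R g l"
  obtains M :: "(real \<times> vec \<times> real) measure" and a w b
  where "params M n R a w b" "(\<integral>m. \<bar>a m\<bar> \<partial>M) \<le> l" "\<And>x. x \<in> euclid n \<Longrightarrow> g x = ridge M n a w b \<sigma> x"
  using assms unfolding bar_def by blast

lemma bar_barron_norm:
  assumes g: "bar \<sigma> n R g l" and \<sigma>: "nice \<sigma>"
  shows "barron_norm \<sigma> 1 (ennreal R) n (euclid n) g \<le> ennreal l"
proof -
  obtain M :: "(real \<times> vec \<times> real) measure" and a w b
    where p: "params M n R a w b" and l: "(\<integral>m. \<bar>a m\<bar> \<partial>M) \<le> l" and gx: "\<And>x. x \<in> euclid n \<Longrightarrow> g x = ridge M n a w b \<sigma> x"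
    using barE[OF g] by blast
  let ?\<rho> = "distr M (triple n) (\<lambda>m. (a m, restrict (w m) {..<n}, b m))"
  note d = params_distr[OF p \<sigma>]
  have "?\<rho> \<in> barron_reps \<sigma> (ennreal R) n (euclid n) g"
    unfolding barron_reps_def
  proof (intro CollectI conjI ballI)
    show "prob_space ?\<rho>" by (rule d(2))
    show "sets ?\<rho> = sets (triple n)" by simp
    show "AE (a, w, b) in ?\<rho>. ennreal (vnorm n w) \<le> ennreal R"
      using d(3) by eventually_elim (auto intro: ennreal_leI)
    fix x assume x: "x \<in> euclid n"
    show "integrable ?\<rho> (\<lambda>(a, w, b). a * \<sigma> (vdot n w x + b))" using d(7)[of x] by (simp add: case_prod_unfold)
    show "g x = (\<integral>(a, w, b). a * \<sigma> (vdot n w x + b) \<partial>?\<rho>)" using d(6)[of x] gx[OF x] by (simp add: case_prod_unfold)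
  qed
  then have "barron_norm \<sigma> 1 (ennreal R) n (euclid n) g \<le> weight_norm 1 ?\<rho>"
    unfolding barron_norm_def by (rule INF_lower)
  also have "weight_norm 1 ?\<rho> = ennreal (\<integral>y. \<bar>fst y\<bar> \<partial>?\<rho>)"
    unfolding weight_norm_1 using nn_integral_eq_integral[OF integrable_abs[OF d(4)]] by (simp add: case_prod_unfold)
  also have "\<dots> \<le> ennreal l" unfolding d(5) using l by (rule ennreal_leI)
  finally show ?thesis .
qed

text \<open>An infimum need not be attained; the slack 1 yields an actual representation, also if
  \<open>l0 = 0\<close>.\<close>

lemma barron_norm_bar:
  assumes "barron_norm \<sigma> 1 (ennreal R) n (euclid n) g \<le> ennreal l0" "0 \<le> l0" "0 \<le> R" and \<sigma>: "nice \<sigma>"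
  shows "bar \<sigma> n R g (l0 + 1)"
proof -
  have "barron_norm \<sigma> 1 (ennreal R) n (euclid n) g < ennreal (l0 + 1)"
    by (rule order_le_less_trans[OF assms(1)]) (use assms(2) in \<open>simp add: ennreal_less_iff\<close>)
  then obtain \<rho> where \<rho>: "\<rho> \<in> barron_reps \<sigma> (ennreal R) n (euclid n) g" and wn: "weight_norm 1 \<rho> < ennreal (l0 + 1)"
    unfolding barron_norm_def INF_less_iff by blast
  have ps: "prob_space \<rho>" and s: "sets \<rho> = sets (triple n)"
    and ae: "AE (a, w, b) in \<rho>. ennreal (vnorm n w) \<le> ennreal R"
    and gx: "\<And>x. x \<in> euclid n \<Longrightarrow> g x = (\<integral>(a, w, b). a * \<sigma> (vdot n w x + b) \<partial>\<rho>)"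
    using \<rho> by (auto simp: barron_reps_def)
  have ae': "AE y in \<rho>. vnorm n (fst (snd y)) \<le> R"
    using ae by eventually_elim (use assms(3) in \<open>auto simp: ennreal_le_iff\<close>)
  have nn: "(\<integral>\<^sup>+y. ennreal \<bar>fst y\<bar> \<partial>\<rho>) < ennreal (l0 + 1)"
    using wn unfolding weight_norm_1 by (simp add: case_prod_unfold)
  have fm: "fst \<in> borel_measurable \<rho>" unfolding measurable_cong_sets[OF s refl] by measurable
  have fi: "integrable \<rho> fst"
    using fm nn by (intro integrableI_bounded) (auto intro: less_trans)
  have "ennreal (\<integral>y. \<bar>fst y\<bar> \<partial>\<rho>) < ennreal (l0 + 1)"
    using nn nn_integral_eq_integral[OF integrable_abs[OF fi]] by simp
  then have le: "(\<integral>y. \<bar>fst y\<bar> \<partial>\<rho>) \<le> l0 + 1" by (simp add: ennreal_less_iff)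
  note t = params_of_triple[OF ps s ae' fi assms(3) \<sigma>]
  show ?thesis
    by (rule barI[OF t(1) \<sigma> le]) (simp add: t(2) gx case_prod_unfold)
qed

lemma bar_mono: "bar \<sigma> n R g l \<Longrightarrow> R \<le> R' \<Longrightarrow> l \<le> l' \<Longrightarrow> bar \<sigma> n R' g l'"
proof -
  assume "bar \<sigma> n R g l" and R: "R \<le> R'" and l: "l \<le> l'"
  then obtain M :: "(real \<times> vec \<times> real) measure" and a w b where *: "params M n R a w b" "(\<integral>m. \<bar>a m\<bar> \<partial>M) \<le> l"
    "\<And>x. x \<in> euclid n \<Longrightarrow> g x = ridge M n a w b \<sigma> x"
    using barE by blast
  have "params M n R' a w b" using *(1) R by (auto simp: params_def intro: order_trans)
  then show ?thesis unfolding bar_def using *(2,3) l by (blast intro: order_trans)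
qed

lemma bar_R_nonneg: "bar \<sigma> n R g l \<Longrightarrow> 0 \<le> R"
  unfolding bar_def using params_R_nonneg by blast

lemma bar_l_nonneg: "bar \<sigma> n R g l \<Longrightarrow> 0 \<le> l"
proof -
  assume "bar \<sigma> n R g l"
  then obtain M :: "(real \<times> vec \<times> real) measure" and a w b where "params M n R a w b" "(\<integral>m. \<bar>a m\<bar> \<partial>M) \<le> l"
    unfolding bar_def by blast
  moreover have "0 \<le> (\<integral>m. \<bar>a m\<bar> \<partial>M)" by (rule integral_nonneg_AE) simp
  ultimately show ?thesis by linarith
qed

lemma bar_zero: "nice \<sigma> \<Longrightarrow> 0 \<le> R \<Longrightarrow> bar \<sigma> n R (\<lambda>x. 0) 0"
  by (rule barI[where M = "return (count_space UNIV) ()" and a = "\<lambda>_. 0" and w = "\<lambda>_ _. 0" and b = "\<lambda>_. 0"])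
     (auto simp: params_def ridge_def L2_set_def prob_space_return)

lemma bar_cmult:
  assumes "bar \<sigma> n R g l" "nice \<sigma>" shows "bar \<sigma> n R (\<lambda>x. k * g x) (\<bar>k\<bar> * l)"
proof -
  obtain M :: "(real \<times> vec \<times> real) measure" and a w b
    where p: "params M n R a w b" and l: "(\<integral>m. \<bar>a m\<bar> \<partial>M) \<le> l" and gx: "\<And>x. x \<in> euclid n \<Longrightarrow> g x = ridge M n a w b \<sigma> x"
    using barE[OF assms(1)] by blast
  show ?thesis
  proof (rule barI[OF params_weight(1)[OF p, of "\<lambda>_. k" "\<bar>k\<bar>"] assms(2)])
    show "(\<integral>m. \<bar>a m * k\<bar> \<partial>M) \<le> \<bar>k\<bar> * l"
      using params_weight(2)[OF p, of "\<lambda>_. k" "\<bar>k\<bar>"] mult_left_mono[OF l, of "\<bar>k\<bar>"] by simp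
    show "k * g x = ridge M n (\<lambda>m. a m * k) w b \<sigma> x" if "x \<in> euclid n" for x
      unfolding gx[OF that] ridge_def integral_mult_right_zero[symmetric] by (simp add: mult_ac)
  qed auto
qed

section \<open>Product spaces and sums of Barron functions\<close>

lemma pair_prob: "prob_space M \<Longrightarrow> prob_space N \<Longrightarrow> pair_prob_space M N"
  unfolding pair_prob_space_def pair_sigma_finite_def by (auto intro: prob_space_imp_sigma_finite)

lemma prob_pair: "prob_space M \<Longrightarrow> prob_space N \<Longrightarrow> prob_space (M \<Otimes>\<^sub>M N)"
proof -
  assume "prob_space M" "prob_space N"
  then interpret pair_prob_space M N by (rule pair_prob)
  show ?thesis by (rule P.prob_space_axioms)
qed

lemma integrable_pair_bound:
  fixes F :: "'a \<times> 'b \<Rightarrow> real"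
  assumes ps: "prob_space M" "prob_space N" and [measurable]: "F \<in> borel_measurable (M \<Otimes>\<^sub>M N)"
    and g: "integrable M g" and h: "integrable N h"
    and b: "\<And>x y. x \<in> space M \<Longrightarrow> y \<in> space N \<Longrightarrow> \<bar>F (x, y)\<bar> \<le> \<bar>g x\<bar> * \<bar>h y\<bar>"
  shows "integrable (M \<Otimes>\<^sub>M N) F" "(\<integral>z. \<bar>F z\<bar> \<partial>(M \<Otimes>\<^sub>M N)) \<le> (\<integral>x. \<bar>g x\<bar> \<partial>M) * (\<integral>y. \<bar>h y\<bar> \<partial>N)"
proof -
  interpret pair_prob_space M N by (rule pair_prob[OF ps])
  have [measurable]: "g \<in> borel_measurable M" "h \<in> borel_measurable N" using g h by auto
  have gh: "integrable (M \<Otimes>\<^sub>M N) (\<lambda>z. \<bar>g (fst z)\<bar> * \<bar>h (snd z)\<bar>)"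
  proof (rule Fubini_integrable)
    show "integrable M (\<lambda>x. \<integral>y. norm (\<bar>g (fst (x, y))\<bar> * \<bar>h (snd (x, y))\<bar>) \<partial>N)"
      using g by (simp add: abs_mult)
  qed (use h in \<open>auto simp: abs_mult\<close>)
  show Fi: "integrable (M \<Otimes>\<^sub>M N) F"
    using b by (intro Bochner_Integration.integrable_bound[OF gh]) (auto simp: space_pair_measure abs_mult)
  have "(\<integral>z. \<bar>F z\<bar> \<partial>(M \<Otimes>\<^sub>M N)) \<le> (\<integral>z. \<bar>g (fst z)\<bar> * \<bar>h (snd z)\<bar> \<partial>(M \<Otimes>\<^sub>M N))"
    using b by (intro integral_mono integrable_abs Fi gh) (auto simp: space_pair_measure)
  also have "\<dots> = (\<integral>x. (\<integral>y. \<bar>g x\<bar> * \<bar>h y\<bar> \<partial>N) \<partial>M)"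
    using integral_fst'[OF gh] by simp
  finally show "(\<integral>z. \<bar>F z\<bar> \<partial>(M \<Otimes>\<^sub>M N)) \<le> (\<integral>x. \<bar>g x\<bar> \<partial>M) * (\<integral>y. \<bar>h y\<bar> \<partial>N)" by simp
qed

lemma vnorm_add: "vnorm n (\<lambda>i. u i + v i) \<le> vnorm n u + vnorm n v"
  by (rule L2_set_triangle_ineq)

lemma vdot_lin: "vdot n (\<lambda>i. k * u i + r * v i) x = k * vdot n u x + r * vdot n v x"
  by (simp add: vdot_def sum.distrib sum_distrib_left algebra_simps)

lemma vdot_cmult: "vdot n (\<lambda>i. k * u i) x = k * vdot n u x"
  by (simp add: vdot_def sum_distrib_left algebra_simps)

text \<open>A fair coin chooses between the two representations, and doubled outer weights
  compensate for the probability 1/2, so both values and norms add up. Drawing both parameters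
  together with the coin keeps the construction a product of spaces.\<close>

lemma bar_add:
  assumes "bar \<sigma> n R g1 l1" "bar \<sigma> n R g2 l2" and \<sigma>: "nice \<sigma>"
  shows "bar \<sigma> n R (\<lambda>x. g1 x + g2 x) (l1 + l2)"
proof -
  obtain M :: "(real \<times> vec \<times> real) measure" and a w b
    where p: "params M n R a w b" and l: "(\<integral>m. \<bar>a m\<bar> \<partial>M) \<le> l1" and gx: "\<And>x. x \<in> euclid n \<Longrightarrow> g1 x = ridge M n a w b \<sigma> x"
    using barE[OF assms(1)] by blast
  obtain N :: "(real \<times> vec \<times> real) measure" and a' w' b'
    where p': "params N n R a' w' b'" and l': "(\<integral>m. \<bar>a' m\<bar> \<partial>N) \<le> l2" and gx': "\<And>x. x \<in> euclid n \<Longrightarrow> g2 x = ridge N n a' w' b' \<sigma> x"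
    using barE[OF assms(2)] by blast
  have ps: "prob_space M" "prob_space N" and ai: "integrable M a" "integrable N a'"
    and m[measurable]: "b \<in> borel_measurable M" "b' \<in> borel_measurable N"
    and wm: "\<And>i. i < n \<Longrightarrow> (\<lambda>m. w m i) \<in> borel_measurable M" "\<And>i. i < n \<Longrightarrow> (\<lambda>m. w' m i) \<in> borel_measurable N"
    using p p' by (auto simp: params_def)
  have am[measurable]: "a \<in> borel_measurable M" "a' \<in> borel_measurable N" using ai by auto
  define B where "B = measure_pmf (bernoulli_pmf (1/2))"
  have Bp: "prob_space B" unfolding B_def by (rule prob_space_measure_pmf)
  have [measurable_cong]: "sets B = sets (count_space UNIV)" by (simp add: B_def)
  interpret MN: pair_prob_space M N by (rule pair_prob[OF ps])
  have MNp: "prob_space (M \<Otimes>\<^sub>M N)" by (rule prob_pair[OF ps])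
  interpret P: pair_prob_space "M \<Otimes>\<^sub>M N" B by (rule pair_prob[OF MNp Bp])
  let ?P = "(M \<Otimes>\<^sub>M N) \<Otimes>\<^sub>M B"
  let ?a = "\<lambda>z. if snd z then 2 * a (fst (fst z)) else 2 * a' (snd (fst z))"
  let ?w = "\<lambda>z. if snd z then w (fst (fst z)) else w' (snd (fst z))"
  let ?b = "\<lambda>z. if snd z then b (fst (fst z)) else b' (snd (fst z))"
  have fs: "integrable (M \<Otimes>\<^sub>M N) (\<lambda>z. a (fst z))" "integrable (M \<Otimes>\<^sub>M N) (\<lambda>z. a' (snd z))"
  proof -
    show "integrable (M \<Otimes>\<^sub>M N) (\<lambda>z. a (fst z))"
      by (rule integrable_pair_bound(1)[OF ps _ ai(1), of _ "\<lambda>_. 1"]) auto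
    show "integrable (M \<Otimes>\<^sub>M N) (\<lambda>z. a' (snd z))"
      by (rule integrable_pair_bound(1)[OF ps _ _ ai(2), of _ "\<lambda>_. 1"]) auto
  qed
  have mI: "integrable ?P ?a"
  proof (rule integrable_pair_bound(1)[OF MNp Bp, where g = "\<lambda>z. 2 * \<bar>a (fst z)\<bar> + 2 * \<bar>a' (snd z)\<bar>" and h = "\<lambda>_. 1"])
    show "?a \<in> borel_measurable ?P" by measurable
    show "integrable (M \<Otimes>\<^sub>M N) (\<lambda>z. 2 * \<bar>a (fst z)\<bar> + 2 * \<bar>a' (snd z)\<bar>)"
      by (intro Bochner_Integration.integrable_add integrable_mult_right integrable_abs fs)
  qed auto
  have pp: "params ?P n R ?a ?w ?b"
    unfolding params_def
  proof (intro conjI allI impI ballI)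
    show "prob_space ?P" by (rule prob_pair[OF MNp Bp])
    show "integrable ?P ?a" by (rule mI)
    show "?b \<in> borel_measurable ?P" by measurable
    show "(\<lambda>m. ?w m i) \<in> borel_measurable ?P" if "i < n" for i
    proof -
      note [measurable] = wm(1)[OF that] wm(2)[OF that]
      have "(\<lambda>z. if snd z then w (fst (fst z)) i else w' (snd (fst z)) i) \<in> borel_measurable ?P" by measurable
      moreover have "(\<lambda>z. if snd z then w (fst (fst z)) i else w' (snd (fst z)) i) = (\<lambda>m. ?w m i)" by (auto simp: fun_eq_iff)
      ultimately show ?thesis by simp
    qed
    show "vnorm n (?w z) \<le> R" if "z \<in> space ?P" for z
      using that p p' by (auto simp: space_pair_measure params_def split: prod.splits)
  qed
  have coin: "(\<integral>z. F z \<partial>?P) = (\<integral>m. F1 m \<partial>M) + (\<integral>k. F2 k \<partial>N)"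
    if F: "integrable ?P F" and F12: "integrable M F1" "integrable N F2"
      and e: "\<And>m k. F ((m, k), True) = 2 * F1 m" "\<And>m k. F ((m, k), False) = 2 * F2 k" for F :: "_ \<Rightarrow> real" and F1 F2
  proof -
    have i12: "integrable (M \<Otimes>\<^sub>M N) (\<lambda>z. F1 (fst z))" "integrable (M \<Otimes>\<^sub>M N) (\<lambda>z. F2 (snd z))"
    proof -
      have [measurable]: "F1 \<in> borel_measurable M" "F2 \<in> borel_measurable N" using F12 by auto
      show "integrable (M \<Otimes>\<^sub>M N) (\<lambda>z. F1 (fst z))"
        by (rule integrable_pair_bound(1)[OF ps _ F12(1), of _ "\<lambda>_. 1"]) auto
      show "integrable (M \<Otimes>\<^sub>M N) (\<lambda>z. F2 (snd z))"
        by (rule integrable_pair_bound(1)[OF ps _ _ F12(2), of _ "\<lambda>_. 1"]) auto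
    qed
    have "(\<integral>z. F z \<partial>?P) = (\<integral>z. (\<integral>c. F (z, c) \<partial>B) \<partial>(M \<Otimes>\<^sub>M N))"
      using P.integral_fst'[OF F] by simp
    also have "\<dots> = (\<integral>z. F1 (fst z) + F2 (snd z) \<partial>(M \<Otimes>\<^sub>M N))"
      by (intro Bochner_Integration.integral_cong refl) (auto simp: B_def e)
    also have "\<dots> = (\<integral>z. F1 (fst z) \<partial>(M \<Otimes>\<^sub>M N)) + (\<integral>z. F2 (snd z) \<partial>(M \<Otimes>\<^sub>M N))"
      by (rule Bochner_Integration.integral_add[OF i12])
    also have "(\<integral>z. F1 (fst z) \<partial>(M \<Otimes>\<^sub>M N)) = (\<integral>m. F1 m \<partial>M)"
      using MN.integral_fst'[OF i12(1)] by (simp add: MN.M2.prob_space)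
    also have "(\<integral>z. F2 (snd z) \<partial>(M \<Otimes>\<^sub>M N)) = (\<integral>k. F2 k \<partial>N)"
      using MN.integral_fst'[OF i12(2)] by (simp add: MN.M1.prob_space)
    finally show ?thesis .
  qed
  show ?thesis
  proof (rule barI[OF pp \<sigma>])
    have "(\<integral>z. \<bar>?a z\<bar> \<partial>?P) = (\<integral>m. \<bar>a m\<bar> \<partial>M) + (\<integral>k. \<bar>a' k\<bar> \<partial>N)"
      by (rule coin) (auto intro!: integrable_abs mI ai)
    then show "(\<integral>z. \<bar>?a z\<bar> \<partial>?P) \<le> l1 + l2" using l l' by linarith
    fix x assume x: "x \<in> euclid n"
    show "g1 x + g2 x = ridge ?P n ?a ?w ?b \<sigma> x"
      unfolding gx[OF x] gx'[OF x] ridge_def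
      by (rule coin[symmetric], rule ridge_integrable[OF pp \<sigma>], rule ridge_integrable[OF p \<sigma>], rule ridge_integrable[OF p' \<sigma>]) auto
  qed
qed

lemma bar_sum:
  assumes "\<And>i. i < k \<Longrightarrow> bar \<sigma> n R (g i) l" and \<sigma>: "nice \<sigma>" and R: "0 \<le> R"
  shows "bar \<sigma> n R (\<lambda>x. \<Sum>i<(k::nat). g i x) (real k * l)"
  using assms(1)
proof (induction k)
  case 0 then show ?case using bar_zero[OF \<sigma> R] by simp
next
  case (Suc k)
  have "bar \<sigma> n R (\<lambda>x. (\<Sum>i<k. g i x) + g k x) (real k * l + l)"
    by (intro bar_add \<sigma> Suc) auto
  then show ?case by (simp add: distrib_right add.commute)
qed

section \<open>The resolvent of the Laplacian on ridge functions\<close>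

abbreviation expo :: "real measure" where
  "expo \<equiv> density lborel (exponential_density 1)"

lemma prob_expo: "prob_space expo"
  by (rule prob_space_exponential_density) simp

text \<open>
  The operator inverse to \<open>1 - r\<^sup>2 D\<^sup>2\<close> averages over shifts with the Laplace distribution of
  scale \<open>r\<close>; integrate \<open>(h - h'') exp (- t)\<close>, \<open>h\<close> the even part of \<open>\<lambda>t. \<tau> (z + r t)\<close>.
\<close>

lemma laplace_resolvent:
  assumes n: "nice \<tau>" "nice \<tau>'" "nice \<tau>''"
    and D: "\<And>s. (\<tau> has_real_derivative \<tau>' s) (at s)" "\<And>s. (\<tau>' has_real_derivative \<tau>'' s) (at s)"
  shows "(\<integral>t. ((\<tau> (z + r * t) - r\<^sup>2 * \<tau>'' (z + r * t)) + (\<tau> (z - r * t) - r\<^sup>2 * \<tau>'' (z - r * t))) / 2 \<partial>expo) = \<tau> z"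
proof -
  interpret prob_space expo by (rule prob_expo)
  let ?h = "\<lambda>t. (\<tau> (z + r * t) + \<tau> (z - r * t)) / 2"
  let ?h' = "\<lambda>t. r * (\<tau>' (z + r * t) - \<tau>' (z - r * t)) / 2"
  let ?h'' = "\<lambda>t. r\<^sup>2 * (\<tau>'' (z + r * t) + \<tau>'' (z - r * t)) / 2"
  let ?f = "\<lambda>t. ?h t - ?h'' t"
  \<comment> \<open>An antiderivative of \<open>?f t * exp (- t)\<close>, as the two terms with
    \<open>?h'\<close> cancel. Since \<open>?h\<close> is even, \<open>?h'\<close> vanishes at 0 and
    \<open>?F 0\<close> is \<open>- \<tau> z\<close>.\<close>
  let ?F = "\<lambda>t. - ((?h t + ?h' t) * exp (- t))"
  obtain C0 where C0: "C0 \<ge> 0" "\<And>s. \<bar>\<tau> s\<bar> \<le> C0" using niceE[OF n(1)] by blast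
  obtain C1 where C1: "C1 \<ge> 0" "\<And>s. \<bar>\<tau>' s\<bar> \<le> C1" using niceE[OF n(2)] by blast
  obtain C2 where C2: "C2 \<ge> 0" "\<And>s. \<bar>\<tau>'' s\<bar> \<le> C2" using niceE[OF n(3)] by blast
  have ct: "isCont \<tau> s" "isCont \<tau>'' s" for s using n by (auto simp: nice_def continuous_on_eq_continuous_at)
  note [measurable] = nice_measurable[OF n(1)] nice_measurable[OF n(3)]
  have fb: "\<bar>?f t\<bar> \<le> C0 + r\<^sup>2 * C2" for t
  proof -
    have "\<bar>?h t\<bar> \<le> C0" using C0(2)[of "z + r * t"] C0(2)[of "z - r * t"] by (simp add: abs_le_iff)
    moreover have "\<bar>\<tau>'' (z + r * t) + \<tau>'' (z - r * t)\<bar> \<le> 2 * C2"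
      using C2(2)[of "z + r * t"] C2(2)[of "z - r * t"] by linarith
    then have "r\<^sup>2 * \<bar>\<tau>'' (z + r * t) + \<tau>'' (z - r * t)\<bar> \<le> r\<^sup>2 * (2 * C2)" by (intro mult_left_mono) auto
    then have "\<bar>?h'' t\<bar> \<le> r\<^sup>2 * C2" by (simp add: abs_mult)
    ultimately show ?thesis by linarith
  qed
  have fm[measurable]: "?f \<in> borel_measurable borel" by measurable
  have lim: "(\<lambda>k. \<integral>t. ?f t * indicator {0..real k} t \<partial>expo) \<longlonglongrightarrow> (\<integral>t. ?f t \<partial>expo)"
  proof (rule integral_dominated_convergence[where w = "\<lambda>_. C0 + r\<^sup>2 * C2"])
    have "AE t in expo. 0 \<le> t"
      by (subst AE_density) (auto simp: exponential_density_def intro!: AE_I2)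
    then show "AE t in expo. (\<lambda>k. ?f t * indicator {0..real k} t) \<longlonglongrightarrow> ?f t"
    proof eventually_elim
      case (elim t)
      obtain N where N: "t \<le> real N" using real_arch_simple by blast
      have "eventually (\<lambda>k. ?f t * indicator {0..real k} t = ?f t) sequentially"
        using eventually_ge_at_top[of N] by eventually_elim (use N elim in \<open>auto simp: indicator_def\<close>)
      then show ?case by (rule tendsto_eventually)
    qed
    show "AE t in expo. norm (?f t * indicator {0..real k} t) \<le> C0 + r\<^sup>2 * C2" for k
    proof (rule AE_I2)
      fix t
      have "\<bar>?f t * indicator {0..real k} t\<bar> \<le> \<bar>?f t\<bar>" by (simp add: indicator_def)
      then show "norm (?f t * indicator {0..real k} t) \<le> C0 + r\<^sup>2 * C2" using fb[of t] by simp
    qed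
  qed simp_all
  have "(\<integral>t. ?f t * indicator {0..real k} t \<partial>expo) = ?F (real k) - ?F 0" for k
  proof -
    have "(\<integral>t. ?f t * indicator {0..real k} t \<partial>expo)
        = (\<integral>t. exponential_density 1 t * (?f t * indicator {0..real k} t) \<partial>lborel)"
      by (subst integral_density) (auto simp: exponential_density_def intro!: AE_I2)
    also have "\<dots> = (\<integral>t. (?f t * exp (- t)) * indicator {0..real k} t \<partial>lborel)"
      by (intro Bochner_Integration.integral_cong refl) (auto simp: exponential_density_def indicator_def)
    also have "\<dots> = ?F (real k) - ?F 0"
    proof (rule integral_FTC_Icc_real)
      show "(0::real) \<le> real k" by simp
      fix t
      have d1: "((\<lambda>t. \<tau> (z + r * t)) has_real_derivative r * \<tau>' (z + r * t)) (at t)"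
        by (rule DERIV_cong[OF DERIV_chain2[OF D(1)]]) (auto intro!: derivative_eq_intros)
      have d2: "((\<lambda>t. \<tau> (z - r * t)) has_real_derivative - r * \<tau>' (z - r * t)) (at t)"
        by (rule DERIV_cong[OF DERIV_chain2[OF D(1)]]) (auto intro!: derivative_eq_intros)
      have d3: "((\<lambda>t. \<tau>' (z + r * t)) has_real_derivative r * \<tau>'' (z + r * t)) (at t)"
        by (rule DERIV_cong[OF DERIV_chain2[OF D(2)]]) (auto intro!: derivative_eq_intros)
      have d4: "((\<lambda>t. \<tau>' (z - r * t)) has_real_derivative - r * \<tau>'' (z - r * t)) (at t)"
        by (rule DERIV_cong[OF DERIV_chain2[OF D(2)]]) (auto intro!: derivative_eq_intros)
      show "(?F has_real_derivative ?f t * exp (- t)) (at t)"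
        by (rule d1 d2 d3 d4 derivative_eq_intros refl | simp)+
           (simp add: field_simps power2_eq_square)
      have cz: "isCont (\<lambda>t. z + r * t) t" "isCont (\<lambda>t. z - r * t) t" by (auto intro!: continuous_intros)
      have "isCont (\<lambda>t. \<tau> (z + r * t)) t" "isCont (\<lambda>t. \<tau> (z - r * t)) t"
        "isCont (\<lambda>t. \<tau>'' (z + r * t)) t" "isCont (\<lambda>t. \<tau>'' (z - r * t)) t"
        using isCont_o2[OF cz(1) ct(1)] isCont_o2[OF cz(2) ct(1)] isCont_o2[OF cz(1) ct(2)] isCont_o2[OF cz(2) ct(2)] by auto
      then show "isCont (\<lambda>t. ?f t * exp (- t)) t"
        by (intro continuous_intros) auto
    qed
    finally show ?thesis .
  qed
  note e = this
  have "(\<lambda>k. ?F (real k) - ?F 0) \<longlonglongrightarrow> 0 - (- \<tau> z)"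
  proof (rule tendsto_diff)
    show "(\<lambda>k. ?F (real k)) \<longlonglongrightarrow> 0"
    proof (rule Lim_null_comparison)
      have "((\<lambda>x::real. exp (- x)) \<longlongrightarrow> 0) at_top" using tendsto_power_div_exp_0[of 0] by (simp add: exp_minus field_simps)
      then have "(\<lambda>k. exp (- real k)) \<longlonglongrightarrow> 0" by (rule filterlim_compose[OF _ filterlim_real_sequentially])
      from tendsto_mult[OF tendsto_const[of "C0 + \<bar>r\<bar> * C1"] this]
      show "(\<lambda>k. (C0 + \<bar>r\<bar> * C1) * exp (- real k)) \<longlonglongrightarrow> 0" by simp
      have "\<bar>?h t + ?h' t\<bar> \<le> C0 + \<bar>r\<bar> * C1" for t
      proof -
        have "\<bar>?h t\<bar> \<le> C0" using C0(2)[of "z + r * t"] C0(2)[of "z - r * t"] by (simp add: abs_le_iff)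
        moreover have "\<bar>\<tau>' (z + r * t) - \<tau>' (z - r * t)\<bar> \<le> 2 * C1"
          using C1(2)[of "z + r * t"] C1(2)[of "z - r * t"] by linarith
        then have "\<bar>r\<bar> * \<bar>\<tau>' (z + r * t) - \<tau>' (z - r * t)\<bar> \<le> \<bar>r\<bar> * (2 * C1)" by (intro mult_left_mono) auto
        then have "\<bar>?h' t\<bar> \<le> \<bar>r\<bar> * C1" by (simp add: abs_mult)
        ultimately show ?thesis by linarith
      qed
      then have "norm (?F (real k)) \<le> (C0 + \<bar>r\<bar> * C1) * exp (- real k)" for k
        by (simp add: abs_mult mult_right_mono)
      then show "eventually (\<lambda>k. norm (?F (real k)) \<le> (C0 + \<bar>r\<bar> * C1) * exp (- real k)) sequentially" by simp
    qed
  qed simp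
  with lim have "(\<integral>t. ?f t \<partial>expo) = \<tau> z" unfolding e using LIMSEQ_unique by fastforce
  moreover have "?f = (\<lambda>t. ((\<tau> (z + r * t) - r\<^sup>2 * \<tau>'' (z + r * t)) + (\<tau> (z - r * t) - r\<^sup>2 * \<tau>'' (z - r * t))) / 2)"
    by (simp add: fun_eq_iff field_simps)
  ultimately show ?thesis by simp
qed

section \<open>Barron calculus for an admissible activation\<close>

text \<open>
  Only \<open>\<bar>p\<bar>, \<bar>q\<bar> \<le> \<kappa>\<close> is recorded about the inner weights of the product representation, so that
  \<open>\<kappa> = 1\<close> is possible for the cosine, where radii add up.
\<close>

locale barron_act =
  fixes \<sigma> :: "real \<Rightarrow> real" and \<kappa> Lm \<kappa>d Ld :: real
  assumes sm: "smooth1 \<sigma>" and n0: "nice \<sigma>" and n1: "nice (deriv \<sigma>)" and n2: "nice (deriv (deriv \<sigma>))"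
    and mult_rep: "\<exists>(Q :: (real \<times> vec \<times> real) measure) a p q b. prob_space Q \<and> integrable Q a \<and>
        p \<in> borel_measurable Q \<and> q \<in> borel_measurable Q \<and> b \<in> borel_measurable Q \<and>
        (\<forall>y\<in>space Q. \<bar>p y\<bar> \<le> \<kappa> \<and> \<bar>q y\<bar> \<le> \<kappa>) \<and> (\<integral>y. \<bar>a y\<bar> \<partial>Q) \<le> Lm \<and>
        (\<forall>s t. \<sigma> s * \<sigma> t = (\<integral>y. a y * \<sigma> (p y * s + q y * t + b y) \<partial>Q))"
    and deriv_rep: "\<exists>(Q :: (real \<times> vec \<times> real) measure) a p b. prob_space Q \<and> integrable Q a \<and>
        p \<in> borel_measurable Q \<and> b \<in> borel_measurable Q \<and>
        (\<forall>y\<in>space Q. \<bar>p y\<bar> \<le> \<kappa>d) \<and> (\<integral>y. \<bar>a y\<bar> \<partial>Q) \<le> Ld \<and>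
        (\<forall>s. deriv \<sigma> s = (\<integral>y. a y * \<sigma> (p y * s + b y) \<partial>Q))"
begin

lemma D0: "(\<sigma> has_real_derivative deriv \<sigma> s) (at s)"
  by (rule smooth1_DERIV[OF sm])

lemma D1: "(deriv \<sigma> has_real_derivative deriv (deriv \<sigma>) s) (at s)"
  by (rule smooth1_DERIV[OF smooth1_deriv[OF sm]])

lemma kd_nonneg: "0 \<le> \<kappa>d" and Ld_nonneg: "0 \<le> Ld" and k_nonneg: "0 \<le> \<kappa>" and Lm_nonneg: "0 \<le> Lm"
proof -
  obtain Q :: "(real \<times> vec \<times> real) measure" and a p where Q: "prob_space Q" "\<forall>y\<in>space Q. \<bar>p y\<bar> \<le> \<kappa>d" "(\<integral>y. \<bar>a y\<bar> \<partial>Q) \<le> Ld"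
    using deriv_rep by blast
  then obtain y where "y \<in> space Q" using prob_space.not_empty by blast
  then have "\<bar>p y\<bar> \<le> \<kappa>d" using Q(2) by blast
  then show "0 \<le> \<kappa>d" by linarith
  have "0 \<le> (\<integral>y. \<bar>a y\<bar> \<partial>Q)" by (rule integral_nonneg_AE) simp
  then show "0 \<le> Ld" using Q(3) by linarith
next
  obtain Q :: "(real \<times> vec \<times> real) measure" and a p where Q: "prob_space Q" "\<And>y. y\<in>space Q \<Longrightarrow> \<bar>p y\<bar> \<le> \<kappa>" "(\<integral>y. \<bar>a y\<bar> \<partial>Q) \<le> Lm"
    using mult_rep by blast
  then obtain y where "y \<in> space Q" using prob_space.not_empty by blast
  then have "\<bar>p y\<bar> \<le> \<kappa>" using Q(2) by blast
  then show "0 \<le> \<kappa>" by linarith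
  have "0 \<le> (\<integral>y. \<bar>a y\<bar> \<partial>Q)" by (rule integral_nonneg_AE) simp
  then show "0 \<le> Lm" using Q(3) by linarith
qed

text \<open>The chain rule puts \<open>w m i\<close>, at most \<open>R\<close> in absolute value,
  into the outer weight. Inserting the representation of \<open>deriv \<sigma>\<close> composes two
  affine maps and multiplies the inner weight by \<open>p\<close>, at most
  \<open>\<kappa>d\<close>.\<close>

lemma bar_partial:
  assumes g: "bar \<sigma> n R g l" and i: "i < n"
  shows "bar \<sigma> n (\<kappa>d * R) (partial i g) (Ld * (R * l))"
proof -
  obtain M :: "(real \<times> vec \<times> real) measure" and a0 w b
    where p0: "params M n R a0 w b" and l0: "(\<integral>m. \<bar>a0 m\<bar> \<partial>M) \<le> l" and gx: "\<And>x. x \<in> euclid n \<Longrightarrow> g x = ridge M n a0 w b \<sigma> x"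
    using barE[OF g] by blast
  obtain Q :: "(real \<times> vec \<times> real) measure" and a' p b'
    where Q: "prob_space Q" "integrable Q a'" and qm[measurable]: "p \<in> borel_measurable Q" "b' \<in> borel_measurable Q"
      and pb: "\<And>y. y\<in>space Q \<Longrightarrow> \<bar>p y\<bar> \<le> \<kappa>d" and lQ: "(\<integral>y. \<bar>a' y\<bar> \<partial>Q) \<le> Ld"
      and rep: "\<And>s. deriv \<sigma> s = (\<integral>y. a' y * \<sigma> (p y * s + b' y) \<partial>Q)"
    using deriv_rep by blast
  have Mp: "prob_space M" and bm[measurable]: "b \<in> borel_measurable M"
    and wm: "\<And>j. j < n \<Longrightarrow> (\<lambda>m. w m j) \<in> borel_measurable M" and wb: "\<And>m. m \<in> space M \<Longrightarrow> vnorm n (w m) \<le> R"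
    using p0 by (auto simp: params_def)
  define a where "a = (\<lambda>m. a0 m * w m i)"
  have p1: "params M n R a w b" unfolding a_def
    by (rule params_weight(1)[OF p0 wm[OF i] params_component_bound[OF p0 i]])
  have la: "(\<integral>m. \<bar>a m\<bar> \<partial>M) \<le> R * l"
  proof -
    have "(\<integral>m. \<bar>a m\<bar> \<partial>M) \<le> R * (\<integral>m. \<bar>a0 m\<bar> \<partial>M)" unfolding a_def
      by (rule params_weight(2)[OF p0 wm[OF i] params_component_bound[OF p0 i]])
    also have "\<dots> \<le> R * l" by (rule mult_left_mono[OF l0 params_R_nonneg[OF p0]])
    finally show ?thesis .
  qed
  have ai: "integrable M a" using p1 by (simp add: params_def)
  have [measurable]: "a \<in> borel_measurable M" "a' \<in> borel_measurable Q" using ai Q(2) by auto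
  interpret pair_prob_space M Q by (rule pair_prob[OF Mp Q(1)])
  let ?a = "\<lambda>(m, y). a m * a' y"
  let ?w = "\<lambda>(m, y) j. p y * w m j"
  let ?b = "\<lambda>(m, y). p y * b m + b' y"
  have Pi: "integrable (M \<Otimes>\<^sub>M Q) ?a" "(\<integral>z. \<bar>?a z\<bar> \<partial>(M \<Otimes>\<^sub>M Q)) \<le> (\<integral>x. \<bar>a x\<bar> \<partial>M) * (\<integral>y. \<bar>a' y\<bar> \<partial>Q)"
    by (rule integrable_pair_bound[OF Mp Q(1) _ ai Q(2)]; simp add: abs_mult)+
  have par: "params (M \<Otimes>\<^sub>M Q) n (\<kappa>d * R) ?a ?w ?b"
    unfolding params_def
  proof (intro conjI allI impI ballI)
    show "prob_space (M \<Otimes>\<^sub>M Q)" by (rule prob_pair[OF Mp Q(1)])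
    show "integrable (M \<Otimes>\<^sub>M Q) ?a" by (rule Pi)
    show "?b \<in> borel_measurable (M \<Otimes>\<^sub>M Q)" by measurable
    show "(\<lambda>z. ?w z j) \<in> borel_measurable (M \<Otimes>\<^sub>M Q)" if "j < n" for j
    proof -
      note [measurable] = wm[OF that]
      have "(\<lambda>(m, y). p y * w m j) \<in> borel_measurable (M \<Otimes>\<^sub>M Q)" by measurable
      then show ?thesis by (simp add: case_prod_unfold)
    qed
    show "vnorm n (?w z) \<le> \<kappa>d * R" if z: "z \<in> space (M \<Otimes>\<^sub>M Q)" for z
    proof -
      obtain m y where zz: "z = (m, y)" "m \<in> space M" "y \<in> space Q" using z by (auto simp: space_pair_measure)
      have "vnorm n (?w z) = \<bar>p y\<bar> * vnorm n (w m)" by (simp add: zz vnorm_cmult)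
      also have "\<dots> \<le> \<kappa>d * R" using pb[OF zz(3)] wb[OF zz(2)] kd_nonneg by (intro mult_mono) auto
      finally show ?thesis .
    qed
  qed
  show ?thesis
  proof (rule barI[OF par n0])
    have "(\<integral>z. \<bar>?a z\<bar> \<partial>(M \<Otimes>\<^sub>M Q)) \<le> (R * l) * Ld"
      using Pi(2) mult_mono[OF la lQ] bar_l_nonneg[OF g] bar_R_nonneg[OF g]
      by (smt (verit) integral_nonneg_AE AE_I2 abs_ge_zero mult_nonneg_nonneg)
    then show "(\<integral>z. \<bar>?a z\<bar> \<partial>(M \<Otimes>\<^sub>M Q)) \<le> Ld * (R * l)" by (simp add: mult.commute)
    fix x assume x: "x \<in> euclid n"
    have "partial i g x = partial i (ridge M n a0 w b \<sigma>) x" by (rule partial_cong[OF x i gx])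
    also have "\<dots> = ridge M n a w b (deriv \<sigma>) x"
      unfolding a_def by (rule partial_ridge[OF p0 n0 n1 D0 i])
    also have "\<dots> = (\<integral>m. (\<integral>y. a m * a' y * \<sigma> (vdot n (\<lambda>j. p y * w m j) x + (p y * b m + b' y)) \<partial>Q) \<partial>M)"
      unfolding ridge_def rep vdot_cmult
      by (simp add: distrib_left add.assoc mult.assoc)
    also have "\<dots> = (\<integral>m. (\<integral>y. (\<lambda>z. ?a z * \<sigma> (vdot n (?w z) x + ?b z)) (m, y) \<partial>Q) \<partial>M)" by simp
    also have "\<dots> = ridge (M \<Otimes>\<^sub>M Q) n ?a ?w ?b \<sigma> x"
      unfolding ridge_def by (rule integral_fst'[OF ridge_integrable[OF par n0]])
    finally show "partial i g x = ridge (M \<Otimes>\<^sub>M Q) n ?a ?w ?b \<sigma> x" .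
  qed
qed

text \<open>The two ridge arguments are substituted into the representation of
  \<open>\<sigma> s * \<sigma> t\<close>. The inner weight becomes \<open>p w + q w'\<close>, of
  norm at most \<open>\<kappa> (R1 + R2)\<close>, and the outer weights multiply.\<close>

lemma bar_mult:
  assumes g1: "bar \<sigma> n R1 g1 l1" and g2: "bar \<sigma> n R2 g2 l2"
  shows "bar \<sigma> n (\<kappa> * (R1 + R2)) (\<lambda>x. g1 x * g2 x) (Lm * (l1 * l2))"
proof -
  obtain M :: "(real \<times> vec \<times> real) measure" and a w b
    where p1: "params M n R1 a w b" and l1: "(\<integral>m. \<bar>a m\<bar> \<partial>M) \<le> l1" and gx: "\<And>x. x \<in> euclid n \<Longrightarrow> g1 x = ridge M n a w b \<sigma> x"
    using barE[OF g1] by blast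
  obtain N :: "(real \<times> vec \<times> real) measure" and a' w' b'
    where p2: "params N n R2 a' w' b'" and l2: "(\<integral>m. \<bar>a' m\<bar> \<partial>N) \<le> l2" and gx': "\<And>x. x \<in> euclid n \<Longrightarrow> g2 x = ridge N n a' w' b' \<sigma> x"
    using barE[OF g2] by blast
  obtain Q :: "(real \<times> vec \<times> real) measure" and a3 p q b3
    where Q: "prob_space Q" "integrable Q a3" and qm[measurable]: "p \<in> borel_measurable Q" "q \<in> borel_measurable Q" "b3 \<in> borel_measurable Q"
      and pb: "\<And>y. y\<in>space Q \<Longrightarrow> \<bar>p y\<bar> \<le> \<kappa>" "\<And>y. y\<in>space Q \<Longrightarrow> \<bar>q y\<bar> \<le> \<kappa>" and l3: "(\<integral>y. \<bar>a3 y\<bar> \<partial>Q) \<le> Lm"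
      and rep: "\<And>s t. \<sigma> s * \<sigma> t = (\<integral>y. a3 y * \<sigma> (p y * s + q y * t + b3 y) \<partial>Q)"
    using mult_rep by blast
  have ps: "prob_space M" "prob_space N" and ai: "integrable M a" "integrable N a'"
    and bm[measurable]: "b \<in> borel_measurable M" "b' \<in> borel_measurable N"
    and wm: "\<And>i. i < n \<Longrightarrow> (\<lambda>m. w m i) \<in> borel_measurable M" "\<And>i. i < n \<Longrightarrow> (\<lambda>m. w' m i) \<in> borel_measurable N"
    and wb: "\<And>m. m \<in> space M \<Longrightarrow> vnorm n (w m) \<le> R1" "\<And>m. m \<in> space N \<Longrightarrow> vnorm n (w' m) \<le> R2"
    using p1 p2 by (auto simp: params_def)
  have am[measurable]: "a \<in> borel_measurable M" "a' \<in> borel_measurable N" "a3 \<in> borel_measurable Q" using ai Q(2) by auto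
  interpret NQ: pair_prob_space N Q by (rule pair_prob[OF ps(2) Q(1)])
  have NQp: "prob_space (N \<Otimes>\<^sub>M Q)" by (rule prob_pair[OF ps(2) Q(1)])
  interpret P: pair_prob_space M "N \<Otimes>\<^sub>M Q" by (rule pair_prob[OF ps(1) NQp])
  let ?P = "M \<Otimes>\<^sub>M (N \<Otimes>\<^sub>M Q)"
  let ?a = "\<lambda>(m, k, y). a m * (a' k * a3 y)"
  let ?w = "\<lambda>(m, k, y) j. p y * w m j + q y * w' k j"
  let ?b = "\<lambda>(m, k, y). p y * b m + q y * b' k + b3 y"
  have i1: "integrable (N \<Otimes>\<^sub>M Q) (\<lambda>(k, y). a' k * a3 y)" "(\<integral>z. \<bar>(\<lambda>(k, y). a' k * a3 y) z\<bar> \<partial>(N \<Otimes>\<^sub>M Q)) \<le> (\<integral>x. \<bar>a' x\<bar> \<partial>N) * (\<integral>y. \<bar>a3 y\<bar> \<partial>Q)"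
    by (rule integrable_pair_bound[OF ps(2) Q(1) _ ai(2) Q(2)]; simp add: abs_mult)+
  have i2: "integrable ?P ?a" "(\<integral>z. \<bar>?a z\<bar> \<partial>?P) \<le> (\<integral>x. \<bar>a x\<bar> \<partial>M) * (\<integral>z. \<bar>(\<lambda>(k, y). a' k * a3 y) z\<bar> \<partial>(N \<Otimes>\<^sub>M Q))"
    by (rule integrable_pair_bound[OF ps(1) NQp _ ai(1) i1(1)]; auto simp: abs_mult split: prod.splits)+
  have par: "params ?P n (\<kappa> * (R1 + R2)) ?a ?w ?b"
    unfolding params_def
  proof (intro conjI allI impI ballI)
    show "prob_space ?P" by (rule prob_pair[OF ps(1) NQp])
    show "integrable ?P ?a" by (rule i2)
    show "?b \<in> borel_measurable ?P" by measurable
    show "(\<lambda>z. ?w z j) \<in> borel_measurable ?P" if "j < n" for j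
    proof -
      note [measurable] = wm(1)[OF that] wm(2)[OF that]
      have "(\<lambda>(m, k, y). p y * w m j + q y * w' k j) \<in> borel_measurable ?P" by measurable
      then show ?thesis by (simp add: case_prod_unfold)
    qed
    show "vnorm n (?w z) \<le> \<kappa> * (R1 + R2)" if z: "z \<in> space ?P" for z
    proof -
      obtain m k y where zz: "z = (m, k, y)" "m \<in> space M" "k \<in> space N" "y \<in> space Q" using z by (auto simp: space_pair_measure)
      have "vnorm n (?w z) \<le> vnorm n (\<lambda>j. p y * w m j) + vnorm n (\<lambda>j. q y * w' k j)"
        unfolding zz by (simp add: vnorm_add)
      also have "\<dots> = \<bar>p y\<bar> * vnorm n (w m) + \<bar>q y\<bar> * vnorm n (w' k)" by (simp add: vnorm_cmult)
      also have "\<dots> \<le> \<kappa> * R1 + \<kappa> * R2"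
        using pb[OF zz(4)] wb(1)[OF zz(2)] wb(2)[OF zz(3)] k_nonneg by (intro add_mono mult_mono) auto
      finally show ?thesis by (simp add: distrib_left)
    qed
  qed
  show ?thesis
  proof (rule barI[OF par n0])
    have nn: "0 \<le> (\<integral>x. \<bar>a' x\<bar> \<partial>N)" "0 \<le> (\<integral>x. \<bar>a x\<bar> \<partial>M)" "0 \<le> (\<integral>x. \<bar>a3 x\<bar> \<partial>Q)"
      by (intro integral_nonneg_AE; simp)+
    have "(\<integral>z. \<bar>?a z\<bar> \<partial>?P) \<le> (\<integral>x. \<bar>a x\<bar> \<partial>M) * ((\<integral>x. \<bar>a' x\<bar> \<partial>N) * (\<integral>y. \<bar>a3 y\<bar> \<partial>Q))"
      by (rule order_trans[OF i2(2) mult_left_mono[OF i1(2) nn(2)]])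
    also have "\<dots> \<le> l1 * (l2 * Lm)"
      using l1 l2 l3 nn bar_l_nonneg[OF g1] bar_l_nonneg[OF g2] by (intro mult_mono) auto
    finally show "(\<integral>z. \<bar>?a z\<bar> \<partial>?P) \<le> Lm * (l1 * l2)" by (simp add: mult_ac)
    fix x assume x: "x \<in> euclid n"
    let ?F = "\<lambda>z. ?a z * \<sigma> (vdot n (?w z) x + ?b z)"
    let ?u = "\<lambda>m. vdot n (w m) x + b m" and ?v = "\<lambda>k. vdot n (w' k) x + b' k"
    obtain C where C: "C \<ge> 0" "\<And>s. \<bar>\<sigma> s\<bar> \<le> C" using niceE[OF n0] by blast
    have Fi: "integrable ?P ?F" by (rule ridge_integrable[OF par n0])
    have Fm: "?F (m, k, y) = a m * (a' k * (a3 y * \<sigma> (p y * ?u m + q y * ?v k + b3 y)))" for m k y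
      by (simp add: vdot_lin algebra_simps)
    note [measurable] = nice_measurable[OF n0] params_vdot_measurable[OF p2]
    \<comment> \<open>Integrability is shown for every section and not for almost every one, because
      the inner integral is split for each \<open>m\<close>.\<close>
    have Fsec: "integrable (N \<Otimes>\<^sub>M Q) (\<lambda>z. ?F (m, z))" if m: "m \<in> space M" for m
    proof (rule integrable_pair_bound(1)[OF ps(2) Q(1), where g = "\<lambda>k. a m * a' k" and h = "\<lambda>y. C * a3 y"])
      have Fm': "?F (m, z) = a m * (a' (fst z) * (a3 (snd z) * \<sigma> (p (snd z) * ?u m + q (snd z) * ?v (fst z) + b3 (snd z))))" for z
        using Fm[of m "fst z" "snd z"] by (simp only: prod.collapse)
      show "(\<lambda>z. ?F (m, z)) \<in> borel_measurable (N \<Otimes>\<^sub>M Q)" unfolding Fm' by measurable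
      show "\<bar>?F (m, (k, y))\<bar> \<le> \<bar>a m * a' k\<bar> * \<bar>C * a3 y\<bar>" for k y
      proof -
        have "\<bar>a m\<bar> * (\<bar>a' k\<bar> * (\<bar>a3 y\<bar> * \<bar>\<sigma> (p y * ?u m + q y * ?v k + b3 y)\<bar>)) \<le> \<bar>a m\<bar> * (\<bar>a' k\<bar> * (\<bar>a3 y\<bar> * C))"
          by (intro mult_left_mono C(2)) auto
        then show ?thesis unfolding Fm using C(1) by (simp add: abs_mult mult_ac)
      qed
    qed (use ai Q(2) in auto)
    have "ridge ?P n ?a ?w ?b \<sigma> x = (\<integral>m. (\<integral>z. ?F (m, z) \<partial>(N \<Otimes>\<^sub>M Q)) \<partial>M)"
      unfolding ridge_def using P.integral_fst'[OF Fi] by simp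
    also have "\<dots> = (\<integral>m. (\<integral>k. (\<integral>y. ?F (m, k, y) \<partial>Q) \<partial>N) \<partial>M)"
      by (intro Bochner_Integration.integral_cong refl NQ.integral_fst'[OF Fsec, symmetric])
    also have "\<dots> = (\<integral>m. (\<integral>k. a m * (a' k * (\<sigma> (?u m) * \<sigma> (?v k))) \<partial>N) \<partial>M)"
      unfolding Fm rep by simp
    also have "\<dots> = (\<integral>m. (a m * \<sigma> (?u m)) * (\<integral>k. a' k * \<sigma> (?v k) \<partial>N) \<partial>M)"
      unfolding integral_mult_right_zero[symmetric] by (simp add: mult_ac)
    also have "\<dots> = g1 x * g2 x" unfolding gx[OF x] gx'[OF x] ridge_def by simp
    finally show "g1 x * g2 x = ridge ?P n ?a ?w ?b \<sigma> x" by simp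
  qed
qed

lemma bar_bddf: "bar \<sigma> n R g l \<Longrightarrow> bddf n g"
proof -
  assume g: "bar \<sigma> n R g l"
  obtain M :: "(real \<times> vec \<times> real) measure" and a w b
    where p: "params M n R a w b" and l: "(\<integral>m. \<bar>a m\<bar> \<partial>M) \<le> l" and gx: "\<And>x. x \<in> euclid n \<Longrightarrow> g x = ridge M n a w b \<sigma> x"
    using barE[OF g] by blast
  obtain C where C: "C \<ge> 0" "\<And>s. \<bar>\<sigma> s\<bar> \<le> C" using niceE[OF n0] by blast
  show ?thesis using ridge_bound[OF p n0 C(2)] gx by (intro bddfI[of n g "C * (\<integral>m. \<bar>a m\<bar> \<partial>M)"]) simp
qed

text \<open>By \<open>bar_partial\<close> the Barron functions of all radii and norms together form
  a class closed under partial derivatives.\<close>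

lemma bar_smooth: "bar \<sigma> n R g l \<Longrightarrow> smooth n g"
proof (rule smooth_coinduct[where S = "{g. \<exists>R l. bar \<sigma> n R g l}"])
  fix \<psi> assume "\<psi> \<in> {g. \<exists>R l. bar \<sigma> n R g l}"
  then obtain R l where b: "bar \<sigma> n R \<psi> l" by blast
  obtain M :: "(real \<times> vec \<times> real) measure" and a w b
    where p: "params M n R a w b" and l: "(\<integral>m. \<bar>a m\<bar> \<partial>M) \<le> l" and gx: "\<And>x. x \<in> euclid n \<Longrightarrow> \<psi> x = ridge M n a w b \<sigma> x"
    using barE[OF b] by blast
  show "continuous_on (euclid n) \<psi>"
    by (rule iffD2[OF continuous_on_cong[OF refl gx] ridge_continuous[OF p n0]])
  fix i assume i: "i < n"
  show "(\<lambda>t. \<psi> (x(i := t))) differentiable (at (x i))" if x: "x \<in> euclid n" for x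
  proof -
    have "(\<lambda>t. \<psi> (x(i := t))) = (\<lambda>t. ridge M n a w b \<sigma> (x(i := t)))"
      by (rule ext, rule gx, rule euclid_upd[OF x i])
    then show ?thesis using ridge_DERIV[OF p n0 n1 D0 i] real_differentiable_def by metis
  qed
  show "\<exists>\<eta>\<in>{g. \<exists>R l. bar \<sigma> n R g l}. \<forall>x\<in>euclid n. partial i \<psi> x = \<eta> x"
    using bar_partial[OF b i] by blast
qed blast

text \<open>On a ridge function the Laplacian is \<open>|w|^2\<close> times the second derivative in
  the scalar argument, so the resolvent is the one of \<open>laplace_resolvent\<close> with
  \<open>r = |w|\<close>. It shifts \<open>b\<close> at random and leaves \<open>a\<close> and
  \<open>w\<close> as they are; neither radius nor norm grows.\<close>

lemma bar_resolvent:
  assumes g: "bar \<sigma> n R g l"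
  obtains v where "bar \<sigma> n R v l" "\<And>x. x \<in> euclid n \<Longrightarrow> v x - (\<Sum>i<n. partial i (partial i v) x) = g x"
proof -
  obtain M :: "(real \<times> vec \<times> real) measure" and a w b
    where p: "params M n R a w b" and l: "(\<integral>m. \<bar>a m\<bar> \<partial>M) \<le> l" and gx: "\<And>x. x \<in> euclid n \<Longrightarrow> g x = ridge M n a w b \<sigma> x"
    using barE[OF g] by blast
  have Mp: "prob_space M" and ai: "integrable M a" and bm[measurable]: "b \<in> borel_measurable M"
    and wm: "\<And>j. j < n \<Longrightarrow> (\<lambda>m. w m j) \<in> borel_measurable M" and wb: "\<And>m. m \<in> space M \<Longrightarrow> vnorm n (w m) \<le> R"
    using p by (auto simp: params_def)
  have am[measurable]: "a \<in> borel_measurable M" using ai by auto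
  have vm[measurable]: "(\<lambda>m. vnorm n (w m)) \<in> borel_measurable M"
    unfolding L2_set_def using wm by (intro borel_measurable_sqrt[THEN measurable_compose[rotated]] borel_measurable_sum borel_measurable_power) auto
  define B where "B = measure_pmf (bernoulli_pmf (1/2))"
  have Bp: "prob_space B" unfolding B_def by (rule prob_space_measure_pmf)
  have [measurable_cong]: "sets B = sets (count_space UNIV)" by (simp add: B_def)
  interpret E: prob_space expo by (rule prob_expo)
  interpret EB: pair_prob_space expo B by (rule pair_prob[OF prob_expo Bp])
  have EBp: "prob_space (expo \<Otimes>\<^sub>M B)" by (rule prob_pair[OF prob_expo Bp])
  interpret P: pair_prob_space M "expo \<Otimes>\<^sub>M B" by (rule pair_prob[OF Mp EBp])
  let ?P = "M \<Otimes>\<^sub>M (expo \<Otimes>\<^sub>M B)"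
  let ?sg = "\<lambda>c::bool. if c then 1 else (-1::real)"
  let ?a = "\<lambda>z. a (fst z)" and ?w = "\<lambda>z. w (fst z)"
  \<comment> \<open>An exponential variable with an independent fair sign has the Laplace
    distribution.\<close>
  let ?b = "\<lambda>z. b (fst z) + ?sg (snd (snd z)) * (vnorm n (w (fst z)) * fst (snd z))"
  have i2: "integrable ?P ?a" "(\<integral>z. \<bar>?a z\<bar> \<partial>?P) \<le> (\<integral>x. \<bar>a x\<bar> \<partial>M) * (\<integral>z. \<bar>1\<bar> \<partial>(expo \<Otimes>\<^sub>M B))"
    by (rule integrable_pair_bound[OF Mp EBp _ ai, where h = "\<lambda>_. 1"]; simp)+
  have par: "params ?P n R ?a ?w ?b"
    unfolding params_def
  proof (intro conjI allI impI ballI)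
    show "prob_space ?P" by (rule prob_pair[OF Mp EBp])
    show "integrable ?P ?a" by (rule i2)
    show "?b \<in> borel_measurable ?P" by measurable
    show "(\<lambda>z. ?w z j) \<in> borel_measurable ?P" if "j < n" for j
      by (rule measurable_compose[OF measurable_fst wm[OF that]])
    show "vnorm n (?w z) \<le> R" if "z \<in> space ?P" for z
      using that wb by (auto simp: space_pair_measure)
  qed
  define v where "v = ridge ?P n ?a ?w ?b \<sigma>"
  have v: "bar \<sigma> n R v l"
    by (rule barI[OF par n0]) (use i2(2) l in \<open>simp_all add: v_def EB.P.prob_space\<close>)
  have pw: "params ?P n R (\<lambda>z. ?a z * ?w z i) ?w ?b" if i: "i < n" for i
    by (rule params_weight(1)[OF par _ params_component_bound[OF par i]]) (use par i in \<open>simp_all add: params_def\<close>)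
  have pww: "params ?P n R (\<lambda>z. ?a z * ?w z i * ?w z i) ?w ?b" if i: "i < n" for i
    by (rule params_weight(1)[OF pw[OF i] _ params_component_bound[OF par i]]) (use par i in \<open>simp_all add: params_def\<close>)
  have ddv: "partial i (partial i v) x = ridge ?P n (\<lambda>z. ?a z * ?w z i * ?w z i) ?w ?b (deriv (deriv \<sigma>)) x" if i: "i < n" for i x
  proof -
    have "partial i v = ridge ?P n (\<lambda>z. ?a z * ?w z i) ?w ?b (deriv \<sigma>)"
      unfolding v_def by (rule ext, rule partial_ridge[OF par n0 n1 D0 i])
    then show ?thesis using partial_ridge[OF pw[OF i] n1 n2 D1 i] by simp
  qed
  have "v x - (\<Sum>i<n. partial i (partial i v) x) = g x" if x: "x \<in> euclid n" for x
  proof -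
    let ?z = "\<lambda>m. vdot n (w m) x + b m" and ?r = "\<lambda>m. vnorm n (w m)"
    let ?h = "\<lambda>m s. \<sigma> s - (?r m)\<^sup>2 * deriv (deriv \<sigma>) s"
    let ?F = "\<lambda>z. ?a z * ?h (fst z) (vdot n (?w z) x + ?b z)"
    have i3: "integrable ?P (\<lambda>z. (?a z * ?w z i * ?w z i) * deriv (deriv \<sigma>) (vdot n (?w z) x + ?b z))" if "i < n" for i
      by (rule ridge_integrable[OF pww[OF that] n2])
    have i4: "integrable ?P (\<lambda>z. ?a z * \<sigma> (vdot n (?w z) x + ?b z))" by (rule ridge_integrable[OF par n0])
    have rr: "(?r m)\<^sup>2 = (\<Sum>i<n. w m i * w m i)" for m
      by (simp add: L2_set_def sum_nonneg power2_eq_square)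
    have Feq: "?F z = ?a z * \<sigma> (vdot n (?w z) x + ?b z) - (\<Sum>i<n. (?a z * ?w z i * ?w z i) * deriv (deriv \<sigma>) (vdot n (?w z) x + ?b z))" for z
      unfolding rr by (simp add: right_diff_distrib sum_distrib_left sum_distrib_right mult_ac)
    have Fi: "integrable ?P ?F" unfolding Feq
      by (intro Bochner_Integration.integrable_diff i4 Bochner_Integration.integrable_sum i3) auto
    have vA: "v x = (\<integral>z. ?a z * \<sigma> (vdot n (?w z) x + ?b z) \<partial>?P)" by (simp only: v_def ridge_def)
    have vB: "(\<Sum>i<n. partial i (partial i v) x)
        = (\<integral>z. (\<Sum>i<n. (?a z * ?w z i * ?w z i) * deriv (deriv \<sigma>) (vdot n (?w z) x + ?b z)) \<partial>?P)"
      using i3 by (subst Bochner_Integration.integral_sum) (auto simp: ddv ridge_def)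
    have "v x - (\<Sum>i<n. partial i (partial i v) x) = (\<integral>z. ?F z \<partial>?P)"
      unfolding vA vB Feq
      by (intro Bochner_Integration.integral_diff[symmetric] i4 Bochner_Integration.integrable_sum i3) auto
    also have "\<dots> = (\<integral>m. (\<integral>y. ?F (m, y) \<partial>(expo \<Otimes>\<^sub>M B)) \<partial>M)" using P.integral_fst'[OF Fi] by simp
    also have "\<dots> = (\<integral>m. a m * \<sigma> (?z m) \<partial>M)"
    proof (rule Bochner_Integration.integral_cong[OF refl])
      fix m assume m: "m \<in> space M"
      let ?G = "\<lambda>y. ?h m (?z m + ?sg (snd y) * (?r m * fst y))"
      note [measurable] = nice_measurable[OF n0] nice_measurable[OF n2]
      obtain C0 where C0: "C0 \<ge> 0" "\<And>s. \<bar>\<sigma> s\<bar> \<le> C0" using niceE[OF n0] by blast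
      obtain C2 where C2: "C2 \<ge> 0" "\<And>s. \<bar>deriv (deriv \<sigma>) s\<bar> \<le> C2" using niceE[OF n2] by blast
      have hb: "\<bar>?h m s\<bar> \<le> C0 + (?r m)\<^sup>2 * C2" for s
      proof -
        have "\<bar>(?r m)\<^sup>2 * deriv (deriv \<sigma>) s\<bar> \<le> (?r m)\<^sup>2 * C2" unfolding abs_mult by (intro mult_mono C2(2)) auto
        then show ?thesis using C0(2)[of s] by linarith
      qed
      have Gm: "?G \<in> borel_measurable (expo \<Otimes>\<^sub>M B)" by measurable
      have Gi: "integrable (expo \<Otimes>\<^sub>M B) ?G"
        by (rule EB.P.integrable_const_bound[where B = "C0 + (?r m)\<^sup>2 * C2", OF _ Gm]) (use hb in \<open>auto intro!: AE_I2\<close>)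
      have "(\<integral>y. ?F (m, y) \<partial>(expo \<Otimes>\<^sub>M B)) = a m * (\<integral>y. ?G y \<partial>(expo \<Otimes>\<^sub>M B))"
        by (simp add: add.assoc)
      also have "(\<integral>y. ?G y \<partial>(expo \<Otimes>\<^sub>M B)) = (\<integral>t. (\<integral>c. ?G (t, c) \<partial>B) \<partial>expo)"
        using EB.integral_fst'[OF Gi] by simp
      also have "\<dots> = (\<integral>t. ((\<sigma> (?z m + ?r m * t) - (?r m)\<^sup>2 * deriv (deriv \<sigma>) (?z m + ?r m * t))
          + (\<sigma> (?z m - ?r m * t) - (?r m)\<^sup>2 * deriv (deriv \<sigma>) (?z m - ?r m * t))) / 2 \<partial>expo)"
        by (intro Bochner_Integration.integral_cong refl) (simp add: B_def add_divide_distrib diff_divide_distrib)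
      also have "\<dots> = \<sigma> (?z m)" by (rule laplace_resolvent[OF n0 n1 n2 D0 D1])
      finally show "(\<integral>y. ?F (m, y) \<partial>(expo \<Otimes>\<^sub>M B)) = a m * \<sigma> (?z m)" .
    qed
    also have "\<dots> = g x" using gx[OF x] by (simp add: ridge_def)
    finally show ?thesis .
  qed
  then show ?thesis using that v by blast
qed

end

section \<open>The iteration\<close>

locale barron_elliptic = barron_act \<sigma> \<kappa> Lm \<kappa>d Ld + elliptic d A c f us amin amax cmin cmax
  for \<sigma> :: "real \<Rightarrow> real" and \<kappa> Lm \<kappa>d Ld :: real
    and d :: nat and A :: "vec \<Rightarrow> nat \<Rightarrow> nat \<Rightarrow> real" and c f us :: "vec \<Rightarrow> real"
    and amin amax cmin cmax :: real +
  fixes RA Rc Rf LA Lc Lf :: real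
  assumes A_bar: "\<And>i j. i < d \<Longrightarrow> j < d \<Longrightarrow> bar \<sigma> d RA (\<lambda>x. A x i j) LA"
    and c_bar: "bar \<sigma> d Rc c Lc" and f_bar: "bar \<sigma> d Rf f Lf"
begin

definition "rho = sqrt (1 - m\<^sup>2 / M\<^sup>2)"

definition rhs :: "(vec \<Rightarrow> real) \<Rightarrow> vec \<Rightarrow> real" where
  "rhs u x = c x * u x - f x - (\<Sum>i<d. partial i (flux (\<lambda>j. partial j u) i) x)"

lemma flux_bar:
  assumes u: "bar \<sigma> d R u l" and i: "i < d"
  shows "bar \<sigma> d (\<kappa> * (RA + \<kappa>d * R)) (flux (\<lambda>j. partial j u) i) (real d * (Lm * (LA * (Ld * (R * l)))))"
  unfolding flux_def[abs_def]
proof (rule bar_sum[OF _ n0])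
  show "bar \<sigma> d (\<kappa> * (RA + \<kappa>d * R)) (\<lambda>x. A x i j * partial j u x) (Lm * (LA * (Ld * (R * l))))" if "j < d" for j
    by (rule bar_mult[OF A_bar[OF i that] bar_partial[OF u that]])
  show "0 \<le> \<kappa> * (RA + \<kappa>d * R)"
    using k_nonneg kd_nonneg bar_R_nonneg[OF u] bar_R_nonneg[OF A_bar[OF i i]] by simp
qed

text \<open>A step enters through its effect \<open>fR\<close> on radii and \<open>fl\<close> on
  norms alone, so the general activation and the cosine share this induction. The start is 0, hence
  the first error is the norm of \<open>us\<close>, controlled by \<open>sol_bound\<close>.\<close>

lemma iteration:
  assumes stp: "\<And>R l u. bar \<sigma> d R u l \<Longrightarrow> \<exists>v. bar \<sigma> d (fR R) v (fl R l) \<and>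
      (\<forall>x\<in>euclid d. v x - (\<Sum>i<d. partial i (partial i v) x) = rhs u x)"
    and fR: "\<And>R. R \<ge> 0 \<Longrightarrow> R \<le> fR R"
    and R0: "Rt 0 = 0" and RS: "\<And>t. Rt (Suc t) = fR (Rt t)"
    and l0: "lt 0 = 0" and lS: "\<And>t. lt (Suc t) = lt t + m / M\<^sup>2 * fl (Rt t) (lt t)"
  shows "\<exists>u. bar \<sigma> d (Rt t) u (lt t) \<and> u \<in> L2 d \<and> (\<forall>i<d. partial i u \<in> L2 d) \<and>
      H1_norm d (\<lambda>x. u x - us x) \<le> rho ^ t * (Hminus1_norm d f / m)"
proof (induction t)
  case 0
  have rep: "H1_rep d (\<lambda>x. 0 + (-1) * us x) (\<lambda>i x. 0 + (-1) * wpartial d i us x)"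
    by (rule H1_rep_lin[OF H1_rep_zero sol_rep])
  have "H1_norm d (\<lambda>x. 0 - us x) = H1_norm d us"
    using H1_norm_nsq[OF rep] H1_norm_nsq[OF sol_rep] by (simp add: nsq_def)
  then have "H1_norm d (\<lambda>x. 0 - us x) \<le> rho ^ 0 * (Hminus1_norm d f / m)" using sol_bound by simp
  moreover have "partial i (\<lambda>x. 0) = (\<lambda>x. 0)" for i
    by (rule ext, rule partial_DERIV) simp
  ultimately show ?case using bar_zero[OF n0, of 0 d] L2_zero
    by (intro exI[of _ "\<lambda>x. 0"]) (simp add: R0 l0)
next
  case (Suc t)
  then obtain u where u: "bar \<sigma> d (Rt t) u (lt t)" "u \<in> L2 d" "\<And>i. i < d \<Longrightarrow> partial i u \<in> L2 d"
    and err: "H1_norm d (\<lambda>x. u x - us x) \<le> rho ^ t * (Hminus1_norm d f / m)" by blast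
  obtain v where v: "bar \<sigma> d (fR (Rt t)) v (fl (Rt t) (lt t))"
    and eq: "\<And>x. x \<in> euclid d \<Longrightarrow> v x - (\<Sum>i<d. partial i (partial i v) x) = rhs u x"
    using stp[OF u(1)] by blast
  \<comment> \<open>All boundedness hypotheses of \<open>step_L2\<close> hold because derivatives
    and fluxes of Barron functions are Barron functions again.\<close>
  have s: "v \<in> L2 d" "\<And>i. i < d \<Longrightarrow> partial i v \<in> L2 d"
    "H1_norm d (\<lambda>x. (u x + (- (m / M\<^sup>2)) * v x) - us x) \<le> sqrt (1 - m\<^sup>2 / M\<^sup>2) * H1_norm d (\<lambda>x. u x - us x)"
    using step_L2[OF bar_smooth[OF u(1)] u(2,3) bar_smooth[OF v] bar_bddf[OF v] bar_bddf[OF bar_partial[OF v]]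
        bar_bddf[OF flux_bar[OF u(1)]] bar_bddf[OF bar_partial[OF bar_partial[OF v]]]
        bar_bddf[OF bar_partial[OF flux_bar[OF u(1)]]] eq[unfolded rhs_def]] by auto
  let ?u = "\<lambda>x. u x + (- (m / M\<^sup>2)) * v x"
  have a0: "0 \<le> m / M\<^sup>2" using m_pos by simp
  have "bar \<sigma> d (Rt (Suc t)) ?u (lt t + \<bar>- (m / M\<^sup>2)\<bar> * fl (Rt t) (lt t))"
    unfolding RS using bar_R_nonneg[OF u(1)]
    by (intro bar_add n0 bar_cmult[OF v n0] bar_mono[OF u(1)] fR) auto
  moreover have "\<bar>- (m / M\<^sup>2)\<bar> = m / M\<^sup>2" using a0 by linarith
  ultimately have "bar \<sigma> d (Rt (Suc t)) ?u (lt (Suc t))" by (simp only: lS)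
  moreover have "?u \<in> L2 d" by (intro L2_add L2_cmult u s)
  moreover have "partial i ?u \<in> L2 d" if i: "i < d" for i
  proof -
    have "(\<lambda>x. partial i u x + (- (m / M\<^sup>2)) * partial i v x) \<in> L2 d" by (intro L2_add L2_cmult u s i)
    moreover have e: "partial i ?u x = partial i u x + (- (m / M\<^sup>2)) * partial i v x" if "x \<in> euclid d" for x
      by (rule trans[OF partial_add[OF bar_smooth[OF u(1)] smooth_cmult[OF bar_smooth[OF v]] i that]
            arg_cong[where f = "\<lambda>y. partial i u x + y", OF partial_cmult[OF bar_smooth[OF v] i that]]])
    moreover have "partial i ?u \<in> borel_measurable (leb d)"
      by (intro smooth_measurable smooth_partial smooth_add smooth_cmult bar_smooth[OF u(1)] bar_smooth[OF v] i)
    moreover have "integrable (leb d) (\<lambda>x. (partial i ?u x)\<^sup>2) = integrable (leb d) (\<lambda>x. (partial i u x + (- (m / M\<^sup>2)) * partial i v x)\<^sup>2)"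
      by (intro Bochner_Integration.integrable_cong refl) (simp only: space_leb e)
    ultimately show ?thesis by (simp add: L2_def)
  qed
  moreover have "H1_norm d (\<lambda>x. ?u x - us x) \<le> rho ^ Suc t * (Hminus1_norm d f / m)"
  proof -
    have "m\<^sup>2 \<le> M\<^sup>2" using m_pos mM by (intro power_mono) auto
    then have "m\<^sup>2 / M\<^sup>2 \<le> 1" using m_pos mM by (simp add: divide_simps)
    then have r0: "0 \<le> rho" by (simp add: rho_def)
    have "H1_norm d (\<lambda>x. ?u x - us x) \<le> rho * H1_norm d (\<lambda>x. u x - us x)" using s(3) by (simp add: rho_def)
    also have "\<dots> \<le> rho * (rho ^ t * (Hminus1_norm d f / m))" by (rule mult_left_mono[OF err r0])
    finally show ?thesis by (simp add: mult.assoc)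
  qed
  ultimately show ?case by blast
qed

text \<open>\<open>bar_add\<close> needs a common radius, for which the radii of all terms are added
  up. The last summand \<open>R\<close> makes the radii increase, as \<open>iteration\<close>
  requires.\<close>

lemma general_step:
  assumes u: "bar \<sigma> d R u l" and d: "d \<ge> 1" and RA: "0 \<le> RA"
  shows "\<exists>v. bar \<sigma> d (\<kappa> * (Rc + R) + Rf + \<kappa>d * (\<kappa> * (RA + \<kappa>d * R)) + R) v
      (Lm * (Lc * l) + Lf + real d * (Ld * ((\<kappa> * (RA + \<kappa>d * R)) * (real d * (Lm * (LA * (Ld * (R * l)))))))) \<and>
      (\<forall>x\<in>euclid d. v x - (\<Sum>i<d. partial i (partial i v) x) = rhs u x)" (is "\<exists>v. bar \<sigma> d ?R v ?l \<and> _")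
proof -
  have nn: "0 \<le> R" "0 \<le> Rc" "0 \<le> Rf" using bar_R_nonneg u c_bar f_bar by blast+
  have nk: "0 \<le> \<kappa> * (Rc + R)" "0 \<le> \<kappa>d * (\<kappa> * (RA + \<kappa>d * R))"
    using nn k_nonneg kd_nonneg RA by simp_all
  have b1: "bar \<sigma> d ?R (\<lambda>x. c x * u x) (Lm * (Lc * l))"
    by (rule bar_mono[OF bar_mult[OF c_bar u]]) (use nn nk in auto)
  have b2: "bar \<sigma> d ?R (\<lambda>x. (-1) * f x) (\<bar>-1\<bar> * Lf)"
    by (rule bar_mono[OF bar_cmult[OF f_bar n0]]) (use nn nk in auto)
  have b3: "bar \<sigma> d ?R (\<lambda>x. \<Sum>i<d. partial i (flux (\<lambda>j. partial j u) i) x)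
      (real d * (Ld * ((\<kappa> * (RA + \<kappa>d * R)) * (real d * (Lm * (LA * (Ld * (R * l))))))))"
    by (rule bar_sum[OF _ n0], rule bar_mono[OF bar_partial[OF flux_bar[OF u]]]) (use nn nk in auto)
  have "bar \<sigma> d ?R (\<lambda>x. (c x * u x + (-1) * f x) + (-1) * (\<Sum>i<d. partial i (flux (\<lambda>j. partial j u) i) x))
      ((Lm * (Lc * l) + \<bar>-1\<bar> * Lf) + \<bar>-1\<bar> * (real d * (Ld * ((\<kappa> * (RA + \<kappa>d * R)) * (real d * (Lm * (LA * (Ld * (R * l)))))))))"
    by (intro bar_add bar_cmult b1 b2 b3 n0)
  then have "bar \<sigma> d ?R (rhs u) ?l" by (simp add: rhs_def[abs_def])
  then show ?thesis
    by (rule bar_resolvent) blast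
qed

end

section \<open>The cosine activation\<close>

lemma deriv_cos_shift: "deriv (\<lambda>x. cos (x + c)) = (\<lambda>x::real. cos (x + (c + pi / 2)))"
proof
  fix x
  have "((\<lambda>x. cos (x + c)) has_real_derivative - sin (x + c)) (at x)"
    by (auto intro!: derivative_eq_intros)
  then have "deriv (\<lambda>x. cos (x + c)) x = - sin (x + c)" by (rule DERIV_imp_deriv)
  also have "\<dots> = cos ((x + c) + pi / 2)" by (simp add: cos_add)
  finally show "deriv (\<lambda>x. cos (x + c)) x = cos (x + (c + pi / 2))" by (simp add: add.assoc)
qed

lemma smooth1_cos: "smooth1 cos"
proof (rule smooth1_coinduct[where S = "range (\<lambda>c x. cos (x + c))"])
  show "cos \<in> range (\<lambda>c x. cos (x + c :: real))" by (rule range_eqI[of _ _ 0]) simp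
  fix g assume "g \<in> range (\<lambda>c x. cos (x + c :: real))"
  then obtain c where g: "g = (\<lambda>x. cos (x + c))" by blast
  show "g differentiable (at x)" for x
  proof -
    have "(g has_real_derivative - sin (x + c)) (at x)" unfolding g by (auto intro!: derivative_eq_intros)
    then show ?thesis using real_differentiable_def by blast
  qed
  show "deriv g \<in> range (\<lambda>c x. cos (x + c :: real))" unfolding g deriv_cos_shift by blast
qed

lemma deriv_cos: "deriv cos = (\<lambda>x::real. - sin x)"
  by (rule ext, rule DERIV_imp_deriv) (auto intro!: derivative_eq_intros)

lemma deriv_neg_sin: "deriv (\<lambda>x::real. - sin x) = (\<lambda>x. - cos x)"
  by (rule ext, rule DERIV_imp_deriv) (auto intro!: derivative_eq_intros)

lemma nice_trig: "nice cos" "nice sin" "nice (\<lambda>x. - sin x)" "nice (\<lambda>x. - cos x)"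
  unfolding nice_def bounded_iff by (auto intro!: continuous_intros exI[of _ 1])

text \<open>\<open>cos s * cos t\<close> is the mean of \<open>cos (s + t)\<close> and
  \<open>cos (s - t)\<close>, and the derivative of the cosine is a shift by \<open>pi / 2\<close>;
  hence all four constants are 1.\<close>

lemma barron_act_cos: "barron_act cos 1 1 1 1"
proof
  show "smooth1 cos" "nice cos" "nice (deriv cos)" "nice (deriv (deriv cos))"
    using smooth1_cos nice_trig by (simp_all add: deriv_cos deriv_neg_sin)
  \<comment> \<open>The fair sign is stored in the first component of a triple, the carrier that
    \<open>barron_act\<close> prescribes.\<close>
  let ?q = "\<lambda>y::real \<times> vec \<times> real. if fst y = 1 then 1 else -1 :: real"
  let ?Q = "map_pmf (\<lambda>c. (if c then 1 else -1, \<lambda>_. 0, 0)) (bernoulli_pmf (1/2)) :: (real \<times> vec \<times> real) pmf"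
  have c: "cos s * cos t = (\<integral>y. 1 * cos (1 * s + ?q y * t + 0) \<partial>measure_pmf ?Q)" for s t :: real
    by (simp add: cos_add cos_diff field_simps)
  show "\<exists>(Q :: (real \<times> vec \<times> real) measure) a p q b. prob_space Q \<and> integrable Q a \<and>
        p \<in> borel_measurable Q \<and> q \<in> borel_measurable Q \<and> b \<in> borel_measurable Q \<and>
        (\<forall>y\<in>space Q. \<bar>p y\<bar> \<le> 1 \<and> \<bar>q y\<bar> \<le> 1) \<and> (\<integral>y. \<bar>a y\<bar> \<partial>Q) \<le> 1 \<and>
        (\<forall>(s::real) t. cos s * cos t = (\<integral>y. a y * cos (p y * s + q y * t + b y) \<partial>Q))"
    by (rule exI[where x = "measure_pmf ?Q"], rule exI[where x = "\<lambda>_::real \<times> vec \<times> real. 1 :: real"], rule exI[where x = "\<lambda>_::real \<times> vec \<times> real. 1 :: real"],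
        rule exI[where x = ?q], rule exI[where x = "\<lambda>_::real \<times> vec \<times> real. 0 :: real"], insert c,
        auto simp: prob_space_measure_pmf measure_pmf.prob_space)
  let ?D = "return_pmf (0, \<lambda>_. 0, 0) :: (real \<times> vec \<times> real) pmf"
  have d: "deriv cos s = (\<integral>y. 1 * cos (1 * s + pi / 2) \<partial>measure_pmf ?D)" for s :: real
    by (simp add: deriv_cos cos_add)
  show "\<exists>(Q :: (real \<times> vec \<times> real) measure) a p b. prob_space Q \<and> integrable Q a \<and>
        p \<in> borel_measurable Q \<and> b \<in> borel_measurable Q \<and>
        (\<forall>y\<in>space Q. \<bar>p y\<bar> \<le> 1) \<and> (\<integral>y. \<bar>a y\<bar> \<partial>Q) \<le> 1 \<and>
        (\<forall>s::real. deriv cos s = (\<integral>y. a y * cos (p y * s + b y) \<partial>Q))"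
    by (rule exI[where x = "measure_pmf ?D"], rule exI[where x = "\<lambda>_::real \<times> vec \<times> real. 1 :: real"], rule exI[where x = "\<lambda>_::real \<times> vec \<times> real. 1 :: real"],
        rule exI[where x = "\<lambda>_::real \<times> vec \<times> real. pi / 2 :: real"], insert d,
        auto simp: prob_space_measure_pmf measure_pmf.prob_space)
qed

text \<open>
  The factor \<open>W\<^sub>i / (1 + \<bar>W\<bar>\<^sup>2)\<close> from \<open>\<partial>\<^sub>i\<close> and the resolvent, \<open>W = w' \<plusminus> w\<close>, absorbs the factor \<open>w'\<^sub>j\<close>
  from \<open>\<partial>\<^sub>j\<close> because \<open>\<bar>w'\<bar> \<le> \<bar>W\<bar> + R1\<close>; hence \<open>R2\<close> does not enter the weight bound.
\<close>

lemma cos_div_resolvent: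
  assumes g1: "bar cos n R1 g1 l1" and g2: "bar cos n R2 g2 l2" and i: "i < n" and j: "j < n"
  shows "\<exists>v. bar cos n (R1 + R2) v ((1 + R1) * (l1 * l2)) \<and>
    (\<forall>x\<in>euclid n. v x - (\<Sum>k<n. partial k (partial k v) x) = partial i (\<lambda>x. g1 x * partial j g2 x) x)"
proof -
  have Dc: "(cos has_real_derivative - sin s) (at s)" "((\<lambda>s. - sin s) has_real_derivative - cos s) (at s)"
    "(sin has_real_derivative cos s) (at s)" for s :: real
    by (auto intro!: derivative_eq_intros)
  obtain M :: "(real \<times> vec \<times> real) measure" and a w b
    where p1: "params M n R1 a w b" and l1: "(\<integral>m. \<bar>a m\<bar> \<partial>M) \<le> l1" and gx: "\<And>x. x \<in> euclid n \<Longrightarrow> g1 x = ridge M n a w b cos x"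
    using barE[OF g1] by blast
  obtain N :: "(real \<times> vec \<times> real) measure" and a' w' b'
    where p2: "params N n R2 a' w' b'" and l2: "(\<integral>m. \<bar>a' m\<bar> \<partial>N) \<le> l2" and gx': "\<And>x. x \<in> euclid n \<Longrightarrow> g2 x = ridge N n a' w' b' cos x"
    using barE[OF g2] by blast
  have ps: "prob_space M" "prob_space N" and ai: "integrable M a" "integrable N a'"
    and bm[measurable]: "b \<in> borel_measurable M" "b' \<in> borel_measurable N"
    and wm: "\<And>i. i < n \<Longrightarrow> (\<lambda>m. w m i) \<in> borel_measurable M" "\<And>i. i < n \<Longrightarrow> (\<lambda>m. w' m i) \<in> borel_measurable N"
    and wb: "\<And>m. m \<in> space M \<Longrightarrow> vnorm n (w m) \<le> R1" "\<And>m. m \<in> space N \<Longrightarrow> vnorm n (w' m) \<le> R2"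
    using p1 p2 by (auto simp: params_def)
  have am[measurable]: "a \<in> borel_measurable M" "a' \<in> borel_measurable N" using ai by auto
  have R1: "R1 \<ge> 0" by (rule params_R_nonneg[OF p1])
  define B where "B = measure_pmf (bernoulli_pmf (1/2))"
  have Bp: "prob_space B" unfolding B_def by (rule prob_space_measure_pmf)
  have [measurable_cong]: "sets B = sets (count_space UNIV)" by (simp add: B_def)
  interpret Bi: prob_space B by (rule Bp)
  interpret NB: pair_prob_space N B by (rule pair_prob[OF ps(2) Bp])
  have NBp: "prob_space (N \<Otimes>\<^sub>M B)" by (rule prob_pair[OF ps(2) Bp])
  interpret P: pair_prob_space M "N \<Otimes>\<^sub>M B" by (rule pair_prob[OF ps(1) NBp])
  let ?P = "M \<Otimes>\<^sub>M (N \<Otimes>\<^sub>M B)"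
  define sg where "sg = (\<lambda>c::bool. if c then 1 else (-1::real))"
  have sg1: "\<bar>sg c\<bar> = 1" for c by (simp add: sg_def)
  have sgm[measurable]: "sg \<in> borel_measurable B" by (simp add: B_def)
  define a0 where "a0 = (\<lambda>z::(real \<times> vec \<times> real) \<times> (real \<times> vec \<times> real) \<times> bool. a (fst z) * a' (fst (snd z)))"
  \<comment> \<open>By the product-to-sum formula the wave of frequency \<open>w\<close> times the
    derivative of the wave of frequency \<open>w'\<close> is the mean of waves of the frequencies
    \<open>w' + w\<close> and \<open>w' - w\<close>; the sign is the coin.\<close>
  define W where "W = (\<lambda>(z::(real \<times> vec \<times> real) \<times> (real \<times> vec \<times> real) \<times> bool) k. w' (fst (snd z)) k + sg (snd (snd z)) * w (fst z) k)"
  define b0 where "b0 = (\<lambda>z::(real \<times> vec \<times> real) \<times> (real \<times> vec \<times> real) \<times> bool. b' (fst (snd z)) + sg (snd (snd z)) * b (fst z))"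
  have i1: "integrable (N \<Otimes>\<^sub>M B) (\<lambda>y. a' (fst y))" "(\<integral>y. \<bar>a' (fst y)\<bar> \<partial>(N \<Otimes>\<^sub>M B)) \<le> (\<integral>x. \<bar>a' x\<bar> \<partial>N) * (\<integral>y. \<bar>1\<bar> \<partial>B)"
    by (rule integrable_pair_bound[OF ps(2) Bp _ ai(2), where h = "\<lambda>_. 1"]; simp)+
  have i2: "integrable ?P a0" "(\<integral>z. \<bar>a0 z\<bar> \<partial>?P) \<le> (\<integral>x. \<bar>a x\<bar> \<partial>M) * (\<integral>y. \<bar>a' (fst y)\<bar> \<partial>(N \<Otimes>\<^sub>M B))"
    unfolding a0_def
    by (rule integrable_pair_bound[OF ps(1) NBp _ ai(1) i1(1)]; simp add: abs_mult)+
  have Wm[measurable]: "(\<lambda>z. W z k) \<in> borel_measurable ?P" if "k < n" for k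
  proof -
    note [measurable] = wm(1)[OF that] wm(2)[OF that]
    show ?thesis unfolding W_def by measurable
  qed
  have Wn: "vnorm n (W z) \<le> R1 + R2" "vnorm n (w' (fst (snd z))) \<le> vnorm n (W z) + R1" if z: "z \<in> space ?P" for z
  proof -
    have zz: "fst z \<in> space M" "fst (snd z) \<in> space N" using z by (auto simp: space_pair_measure)
    have "vnorm n (W z) \<le> vnorm n (w' (fst (snd z))) + vnorm n (\<lambda>k. sg (snd (snd z)) * w (fst z) k)"
      unfolding W_def by (rule vnorm_add)
    then show "vnorm n (W z) \<le> R1 + R2" using wb(1)[OF zz(1)] wb(2)[OF zz(2)] by (simp add: vnorm_cmult sg1)
    have "vnorm n (w' (fst (snd z))) = vnorm n (\<lambda>k. W z k + (- sg (snd (snd z))) * w (fst z) k)"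
      by (simp add: W_def)
    also have "\<dots> \<le> vnorm n (W z) + vnorm n (\<lambda>k. (- sg (snd (snd z))) * w (fst z) k)" by (rule vnorm_add)
    also have "\<dots> \<le> vnorm n (W z) + R1" using wb(1)[OF zz(1)] unfolding vnorm_cmult by (simp add: sg1)
    finally show "vnorm n (w' (fst (snd z))) \<le> vnorm n (W z) + R1" .
  qed
  have par: "params ?P n (R1 + R2) a0 W b0"
    unfolding params_def
  proof (intro conjI allI impI ballI)
    show "prob_space ?P" by (rule prob_pair[OF ps(1) NBp])
    show "integrable ?P a0" by (rule i2)
    show "b0 \<in> borel_measurable ?P" unfolding b0_def by measurable
  qed (use Wm Wn in auto)
  have w'm: "(\<lambda>z. - w' (fst (snd z)) j) \<in> borel_measurable ?P"
  proof -
    note [measurable] = wm(2)[OF j]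
    show ?thesis by measurable
  qed
  have w'b: "\<bar>- w' (fst (snd z)) j\<bar> \<le> R2" if "z \<in> space ?P" for z
    using that params_component_bound[OF p2 j, of "fst (snd z)"] by (auto simp: space_pair_measure)
  have parG: "params ?P n (R1 + R2) (\<lambda>z. a0 z * - w' (fst (snd z)) j) W b0"
    by (rule params_weight(1)[OF par w'm w'b])
  have parDG: "params ?P n (R1 + R2) (\<lambda>z. a0 z * - w' (fst (snd z)) j * W z i) W b0"
    by (rule params_weight(1)[OF parG Wm[OF i] params_component_bound[OF parG i]])
  \<comment> \<open>The factor \<open>- w' j\<close> comes from \<open>partial j\<close>, the factor
    \<open>W i\<close> from \<open>partial i\<close>, and the denominator is the symbol of
    \<open>1 - \<Delta>\<close> on a wave of frequency \<open>W\<close>.\<close>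
  define h where "h = (\<lambda>z. - w' (fst (snd z)) j * W z i / (1 + (vnorm n (W z))\<^sup>2))"
  have nm[measurable]: "(\<lambda>z. vnorm n (W z)) \<in> borel_measurable ?P"
    unfolding L2_set_def using Wm by (intro borel_measurable_sqrt[THEN measurable_compose[rotated]] borel_measurable_sum borel_measurable_power) auto
  have hm: "h \<in> borel_measurable ?P"
    unfolding h_def using w'm Wm[OF i] by measurable
  have hb: "\<bar>h z\<bar> \<le> 1 + R1" if z: "z \<in> space ?P" for z
  proof -
    define r where "r = vnorm n (W z)"
    have r0: "r \<ge> 0" by (simp add: r_def)
    have "\<bar>w' (fst (snd z)) j\<bar> \<le> vnorm n (w' (fst (snd z)))" by (rule abs_component_le_vnorm[OF j])
    also have "\<dots> \<le> r + R1" using Wn(2)[OF z] by (simp add: r_def)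
    finally have "\<bar>w' (fst (snd z)) j\<bar> * \<bar>W z i\<bar> \<le> (r + R1) * r"
      using abs_component_le_vnorm[OF i, of "W z"] R1 r0 by (intro mult_mono) (auto simp: r_def)
    also have "\<dots> = r\<^sup>2 + R1 * r" by (simp add: power2_eq_square algebra_simps)
    also have "\<dots> \<le> (1 + r\<^sup>2) + R1 * (1 + r\<^sup>2)"
    proof -
      have "r \<le> 1 + r\<^sup>2" using sum_squares_bound[of 1 r] r0 by simp
      then show ?thesis using R1 by (intro add_mono mult_left_mono) auto
    qed
    finally have "\<bar>w' (fst (snd z)) j\<bar> * \<bar>W z i\<bar> \<le> (1 + R1) * (1 + r\<^sup>2)" by (simp add: algebra_simps)
    moreover have "1 + r\<^sup>2 > 0" by (simp add: add_pos_nonneg)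
    ultimately show ?thesis by (simp add: h_def abs_mult divide_le_eq r_def)
  qed
  have parV: "params ?P n (R1 + R2) (\<lambda>z. a0 z * h z) W b0"
    by (rule params_weight(1)[OF par hm hb])
  have parV1: "params ?P n (R1 + R2) (\<lambda>z. a0 z * h z * W z k) W b0" if "k < n" for k
    by (rule params_weight(1)[OF parV Wm[OF that] params_component_bound[OF parV that]])
  have parV2: "params ?P n (R1 + R2) (\<lambda>z. a0 z * h z * W z k * W z k) W b0" if "k < n" for k
    by (rule params_weight(1)[OF parV1[OF that] Wm[OF that] params_component_bound[OF parV that]])
  define v where "v = ridge ?P n (\<lambda>z. a0 z * h z) W b0 cos"
  have lv: "(\<integral>z. \<bar>a0 z * h z\<bar> \<partial>?P) \<le> (1 + R1) * (l1 * l2)"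
  proof -
    have nn: "0 \<le> (\<integral>x. \<bar>a' x\<bar> \<partial>N)" "0 \<le> (\<integral>x. \<bar>a x\<bar> \<partial>M)"
      by (intro integral_nonneg_AE; simp)+
    have "(\<integral>z. \<bar>a0 z * h z\<bar> \<partial>?P) \<le> (1 + R1) * (\<integral>z. \<bar>a0 z\<bar> \<partial>?P)"
      by (rule params_weight(2)[OF par hm hb])
    also have "(\<integral>z. \<bar>a0 z\<bar> \<partial>?P) \<le> (\<integral>x. \<bar>a x\<bar> \<partial>M) * (\<integral>x. \<bar>a' x\<bar> \<partial>N)"
      using i2(2) mult_left_mono[OF i1(2) nn(2)] by (simp add: Bi.prob_space)
    also have "(\<integral>x. \<bar>a x\<bar> \<partial>M) * (\<integral>x. \<bar>a' x\<bar> \<partial>N) \<le> l1 * l2"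
      using l1 l2 nn bar_l_nonneg[OF g1] by (intro mult_mono) auto
    finally show ?thesis using R1 by (simp add: mult_left_mono)
  qed
  have vb: "bar cos n (R1 + R2) v ((1 + R1) * (l1 * l2))"
    by (rule barI[OF parV nice_trig(1) lv]) (simp add: v_def)
  have G: "g1 x * partial j g2 x = ridge ?P n (\<lambda>z. a0 z * - w' (fst (snd z)) j) W b0 sin x" if x: "x \<in> euclid n" for x
  proof -
    let ?u = "\<lambda>m. vdot n (w m) x + b m" and ?v = "\<lambda>k. vdot n (w' k) x + b' k"
    let ?F = "\<lambda>z. (a0 z * - w' (fst (snd z)) j) * sin (vdot n (W z) x + b0 z)"
    have Fi: "integrable ?P ?F" by (rule ridge_integrable[OF parG nice_trig(2)])
    have Fm: "?F (m, k, c) = - (a m * (a' k * w' k j * sin (?v k + sg c * ?u m)))" for m k c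
    proof -
      have "vdot n (W (m, k, c)) x + b0 (m, k, c) = ?v k + sg c * ?u m"
        unfolding W_def b0_def using vdot_lin[of n 1 "w' k" "sg c" "w m" x] by (simp add: algebra_simps)
      then show ?thesis by (simp add: a0_def)
    qed
    note [measurable] = params_vdot_measurable[OF p2] wm(2)[OF j]
    have p2': "params N n R2 (\<lambda>m. a' m * w' m j) w' b'"
      by (rule params_weight(1)[OF p2 wm(2)[OF j] params_component_bound[OF p2 j]])
    have aw: "integrable N (\<lambda>k. a' k * w' k j)" using p2' by (simp add: params_def)
    have Fsec: "integrable (N \<Otimes>\<^sub>M B) (\<lambda>y. ?F (m, y))" for m
    proof (rule integrable_pair_bound(1)[OF ps(2) Bp, where g = "\<lambda>k. a m * (a' k * w' k j)" and h = "\<lambda>_. 1"])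
      have Fm': "?F (m, y) = - (a m * (a' (fst y) * w' (fst y) j * sin (?v (fst y) + sg (snd y) * ?u m)))" for y
        using Fm[of m "fst y" "snd y"] by (simp only: prod.collapse)
      show "(\<lambda>y. ?F (m, y)) \<in> borel_measurable (N \<Otimes>\<^sub>M B)" unfolding Fm' by measurable
      show "\<bar>?F (m, (k, c))\<bar> \<le> \<bar>a m * (a' k * w' k j)\<bar> * \<bar>1\<bar>" for k c
        unfolding Fm by (simp add: abs_mult mult_left_le mult_left_mono)
    qed (use aw in auto)
    have "ridge ?P n (\<lambda>z. a0 z * - w' (fst (snd z)) j) W b0 sin x = (\<integral>m. (\<integral>y. ?F (m, y) \<partial>(N \<Otimes>\<^sub>M B)) \<partial>M)"
      unfolding ridge_def using P.integral_fst'[OF Fi] by simp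
    also have "\<dots> = (\<integral>m. (\<integral>k. (\<integral>c. ?F (m, k, c) \<partial>B) \<partial>N) \<partial>M)"
      by (intro Bochner_Integration.integral_cong refl NB.integral_fst'[OF Fsec, symmetric])
    also have "\<dots> = (\<integral>m. (\<integral>k. (a m * cos (?u m)) * ((a' k * w' k j) * - sin (?v k)) \<partial>N) \<partial>M)"
    proof (intro Bochner_Integration.integral_cong refl)
      fix m k
      have trig: "- (p * (r * sin (s + t))) * (1 / 2) + - (p * (r * sin (s - t))) * (1 / 2) = (p * cos t) * (r * - sin s)"
        for p r s t :: real
        by (simp add: sin_add sin_diff algebra_simps)
      have gen: "(\<integral>c. - (p * (r * sin (s + sg c * t))) \<partial>B) = - (p * (r * sin (s + t))) * (1 / 2) + - (p * (r * sin (s - t))) * (1 / 2)"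
        for p r s t :: real
        by (simp add: B_def sg_def field_simps)
      show "(\<integral>c. ?F (m, k, c) \<partial>B) = (a m * cos (?u m)) * ((a' k * w' k j) * - sin (?v k))"
        unfolding Fm gen trig ..
    qed
    also have "\<dots> = (\<integral>m. (a m * cos (?u m)) * (\<integral>k. (a' k * w' k j) * - sin (?v k) \<partial>N) \<partial>M)"
      unfolding integral_mult_right_zero ..
    also have "\<dots> = ridge M n a w b cos x * ridge N n (\<lambda>k. a' k * w' k j) w' b' (\<lambda>s. - sin s) x"
      unfolding ridge_def by simp
    also have "ridge N n (\<lambda>k. a' k * w' k j) w' b' (\<lambda>s. - sin s) x = partial j g2 x"
      by (rule trans[OF partial_ridge[OF p2 nice_trig(1,3) Dc(1) j, symmetric] partial_cong[OF x j gx', symmetric]])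
    finally show ?thesis using gx[OF x] by simp
  qed
  have ddv: "partial k (partial k v) x = ridge ?P n (\<lambda>z. a0 z * h z * W z k * W z k) W b0 (\<lambda>s. - cos s) x" if k: "k < n" for k x
  proof -
    have "partial k v = ridge ?P n (\<lambda>z. a0 z * h z * W z k) W b0 (\<lambda>s. - sin s)"
      unfolding v_def by (rule ext, rule partial_ridge[OF parV nice_trig(1,3) Dc(1) k])
    then show ?thesis using partial_ridge[OF parV1[OF k] nice_trig(3,4) Dc(2) k] by simp
  qed
  have "v x - (\<Sum>k<n. partial k (partial k v) x) = partial i (\<lambda>x. g1 x * partial j g2 x) x" if x: "x \<in> euclid n" for x
  proof -
    let ?c = "\<lambda>z. cos (vdot n (W z) x + b0 z)"
    have e: "(vnorm n (W z))\<^sup>2 = (\<Sum>k<n. W z k * W z k)" for z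
      by (simp add: L2_set_def sum_nonneg power2_eq_square)
    have j1: "integrable ?P (\<lambda>z. a0 z * h z * ?c z)" by (rule ridge_integrable[OF parV nice_trig(1)])
    have j2: "integrable ?P (\<lambda>z. a0 z * h z * W z k * W z k * - ?c z)" if "k < n" for k
      by (rule ridge_integrable[OF parV2[OF that] nice_trig(4)])
    have vA: "v x = (\<integral>z. a0 z * h z * ?c z \<partial>?P)" by (simp only: v_def ridge_def)
    have vB: "(\<Sum>k<n. partial k (partial k v) x) = (\<integral>z. (\<Sum>k<n. a0 z * h z * W z k * W z k * - ?c z) \<partial>?P)"
      using j2 by (subst Bochner_Integration.integral_sum) (auto simp: ddv ridge_def)
    have "v x - (\<Sum>k<n. partial k (partial k v) x) = (\<integral>z. a0 z * h z * ?c z - (\<Sum>k<n. a0 z * h z * W z k * W z k * - ?c z) \<partial>?P)"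
      unfolding vA vB
      by (intro Bochner_Integration.integral_diff[symmetric] j1 Bochner_Integration.integrable_sum j2) auto
    also have "\<dots> = (\<integral>z. (a0 z * - w' (fst (snd z)) j * W z i) * ?c z \<partial>?P)"
    proof (rule Bochner_Integration.integral_cong[OF refl])
      fix z
      have "1 + (vnorm n (W z))\<^sup>2 \<noteq> 0" using zero_le_power2[of "vnorm n (W z)"] by linarith
      then have "h z * (1 + (vnorm n (W z))\<^sup>2) = - w' (fst (snd z)) j * W z i" unfolding h_def by simp
      moreover have "a0 z * h z * ?c z - (\<Sum>k<n. a0 z * h z * W z k * W z k * - ?c z) = a0 z * (h z * (1 + (vnorm n (W z))\<^sup>2)) * ?c z"
        unfolding e by (simp add: sum_negf sum_distrib_left sum_distrib_right algebra_simps)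
      ultimately show "a0 z * h z * ?c z - (\<Sum>k<n. a0 z * h z * W z k * W z k * - ?c z) = (a0 z * - w' (fst (snd z)) j * W z i) * ?c z"
        by simp
    qed
    also have "\<dots> = ridge ?P n (\<lambda>z. a0 z * - w' (fst (snd z)) j * W z i) W b0 cos x" by (simp only: ridge_def)
    also have "\<dots> = partial i (ridge ?P n (\<lambda>z. a0 z * - w' (fst (snd z)) j) W b0 sin) x"
      by (rule partial_ridge[OF parG nice_trig(2,1) Dc(3) i, symmetric])
    also have "\<dots> = partial i (\<lambda>x. g1 x * partial j g2 x) x"
      by (rule partial_cong[OF x i G, symmetric])
    finally show ?thesis .
  qed
  then show ?thesis using vb by blast
qed

text \<open>A relation instead of an operator: solutions are found term by term and superposed, and
  uniqueness is never at issue.\<close>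

definition reslv :: "nat \<Rightarrow> (vec \<Rightarrow> real) \<Rightarrow> (vec \<Rightarrow> real) \<Rightarrow> bool" where
  "reslv d g v \<longleftrightarrow> smooth d v \<and> (\<forall>x\<in>euclid d. v x - (\<Sum>k<d. partial k (partial k v) x) = g x)"

lemma reslv_add:
  assumes "reslv d g v" "reslv d g' v'" shows "reslv d (\<lambda>x. g x + r * g' x) (\<lambda>x. v x + r * v' x)"
proof -
  have s: "smooth d v" "smooth d v'" using assms by (auto simp: reslv_def)
  have "partial k (partial k (\<lambda>x. v x + r * v' x)) x = partial k (partial k v) x + r * partial k (partial k v') x"
    if k: "k < d" and x: "x \<in> euclid d" for k x
  proof -
    have "partial k (\<lambda>x. v x + r * v' x) y = partial k v y + r * partial k v' y" if "y \<in> euclid d" for y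
      using partial_add[OF s(1) smooth_cmult[OF s(2)] k that] partial_cmult[OF s(2) k that] by simp
    note partial_cong[OF x k this]
    also have "partial k (\<lambda>y. partial k v y + r * partial k v' y) x = partial k (partial k v) x + r * partial k (partial k v') x"
      using partial_add[OF smooth_partial[OF s(1) k] smooth_cmult[OF smooth_partial[OF s(2) k]] k x]
        partial_cmult[OF smooth_partial[OF s(2) k] k x] by simp
    finally show ?thesis .
  qed
  moreover have "smooth d (\<lambda>x. v x + r * v' x)" by (intro smooth_add smooth_cmult s)
  ultimately show ?thesis using assms
    by (simp add: reslv_def sum.distrib sum_distrib_left[symmetric]) (simp add: algebra_simps flip: right_diff_distrib)
qed

lemma reslv_zero: "reslv d (\<lambda>x. 0) (\<lambda>x. 0)"
proof -
  have "partial i (\<lambda>x. 0) = (\<lambda>x. 0)" for i by (rule ext, rule partial_DERIV) simp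
  then show ?thesis by (simp add: reslv_def smooth_const)
qed

lemma reslv_sum:
  assumes "\<And>i. i < (k::nat) \<Longrightarrow> reslv d (g i) (v i)"
  shows "reslv d (\<lambda>x. \<Sum>i<k. g i x) (\<lambda>x. \<Sum>i<k. v i x)"
  using assms
proof (induction k)
  case (Suc k)
  then have "reslv d (\<lambda>x. (\<Sum>i<k. g i x) + 1 * g k x) (\<lambda>x. (\<Sum>i<k. v i x) + 1 * v k x)"
    by (intro reslv_add) auto
  then show ?case by simp
qed (simp add: reslv_zero)

text \<open>The divergence of the flux is resolved one pair \<open>i\<close>, \<open>j\<close> at a
  time by \<open>cos_div_resolvent\<close>, which costs \<open>d^2\<close> but no factor
  \<open>R\<close> in the norm; the terms without derivatives go through
  \<open>bar_resolvent\<close>. The radius grows by a fixed amount.\<close>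

lemma cos_step:
  assumes "barron_elliptic cos 1 1 1 1 d A c f us amin amax cmin cmax RA Rc Rf LA Lc Lf"
    and u: "bar cos d R u l" and nn: "0 \<le> RA" "0 \<le> LA"
  shows "\<exists>v. bar cos d (R + (RA + Rc + Rf)) v (Lc * l + Lf + real d * (real d * ((1 + RA) * (LA * l)))) \<and>
      (\<forall>x\<in>euclid d. v x - (\<Sum>i<d. partial i (partial i v) x) = barron_elliptic.rhs d A c f u x)"
proof -
  interpret barron_elliptic cos 1 1 1 1 d A c f us amin amax cmin cmax RA Rc Rf LA Lc Lf by (rule assms(1))
  have nr: "0 \<le> R" "0 \<le> Rc" "0 \<le> Rf" using bar_R_nonneg u c_bar f_bar by blast+
  let ?R = "R + (RA + Rc + Rf)"
  have "bar cos d ?R (\<lambda>x. c x * u x) (1 * (Lc * l))"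
    by (rule bar_mono[OF bar_mult[OF c_bar u]]) (use nr nn in auto)
  moreover have "bar cos d ?R (\<lambda>x. (-1) * f x) (\<bar>-1\<bar> * Lf)"
    by (rule bar_mono[OF bar_cmult[OF f_bar n0]]) (use nr nn in auto)
  ultimately have "bar cos d ?R (\<lambda>x. c x * u x + (-1) * f x) (1 * (Lc * l) + \<bar>-1\<bar> * Lf)"
    by (rule bar_add[OF _ _ n0])
  then obtain v0 where v0: "bar cos d ?R v0 (1 * (Lc * l) + \<bar>-1\<bar> * Lf)"
    and r0: "\<And>x. x \<in> euclid d \<Longrightarrow> v0 x - (\<Sum>i<d. partial i (partial i v0) x) = c x * u x + (-1) * f x"
    by (rule bar_resolvent) (rule that, blast+)
  let ?P = "\<lambda>i j v. bar cos d (RA + R) v ((1 + RA) * (LA * l)) \<and>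
      (\<forall>x\<in>euclid d. v x - (\<Sum>k<d. partial k (partial k v) x) = partial i (\<lambda>x. A x i j * partial j u x) x)"
  have ex: "\<exists>v. bar cos d (RA + R) v ((1 + RA) * (LA * l)) \<and>
      (\<forall>x\<in>euclid d. v x - (\<Sum>k<d. partial k (partial k v) x) = partial i (\<lambda>x. A x i j * partial j u x) x)"
    if "i < d" "j < d" for i j
    by (rule cos_div_resolvent[OF A_bar[OF that] u that])
  define V where "V = (\<lambda>i j. SOME v. ?P i j v)"
  have PV: "?P i j (V i j)" if "i < d" "j < d" for i j
    unfolding V_def by (rule someI_ex[OF ex[OF that]])
  then have V: "\<And>i j. i < d \<Longrightarrow> j < d \<Longrightarrow> bar cos d (RA + R) (V i j) ((1 + RA) * (LA * l))"
    "\<And>i j x. i < d \<Longrightarrow> j < d \<Longrightarrow> x \<in> euclid d \<Longrightarrow>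
       V i j x - (\<Sum>k<d. partial k (partial k (V i j)) x) = partial i (\<lambda>x. A x i j * partial j u x) x"
    by blast+
  have r0': "reslv d (\<lambda>x. c x * u x + (-1) * f x) v0"
    unfolding reslv_def using r0 bar_smooth[OF v0] by blast
  have rV: "reslv d (\<lambda>x. partial i (\<lambda>x. A x i j * partial j u x) x) (V i j)" if "i < d" "j < d" for i j
    unfolding reslv_def using bar_smooth[OF V(1)[OF that]] V(2)[OF that] by blast
  let ?S = "\<lambda>x. \<Sum>i<d. \<Sum>j<d. V i j x"
  let ?v = "\<lambda>x. v0 x + (-1) * ?S x"
  have "bar cos d ?R ?S (real d * (real d * ((1 + RA) * (LA * l))))"
    by (intro bar_sum n0 bar_mono[OF V(1)]) (use nr nn in auto)
  then have "bar cos d ?R ?v ((1 * (Lc * l) + \<bar>-1\<bar> * Lf) + \<bar>-1\<bar> * (real d * (real d * ((1 + RA) * (LA * l)))))"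
    by (intro bar_add v0 bar_cmult n0)
  moreover have "reslv d (\<lambda>x. (c x * u x + (-1) * f x) + (-1) * (\<Sum>i<d. \<Sum>j<d. partial i (\<lambda>x. A x i j * partial j u x) x)) ?v"
    by (rule reslv_add[OF r0'], rule reslv_sum, rule reslv_sum, rule rV)
  moreover have "(\<Sum>j<d. partial i (\<lambda>x. A x i j * partial j u x) x) = partial i (flux (\<lambda>j. partial j u) i) x" if "i < d" "x \<in> euclid d" for i x
  proof -
    have "smooth d (\<lambda>x. A x i j * partial j u x)" if "j \<in> {..<d}" for j
      using that \<open>i < d\<close> by (intro smooth_mult[OF A_smooth smooth_partial[OF bar_smooth[OF u]]]) auto
    then show ?thesis unfolding flux_def[abs_def] by (rule partial_sum[symmetric, OF _ that])
  qed
  ultimately show ?thesis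
    by (intro exI[of _ ?v]) (simp add: reslv_def rhs_def)
qed

section \<open>A Plancherel inequality on the line\<close>

text \<open>The uniform distribution on \<open>[-S, S]\<close>. A Lebesgue integral over frequencies
  in this interval becomes \<open>2 * S\<close> times an expectation, as ridge representations and
  Fubini's theorem for probability spaces want it.\<close>

definition unif :: "real \<Rightarrow> real measure" where
  "unif S = density lborel (\<lambda>x. ennreal (indicator {-S..S} x / (2 * S)))"

lemma sets_unif [measurable_cong]: "sets (unif S) = sets borel"
  by (simp add: unif_def)

lemma space_unif [simp]: "space (unif S) = UNIV"
  by (simp add: unif_def)

lemma prob_unif: "S > 0 \<Longrightarrow> prob_space (unif S)"
proof
  assume S: "S > 0"
  have "emeasure (unif S) (space (unif S)) = (\<integral>\<^sup>+x. ennreal (indicator {-S..S} x / (2 * S)) \<partial>lborel)"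
    by (simp add: unif_def emeasure_density)
  also have "\<dots> = (\<integral>\<^sup>+x. ennreal (1 / (2 * S)) * indicator {-S..S} x \<partial>lborel)"
    by (intro nn_integral_cong) (auto simp: indicator_def)
  also have "\<dots> = ennreal (1 / (2 * S)) * ennreal (2 * S)"
    using S by (subst nn_integral_cmult_indicator) auto
  also have "\<dots> = 1" using S by (simp flip: ennreal_mult)
  finally show "emeasure (unif S) (space (unif S)) = 1" .
qed

lemma unif_integral:
  fixes f :: "real \<Rightarrow> real"
  assumes S: "S > 0" and [measurable]: "f \<in> borel_measurable borel" and z: "\<And>\<xi>. \<bar>\<xi>\<bar> > S \<Longrightarrow> f \<xi> = 0"
  shows "(\<integral>\<xi>. f \<xi> \<partial>lborel) = 2 * S * (\<integral>\<xi>. f \<xi> \<partial>unif S)"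
proof -
  have "(\<integral>\<xi>. f \<xi> \<partial>unif S) = (\<integral>\<xi>. (indicator {-S..S} \<xi> / (2 * S)) * f \<xi> \<partial>lborel)"
    unfolding unif_def using S by (subst integral_density) auto
  also have "\<dots> = (\<integral>\<xi>. (1 / (2 * S)) * f \<xi> \<partial>lborel)"
  proof (intro Bochner_Integration.integral_cong refl)
    fix \<xi>
    show "indicator {-S..S} \<xi> / (2 * S) * f \<xi> = (1 / (2 * S)) * f \<xi>"
      using z[of \<xi>] by (cases "\<bar>\<xi>\<bar> > S") (auto simp: indicator_def abs_le_iff minus_le_iff)
  qed
  finally show ?thesis using S by simp
qed

lemma prob_normal: "prob_space std_normal_distribution"
  by (rule prob_space_normal_density) simp

lemma prob_normal_UNIV [simp]: "measure std_normal_distribution UNIV = 1"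
  using prob_space.prob_space[OF prob_normal] by simp

lemma normal_cos_sin:
  "(\<integral>y. cos (t * y) \<partial>std_normal_distribution) = exp (- t\<^sup>2 / 2)"
  "(\<integral>y. sin (t * y) \<partial>std_normal_distribution) = 0"
proof -
  interpret prob_space std_normal_distribution by (rule prob_normal)
  have "integrable std_normal_distribution (\<lambda>y. iexp (t * y))"
    by (rule integrable_const_bound[where B = 1]) auto
  then have "(\<integral>y. Re (iexp (t * y)) \<partial>std_normal_distribution) = Re (char std_normal_distribution t)"
    "(\<integral>y. Im (iexp (t * y)) \<partial>std_normal_distribution) = Im (char std_normal_distribution t)"
    unfolding char_def by (simp_all add: mult.commute)
  then show "(\<integral>y. cos (t * y) \<partial>std_normal_distribution) = exp (- t\<^sup>2 / 2)"
    "(\<integral>y. sin (t * y) \<partial>std_normal_distribution) = 0"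
    unfolding char_std_normal_distribution by (simp_all add: Re_exp Im_exp)
qed

lemma gauss_shift_integral:
  fixes f :: "real \<Rightarrow> real"
  assumes s: "s > 0" and [measurable]: "f \<in> borel_measurable borel"
  shows "(\<integral>\<eta>. f \<eta> * exp (- ((\<xi> - \<eta>) / s)\<^sup>2 / 2) \<partial>lborel)
    = s * sqrt (2 * pi) * (\<integral>z. f (\<xi> + s * z) \<partial>std_normal_distribution)"
proof -
  have "(\<integral>\<eta>. f \<eta> * exp (- ((\<xi> - \<eta>) / s)\<^sup>2 / 2) \<partial>lborel)
      = \<bar>s\<bar> *\<^sub>R (\<integral>z. f (\<xi> + s * z) * exp (- ((\<xi> - (\<xi> + s * z)) / s)\<^sup>2 / 2) \<partial>lborel)"
    using s by (intro lborel_integral_real_affine) simp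
  also have "(\<lambda>z. f (\<xi> + s * z) * exp (- ((\<xi> - (\<xi> + s * z)) / s)\<^sup>2 / 2))
      = (\<lambda>z. sqrt (2 * pi) * (std_normal_density z * f (\<xi> + s * z)))"
    using s by (auto simp: std_normal_density_def fun_eq_iff)
  also have "(\<integral>z. sqrt (2 * pi) * (std_normal_density z * f (\<xi> + s * z)) \<partial>lborel)
      = sqrt (2 * pi) * (\<integral>z. f (\<xi> + s * z) \<partial>std_normal_distribution)"
    by (subst integral_density) auto
  finally show ?thesis using s by simp
qed

lemma reflect_integral: "(\<integral>\<eta>. (f :: real \<Rightarrow> real) (- \<eta>) \<partial>lborel) = (\<integral>\<eta>. f \<eta> \<partial>lborel)"
  using lborel_integral_real_affine[of "-1" f 0] by simp

text \<open>\<open>p + i q\<close> is Hermitian, so its Fourier integral against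
  \<open>exp (i \<xi> x)\<close> is real: the imaginary part vanishes by parity and the real part is
  \<open>V\<close>.\<close>

locale hermitian =
  fixes p q :: "real \<Rightarrow> real" and S C :: real
  assumes S: "S > 0" and pc: "continuous_on UNIV p" and qc: "continuous_on UNIV q"
    and p0: "\<And>\<xi>. \<bar>\<xi>\<bar> > S \<Longrightarrow> p \<xi> = 0" and q0: "\<And>\<xi>. \<bar>\<xi>\<bar> > S \<Longrightarrow> q \<xi> = 0"
    and pe: "\<And>\<xi>. p (- \<xi>) = p \<xi>" and qo: "\<And>\<xi>. q (- \<xi>) = - q \<xi>"
    and pC: "\<And>\<xi>. \<bar>p \<xi>\<bar> \<le> C" and qC: "\<And>\<xi>. \<bar>q \<xi>\<bar> \<le> C"
begin

definition V :: "real \<Rightarrow> real" where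
  "V x = 2 * S * (\<integral>\<xi>. p \<xi> * cos (\<xi> * x) - q \<xi> * sin (\<xi> * x) \<partial>unif S)"

lemma C0: "C \<ge> 0" using pC[of 0] by linarith

lemma pm [measurable]: "p \<in> borel_measurable borel" and qm [measurable]: "q \<in> borel_measurable borel"
  using pc qc by (auto intro: borel_measurable_continuous_onI)

lemma trig_bound: "\<bar>p \<xi> * cos t - q \<xi> * sin t\<bar> \<le> 2 * C"
proof -
  have "\<bar>p \<xi> * cos t\<bar> \<le> C * 1" unfolding abs_mult by (intro mult_mono pC) (use C0 in auto)
  moreover have "\<bar>q \<xi> * sin t\<bar> \<le> C * 1" unfolding abs_mult by (intro mult_mono qC) (use C0 in auto)
  ultimately show ?thesis by linarith
qed

text \<open>A Gaussian weight of width \<open>1 / s\<close> on the line turns into a Gaussian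
  average of width \<open>s\<close> over shifts of the frequency. The weight makes the measure on
  the line finite, so the integrations may be exchanged for bounded integrands although the square
  of \<open>V\<close> need not be integrable yet.\<close>

lemma gauss_average:
  assumes s: "s > 0"
  shows "(\<integral>y. (V (y / s))\<^sup>2 \<partial>std_normal_distribution)
    = s * sqrt (2 * pi) * (2 * S * (\<integral>\<xi>. (\<integral>z. p \<xi> * p (\<xi> + s * z) + q \<xi> * q (\<xi> + s * z) \<partial>std_normal_distribution) \<partial>unif S))"
proof -
  let ?N = std_normal_distribution and ?U = "unif S"
  interpret N: prob_space ?N by (rule prob_normal)
  interpret U: prob_space ?U by (rule prob_unif[OF S])
  interpret UU: pair_prob_space ?U ?U by (rule pair_prob[OF prob_unif[OF S] prob_unif[OF S]])
  have UUp: "prob_space (?U \<Otimes>\<^sub>M ?U)" by (rule prob_pair[OF prob_unif[OF S] prob_unif[OF S]])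
  interpret NUU: pair_prob_space ?N "?U \<Otimes>\<^sub>M ?U" by (rule pair_prob[OF prob_normal UUp])
  define e where "e = (\<lambda>y \<xi>. p \<xi> * cos (\<xi> * (y / s)) - q \<xi> * sin (\<xi> * (y / s)))"
  have eb: "\<bar>e y \<xi>\<bar> \<le> 2 * C" for y \<xi> unfolding e_def by (rule trig_bound)
  have em[measurable]: "(\<lambda>\<xi>. e y \<xi>) \<in> borel_measurable borel" for y unfolding e_def by measurable
  have em2[measurable]: "(\<lambda>z. e (fst z) (fst (snd z))) \<in> borel_measurable (?N \<Otimes>\<^sub>M (?U \<Otimes>\<^sub>M ?U))"
    "(\<lambda>z. e (fst z) (snd (snd z))) \<in> borel_measurable (?N \<Otimes>\<^sub>M (?U \<Otimes>\<^sub>M ?U))"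
    unfolding e_def by measurable
  \<comment> \<open>The Gaussian average of \<open>e y \<xi> * e y \<eta>\<close>: cosines become
    Gaussians in the sum and the difference of the frequencies, sines average to 0.\<close>
  define H where "H = (\<lambda>\<xi> \<eta>. ((p \<xi> * p \<eta> + q \<xi> * q \<eta>) * exp (- ((\<xi> - \<eta>) / s)\<^sup>2 / 2)
      + (p \<xi> * p \<eta> - q \<xi> * q \<eta>) * exp (- ((\<xi> + \<eta>) / s)\<^sup>2 / 2)) / 2)"
  have b4: "\<bar>e y \<xi> * e y \<eta>\<bar> \<le> 2 * C * (2 * C)" for y \<xi> \<eta>
    unfolding abs_mult using C0 by (intro mult_mono eb) auto
  have int3: "integrable (?N \<Otimes>\<^sub>M (?U \<Otimes>\<^sub>M ?U)) (\<lambda>(y, z). e y (fst z) * e y (snd z))"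
    by (rule NUU.P.integrable_const_bound[where B = "2 * C * (2 * C)"])
       (use b4 in \<open>auto simp: case_prod_unfold\<close>)
  have Ve: "(V (y / s))\<^sup>2 = (2 * S)\<^sup>2 * (\<integral>z. e y (fst z) * e y (snd z) \<partial>(?U \<Otimes>\<^sub>M ?U))" for y
  proof -
    have i: "integrable (?U \<Otimes>\<^sub>M ?U) (\<lambda>z. e y (fst z) * e y (snd z))"
      by (rule UU.P.integrable_const_bound[where B = "2 * C * (2 * C)"]) (use b4 in auto)
    have "(\<integral>z. e y (fst z) * e y (snd z) \<partial>(?U \<Otimes>\<^sub>M ?U)) = (\<integral>\<xi>. (\<integral>\<eta>. e y \<xi> * e y \<eta> \<partial>?U) \<partial>?U)"
      using UU.integral_fst'[OF i] by simp
    also have "\<dots> = (\<integral>\<xi>. e y \<xi> \<partial>?U) * (\<integral>\<eta>. e y \<eta> \<partial>?U)" by simp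
    finally show ?thesis unfolding V_def e_def by (simp add: power2_eq_square)
  qed
  have NH: "(\<integral>y. e y \<xi> * e y \<eta> \<partial>?N) = H \<xi> \<eta>" for \<xi> \<eta>
  proof -
    have ic: "integrable ?N (\<lambda>y. cos (t * y))" "integrable ?N (\<lambda>y. sin (t * y))" for t
      by (rule N.integrable_const_bound[where B = 1]; simp)+
    have g: "(\<integral>y. k1 * cos (t * y) + k2 * cos (r * y) - k3 * sin (r * y) + k4 * sin (t * y) \<partial>?N)
        = k1 * exp (- t\<^sup>2 / 2) + k2 * exp (- r\<^sup>2 / 2)" for k1 k2 k3 k4 t r
      using ic by (simp add: normal_cos_sin)
    have "e y \<xi> * e y \<eta> = (p \<xi> * p \<eta> + q \<xi> * q \<eta>) / 2 * cos ((\<xi> - \<eta>) / s * y) + (p \<xi> * p \<eta> - q \<xi> * q \<eta>) / 2 * cos ((\<xi> + \<eta>) / s * y)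
       - (p \<xi> * q \<eta> + q \<xi> * p \<eta>) / 2 * sin ((\<xi> + \<eta>) / s * y) + (p \<xi> * q \<eta> - q \<xi> * p \<eta>) / 2 * sin ((\<xi> - \<eta>) / s * y)" for y
    proof -
      let ?A = "\<xi> * (y / s)" and ?B = "\<eta> * (y / s)"
      have a: "(\<xi> - \<eta>) / s * y = ?A - ?B" "(\<xi> + \<eta>) / s * y = ?A + ?B" by (simp_all add: algebra_simps add_divide_distrib diff_divide_distrib)
      show ?thesis unfolding a e_def cos_add cos_diff sin_add sin_diff by (simp add: field_simps)
    qed
    then have "(\<integral>y. e y \<xi> * e y \<eta> \<partial>?N) = (p \<xi> * p \<eta> + q \<xi> * q \<eta>) / 2 * exp (- ((\<xi> - \<eta>) / s)\<^sup>2 / 2) + (p \<xi> * p \<eta> - q \<xi> * q \<eta>) / 2 * exp (- ((\<xi> + \<eta>) / s)\<^sup>2 / 2)"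
      by (simp only: g)
    then show ?thesis by (simp add: H_def add_divide_distrib)
  qed
  have Hm: "(\<lambda>z. H (fst z) (snd z)) \<in> borel_measurable (?U \<Otimes>\<^sub>M ?U)" unfolding H_def by measurable
  have Hm1[measurable]: "(\<lambda>\<eta>. H \<xi> \<eta>) \<in> borel_measurable borel" for \<xi> unfolding H_def by measurable
  have Hb: "\<bar>H \<xi> \<eta>\<bar> \<le> 2 * C * (2 * C)" for \<xi> \<eta>
  proof -
    have "\<bar>\<integral>y. e y \<xi> * e y \<eta> \<partial>?N\<bar> \<le> (\<integral>y. \<bar>e y \<xi> * e y \<eta>\<bar> \<partial>?N)" by (rule integral_abs_bound)
    also have "\<dots> \<le> (\<integral>y. 2 * C * (2 * C) \<partial>?N)"
    proof (rule integral_mono)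
      have m: "(\<lambda>y. \<bar>e y \<xi> * e y \<eta>\<bar>) \<in> borel_measurable ?N" unfolding e_def by measurable
      show "integrable ?N (\<lambda>y. \<bar>e y \<xi> * e y \<eta>\<bar>)"
        by (rule N.integrable_const_bound[where B = "2 * C * (2 * C)", OF _ m]) (use b4 in auto)
    qed (use b4 in auto)
    finally show ?thesis unfolding NH by (simp add: N.prob_space)
  qed
  have Hi: "integrable (?U \<Otimes>\<^sub>M ?U) (\<lambda>z. H (fst z) (snd z))"
    by (rule UU.P.integrable_const_bound[where B = "2 * C * (2 * C)", OF _ Hm]) (use Hb in auto)
  have inner: "2 * S * (\<integral>\<eta>. H \<xi> \<eta> \<partial>?U) = s * sqrt (2 * pi) * (\<integral>z. p \<xi> * p (\<xi> + s * z) + q \<xi> * q (\<xi> + s * z) \<partial>?N)" for \<xi>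
  proof -
    \<comment> \<open>By the parity of \<open>p\<close> and \<open>q\<close> the function
      \<open>H\<close> is the even part of \<open>?g\<close> in \<open>\<eta>\<close>, so the two
      have the same integral.\<close>
    let ?g = "\<lambda>\<eta>. (p \<xi> * p \<eta> + q \<xi> * q \<eta>) * exp (- ((\<xi> - \<eta>) / s)\<^sup>2 / 2)"
    have gi: "integrable lborel ?g"
    proof (rule Bochner_Integration.integrable_bound)
      show "integrable lborel (\<lambda>\<eta>. (C * C + C * C) * indicator {-S..S} \<eta>)"
        by (intro integrable_mult_right integrable_real_indicator) (auto simp: emeasure_lborel_Icc_eq)
      show "AE \<eta> in lborel. norm (?g \<eta>) \<le> norm ((C * C + C * C) * indicator {-S..S} \<eta>)"
      proof (rule AE_I2)
        fix \<eta>
        show "norm (?g \<eta>) \<le> norm ((C * C + C * C) * indicator {-S..S} \<eta>)"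
        proof (cases "\<bar>\<eta>\<bar> > S")
          case True then show ?thesis using p0 q0 by simp
        next
          case False
          then have m: "\<eta> \<in> {-S..S}" by (auto simp: abs_le_iff)
          have "\<bar>p \<xi> * p \<eta>\<bar> \<le> C * C" "\<bar>q \<xi> * q \<eta>\<bar> \<le> C * C"
            unfolding abs_mult using C0 by (intro mult_mono pC qC; simp)+
          then have "\<bar>p \<xi> * p \<eta> + q \<xi> * q \<eta>\<bar> \<le> C * C + C * C" by linarith
          then have "\<bar>p \<xi> * p \<eta> + q \<xi> * q \<eta>\<bar> * exp (- ((\<xi> - \<eta>) / s)\<^sup>2 / 2) \<le> (C * C + C * C) * 1"
            by (intro mult_mono) auto
          then show ?thesis using m C0 by (simp add: abs_mult)
        qed
      qed
    qed measurable
    have gi': "integrable lborel (\<lambda>\<eta>. ?g (- \<eta>))"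
      using gi lborel_integrable_real_affine_iff[of "-1" ?g 0] by simp
    have "2 * S * (\<integral>\<eta>. H \<xi> \<eta> \<partial>?U) = (\<integral>\<eta>. H \<xi> \<eta> \<partial>lborel)"
      by (rule unif_integral[symmetric, OF S Hm1]) (simp add: H_def p0 q0)
    also have "\<dots> = (\<integral>\<eta>. (?g \<eta> + ?g (- \<eta>)) / 2 \<partial>lborel)"
      by (intro Bochner_Integration.integral_cong refl) (simp add: H_def pe qo)
    also have "\<dots> = ((\<integral>\<eta>. ?g \<eta> \<partial>lborel) + (\<integral>\<eta>. ?g (- \<eta>) \<partial>lborel)) / 2"
      using gi gi' by simp
    also have "(\<integral>\<eta>. ?g (- \<eta>) \<partial>lborel) = (\<integral>\<eta>. ?g \<eta> \<partial>lborel)" by (rule reflect_integral)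
    finally have "2 * S * (\<integral>\<eta>. H \<xi> \<eta> \<partial>?U) = (\<integral>\<eta>. ?g \<eta> \<partial>lborel)" by simp
    then show ?thesis by (subst (asm) gauss_shift_integral[OF s]) simp_all
  qed
  have "(\<integral>y. (V (y / s))\<^sup>2 \<partial>?N) = (2 * S)\<^sup>2 * (\<integral>y. (\<integral>z. e y (fst z) * e y (snd z) \<partial>(?U \<Otimes>\<^sub>M ?U)) \<partial>?N)"
    unfolding Ve by simp
  also have "(\<integral>y. (\<integral>z. e y (fst z) * e y (snd z) \<partial>(?U \<Otimes>\<^sub>M ?U)) \<partial>?N) = (\<integral>z. (\<integral>y. e y (fst z) * e y (snd z) \<partial>?N) \<partial>(?U \<Otimes>\<^sub>M ?U))"
    by (rule NUU.Fubini_integral[OF int3, symmetric])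
  also have "\<dots> = (\<integral>z. H (fst z) (snd z) \<partial>(?U \<Otimes>\<^sub>M ?U))" unfolding NH ..
  also have "\<dots> = (\<integral>\<xi>. (\<integral>\<eta>. H \<xi> \<eta> \<partial>?U) \<partial>?U)" using UU.integral_fst'[OF Hi] by simp
  also have "(2 * S)\<^sup>2 * (\<integral>\<xi>. (\<integral>\<eta>. H \<xi> \<eta> \<partial>?U) \<partial>?U) = 2 * S * (\<integral>\<xi>. 2 * S * (\<integral>\<eta>. H \<xi> \<eta> \<partial>?U) \<partial>?U)"
    by (simp add: power2_eq_square)
  finally show ?thesis unfolding inner by simp
qed

lemma V_measurable [measurable]: "V \<in> borel_measurable borel"
proof -
  interpret U: prob_space "unif S" by (rule prob_unif[OF S])
  show ?thesis unfolding V_def[abs_def] by measurable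
qed

text \<open>On the line the Gaussian density is replaced by its maximum
  \<open>1 / sqrt (2 * pi)\<close>, which gives an inequality for every \<open>s\<close>. As
  \<open>s\<close> tends to 0 the frequency average concentrates at shift 0, by continuity of
  \<open>p\<close> and \<open>q\<close>.\<close>

lemma plancherel_le:
  assumes Vi: "integrable lborel (\<lambda>x. (V x)\<^sup>2)"
  shows "2 * pi * (\<integral>\<xi>. (p \<xi>)\<^sup>2 + (q \<xi>)\<^sup>2 \<partial>lborel) \<le> (\<integral>x. (V x)\<^sup>2 \<partial>lborel)"
proof -
  let ?N = std_normal_distribution and ?U = "unif S"
  interpret N: prob_space ?N by (rule prob_normal)
  interpret U: prob_space ?U by (rule prob_unif[OF S])
  define D where "D = (\<lambda>s. \<integral>\<xi>. (\<integral>z. p \<xi> * p (\<xi> + s * z) + q \<xi> * q (\<xi> + s * z) \<partial>?N) \<partial>?U)"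
  have le: "2 * pi * (2 * S * D s) \<le> (\<integral>x. (V x)\<^sup>2 \<partial>lborel)" if s: "s > 0" for s
  proof -
    have "(\<integral>y. (V (y / s))\<^sup>2 \<partial>?N) = (\<integral>y. std_normal_density y * (V (y / s))\<^sup>2 \<partial>lborel)"
      by (subst integral_density) auto
    also have "\<dots> = \<bar>s\<bar> *\<^sub>R (\<integral>x. std_normal_density (0 + s * x) * (V ((0 + s * x) / s))\<^sup>2 \<partial>lborel)"
      using s by (intro lborel_integral_real_affine) simp
    also have "\<dots> = s * (\<integral>x. std_normal_density (s * x) * (V x)\<^sup>2 \<partial>lborel)" using s by simp
    also have "\<dots> \<le> s * (\<integral>x. (1 / sqrt (2 * pi)) * (V x)\<^sup>2 \<partial>lborel)"
    proof (intro mult_left_mono integral_mono')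
      show "integrable lborel (\<lambda>x. (1 / sqrt (2 * pi)) * (V x)\<^sup>2)" by (intro integrable_mult_right Vi)
      show "std_normal_density (s * x) * (V x)\<^sup>2 \<le> (1 / sqrt (2 * pi)) * (V x)\<^sup>2" for x
        by (intro mult_right_mono) (auto simp: std_normal_density_def divide_right_mono)
    qed (use s in auto)
    finally have "s * sqrt (2 * pi) * (2 * S * D s) \<le> s * (1 / sqrt (2 * pi) * (\<integral>x. (V x)\<^sup>2 \<partial>lborel))"
      unfolding gauss_average[OF s] D_def by simp
    then have "s * (sqrt (2 * pi) * (2 * S * D s)) \<le> s * (1 / sqrt (2 * pi) * (\<integral>x. (V x)\<^sup>2 \<partial>lborel))" by (simp only: mult.assoc)
    then have "sqrt (2 * pi) * (2 * S * D s) \<le> 1 / sqrt (2 * pi) * (\<integral>x. (V x)\<^sup>2 \<partial>lborel)"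
      using s by (rule mult_left_le_imp_le)
    then have "sqrt (2 * pi) * (sqrt (2 * pi) * (2 * S * D s)) \<le> sqrt (2 * pi) * (1 / sqrt (2 * pi) * (\<integral>x. (V x)\<^sup>2 \<partial>lborel))"
      by (rule mult_left_mono) simp
    then have "(sqrt (2 * pi) * sqrt (2 * pi)) * (2 * S * D s) \<le> (\<integral>x. (V x)\<^sup>2 \<partial>lborel)"
      by (simp only: mult.assoc[symmetric]) simp
    then show ?thesis by simp
  qed
  have b2: "\<bar>p \<xi> * p \<eta> + q \<xi> * q \<eta>\<bar> \<le> C * C + C * C" for \<xi> \<eta>
  proof -
    have "\<bar>p \<xi> * p \<eta>\<bar> \<le> C * C" "\<bar>q \<xi> * q \<eta>\<bar> \<le> C * C"
      unfolding abs_mult using C0 by (intro mult_mono pC qC; simp)+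
    then show ?thesis by linarith
  qed
  have ii: "integrable ?N (\<lambda>z. p \<xi> * p (\<xi> + s * z) + q \<xi> * q (\<xi> + s * z))" for \<xi> s
    by (rule N.integrable_const_bound[where B = "C * C + C * C"]) (use b2 in auto)
  have "(\<lambda>n. D (1 / real (Suc n))) \<longlonglongrightarrow> (\<integral>\<xi>. (\<integral>z. p \<xi> * p \<xi> + q \<xi> * q \<xi> \<partial>?N) \<partial>?U)"
    unfolding D_def
  proof (rule integral_dominated_convergence[where w = "\<lambda>_. C * C + C * C"])
    show "AE \<xi> in ?U. (\<lambda>n. \<integral>z. p \<xi> * p (\<xi> + 1 / real (Suc n) * z) + q \<xi> * q (\<xi> + 1 / real (Suc n) * z) \<partial>?N)
        \<longlonglongrightarrow> (\<integral>z. p \<xi> * p \<xi> + q \<xi> * q \<xi> \<partial>?N)"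
    proof (rule AE_I2)
      fix \<xi>
      show "(\<lambda>n. \<integral>z. p \<xi> * p (\<xi> + 1 / real (Suc n) * z) + q \<xi> * q (\<xi> + 1 / real (Suc n) * z) \<partial>?N)
        \<longlonglongrightarrow> (\<integral>z. p \<xi> * p \<xi> + q \<xi> * q \<xi> \<partial>?N)"
      proof (rule integral_dominated_convergence[where w = "\<lambda>_. C * C + C * C"])
        show "AE z in ?N. (\<lambda>n. p \<xi> * p (\<xi> + 1 / real (Suc n) * z) + q \<xi> * q (\<xi> + 1 / real (Suc n) * z))
            \<longlonglongrightarrow> p \<xi> * p \<xi> + q \<xi> * q \<xi>"
        proof (rule AE_I2)
          fix z
          have "(\<lambda>n. \<xi> + 1 / real (Suc n) * z) \<longlonglongrightarrow> \<xi> + 0 * z"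
            by (intro tendsto_intros LIMSEQ_Suc[OF lim_1_over_n])
          then have l: "(\<lambda>n. \<xi> + 1 / real (Suc n) * z) \<longlonglongrightarrow> \<xi>" by simp
          have "isCont p \<xi>" "isCont q \<xi>" using pc qc by (auto simp: continuous_on_eq_continuous_at)
          then show "(\<lambda>n. p \<xi> * p (\<xi> + 1 / real (Suc n) * z) + q \<xi> * q (\<xi> + 1 / real (Suc n) * z))
            \<longlonglongrightarrow> p \<xi> * p \<xi> + q \<xi> * q \<xi>"
            by (intro tendsto_intros isCont_tendsto_compose[OF _ l])
        qed
        show "AE z in ?N. norm (p \<xi> * p (\<xi> + 1 / real (Suc n) * z) + q \<xi> * q (\<xi> + 1 / real (Suc n) * z)) \<le> C * C + C * C" for n
          using b2 by auto
      qed auto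
    qed
    show "AE \<xi> in ?U. norm (\<integral>z. p \<xi> * p (\<xi> + 1 / real (Suc n) * z) + q \<xi> * q (\<xi> + 1 / real (Suc n) * z) \<partial>?N) \<le> C * C + C * C" for n
    proof (rule AE_I2)
      fix \<xi>
      let ?f = "\<lambda>z. p \<xi> * p (\<xi> + 1 / real (Suc n) * z) + q \<xi> * q (\<xi> + 1 / real (Suc n) * z)"
      have "norm (\<integral>z. ?f z \<partial>?N) \<le> (\<integral>z. norm (?f z) \<partial>?N)" by (rule integral_norm_bound)
      also have "\<dots> \<le> (\<integral>z. C * C + C * C \<partial>?N)"
        using b2 by (intro integral_mono integrable_norm ii) auto
      finally show "norm (\<integral>z. ?f z \<partial>?N) \<le> C * C + C * C" by (simp add: N.prob_space)
    qed
  qed (auto simp: N.prob_space)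
  then have lim: "(\<lambda>n. D (1 / real (Suc n))) \<longlonglongrightarrow> (\<integral>\<xi>. (p \<xi>)\<^sup>2 + (q \<xi>)\<^sup>2 \<partial>?U)"
    by (simp add: N.prob_space power2_eq_square)
  have "2 * pi * (2 * S * D (1 / real (Suc n))) \<le> (\<integral>x. (V x)\<^sup>2 \<partial>lborel)" for n by (rule le) simp
  then have "2 * pi * (2 * S * (\<integral>\<xi>. (p \<xi>)\<^sup>2 + (q \<xi>)\<^sup>2 \<partial>?U)) \<le> (\<integral>x. (V x)\<^sup>2 \<partial>lborel)"
    by (intro LIMSEQ_le_const2[OF tendsto_mult[OF tendsto_const tendsto_mult[OF tendsto_const lim]]] exI[of _ 0] allI impI)
       blast
  moreover have "(\<integral>\<xi>. (p \<xi>)\<^sup>2 + (q \<xi>)\<^sup>2 \<partial>lborel) = 2 * S * (\<integral>\<xi>. (p \<xi>)\<^sup>2 + (q \<xi>)\<^sup>2 \<partial>?U)"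
    by (rule unif_integral[OF S]) (auto simp: p0 q0)
  ultimately show ?thesis by simp
qed

end

section \<open>Barron norms of band-limited functions on the line\<close>

text \<open>The Epanechnikov density. Its continuity makes the smoothed spectrum continuous, and its
  compact support keeps the taper band-limited.\<close>

definition kern :: "real \<Rightarrow> real" where
  "kern y = 3 / 4 * max 0 (1 - y\<^sup>2)"

lemma kern_nonneg: "0 \<le> kern y" and kern_even: "kern (- y) = kern y"
  by (auto simp: kern_def)

lemma kern_le_1: "kern y \<le> 1"
proof -
  have k: "3 / 4 * k \<le> 1" if "k \<le> 1" for k :: real using that by simp
  show ?thesis unfolding kern_def by (rule k) simp
qed

lemma kern_0: "\<bar>y\<bar> \<ge> 1 \<Longrightarrow> kern y = 0"
  using power_mono[of 1 "\<bar>y\<bar>" 2] by (simp add: kern_def)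

lemma kern_continuous: "continuous_on UNIV kern"
  unfolding kern_def[abs_def] by (intro continuous_intros)

lemma kern_measurable [measurable]: "kern \<in> borel_measurable borel"
  by (rule borel_measurable_continuous_onI[OF kern_continuous])

lemma kern_integral: "(\<integral>y. kern y \<partial>lborel) = 1"
proof -
  have e: "kern y = (3 / 4 * (1 - y\<^sup>2)) * indicator {-1..1} y" for y
  proof (cases "\<bar>y\<bar> \<le> 1")
    case True
    then have "y\<^sup>2 \<le> 1" using power_mono[of "\<bar>y\<bar>" 1 2] by simp
    moreover have "y \<in> {-1..1}" using True by (auto simp: abs_le_iff)
    ultimately show ?thesis by (simp add: kern_def)
  next
    case False
    then have "y \<notin> {-1..1}" by auto
    then show ?thesis using False kern_0[of y] by simp
  qed
  have "(\<integral>y. (3 / 4 * (1 - (y::real)\<^sup>2)) * indicator {-1..1} y \<partial>lborel)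
      = (\<lambda>y. 3 / 4 * (y - y ^ 3 / 3)) 1 - (\<lambda>y. 3 / 4 * (y - y ^ 3 / 3)) (-1)"
    by (rule integral_FTC_Icc_real)
       (auto intro!: derivative_eq_intros continuous_intros simp: power2_eq_square)
  also have "\<dots> = 1" by simp
  finally show ?thesis unfolding e .
qed

lemma kern_integrable: "integrable lborel kern"
  using kern_integral not_integrable_integral_eq by fastforce

lemma kern_cos_integrable: "integrable lborel (\<lambda>\<eta>. kern \<eta> * cos (\<eta> * y + r))"
  by (rule Bochner_Integration.integrable_bound[OF kern_integrable])
     (auto simp: abs_mult kern_nonneg intro!: mult_left_le)

text \<open>The characteristic function of \<open>kern\<close>, real because \<open>kern\<close> is
  even. Multiplying by \<open>tap (\<delta> * x)\<close> convolves a spectrum with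
  \<open>kern\<close> rescaled to width \<open>\<delta>\<close>.\<close>

definition tap :: "real \<Rightarrow> real" where
  "tap y = (\<integral>\<eta>. kern \<eta> * cos (\<eta> * y) \<partial>lborel)"

text \<open>\<open>kern\<close> is even, so averaging over \<open>\<eta>\<close> and
  \<open>- \<eta>\<close> removes the sine part of the addition formula.\<close>

lemma kern_cos: "(\<integral>\<eta>. kern \<eta> * cos (\<eta> * y + r) \<partial>lborel) = tap y * cos r"
proof -
  have i: "integrable lborel (\<lambda>\<eta>. kern \<eta> * cos (\<eta> * y + r))" "integrable lborel (\<lambda>\<eta>. kern (- \<eta>) * cos (- \<eta> * y + r))"
    using kern_cos_integrable[of y r] kern_cos_integrable[of "- y" r] by (simp_all add: kern_even)
  have "(\<integral>\<eta>. kern \<eta> * cos (\<eta> * y + r) \<partial>lborel) = (\<integral>\<eta>. kern (- \<eta>) * cos (- \<eta> * y + r) \<partial>lborel)"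
    by (rule reflect_integral[symmetric])
  then have "2 * (\<integral>\<eta>. kern \<eta> * cos (\<eta> * y + r) \<partial>lborel)
      = (\<integral>\<eta>. kern \<eta> * cos (\<eta> * y + r) + kern (- \<eta>) * cos (- \<eta> * y + r) \<partial>lborel)"
    using i by simp
  also have "\<dots> = (\<integral>\<eta>. 2 * cos r * (kern \<eta> * cos (\<eta> * y)) \<partial>lborel)"
    by (intro Bochner_Integration.integral_cong refl) (simp add: kern_even cos_add cos_diff algebra_simps)
  finally show ?thesis by (simp add: tap_def)
qed

lemma tap_bound: "\<bar>tap y\<bar> \<le> 1"
proof -
  have "\<bar>tap y\<bar> \<le> (\<integral>\<eta>. \<bar>kern \<eta> * cos (\<eta> * y)\<bar> \<partial>lborel)" unfolding tap_def by (rule integral_abs_bound)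
  also have "\<dots> \<le> (\<integral>\<eta>. kern \<eta> \<partial>lborel)"
    using kern_cos_integrable[of y 0]
    by (intro integral_mono integrable_abs kern_integrable) (auto simp: abs_mult kern_nonneg intro!: mult_left_le)
  finally show ?thesis by (simp add: kern_integral)
qed

lemma tap_tendsto: "(\<lambda>n. tap (1 / real (Suc n) * y)) \<longlonglongrightarrow> 1"
proof -
  have "(\<lambda>n. \<integral>\<eta>. kern \<eta> * cos (\<eta> * (1 / real (Suc n) * y)) \<partial>lborel) \<longlonglongrightarrow> (\<integral>\<eta>. kern \<eta> \<partial>lborel)"
  proof (rule integral_dominated_convergence[where w = kern])
    show "AE \<eta> in lborel. (\<lambda>n. kern \<eta> * cos (\<eta> * (1 / real (Suc n) * y))) \<longlonglongrightarrow> kern \<eta>"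
    proof (rule AE_I2)
      fix \<eta>
      have "(\<lambda>n. kern \<eta> * cos (\<eta> * (1 / real (Suc n) * y))) \<longlonglongrightarrow> kern \<eta> * cos (\<eta> * (0 * y))"
        by (intro tendsto_intros LIMSEQ_Suc[OF lim_1_over_n])
      then show "(\<lambda>n. kern \<eta> * cos (\<eta> * (1 / real (Suc n) * y))) \<longlonglongrightarrow> kern \<eta>" by simp
    qed
    show "AE \<eta> in lborel. norm (kern \<eta> * cos (\<eta> * (1 / real (Suc n) * y))) \<le> kern \<eta>" for n
      by (auto simp: abs_mult kern_nonneg intro!: mult_left_le)
  qed (auto intro: kern_integrable)
  then show ?thesis unfolding tap_def kern_integral .
qed

section \<open>Ridge functions on the line and their tapering\<close>

lemma vdot_1: "vdot 1 w x = w 0 * x 0"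
  by (simp add: vdot_def)

lemma vnorm_1: "vnorm 1 w = \<bar>w 0\<bar>"
  by (simp add: L2_set_def)

text \<open>\<open>a\<close> vanishes outside \<open>[-S, S]\<close>, so the inner weight may be set
  to 0 there without changing the function; its bound then holds everywhere, as
  \<open>params\<close> demands.\<close>

lemma params_unif:
  assumes S: "S > 0" and [measurable]: "a \<in> borel_measurable borel" and a: "\<And>\<xi>. \<bar>a \<xi>\<bar> \<le> C"
    and z: "\<And>\<xi>. \<bar>\<xi>\<bar> > S \<Longrightarrow> a \<xi> = 0"
  shows "params (unif S) 1 (\<bar>k\<bar> * S) a (\<lambda>\<xi> _. if \<bar>\<xi>\<bar> > S then 0 else k * \<xi>) (\<lambda>_. b)"
    and "ridge (unif S) 1 a (\<lambda>\<xi> _. if \<bar>\<xi>\<bar> > S then 0 else k * \<xi>) (\<lambda>_. b) \<tau> x = (\<integral>\<xi>. a \<xi> * \<tau> (k * \<xi> * x 0 + b) \<partial>unif S)"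
proof -
  interpret prob_space "unif S" by (rule prob_unif[OF S])
  show "params (unif S) 1 (\<bar>k\<bar> * S) a (\<lambda>\<xi> _. if \<bar>\<xi>\<bar> > S then 0 else k * \<xi>) (\<lambda>_. b)"
    unfolding params_def
  proof (intro conjI allI impI ballI)
    show "prob_space (unif S)" by (rule prob_unif[OF S])
    show "integrable (unif S) a" by (rule integrable_const_bound[where B = C]) (use a in auto)
    show "vnorm 1 (\<lambda>_. if \<bar>\<xi>\<bar> > S then 0 else k * \<xi>) \<le> \<bar>k\<bar> * S" for \<xi>
      using S unfolding vnorm_1 by (auto simp: abs_mult intro!: mult_left_mono)
  qed measurable
  show "ridge (unif S) 1 a (\<lambda>\<xi> _. if \<bar>\<xi>\<bar> > S then 0 else k * \<xi>) (\<lambda>_. b) \<tau> x = (\<integral>\<xi>. a \<xi> * \<tau> (k * \<xi> * x 0 + b) \<partial>unif S)"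
    unfolding ridge_def vdot_1 by (intro Bochner_Integration.integral_cong refl) (auto simp: z)
qed

lemma tap_partial:
  assumes "\<delta> > 0"
  shows "((\<lambda>t. tap (\<delta> * (x(0 := t)) 0)) has_real_derivative partial 0 (\<lambda>x. tap (\<delta> * x 0)) x) (at (x 0))"
    and "\<bar>partial 0 (\<lambda>x. tap (\<delta> * x 0)) x\<bar> \<le> \<delta>"
    and "smooth 1 (\<lambda>x. tap (\<delta> * x 0))"
proof -
  interpret prob_space "unif 1" by (rule prob_unif) simp
  \<comment> \<open>The factor 2 is the length of \<open>[-1, 1]\<close>, by which
    \<open>unif 1\<close> divides.\<close>
  let ?a = "\<lambda>\<xi>. 2 * kern \<xi>" and ?w = "\<lambda>\<xi> (_::nat). if \<bar>\<xi>\<bar> > 1 then 0 else \<delta> * \<xi>"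
  have z: "?a \<xi> = 0" if "\<bar>\<xi>\<bar> > 1" for \<xi> using kern_0[of \<xi>] that by simp
  have b: "\<bar>?a \<xi>\<bar> \<le> 2" for \<xi> using kern_nonneg[of \<xi>] kern_le_1[of \<xi>] by simp
  have am: "?a \<in> borel_measurable borel" by measurable
  note par = params_unif[where k = \<delta> and b = 0, OF zero_less_one am b z]
  have e: "(\<lambda>x. tap (\<delta> * x 0)) = ridge (unif 1) 1 ?a ?w (\<lambda>_. 0) cos"
  proof
    fix x :: vec
    have "tap (\<delta> * x 0) = 2 * 1 * (\<integral>\<eta>. kern \<eta> * cos (\<eta> * (\<delta> * x 0)) \<partial>unif 1)"
      unfolding tap_def by (rule unif_integral) (auto simp: kern_0)
    also have "\<dots> = (\<integral>\<xi>. 2 * (kern \<xi> * cos (\<xi> * (\<delta> * x 0))) \<partial>unif 1)" by simp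
    also have "\<dots> = ridge (unif 1) 1 ?a ?w (\<lambda>_. 0) cos x"
      by (subst par(2), assumption) (intro Bochner_Integration.integral_cong refl, simp add: mult_ac)
    finally show "tap (\<delta> * x 0) = ridge (unif 1) 1 ?a ?w (\<lambda>_. 0) cos x" .
  qed
  have D: "(cos has_real_derivative - sin s) (at s)" for s :: real by (auto intro!: derivative_eq_intros)
  have ns: "\<bar>- sin s\<bar> \<le> 1" for s :: real using abs_sin_le_one[of s] by linarith
  have par1: "params (unif 1) 1 (\<bar>\<delta>\<bar> * 1) ?a ?w (\<lambda>_. 0)" by (rule par(1))
  have d: "((\<lambda>t. ridge (unif 1) 1 ?a ?w (\<lambda>_. 0) cos (x(0 := t))) has_real_derivative
      ridge (unif 1) 1 (\<lambda>m. ?a m * ?w m 0) ?w (\<lambda>_. 0) (\<lambda>s. - sin s) x) (at (x 0))" for x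
    by (rule ridge_DERIV[OF par1 nice_trig(1,3) D]) simp
  have pe: "partial 0 (\<lambda>x. tap (\<delta> * x 0)) x = ridge (unif 1) 1 (\<lambda>m. ?a m * ?w m 0) ?w (\<lambda>_. 0) (\<lambda>s. - sin s) x" for x
    unfolding e by (rule partial_DERIV[OF d])
  show "((\<lambda>t. tap (\<delta> * (x(0 := t)) 0)) has_real_derivative partial 0 (\<lambda>x. tap (\<delta> * x 0)) x) (at (x 0))"
    using d[of x] unfolding pe fun_cong[OF e, symmetric] .
  have wm: "(\<lambda>m. ?w m 0) \<in> borel_measurable (unif 1)" by measurable
  have wb: "\<bar>?w m 0\<bar> \<le> \<delta>" if "m \<in> space (unif 1)" for m
    using assms by (auto simp: abs_mult intro!: mult_left_le)
  note pw = params_weight[OF par1 wm wb]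
  have "\<bar>partial 0 (\<lambda>x. tap (\<delta> * x 0)) x\<bar> \<le> 1 * (\<integral>m. \<bar>?a m * ?w m 0\<bar> \<partial>unif 1)"
    unfolding pe by (rule ridge_bound[OF pw(1) nice_trig(3) ns])
  also have "\<dots> \<le> \<delta> * (\<integral>m. \<bar>?a m\<bar> \<partial>unif 1)" using pw(2) by simp
  also have "(\<integral>m. \<bar>?a m\<bar> \<partial>unif 1) = 2 * 1 * (\<integral>m. kern m \<partial>unif 1)" by (simp add: kern_nonneg)
  also have "\<dots> = (\<integral>m. kern m \<partial>lborel)" by (rule unif_integral[symmetric]) (auto simp: kern_0)
  finally show "\<bar>partial 0 (\<lambda>x. tap (\<delta> * x 0)) x\<bar> \<le> \<delta>" by (simp add: kern_integral)
  interpret barron_act cos 1 1 1 1 by (rule barron_act_cos)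
  have "bar cos 1 (\<bar>\<delta>\<bar> * 1) (\<lambda>x. tap (\<delta> * x 0)) (\<integral>m. \<bar>?a m\<bar> \<partial>unif 1)"
    by (rule barI[OF par1 nice_trig(1) order_refl], rule fun_cong[OF e])
  then show "smooth 1 (\<lambda>x. tap (\<delta> * x 0))" by (rule bar_smooth)
qed

lemma leb_1_integral:
  fixes f :: "real \<Rightarrow> real"
  assumes [measurable]: "f \<in> borel_measurable borel"
  shows "(\<integral>x. f (x 0) \<partial>leb 1) = (\<integral>t. f t \<partial>lborel)" "integrable (leb 1) (\<lambda>x. f (x 0)) \<longleftrightarrow> integrable lborel f"
proof -
  have L: "leb 1 = (\<Pi>\<^sub>M i\<in>{0::nat}. lborel)" by (simp add: leb_def lessThan_Suc)
  have m: "(\<lambda>x. x 0) \<in> leb 1 \<rightarrow>\<^sub>M lborel" using leb_component[of 0 1] by simp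
  have d: "distr (leb 1) lborel (\<lambda>x. x 0) = lborel" unfolding L by (rule lebp.distr_singleton)
  show "(\<integral>x. f (x 0) \<partial>leb 1) = (\<integral>t. f t \<partial>lborel)"
    using integral_distr[OF m, of f] unfolding d by simp
  show "integrable (leb 1) (\<lambda>x. f (x 0)) \<longleftrightarrow> integrable lborel f"
    using integrable_distr_eq[OF m, of f] unfolding d by simp
qed

text \<open>What is gained is a norm bound that contains neither \<open>l\<close> nor
  \<open>R\<close> nor \<open>\<delta>\<close>. With \<open>p + i q\<close> the spectrum of
  \<open>v\<close>, the Barron norm is at most the integral of \<open>|p| + |q|\<close>, and Young's
  inequality with the integrable weight \<open>1 / (1 + \<xi>^2)\<close> compares it with the
  integral of \<open>(1 + \<xi>^2) (p^2 + q^2)\<close>, that is with \<open>v\<close> and its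
  derivative in L2.\<close>

lemma taper_band_limited:
  assumes u: "bar cos 1 R u l" and uL: "u \<in> L2 1" and duL: "partial 0 u \<in> L2 1" and \<delta>: "0 < \<delta>" "\<delta> \<le> 1"
  shows "\<exists>v. bar cos 1 (R + 1) v ((\<integral>\<xi>. wt1 1 \<xi> \<partial>lborel) + nsq 1 v (\<lambda>i. partial i v)) \<and>
     (\<forall>x\<in>euclid 1. v x = tap (\<delta> * x 0) * u x)"
proof -
  interpret act: barron_act cos 1 1 1 1 by (rule barron_act_cos)
  obtain M :: "(real \<times> vec \<times> real) measure" and a w b
    where par: "params M 1 R a w b" and "(\<integral>m. \<bar>a m\<bar> \<partial>M) \<le> l" and ux: "\<And>x. x \<in> euclid 1 \<Longrightarrow> u x = ridge M 1 a w b cos x"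
    using barE[OF u] by blast
  have Mp: "prob_space M" and ai: "integrable M a" and bm[measurable]: "b \<in> borel_measurable M"
    using par by (auto simp: params_def)
  have am[measurable]: "a \<in> borel_measurable M" using ai by auto
  define \<omega> where "\<omega> = (\<lambda>m. w m 0)"
  have om[measurable]: "\<omega> \<in> borel_measurable M" using par by (auto simp: params_def \<omega>_def)
  have ob: "\<bar>\<omega> m\<bar> \<le> R" if "m \<in> space M" for m
    using params_component_bound[OF par _ that, of 0] by (simp add: \<omega>_def)
  have R0: "R \<ge> 0" by (rule params_R_nonneg[OF par])
  \<comment> \<open>The frequencies of \<open>u\<close> are at most \<open>R\<close> in absolute
    value, and smoothing at scale \<open>\<delta> \<le> 1\<close> moves them by at most 1.\<close>
  define S where "S = R + 1"
  have S: "S > 0" using R0 by (simp add: S_def)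
  define la where "la = (\<integral>m. \<bar>a m\<bar> \<partial>M)"
  define C where "C = la / \<delta>"
  interpret M: prob_space M by (rule Mp)
  interpret U: prob_space "unif S" by (rule prob_unif[OF S])
  interpret UM: pair_prob_space "unif S" M by (rule pair_prob[OF prob_unif[OF S] Mp])
  let ?km = "\<lambda>\<xi> m. kern ((\<xi> - \<omega> m) / \<delta>)" and ?kp = "\<lambda>\<xi> m. kern ((\<xi> + \<omega> m) / \<delta>)"
  \<comment> \<open>\<open>P\<close> and \<open>Q\<close> are the real and imaginary part of the
    smoothed spectrum of \<open>a cos (\<omega> x + b)\<close>: mass \<open>a exp (i b) / 2\<close>
    at \<open>\<omega>\<close> and the conjugate mass at \<open>- \<omega>\<close>, both spread out
    by the density \<open>kern (_ / \<delta>) / \<delta>\<close>.\<close>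
  define P where "P = (\<lambda>\<xi> m. a m / (2 * \<delta>) * (cos (b m) * (?km \<xi> m + ?kp \<xi> m)))"
  define Q where "Q = (\<lambda>\<xi> m. a m / (2 * \<delta>) * (sin (b m) * (?km \<xi> m - ?kp \<xi> m)))"
  define p where "p = (\<lambda>\<xi>. \<integral>m. P \<xi> m \<partial>M)"
  define q where "q = (\<lambda>\<xi>. \<integral>m. Q \<xi> m \<partial>M)"
  have km: "\<bar>?km \<xi> m + ?kp \<xi> m\<bar> \<le> 2" "\<bar>?km \<xi> m - ?kp \<xi> m\<bar> \<le> 2" for \<xi> m
    using kern_nonneg[of "(\<xi> - \<omega> m) / \<delta>"] kern_nonneg[of "(\<xi> + \<omega> m) / \<delta>"] kern_le_1[of "(\<xi> - \<omega> m) / \<delta>"] kern_le_1[of "(\<xi> + \<omega> m) / \<delta>"]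
    by linarith+
  have half: "\<bar>a m / (2 * \<delta>) * (t * k)\<bar> \<le> \<bar>a m\<bar> / \<delta>" if "\<bar>t\<bar> \<le> 1" "\<bar>k\<bar> \<le> 2" for m t k
  proof -
    have "\<bar>t\<bar> * \<bar>k\<bar> \<le> 1 * 2" using that by (intro mult_mono) auto
    then have "\<bar>a m\<bar> * (\<bar>t\<bar> * \<bar>k\<bar>) \<le> \<bar>a m\<bar> * 2" by (intro mult_left_mono) auto
    then show ?thesis using \<delta>(1) by (simp add: abs_mult divide_simps)
  qed
  have Pb: "\<bar>P \<xi> m\<bar> \<le> \<bar>a m\<bar> / \<delta>" and Qb: "\<bar>Q \<xi> m\<bar> \<le> \<bar>a m\<bar> / \<delta>" for \<xi> m
    unfolding P_def Q_def by (intro half km; simp)+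
  have Pm[measurable]: "(\<lambda>m. P \<xi> m) \<in> borel_measurable M" and Qm[measurable]: "(\<lambda>m. Q \<xi> m) \<in> borel_measurable M" for \<xi>
    unfolding P_def Q_def by measurable
  have adi: "integrable M (\<lambda>m. \<bar>a m\<bar> / \<delta>)" using ai by simp
  have Pi: "integrable M (P \<xi>)" and Qi: "integrable M (Q \<xi>)" for \<xi>
    using Pb Qb \<delta>(1) by (auto intro!: Bochner_Integration.integrable_bound[OF adi])
  have iC: "(\<integral>m. \<bar>a m\<bar> / \<delta> \<partial>M) = C" by (simp add: C_def la_def)
  \<comment> \<open>The spread kernels are continuous with a common integrable bound, so averaging
    over \<open>m\<close> preserves continuity even if the law of the frequencies has atoms.\<close>
  have cont: "continuous_on UNIV (\<lambda>\<xi>. \<integral>m. F \<xi> m \<partial>M)"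
    if Fb: "\<And>\<xi> m. \<bar>F \<xi> m\<bar> \<le> \<bar>a m\<bar> / \<delta>" and Fm: "\<And>\<xi>. F \<xi> \<in> borel_measurable M"
      and Fc: "\<And>m. continuous_on UNIV (\<lambda>\<xi>. F \<xi> m)" for F :: "real \<Rightarrow> _ \<Rightarrow> real"
  proof (rule continuous_on_sequentiallyI)
    fix s :: "nat \<Rightarrow> real" and \<xi> assume s: "s \<longlonglongrightarrow> \<xi>"
    show "(\<lambda>n. \<integral>m. F (s n) m \<partial>M) \<longlonglongrightarrow> (\<integral>m. F \<xi> m \<partial>M)"
    proof (rule integral_dominated_convergence[where w = "\<lambda>m. \<bar>a m\<bar> / \<delta>"])
      show "AE m in M. (\<lambda>n. F (s n) m) \<longlonglongrightarrow> F \<xi> m"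
      proof (rule AE_I2)
        fix m
        have "isCont (\<lambda>\<xi>. F \<xi> m) \<xi>" using Fc[of m] by (simp add: continuous_on_eq_continuous_at)
        then show "(\<lambda>n. F (s n) m) \<longlonglongrightarrow> F \<xi> m" by (rule isCont_tendsto_compose[OF _ s])
      qed
    qed (use Fb Fm adi in auto)
  qed
  have kc: "continuous_on UNIV (\<lambda>\<xi>. kern ((\<xi> + t) / \<delta>))" for t
    by (rule continuous_on_compose2[OF kern_continuous]) (use \<delta>(1) in \<open>auto intro!: continuous_intros\<close>)
  have kc': "continuous_on UNIV (\<lambda>\<xi>. kern ((\<xi> - t) / \<delta>))" for t using kc[of "- t"] by simp
  have pc: "continuous_on UNIV p" and qc: "continuous_on UNIV q"
    unfolding p_def q_def
    by (rule cont[OF Pb Pm] cont[OF Qb Qm]; unfold P_def Q_def; intro continuous_intros kc kc')+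
  have far: "?km \<xi> m = 0" "?kp \<xi> m = 0" if "\<bar>\<xi>\<bar> > S" "m \<in> space M" for \<xi> m
  proof -
    have "1 \<le> \<bar>\<xi> - \<omega> m\<bar>" "1 \<le> \<bar>\<xi> + \<omega> m\<bar>" using ob[OF that(2)] that(1) by (auto simp: S_def abs_if split: if_splits)
    then have "\<delta> \<le> \<bar>\<xi> - \<omega> m\<bar>" "\<delta> \<le> \<bar>\<xi> + \<omega> m\<bar>" using \<delta>(2) by linarith+
    then have "1 \<le> \<bar>(\<xi> - \<omega> m) / \<delta>\<bar>" "1 \<le> \<bar>(\<xi> + \<omega> m) / \<delta>\<bar>" using \<delta>(1) by (simp_all add: divide_simps)
    then show "?km \<xi> m = 0" "?kp \<xi> m = 0" by (auto intro: kern_0)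
  qed
  have p0: "p \<xi> = 0" and q0: "q \<xi> = 0" if xi: "\<bar>\<xi>\<bar> > S" for \<xi>
  proof -
    have z: "P \<xi> m = 0" "Q \<xi> m = 0" if "m \<in> space M" for m by (simp_all add: P_def Q_def far[OF xi that])
    have "(\<integral>m. P \<xi> m \<partial>M) = (\<integral>m. 0 \<partial>M)" "(\<integral>m. Q \<xi> m \<partial>M) = (\<integral>m. 0 \<partial>M)"
      by (intro Bochner_Integration.integral_cong refl z; assumption)+
    then show "p \<xi> = 0" "q \<xi> = 0" by (simp_all add: p_def q_def)
  qed
  have kflip: "kern ((- \<xi> - t) / \<delta>) = kern ((\<xi> + t) / \<delta>)" "kern ((- \<xi> + t) / \<delta>) = kern ((\<xi> - t) / \<delta>)" for \<xi> t
    using kern_even[of "(\<xi> + t) / \<delta>"] kern_even[of "(\<xi> - t) / \<delta>"] by (simp_all add: minus_divide_left add.commute)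
  have pe: "p (- \<xi>) = p \<xi>" for \<xi>
  proof -
    have "P (- \<xi>) = P \<xi>" unfolding P_def kflip by (simp add: add.commute)
    then show ?thesis by (simp add: p_def)
  qed
  have qo: "q (- \<xi>) = - q \<xi>" for \<xi>
  proof -
    have "Q (- \<xi>) = (\<lambda>m. - Q \<xi> m)" unfolding Q_def kflip by (simp add: fun_eq_iff algebra_simps)
    then show ?thesis by (simp add: q_def)
  qed
  have bnd: "\<bar>\<integral>m. F m \<partial>M\<bar> \<le> C" if "\<And>m. \<bar>F m\<bar> \<le> \<bar>a m\<bar> / \<delta>" "integrable M F" for F :: "_ \<Rightarrow> real"
  proof -
    have "\<bar>\<integral>m. F m \<partial>M\<bar> \<le> (\<integral>m. \<bar>F m\<bar> \<partial>M)" by (rule integral_abs_bound)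
    also have "\<dots> \<le> (\<integral>m. \<bar>a m\<bar> / \<delta> \<partial>M)" by (intro integral_mono integrable_abs that adi)
    finally show ?thesis unfolding iC .
  qed
  have pC: "\<bar>p \<xi>\<bar> \<le> C" and qC: "\<bar>q \<xi>\<bar> \<le> C" for \<xi>
    unfolding p_def q_def by (rule bnd[OF Pb Pi] bnd[OF Qb Qi])+
  interpret h: hermitian p q S C
    by unfold_locales (fact S pc qc p0 q0 pe qo pC qC)+
  have SC: "\<bar>\<xi> * t\<bar> \<le> S * C" if "\<bar>t\<bar> \<le> C" "\<bar>\<xi>\<bar> > S \<longrightarrow> t = 0" for \<xi> t
  proof (cases "\<bar>\<xi>\<bar> > S")
    case False
    then show ?thesis unfolding abs_mult using that(1) S h.C0 by (intro mult_mono) auto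
  qed (use that S h.C0 in auto)
  \<comment> \<open>The spectrum of the derivative of \<open>v\<close>:
    \<open>i \<xi> (p + i q)\<close> has real part \<open>- \<xi> q\<close> and imaginary part
    \<open>\<xi> p\<close>, again even and odd.\<close>
  interpret h1: hermitian "\<lambda>\<xi>. - (\<xi> * q \<xi>)" "\<lambda>\<xi>. \<xi> * p \<xi>" S "S * C"
  proof
    show "continuous_on UNIV (\<lambda>\<xi>. - (\<xi> * q \<xi>))" "continuous_on UNIV (\<lambda>\<xi>. \<xi> * p \<xi>)"
      by (intro continuous_intros pc qc)+
    show "\<bar>- (\<xi> * q \<xi>)\<bar> \<le> S * C" for \<xi> using SC[OF qC, of \<xi> \<xi>] q0[of \<xi>] by simp
    show "\<bar>\<xi> * p \<xi>\<bar> \<le> S * C" for \<xi> using SC[OF pC, of \<xi> \<xi>] p0[of \<xi>] by simp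
  qed (use S p0 q0 pe qo in auto)
  define v where "v = (\<lambda>x::vec. h.V (x 0))"
  have Vu: "v x = tap (\<delta> * x 0) * u x" if x: "x \<in> euclid 1" for x
  proof -
    let ?t = "x 0"
    define G where "G = (\<lambda>\<xi> m. P \<xi> m * cos (\<xi> * ?t) - Q \<xi> m * sin (\<xi> * ?t))"
    \<comment> \<open>The addition formulas separate the bumps at \<open>\<omega> m\<close> and
      \<open>- \<omega> m\<close>; integrated over \<open>\<xi>\<close>, each of them reproduces
      half of the wave times the taper.\<close>
    have G2: "G \<xi> m = a m / (2 * \<delta>) * (?km \<xi> m * cos (\<xi> * ?t + b m) + ?kp \<xi> m * cos (\<xi> * ?t - b m))" for \<xi> m
      unfolding G_def P_def Q_def cos_add cos_diff by (simp add: algebra_simps)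
    have Gb: "\<bar>G \<xi> m\<bar> \<le> \<bar>1::real\<bar> * \<bar>a m / \<delta>\<bar>" for \<xi> m
    proof -
      have "\<bar>?km \<xi> m * cos (\<xi> * ?t + b m)\<bar> \<le> 1 * 1" "\<bar>?kp \<xi> m * cos (\<xi> * ?t - b m)\<bar> \<le> 1 * 1"
        unfolding abs_mult by (intro mult_mono; simp add: kern_nonneg kern_le_1)+
      then have "\<bar>?km \<xi> m * cos (\<xi> * ?t + b m) + ?kp \<xi> m * cos (\<xi> * ?t - b m)\<bar> \<le> 2" by linarith
      then show ?thesis unfolding G2 using half[of 1 "?km \<xi> m * cos (\<xi> * ?t + b m) + ?kp \<xi> m * cos (\<xi> * ?t - b m)" m] \<delta>(1) by simp
    qed
    have Gm: "(\<lambda>z. G (fst z) (snd z)) \<in> borel_measurable (unif S \<Otimes>\<^sub>M M)"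
      unfolding G2 by measurable
    have Gi: "integrable (unif S \<Otimes>\<^sub>M M) (\<lambda>(\<xi>, m). G \<xi> m)"
      by (rule integrable_pair_bound(1)[OF prob_unif[OF S] Mp, where g = "\<lambda>_. 1" and h = "\<lambda>m. a m / \<delta>"])
         (use Gm Gb ai in \<open>auto simp: case_prod_unfold\<close>)
    have in1: "2 * S * (\<integral>\<xi>. ?km \<xi> m * cos (\<xi> * ?t + b m) \<partial>unif S) = \<delta> * (tap (\<delta> * ?t) * cos (\<omega> m * ?t + b m))"
      if m: "m \<in> space M" for m
    proof -
      have "2 * S * (\<integral>\<xi>. ?km \<xi> m * cos (\<xi> * ?t + b m) \<partial>unif S) = (\<integral>\<xi>. ?km \<xi> m * cos (\<xi> * ?t + b m) \<partial>lborel)"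
        by (rule unif_integral[symmetric, OF S]) (use far[OF _ m] in auto)
      also have "\<dots> = \<bar>\<delta>\<bar> *\<^sub>R (\<integral>\<eta>. ?km (\<omega> m + \<delta> * \<eta>) m * cos ((\<omega> m + \<delta> * \<eta>) * ?t + b m) \<partial>lborel)"
        using \<delta>(1) by (intro lborel_integral_real_affine) simp
      also have "\<dots> = \<delta> * (\<integral>\<eta>. kern \<eta> * cos (\<eta> * (\<delta> * ?t) + (\<omega> m * ?t + b m)) \<partial>lborel)"
        using \<delta>(1) by (simp add: algebra_simps)
      finally show ?thesis unfolding kern_cos .
    qed
    have in2: "2 * S * (\<integral>\<xi>. ?kp \<xi> m * cos (\<xi> * ?t - b m) \<partial>unif S) = \<delta> * (tap (\<delta> * ?t) * cos (\<omega> m * ?t + b m))"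
      if m: "m \<in> space M" for m
    proof -
      have "2 * S * (\<integral>\<xi>. ?kp \<xi> m * cos (\<xi> * ?t - b m) \<partial>unif S) = (\<integral>\<xi>. ?kp \<xi> m * cos (\<xi> * ?t - b m) \<partial>lborel)"
        by (rule unif_integral[symmetric, OF S]) (use far[OF _ m] in auto)
      also have "\<dots> = \<bar>\<delta>\<bar> *\<^sub>R (\<integral>\<eta>. ?kp (- \<omega> m + \<delta> * \<eta>) m * cos ((- \<omega> m + \<delta> * \<eta>) * ?t - b m) \<partial>lborel)"
        using \<delta>(1) by (intro lborel_integral_real_affine) simp
      also have "\<dots> = \<delta> * (\<integral>\<eta>. kern \<eta> * cos (\<eta> * (\<delta> * ?t) + (- (\<omega> m * ?t + b m))) \<partial>lborel)"
        using \<delta>(1) by (simp add: algebra_simps)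
      also have "\<dots> = \<delta> * (tap (\<delta> * ?t) * cos (- (\<omega> m * ?t + b m)))" unfolding kern_cos ..
      finally show ?thesis by (simp only: cos_minus)
    qed
    have kint: "integrable (unif S) (\<lambda>\<xi>. ?km \<xi> m * cos (\<xi> * ?t + b m))" "integrable (unif S) (\<lambda>\<xi>. ?kp \<xi> m * cos (\<xi> * ?t - b m))" for m
    proof -
      have "\<bar>?km \<xi> m * cos (\<xi> * ?t + b m)\<bar> \<le> 1 * 1" "\<bar>?kp \<xi> m * cos (\<xi> * ?t - b m)\<bar> \<le> 1 * 1" for \<xi>
        unfolding abs_mult by (intro mult_mono; simp add: kern_nonneg kern_le_1)+
      then show "integrable (unif S) (\<lambda>\<xi>. ?km \<xi> m * cos (\<xi> * ?t + b m))" "integrable (unif S) (\<lambda>\<xi>. ?kp \<xi> m * cos (\<xi> * ?t - b m))"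
        by (auto intro!: U.integrable_const_bound[where B = 1])
    qed
    have Gp: "(\<integral>m. G \<xi> m \<partial>M) = p \<xi> * cos (\<xi> * ?t) - q \<xi> * sin (\<xi> * ?t)" for \<xi>
      unfolding p_def q_def G_def using Pi Qi by simp
    have "v x = 2 * S * (\<integral>\<xi>. (\<integral>m. G \<xi> m \<partial>M) \<partial>unif S)"
      by (simp only: v_def h.V_def Gp)
    also have "(\<integral>\<xi>. (\<integral>m. G \<xi> m \<partial>M) \<partial>unif S) = (\<integral>m. (\<integral>\<xi>. G \<xi> m \<partial>unif S) \<partial>M)"
      by (rule UM.Fubini_integral[OF Gi, symmetric])
    also have "2 * S * (\<integral>m. (\<integral>\<xi>. G \<xi> m \<partial>unif S) \<partial>M) = (\<integral>m. 2 * S * (\<integral>\<xi>. G \<xi> m \<partial>unif S) \<partial>M)" by simp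
    also have "\<dots> = (\<integral>m. tap (\<delta> * ?t) * (a m * cos (vdot 1 (w m) x + b m)) \<partial>M)"
    proof (rule Bochner_Integration.integral_cong[OF refl])
      fix m assume m: "m \<in> space M"
      have "2 * S * (\<integral>\<xi>. G \<xi> m \<partial>unif S) = a m / (2 * \<delta>) * (2 * S * (\<integral>\<xi>. ?km \<xi> m * cos (\<xi> * ?t + b m) \<partial>unif S) + 2 * S * (\<integral>\<xi>. ?kp \<xi> m * cos (\<xi> * ?t - b m) \<partial>unif S))"
        unfolding G2 using kint[of m] by (simp add: algebra_simps)
      also have "\<dots> = a m / (2 * \<delta>) * (2 * (\<delta> * (tap (\<delta> * ?t) * cos (\<omega> m * ?t + b m))))"
        unfolding in1[OF m] in2[OF m] by simp
      also have "\<dots> = tap (\<delta> * ?t) * (a m * cos (\<omega> m * ?t + b m))" using \<delta>(1) by simp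
      finally show "2 * S * (\<integral>\<xi>. G \<xi> m \<partial>unif S) = tap (\<delta> * ?t) * (a m * cos (vdot 1 (w m) x + b m))"
        by (simp only: vdot_1 \<omega>_def)
    qed
    also have "\<dots> = tap (\<delta> * ?t) * u x" unfolding ux[OF x] ridge_def by simp
    finally show ?thesis .
  qed
  let ?w = "\<lambda>\<xi> (_::nat). if \<bar>\<xi>\<bar> > S then 0 else 1 * \<xi>"
  have c2: "\<bar>2 * S * p \<xi>\<bar> \<le> 2 * S * C" "\<bar>2 * S * q \<xi>\<bar> \<le> 2 * S * C" for \<xi>
    using pC[of \<xi>] qC[of \<xi>] S by (simp_all add: abs_mult)
  have parp: "params (unif S) 1 (\<bar>1\<bar> * S) (\<lambda>\<xi>. 2 * S * p \<xi>) ?w (\<lambda>_. r)" for r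
    by (rule params_unif(1)[OF S _ c2(1)]) (auto simp: p0)
  have parq: "params (unif S) 1 (\<bar>1\<bar> * S) (\<lambda>\<xi>. 2 * S * q \<xi>) ?w (\<lambda>_. r)" for r
    by (rule params_unif(1)[OF S _ c2(2)]) (auto simp: q0)
  have rp: "ridge (unif S) 1 (\<lambda>\<xi>. 2 * S * p \<xi>) ?w (\<lambda>_. r) \<tau> x = (\<integral>\<xi>. 2 * S * p \<xi> * \<tau> (1 * \<xi> * x 0 + r) \<partial>unif S)" for r \<tau> x
    by (rule params_unif(2)[OF S _ c2(1)]) (auto simp: p0)
  have rq: "ridge (unif S) 1 (\<lambda>\<xi>. 2 * S * q \<xi>) ?w (\<lambda>_. r) \<tau> x = (\<integral>\<xi>. 2 * S * q \<xi> * \<tau> (1 * \<xi> * x 0 + r) \<partial>unif S)" for r \<tau> x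
    by (rule params_unif(2)[OF S _ c2(2)]) (auto simp: q0)
  have pqi: "integrable (unif S) (\<lambda>\<xi>. p \<xi> * \<tau> (\<xi> * t))" "integrable (unif S) (\<lambda>\<xi>. q \<xi> * \<tau> (\<xi> * t))"
    "integrable (unif S) (\<lambda>\<xi>. \<xi> * p \<xi> * \<tau> (\<xi> * t))" "integrable (unif S) (\<lambda>\<xi>. \<xi> * q \<xi> * \<tau> (\<xi> * t))"
    if \<tau>: "\<tau> \<in> {cos, sin}" for \<tau> :: "real \<Rightarrow> real" and t
  proof -
    have [measurable]: "\<tau> \<in> borel_measurable borel" using \<tau> by auto
    have t1: "\<bar>\<tau> s\<bar> \<le> 1" for s using \<tau> by auto
    have m1: "\<bar>k * \<tau> s\<bar> \<le> K" if "\<bar>k\<bar> \<le> K" for k K s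
      using mult_mono[OF that t1[of s]] that by (simp add: abs_mult)
    show "integrable (unif S) (\<lambda>\<xi>. p \<xi> * \<tau> (\<xi> * t))" "integrable (unif S) (\<lambda>\<xi>. q \<xi> * \<tau> (\<xi> * t))"
      by (rule U.integrable_const_bound[where B = C]; use m1[OF pC] m1[OF qC] in simp)+
    show "integrable (unif S) (\<lambda>\<xi>. \<xi> * p \<xi> * \<tau> (\<xi> * t))" "integrable (unif S) (\<lambda>\<xi>. \<xi> * q \<xi> * \<tau> (\<xi> * t))"
      by (rule U.integrable_const_bound[where B = "S * C"]; use m1[OF h1.qC] m1[OF h1.pC[unfolded abs_minus_cancel]] in simp)+
  qed
  \<comment> \<open>\<open>- sin\<close> is the cosine shifted by \<open>pi / 2\<close>, so both
    parts are ridge functions of the cosine.\<close>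
  have ve: "v x = ridge (unif S) 1 (\<lambda>\<xi>. 2 * S * p \<xi>) ?w (\<lambda>_. 0) cos x + ridge (unif S) 1 (\<lambda>\<xi>. 2 * S * q \<xi>) ?w (\<lambda>_. pi / 2) cos x" for x
  proof -
    have "v x = 2 * S * ((\<integral>\<xi>. p \<xi> * cos (\<xi> * x 0) \<partial>unif S) - (\<integral>\<xi>. q \<xi> * sin (\<xi> * x 0) \<partial>unif S))"
      unfolding v_def h.V_def using pqi by simp
    then show ?thesis unfolding rp rq by (simp add: cos_add right_diff_distrib mult.assoc)
  qed
  have dve: "partial 0 v x = h1.V (x 0)" for x
  proof -
    have D: "(cos has_real_derivative - sin s) (at s)" for s :: real by (auto intro!: derivative_eq_intros)
    have "((\<lambda>t. v (x(0 := t))) has_real_derivative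
       ridge (unif S) 1 (\<lambda>\<xi>. 2 * S * p \<xi> * ?w \<xi> 0) ?w (\<lambda>_. 0) (\<lambda>s. - sin s) x + ridge (unif S) 1 (\<lambda>\<xi>. 2 * S * q \<xi> * ?w \<xi> 0) ?w (\<lambda>_. pi / 2) (\<lambda>s. - sin s) x) (at (x 0))"
      unfolding ve by (intro DERIV_add ridge_DERIV[OF parp nice_trig(1,3) D] ridge_DERIV[OF parq nice_trig(1,3) D]) auto
    then have "partial 0 v x = ridge (unif S) 1 (\<lambda>\<xi>. 2 * S * p \<xi> * ?w \<xi> 0) ?w (\<lambda>_. 0) (\<lambda>s. - sin s) x + ridge (unif S) 1 (\<lambda>\<xi>. 2 * S * q \<xi> * ?w \<xi> 0) ?w (\<lambda>_. pi / 2) (\<lambda>s. - sin s) x"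
      by (rule partial_DERIV)
    also have "ridge (unif S) 1 (\<lambda>\<xi>. 2 * S * p \<xi> * ?w \<xi> 0) ?w (\<lambda>_. 0) (\<lambda>s. - sin s) x = (\<integral>\<xi>. - (2 * S) * (\<xi> * p \<xi> * sin (\<xi> * x 0)) \<partial>unif S)"
      unfolding ridge_def vdot_1 by (intro Bochner_Integration.integral_cong refl) (auto simp: p0)
    also have "ridge (unif S) 1 (\<lambda>\<xi>. 2 * S * q \<xi> * ?w \<xi> 0) ?w (\<lambda>_. pi / 2) (\<lambda>s. - sin s) x = (\<integral>\<xi>. - (2 * S) * (\<xi> * q \<xi> * cos (\<xi> * x 0)) \<partial>unif S)"
      unfolding ridge_def vdot_1 by (intro Bochner_Integration.integral_cong refl) (auto simp: q0 sin_add)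
    also have "(\<integral>\<xi>. - (2 * S) * (\<xi> * p \<xi> * sin (\<xi> * x 0)) \<partial>unif S) + (\<integral>\<xi>. - (2 * S) * (\<xi> * q \<xi> * cos (\<xi> * x 0)) \<partial>unif S)
        = 2 * S * (\<integral>\<xi>. - (\<xi> * q \<xi> * cos (\<xi> * x 0)) - \<xi> * p \<xi> * sin (\<xi> * x 0) \<partial>unif S)"
    proof -
      have i: "integrable (unif S) (\<lambda>\<xi>. \<xi> * p \<xi> * sin (\<xi> * x 0))" "integrable (unif S) (\<lambda>\<xi>. \<xi> * q \<xi> * cos (\<xi> * x 0))"
        by (rule pqi; simp)+
      show ?thesis
        by (simp only: integral_mult_right_zero Bochner_Integration.integral_diff[OF Bochner_Integration.integrable_minus[OF i(2)] i(1)] Bochner_Integration.integral_minus)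
           (simp add: algebra_simps)
    qed
    finally show ?thesis unfolding h1.V_def by simp
  qed
  have us: "smooth 1 u" by (rule act.bar_smooth[OF u])
  note ts = tap_partial[OF \<delta>(1)]
  have vsm: "smooth 1 v" by (rule smooth_cong[OF smooth_mult[OF ts(3) us]]) (simp add: Vu)
  have vL: "v \<in> L2 1"
  proof -
    have "(\<lambda>x. tap (\<delta> * x 0) * u x) \<in> L2 1"
      by (rule L2_bounded_mult[OF uL smooth_measurable[OF ts(3)] tap_bound])
    moreover have "integrable (leb 1) (\<lambda>x. (v x)\<^sup>2) = integrable (leb 1) (\<lambda>x. (tap (\<delta> * x 0) * u x)\<^sup>2)"
      by (intro Bochner_Integration.integrable_cong refl) (simp only: space_leb Vu)
    ultimately show ?thesis using smooth_measurable[OF vsm] by (simp add: L2_def)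
  qed
  have dv: "partial 0 v x = partial 0 (\<lambda>x. tap (\<delta> * x 0)) x * u x + tap (\<delta> * x 0) * partial 0 u x" if "x \<in> euclid 1" for x
    using partial_cong[OF that _ Vu, of 0] partial_mult[OF ts(3) us _ that, of 0] by simp
  have dvL: "partial 0 v \<in> L2 1"
  proof -
    have "(\<lambda>x. partial 0 (\<lambda>x. tap (\<delta> * x 0)) x * u x + tap (\<delta> * x 0) * partial 0 u x) \<in> L2 1"
      by (intro L2_add L2_bounded_mult[OF uL smooth_measurable[OF smooth_partial[OF ts(3)]] ts(2)]
          L2_bounded_mult[OF duL smooth_measurable[OF ts(3)] tap_bound]) simp
    moreover have "integrable (leb 1) (\<lambda>x. (partial 0 v x)\<^sup>2) = integrable (leb 1) (\<lambda>x. (partial 0 (\<lambda>x. tap (\<delta> * x 0)) x * u x + tap (\<delta> * x 0) * partial 0 u x)\<^sup>2)"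
      by (intro Bochner_Integration.integrable_cong refl) (simp only: space_leb dv)
    moreover have "partial 0 v \<in> borel_measurable (leb 1)" by (intro smooth_measurable smooth_partial vsm) simp
    ultimately show ?thesis by (simp add: L2_def)
  qed
  have V1: "integrable lborel (\<lambda>t. (h.V t)\<^sup>2)" "(\<integral>x. (v x)\<^sup>2 \<partial>leb 1) = (\<integral>t. (h.V t)\<^sup>2 \<partial>lborel)"
    using L2_integrable_sq[OF vL] leb_1_integral[of "\<lambda>t. (h.V t)\<^sup>2"] by (auto simp: v_def)
  have V2: "integrable lborel (\<lambda>t. (h1.V t)\<^sup>2)" "(\<integral>x. (partial 0 v x)\<^sup>2 \<partial>leb 1) = (\<integral>t. (h1.V t)\<^sup>2 \<partial>lborel)"
    using L2_integrable_sq[OF dvL] leb_1_integral[of "\<lambda>t. (h1.V t)\<^sup>2"] by (auto simp: dve)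
  have n: "nsq 1 v (\<lambda>i. partial i v) = (\<integral>t. (h.V t)\<^sup>2 \<partial>lborel) + (\<integral>t. (h1.V t)\<^sup>2 \<partial>lborel)"
    using L2_integrable_sq[OF vL] L2_integrable_sq[OF dvL] V1 V2 by (simp add: nsq_def)
  have comp: "integrable lborel (\<lambda>\<xi>. f \<xi>)" if [measurable]: "f \<in> borel_measurable borel" and b: "\<And>\<xi>. \<bar>f \<xi>\<bar> \<le> K" and z: "\<And>\<xi>. \<bar>\<xi>\<bar> > S \<Longrightarrow> f \<xi> = 0" for f :: "real \<Rightarrow> real" and K
  proof (rule Bochner_Integration.integrable_bound)
    show "integrable lborel (\<lambda>\<xi>. K * indicator {-S..S} \<xi>)"
      by (intro integrable_mult_right integrable_real_indicator) (auto simp: emeasure_lborel_Icc_eq)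
    show "AE \<xi> in lborel. norm (f \<xi>) \<le> norm (K * indicator {-S..S} \<xi>)"
    proof (rule AE_I2)
      fix \<xi>
      show "norm (f \<xi>) \<le> norm (K * indicator {-S..S} \<xi>)"
      proof (cases "\<bar>\<xi>\<bar> > S")
        case False
        then have "\<xi> \<in> {-S..S}" by (auto simp: abs_le_iff)
        then show ?thesis using b[of \<xi>] by simp
      qed (simp add: z)
    qed
  qed measurable
  have CC: "0 \<le> C" by (rule h.C0)
  have sq: "t\<^sup>2 \<le> K\<^sup>2" if "\<bar>t\<bar> \<le> K" for t K :: real using power_mono[OF that abs_ge_zero, of 2] by simp
  have ip: "integrable lborel (\<lambda>\<xi>. (p \<xi>)\<^sup>2 + (q \<xi>)\<^sup>2)"
  proof (rule comp)
    show "\<bar>(p \<xi>)\<^sup>2 + (q \<xi>)\<^sup>2\<bar> \<le> C\<^sup>2 + C\<^sup>2" for \<xi>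
      using sq[OF pC[of \<xi>]] sq[OF qC[of \<xi>]] by simp
  qed (auto simp: p0 q0)
  have ip1: "integrable lborel (\<lambda>\<xi>. (- (\<xi> * q \<xi>))\<^sup>2 + (\<xi> * p \<xi>)\<^sup>2)"
  proof (rule comp)
    show "\<bar>(- (\<xi> * q \<xi>))\<^sup>2 + (\<xi> * p \<xi>)\<^sup>2\<bar> \<le> (S * C)\<^sup>2 + (S * C)\<^sup>2" for \<xi>
      using sq[OF h1.pC[of \<xi>]] sq[OF h1.qC[of \<xi>]] by simp
  qed (auto simp: p0 q0)
  have iw: "integrable lborel (wt1 1)" by (rule integrable_wt1) simp
  \<comment> \<open>The square \<open>(1 - k |t|)^2\<close>, divided by
    \<open>k = 1 + \<xi>^2\<close> and expanded.\<close>
  have pt: "\<bar>t\<bar> \<le> (wt1 1 \<xi> + (t\<^sup>2 + (\<xi> * t)\<^sup>2)) / 2" for t \<xi> :: real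
  proof -
    define k where "k = 1 + \<xi>\<^sup>2"
    have k: "k > 0" by (simp add: k_def add_pos_nonneg)
    have "0 \<le> (1 - k * \<bar>t\<bar>)\<^sup>2 / k" using k by simp
    also have "\<dots> = 1 / k - 2 * \<bar>t\<bar> + k * t\<^sup>2" using k by (simp add: power2_eq_square field_simps)
    finally show ?thesis by (simp add: wt1_def k_def power_mult_distrib distrib_right)
  qed
  have pp: "(\<integral>\<xi>. \<bar>2 * S * p \<xi>\<bar> \<partial>unif S) = (\<integral>\<xi>. \<bar>p \<xi>\<bar> \<partial>lborel)" "(\<integral>\<xi>. \<bar>2 * S * q \<xi>\<bar> \<partial>unif S) = (\<integral>\<xi>. \<bar>q \<xi>\<bar> \<partial>lborel)"
    using unif_integral[OF S, of "\<lambda>\<xi>. \<bar>p \<xi>\<bar>"] unif_integral[OF S, of "\<lambda>\<xi>. \<bar>q \<xi>\<bar>"] S by (simp_all add: p0 q0 abs_mult)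
  have iap: "integrable lborel (\<lambda>\<xi>. \<bar>p \<xi>\<bar>)" "integrable lborel (\<lambda>\<xi>. \<bar>q \<xi>\<bar>)"
    by (rule comp[of _ C]; use pC qC in \<open>auto simp: p0 q0\<close>)+
  have "(\<integral>\<xi>. \<bar>p \<xi>\<bar> \<partial>lborel) + (\<integral>\<xi>. \<bar>q \<xi>\<bar> \<partial>lborel) = (\<integral>\<xi>. \<bar>p \<xi>\<bar> + \<bar>q \<xi>\<bar> \<partial>lborel)" using iap by simp
  also have "\<dots> \<le> (\<integral>\<xi>. wt1 1 \<xi> + ((p \<xi>)\<^sup>2 + (q \<xi>)\<^sup>2) / 2 + ((- (\<xi> * q \<xi>))\<^sup>2 + (\<xi> * p \<xi>)\<^sup>2) / 2 \<partial>lborel)"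
  proof (rule integral_mono)
    show "integrable lborel (\<lambda>\<xi>. \<bar>p \<xi>\<bar> + \<bar>q \<xi>\<bar>)" using iap by simp
    show "integrable lborel (\<lambda>\<xi>. wt1 1 \<xi> + ((p \<xi>)\<^sup>2 + (q \<xi>)\<^sup>2) / 2 + ((- (\<xi> * q \<xi>))\<^sup>2 + (\<xi> * p \<xi>)\<^sup>2) / 2)"
      by (intro Bochner_Integration.integrable_add integrable_divide iw ip ip1)
    show "\<bar>p \<xi>\<bar> + \<bar>q \<xi>\<bar> \<le> wt1 1 \<xi> + ((p \<xi>)\<^sup>2 + (q \<xi>)\<^sup>2) / 2 + ((- (\<xi> * q \<xi>))\<^sup>2 + (\<xi> * p \<xi>)\<^sup>2) / 2" for \<xi>
      using pt[of "p \<xi>" \<xi>] pt[of "q \<xi>" \<xi>] by (simp add: field_simps)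
  qed
  also have "\<dots> = (\<integral>\<xi>. wt1 1 \<xi> \<partial>lborel) + (\<integral>\<xi>. (p \<xi>)\<^sup>2 + (q \<xi>)\<^sup>2 \<partial>lborel) / 2 + (\<integral>\<xi>. (- (\<xi> * q \<xi>))\<^sup>2 + (\<xi> * p \<xi>)\<^sup>2 \<partial>lborel) / 2"
  proof -
    have i: "integrable lborel (\<lambda>\<xi>. ((p \<xi>)\<^sup>2 + (q \<xi>)\<^sup>2) / 2)" "integrable lborel (\<lambda>\<xi>. ((- (\<xi> * q \<xi>))\<^sup>2 + (\<xi> * p \<xi>)\<^sup>2) / 2)"
      by (rule integrable_divide, rule ip, rule integrable_divide, rule ip1)
    show ?thesis
      by (simp only: Bochner_Integration.integral_add[OF Bochner_Integration.integrable_add[OF iw i(1)] i(2)]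
          Bochner_Integration.integral_add[OF iw i(1)] integral_divide_zero)
  qed
  also have "\<dots> \<le> (\<integral>\<xi>. wt1 1 \<xi> \<partial>lborel) + nsq 1 v (\<lambda>i. partial i v)"
  proof -
    have a1: "(\<integral>\<xi>. (p \<xi>)\<^sup>2 + (q \<xi>)\<^sup>2 \<partial>lborel) \<ge> 0" "(\<integral>\<xi>. (- (\<xi> * q \<xi>))\<^sup>2 + (\<xi> * p \<xi>)\<^sup>2 \<partial>lborel) \<ge> 0"
      by (intro integral_nonneg_AE; simp)+
    have pi1: "2 * pi \<ge> 1" using pi_ge_two by linarith
    have "1 * (\<integral>\<xi>. (p \<xi>)\<^sup>2 + (q \<xi>)\<^sup>2 \<partial>lborel) \<le> 2 * pi * (\<integral>\<xi>. (p \<xi>)\<^sup>2 + (q \<xi>)\<^sup>2 \<partial>lborel)"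
      "1 * (\<integral>\<xi>. (- (\<xi> * q \<xi>))\<^sup>2 + (\<xi> * p \<xi>)\<^sup>2 \<partial>lborel) \<le> 2 * pi * (\<integral>\<xi>. (- (\<xi> * q \<xi>))\<^sup>2 + (\<xi> * p \<xi>)\<^sup>2 \<partial>lborel)"
      by (rule mult_right_mono[OF pi1 a1(1)], rule mult_right_mono[OF pi1 a1(2)])
    then show ?thesis unfolding n using h.plancherel_le[OF V1(1)] h1.plancherel_le[OF V2(1)] a1 by linarith
  qed
  finally have L: "(\<integral>\<xi>. \<bar>2 * S * p \<xi>\<bar> \<partial>unif S) + (\<integral>\<xi>. \<bar>2 * S * q \<xi>\<bar> \<partial>unif S) \<le> (\<integral>\<xi>. wt1 1 \<xi> \<partial>lborel) + nsq 1 v (\<lambda>i. partial i v)"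
    unfolding pp .
  have "bar cos 1 (\<bar>1\<bar> * S) v ((\<integral>\<xi>. \<bar>2 * S * p \<xi>\<bar> \<partial>unif S) + (\<integral>\<xi>. \<bar>2 * S * q \<xi>\<bar> \<partial>unif S))"
    unfolding ve[abs_def]
    by (intro bar_add nice_trig(1) barI[OF parp nice_trig(1) order_refl] barI[OF parq nice_trig(1) order_refl]) auto
  then have "bar cos 1 (R + 1) v ((\<integral>\<xi>. wt1 1 \<xi> \<partial>lborel) + nsq 1 v (\<lambda>i. partial i v))"
    by (rule bar_mono) (use L in \<open>auto simp: S_def\<close>)
  then show ?thesis using Vu by blast
qed

text \<open>As \<open>\<delta>\<close> tends to 0 the taper tends to 1 and its derivative to 0, so
  the tapered functions converge to \<open>u\<close> in H1. The bound on their Barron norm refers to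
  their own H1 norm and therefore does not deteriorate on the way.\<close>

lemma band_limited_approx:
  assumes u: "bar cos 1 R u l" and uL: "u \<in> L2 1" and duL: "partial 0 u \<in> L2 1" and \<epsilon>: "\<epsilon> > 0"
  obtains v where "bar cos 1 (R + 1) v ((\<integral>\<xi>. wt1 1 \<xi> \<partial>lborel) + nsq 1 v (\<lambda>i. partial i v))"
    and "v \<in> L2 1" "partial 0 v \<in> L2 1" "nsq 1 (\<lambda>x. v x - u x) (\<lambda>i x. partial i v x - partial i u x) \<le> \<epsilon>"
proof -
  interpret act: barron_act cos 1 1 1 1 by (rule barron_act_cos)
  have us: "smooth 1 u" by (rule act.bar_smooth[OF u])
  define \<delta> where "\<delta> = (\<lambda>n. 1 / real (Suc n))"
  have \<delta>: "0 < \<delta> n" "\<delta> n \<le> 1" for n by (auto simp: \<delta>_def)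
  have "\<forall>n. \<exists>v. bar cos 1 (R + 1) v ((\<integral>\<xi>. wt1 1 \<xi> \<partial>lborel) + nsq 1 v (\<lambda>i. partial i v)) \<and>
     (\<forall>x\<in>euclid 1. v x = tap (\<delta> n * x 0) * u x)"
    using taper_band_limited[OF u uL duL \<delta>] by blast
  then obtain v where vb: "\<And>n. bar cos 1 (R + 1) (v n) ((\<integral>\<xi>. wt1 1 \<xi> \<partial>lborel) + nsq 1 (v n) (\<lambda>i. partial i (v n)))"
    and ve: "\<And>n x. x\<in>euclid 1 \<Longrightarrow> v n x = tap (\<delta> n * x 0) * u x"
    by (auto dest!: choice)
  note ts = tap_partial[OF \<delta>(1)]
  have dv: "partial 0 (v n) x = partial 0 (\<lambda>x. tap (\<delta> n * x 0)) x * u x + tap (\<delta> n * x 0) * partial 0 u x" if "x \<in> euclid 1" for x n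
    using partial_cong[OF that _ ve, of 0] partial_mult[OF ts(3) us _ that, of 0] by simp
  have vs: "smooth 1 (v n)" for n by (rule act.bar_smooth[OF vb])
  have L2c: "g \<in> L2 1" if "h \<in> L2 1" "smooth 1 g" "\<And>x. x \<in> euclid 1 \<Longrightarrow> g x = h x" for g h
  proof -
    have "integrable (leb 1) (\<lambda>x. (g x)\<^sup>2) = integrable (leb 1) (\<lambda>x. (h x)\<^sup>2)"
      by (intro Bochner_Integration.integrable_cong refl) (simp only: space_leb that(3))
    then show ?thesis using that(1) smooth_measurable[OF that(2)] by (simp add: L2_def)
  qed
  have vL: "v n \<in> L2 1" for n
    by (rule L2c[OF _ vs ve], rule L2_bounded_mult[OF uL smooth_measurable[OF ts(3)] tap_bound])
  have dvL: "partial 0 (v n) \<in> L2 1" for n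
    by (rule L2c[OF _ smooth_partial[OF vs] dv], intro L2_add L2_bounded_mult[OF uL smooth_measurable[OF smooth_partial[OF ts(3)]] ts(2)]
          L2_bounded_mult[OF duL smooth_measurable[OF ts(3)] tap_bound]) simp_all
  let ?f = "\<lambda>n x. (v n x - u x)\<^sup>2 + (\<Sum>i<1. (partial i (v n) x - partial i u x)\<^sup>2)"
  have dl: "\<delta> \<longlonglongrightarrow> 0" unfolding \<delta>_def by (rule LIMSEQ_Suc[OF lim_1_over_n])
  have tl: "(\<lambda>n. tap (\<delta> n * y)) \<longlonglongrightarrow> 1" for y unfolding \<delta>_def by (rule tap_tendsto)
  have s2: "(r + s)\<^sup>2 \<le> 2 * r\<^sup>2 + 2 * s\<^sup>2" for r s :: real
    using sum_squares_bound[of r s] by (simp add: power2_sum)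
  have sq: "(k * y)\<^sup>2 \<le> K\<^sup>2 * y\<^sup>2" if "\<bar>k\<bar> \<le> K" for k K y :: real
    using power_mono[OF that abs_ge_zero, of 2] by (simp add: power_mult_distrib mult_right_mono)
  have t2: "\<bar>tap y - 1\<bar> \<le> 2" for y using tap_bound[of y] by linarith
  have "(\<lambda>n. \<integral>x. ?f n x \<partial>leb 1) \<longlonglongrightarrow> (\<integral>x. 0 \<partial>leb 1)"
  \<comment> \<open>From \<open>|tap - 1| \<le> 2\<close> comes \<open>4 u^2\<close>; the square of
    the derivative gives \<open>2 u^2\<close> and 8 times the square of the derivative of
    \<open>u\<close>, by \<open>(r + s)^2 \<le> 2 r^2 + 2 s^2\<close>.\<close>
  proof (rule integral_dominated_convergence[where w = "\<lambda>x. 6 * (u x)\<^sup>2 + 8 * (partial 0 u x)\<^sup>2"])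
    show "?f n \<in> borel_measurable (leb 1)" for n
      using L2_measurable[OF vL] L2_measurable[OF dvL] L2_measurable[OF uL] L2_measurable[OF duL] by simp
    show "integrable (leb 1) (\<lambda>x. 6 * (u x)\<^sup>2 + 8 * (partial 0 u x)\<^sup>2)"
      by (intro Bochner_Integration.integrable_add integrable_mult_right L2_integrable_sq uL duL)
    have fe: "?f n x = ((tap (\<delta> n * x 0) - 1) * u x)\<^sup>2 + (partial 0 (\<lambda>x. tap (\<delta> n * x 0)) x * u x + (tap (\<delta> n * x 0) - 1) * partial 0 u x)\<^sup>2"
      if "x \<in> euclid 1" for n x
      using ve[OF that] dv[OF that] by (simp add: algebra_simps)
    show "AE x in leb 1. (\<lambda>n. ?f n x) \<longlonglongrightarrow> 0"
    proof (rule AE_I2)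
      fix x assume "x \<in> space (leb 1)"
      then have x: "x \<in> euclid 1" by (simp add: space_leb)
      have "(\<lambda>n. partial 0 (\<lambda>x. tap (\<delta> n * x 0)) x) \<longlonglongrightarrow> 0"
        by (rule Lim_null_comparison[OF _ dl]) (use ts(2) in auto)
      then have "(\<lambda>n. ((tap (\<delta> n * x 0) - 1) * u x)\<^sup>2 + (partial 0 (\<lambda>x. tap (\<delta> n * x 0)) x * u x + (tap (\<delta> n * x 0) - 1) * partial 0 u x)\<^sup>2)
          \<longlonglongrightarrow> ((1 - 1) * u x)\<^sup>2 + (0 * u x + (1 - 1) * partial 0 u x)\<^sup>2"
        by (intro tendsto_intros tl)
      then show "(\<lambda>n. ?f n x) \<longlonglongrightarrow> 0" unfolding fe[OF x] by simp
    qed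
    show "AE x in leb 1. norm (?f n x) \<le> 6 * (u x)\<^sup>2 + 8 * (partial 0 u x)\<^sup>2" for n
    proof (rule AE_I2)
      fix x assume "x \<in> space (leb 1)"
      then have x: "x \<in> euclid 1" by (simp add: space_leb)
      have d1: "\<bar>partial 0 (\<lambda>x. tap (\<delta> n * x 0)) x\<bar> \<le> 1" using ts(2)[of n x] \<delta>(2)[of n] by linarith
      have "?f n x \<le> 2\<^sup>2 * (u x)\<^sup>2 + (2 * (1\<^sup>2 * (u x)\<^sup>2) + 2 * (2\<^sup>2 * (partial 0 u x)\<^sup>2))"
        unfolding fe[OF x] by (intro add_mono sq t2 d1 order_trans[OF s2] mult_left_mono) auto
      moreover have "0 \<le> ?f n x" by (intro add_nonneg_nonneg sum_nonneg) auto
      ultimately show "norm (?f n x) \<le> 6 * (u x)\<^sup>2 + 8 * (partial 0 u x)\<^sup>2" by simp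
    qed
  qed simp
  then have "(\<lambda>n. nsq 1 (\<lambda>x. v n x - u x) (\<lambda>i x. partial i (v n) x - partial i u x)) \<longlonglongrightarrow> 0"
    unfolding nsq_def by simp
  then have "eventually (\<lambda>n. nsq 1 (\<lambda>x. v n x - u x) (\<lambda>i x. partial i (v n) x - partial i u x) < \<epsilon>) sequentially"
    using \<epsilon> by (rule order_tendstoD(2))
  then obtain n where n: "nsq 1 (\<lambda>x. v n x - u x) (\<lambda>i x. partial i (v n) x - partial i u x) < \<epsilon>"
    using eventually_happens'[OF sequentially_bot] by blast
  show ?thesis by (rule that[OF vb vL dvL less_imp_le[OF n]])
qed

section \<open>Rates and the main theorem\<close>

text \<open>Since \<open>\<epsilon> < 1/2\<close> keeps \<open>|ln \<epsilon>|\<close> above 1/2,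
  additive constants can be absorbed into multiples of it.\<close>

lemma abs_ln_ge: "0 < (\<epsilon> :: real) \<Longrightarrow> \<epsilon> < 1/2 \<Longrightarrow> 1 \<le> 2 * \<bar>ln \<epsilon>\<bar> \<and> exp (- \<bar>ln \<epsilon>\<bar>) = \<epsilon>"
proof -
  assume e: "0 < \<epsilon>" "\<epsilon> < (1/2::real)"
  have "ln \<epsilon> \<le> ln (1/2)" using e by simp
  also have "ln (1/2) \<le> (- 1/2 :: real)" using ln_le_minus_one[of "1/2 :: real"] by simp
  finally have l: "ln \<epsilon> \<le> -1/2" .
  then have "\<bar>ln \<epsilon>\<bar> = - ln \<epsilon>" by linarith
  then show ?thesis using l e by simp
qed

text \<open>The initial error \<open>B\<close> has to be beaten as well. With
  \<open>L = |ln \<epsilon>|\<close> it is at most \<open>exp B \<le> exp (2 * B * L)\<close>, so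
  \<open>T\<close> is chosen such that the power is at most
  \<open>exp (- L - 2 * B * L)\<close>.\<close>

lemma iteration_count:
  fixes \<rho> B :: real
  assumes \<rho>: "0 \<le> \<rho>" "\<rho> < 1" and B: "0 \<le> B"
  obtains K where "K > 0" "\<And>\<epsilon>. 0 < \<epsilon> \<Longrightarrow> \<epsilon> < 1/2 \<Longrightarrow> \<exists>T. \<rho> ^ T * B \<le> \<epsilon> \<and> real T \<le> K * \<bar>ln \<epsilon>\<bar>"
proof -
  \<comment> \<open>\<open>\<rho>\<close> may be 0, and the logarithm of the base is taken
    below.\<close>
  define r where "r = max \<rho> (1/2)"
  have r: "0 < r" "r < 1" "\<rho> \<le> r" using \<rho> by (auto simp: r_def)
  define \<kappa> where "\<kappa> = - ln r"
  have \<kappa>: "\<kappa> > 0" using r by (simp add: \<kappa>_def)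
  define K0 where "K0 = (1 + 2 * B) / \<kappa>"
  have K0: "K0 > 0" using \<kappa> B by (simp add: K0_def)
  show ?thesis
  \<comment> \<open>The 2 pays for rounding up, by \<open>1 \<le> 2 * L\<close>.\<close>
  proof (rule that[of "K0 + 2"])
    fix \<epsilon> :: real assume e: "0 < \<epsilon>" "\<epsilon> < 1/2"
    define L where "L = \<bar>ln \<epsilon>\<bar>"
    have L: "1 \<le> 2 * L" "exp (- L) = \<epsilon>" using abs_ln_ge[OF e] by (auto simp: L_def)
    define T where "T = nat \<lceil>K0 * L\<rceil>"
    have KL: "0 \<le> K0 * L" using K0 L by (intro mult_nonneg_nonneg) auto
    have T: "K0 * L \<le> real T" "real T \<le> K0 * L + 1" using KL unfolding T_def by linarith+
    have "\<rho> ^ T \<le> r ^ T" using \<rho> r by (intro power_mono) auto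
    also have "r ^ T = exp (- \<kappa> * real T)" using r by (simp add: \<kappa>_def exp_of_nat_mult mult.commute)
    also have "\<dots> \<le> exp (- \<kappa> * (K0 * L))" using \<kappa> T by (simp add: mult_left_mono)
    also have "- \<kappa> * (K0 * L) = - L - 2 * B * L" using \<kappa> by (simp add: K0_def field_simps)
    finally have 1: "\<rho> ^ T \<le> exp (- L - 2 * B * L)" .
    have "B \<le> exp B" using exp_ge_add_one_self[of B] by linarith
    also have "\<dots> \<le> exp (2 * B * L)" using mult_left_mono[OF L(1) B] by (simp add: mult_ac)
    finally have "\<rho> ^ T * B \<le> exp (- L - 2 * B * L) * exp (2 * B * L)" using 1 B \<rho> by (intro mult_mono) auto
    also have "\<dots> = \<epsilon>" unfolding exp_add[symmetric] using L(2) by simp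
    finally have "\<rho> ^ T * B \<le> \<epsilon>" .
    moreover have "real T \<le> (K0 + 2) * L" using T(2) L(1) by (simp add: distrib_right)
    ultimately show "\<exists>T. \<rho> ^ T * B \<le> \<epsilon> \<and> real T \<le> (K0 + 2) * \<bar>ln \<epsilon>\<bar>" unfolding L_def by blast
  qed (use K0 in simp)
qed

section \<open>From the hypotheses to the locales\<close>

lemma bar_euclid_1:
  assumes g: "bar \<sigma> 1 R (\<lambda>y. g (y 0)) l"
  shows "\<exists>(Q :: (real \<times> vec \<times> real) measure) a p b. prob_space Q \<and> integrable Q a \<and>
        p \<in> borel_measurable Q \<and> b \<in> borel_measurable Q \<and>
        (\<forall>y\<in>space Q. \<bar>p y\<bar> \<le> R) \<and> (\<integral>y. \<bar>a y\<bar> \<partial>Q) \<le> l \<and>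
        (\<forall>s. g s = (\<integral>y. a y * \<sigma> (p y * s + b y) \<partial>Q))"
proof -
  obtain M :: "(real \<times> vec \<times> real) measure" and a w b
    where p: "params M 1 R a w b" and l: "(\<integral>m. \<bar>a m\<bar> \<partial>M) \<le> l" and gx: "\<And>x. x \<in> euclid 1 \<Longrightarrow> g (x 0) = ridge M 1 a w b \<sigma> x"
    using barE[OF g] by blast
  have "g s = (\<integral>y. a y * \<sigma> (w y 0 * s + b y) \<partial>M)" for s
    using gx[of "\<lambda>i\<in>{..<1}. s"] by (simp add: ridge_def vdot_def)
  then show ?thesis using p l params_component_bound[OF p, of 0]
    by (intro exI[of _ M] exI[of _ a] exI[of _ "\<lambda>y. w y 0"] exI[of _ b]) (simp add: params_def)
qed

lemma bar_euclid_2: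
  assumes g: "bar \<sigma> 2 R (\<lambda>y. g (y 0) (y 1)) l"
  shows "\<exists>(Q :: (real \<times> vec \<times> real) measure) a p q b. prob_space Q \<and> integrable Q a \<and>
        p \<in> borel_measurable Q \<and> q \<in> borel_measurable Q \<and> b \<in> borel_measurable Q \<and>
        (\<forall>y\<in>space Q. \<bar>p y\<bar> \<le> R \<and> \<bar>q y\<bar> \<le> R) \<and> (\<integral>y. \<bar>a y\<bar> \<partial>Q) \<le> l \<and>
        (\<forall>s t. g s t = (\<integral>y. a y * \<sigma> (p y * s + q y * t + b y) \<partial>Q))"
proof -
  obtain M :: "(real \<times> vec \<times> real) measure" and a w b
    where p: "params M 2 R a w b" and l: "(\<integral>m. \<bar>a m\<bar> \<partial>M) \<le> l" and gx: "\<And>x. x \<in> euclid 2 \<Longrightarrow> g (x 0) (x 1) = ridge M 2 a w b \<sigma> x"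
    using barE[OF g] by blast
  have "g s t = (\<integral>y. a y * \<sigma> (w y 0 * s + w y 1 * t + b y) \<partial>M)" for s t
    using gx[of "\<lambda>i\<in>{..<2}. if i = 0 then s else t"] by (simp add: ridge_def vdot_def numeral_2_eq_2)
  then show ?thesis using p l params_component_bound[OF p, of 0] params_component_bound[OF p, of 1]
    by (intro exI[of _ M] exI[of _ a] exI[of _ "\<lambda>y. w y 0"] exI[of _ "\<lambda>y. w y 1"] exI[of _ b]) (simp add: params_def)
qed

lemma Act_nice:
  assumes "Act \<sigma>" shows "smooth1 \<sigma>" "nice \<sigma>" "nice (deriv \<sigma>)" "nice (deriv (deriv \<sigma>))"
proof -
  show s: "smooth1 \<sigma>" using assms by (simp add: Act_def smooth1_def)
  show "nice \<sigma>" "nice (deriv \<sigma>)" "nice (deriv (deriv \<sigma>))"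
    using assms smooth1_continuous[OF s] smooth1_continuous[OF smooth1_deriv[OF s]] smooth1_continuous[OF smooth1_deriv[OF smooth1_deriv[OF s]]]
    by (auto simp: Act_def nice_def)
qed

lemma barron_act_general:
  assumes a: "Act \<sigma>" and m: "Mult \<sigma> Rm lm" and D: "Deriv \<sigma> Rd1 Rd2 ld1 ld2"
  shows "barron_act \<sigma> Rm (lm + 1) Rd1 (ld1 + 1)"
proof
  note n = Act_nice[OF a]
  show "smooth1 \<sigma>" "nice \<sigma>" "nice (deriv \<sigma>)" "nice (deriv (deriv \<sigma>))" by (fact n)+
  show "\<exists>(Q :: (real \<times> vec \<times> real) measure) a p q b. prob_space Q \<and> integrable Q a \<and>
        p \<in> borel_measurable Q \<and> q \<in> borel_measurable Q \<and> b \<in> borel_measurable Q \<and>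
        (\<forall>y\<in>space Q. \<bar>p y\<bar> \<le> Rm \<and> \<bar>q y\<bar> \<le> Rm) \<and> (\<integral>y. \<bar>a y\<bar> \<partial>Q) \<le> lm + 1 \<and>
        (\<forall>s t. \<sigma> s * \<sigma> t = (\<integral>y. a y * \<sigma> (p y * s + q y * t + b y) \<partial>Q))"
    by (rule bar_euclid_2, rule barron_norm_bar) (use m n in \<open>auto simp: Mult_def\<close>)
  show "\<exists>(Q :: (real \<times> vec \<times> real) measure) a p b. prob_space Q \<and> integrable Q a \<and>
        p \<in> borel_measurable Q \<and> b \<in> borel_measurable Q \<and>
        (\<forall>y\<in>space Q. \<bar>p y\<bar> \<le> Rd1) \<and> (\<integral>y. \<bar>a y\<bar> \<partial>Q) \<le> ld1 + 1 \<and>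
        (\<forall>s. deriv \<sigma> s = (\<integral>y. a y * \<sigma> (p y * s + b y) \<partial>Q))"
    by (rule bar_euclid_1, rule barron_norm_bar) (use D n in \<open>auto simp: Deriv_def\<close>)
qed

lemma barron_elliptic_intro:
  assumes act: "barron_act \<sigma> \<kappa> Lm \<kappa>d Ld" and co: "Coeff d A c f amin amax cmin cmax"
    and bc: "Barron_Coeff \<sigma> d A c f RA Rc Rf lA lc lf" and sol: "weak_solution d A c f us" and d: "d \<ge> 1"
  shows "barron_elliptic \<sigma> \<kappa> Lm \<kappa>d Ld d A c f us amin amax cmin cmax RA Rc Rf (lA + 1) (lc + 1) (lf + 1)"
proof -
  interpret barron_act \<sigma> \<kappa> Lm \<kappa>d Ld by (rule act)
  have A: "bar \<sigma> d RA (\<lambda>x. A x i j) (lA + 1)" if "i < d" "j < d" for i j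
  proof (rule barron_norm_bar[OF _ _ _ n0])
    have "barron_norm \<sigma> 1 (ennreal RA) d (euclid d) (\<lambda>x. A x i j)
        \<le> Max ((\<lambda>(i, j). barron_norm \<sigma> 1 (ennreal RA) d (euclid d) (\<lambda>x. A x i j)) ` ({..<d} \<times> {..<d}))"
      using that by (intro Max_ge) auto
    then show "barron_norm \<sigma> 1 (ennreal RA) d (euclid d) (\<lambda>x. A x i j) \<le> ennreal lA"
      using bc by (simp add: Barron_Coeff_def)
  qed (use bc in \<open>auto simp: Barron_Coeff_def\<close>)
  have c: "bar \<sigma> d Rc c (lc + 1)" and f: "bar \<sigma> d Rf f (lf + 1)"
    using bc by (auto simp: Barron_Coeff_def intro!: barron_norm_bar n0)
  show ?thesis
    by unfold_locales (use co sol A c f bar_smooth bar_bddf in blast)+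
qed

context barron_elliptic
begin

lemma error_H1:
  assumes u: "bar \<sigma> d R u l" "u \<in> L2 d" "\<And>i. i < d \<Longrightarrow> partial i u \<in> L2 d"
  shows "H1_rep d (\<lambda>x. u x - us x) (\<lambda>i x. partial i u x - wpartial d i us x)"
  using H1_rep_lin[OF H1_rep_smooth[OF bar_smooth[OF u(1)] u(2,3)] sol_rep, of "-1"] by simp

lemma conclude:
  assumes u: "bar \<sigma> d R u l" and R: "R \<le> r" and l: "l \<le> b" and H: "(\<lambda>x. u x - us x) \<in> H1 d" "H1_norm d (\<lambda>x. u x - us x) \<le> \<epsilon>"
  shows "\<exists>R\<ge>0. \<exists>u\<in>barron_space \<sigma> 1 (ennreal R) d (euclid d). R \<le> r \<and>
     enn2real (barron_norm \<sigma> 1 (ennreal R) d (euclid d) u) \<le> b \<and>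
     (\<lambda>x. u x - us x) \<in> H1 d \<and> H1_norm d (\<lambda>x. u x - us x) \<le> \<epsilon>"
proof (intro exI[of _ R] conjI bexI[of _ u])
  have n: "barron_norm \<sigma> 1 (ennreal R) d (euclid d) u \<le> ennreal l" by (rule bar_barron_norm[OF u n0])
  then show "u \<in> barron_space \<sigma> 1 (ennreal R) d (euclid d)"
    unfolding barron_space_def by (simp add: order_le_less_trans[OF n])
  show "enn2real (barron_norm \<sigma> 1 (ennreal R) d (euclid d) u) \<le> b"
    using enn2real_leI[OF bar_l_nonneg[OF u] n] l by linarith
  show "R \<ge> 0" by (rule bar_R_nonneg[OF u])
qed (use R H in auto)

end

text \<open>The constant \<open>M\<close> of \<open>elliptic\<close>, available before the dimension
  and the coefficients are chosen.\<close>

definition lip :: "real \<Rightarrow> real \<Rightarrow> real \<Rightarrow> real \<Rightarrow> real" where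
  "lip amin amax cmin cmax = \<bar>amax\<bar> + \<bar>cmax\<bar> + min amin cmin"

text \<open>One step is affine in the radius, with both coefficients at most \<open>K\<close>. For
  \<open>1 + Rt t\<close> it is multiplicative; doubling \<open>K\<close> absorbs the additional
  1.\<close>

lemma growth_radius:
  fixes Rt :: "nat \<Rightarrow> real"
  assumes "Rt 0 = 0" "\<And>t. Rt (Suc t) = \<kappa> * (Rc + Rt t) + Rf + \<kappa>d * (\<kappa> * (RA + \<kappa>d * Rt t)) + Rt t"
    and nn: "0 \<le> \<kappa>" "0 \<le> Rc" "0 \<le> Rf" "0 \<le> \<kappa>d" "0 \<le> RA"
    and K: "\<kappa> * (Rc + 1) + Rf + \<kappa>d * (\<kappa> * (RA + \<kappa>d)) + 1 \<le> K"
  shows "0 \<le> Rt t \<and> 1 + Rt t \<le> (2 * K) ^ t"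
proof (induction t)
  case (Suc t)
  then have R: "0 \<le> Rt t" and IH: "1 + Rt t \<le> (2 * K) ^ t" by auto
  have K1: "1 \<le> K" using K nn by (smt (verit) mult_nonneg_nonneg)
  have nn2: "0 \<le> \<kappa> * Rc" "0 \<le> \<kappa>d * (\<kappa> * RA)" "0 \<le> \<kappa>" "0 \<le> \<kappa>d * (\<kappa> * \<kappa>d)" using nn by auto
  have e: "Rt (Suc t) = (\<kappa> * Rc + Rf + \<kappa>d * (\<kappa> * RA)) + (\<kappa> + \<kappa>d * (\<kappa> * \<kappa>d) + 1) * Rt t"
    unfolding assms(2) by (simp add: algebra_simps)
  have p: "0 \<le> Rt (Suc t)" unfolding e using nn nn2 R by simp
  have a: "\<kappa> * Rc + Rf + \<kappa>d * (\<kappa> * RA) \<le> K" "\<kappa> + \<kappa>d * (\<kappa> * \<kappa>d) + 1 \<le> K"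
  proof -
    have "\<kappa> * Rc + \<kappa> + Rf + \<kappa>d * (\<kappa> * RA) + \<kappa>d * (\<kappa> * \<kappa>d) + 1 \<le> K" using K by (simp add: algebra_simps)
    then show "\<kappa> * Rc + Rf + \<kappa>d * (\<kappa> * RA) \<le> K" "\<kappa> + \<kappa>d * (\<kappa> * \<kappa>d) + 1 \<le> K"
      using nn nn2 by linarith+
  qed
  have "Rt (Suc t) \<le> K + K * Rt t" unfolding e using a R by (intro add_mono mult_right_mono) auto
  moreover have "0 \<le> K * Rt t" using K1 R by simp
  ultimately have "1 + Rt (Suc t) \<le> 2 * K * (1 + Rt t)"
    using K1 by (simp only: distrib_left mult_1_right mult.assoc)
  also have "\<dots> \<le> 2 * K * (2 * K) ^ t" using IH K1 by (intro mult_left_mono) auto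
  finally show ?case using p by simp
qed (simp add: assms(1))

text \<open>The radius, at most \<open>E ^ t\<close>, enters step \<open>t\<close> squared. The
  exponents \<open>2 * t\<close> accumulate to order \<open>t^2\<close>, for which
  \<open>2 * t * t\<close> is a convenient majorant.\<close>

lemma growth_norm:
  fixes lt Rt :: "nat \<Rightarrow> real"
  assumes l0: "lt 0 = 0" and lS: "\<And>t. lt (Suc t) \<le> E * (real d)\<^sup>2 * (1 + Rt t)\<^sup>2 * (1 + lt t) - 1" "\<And>t. 0 \<le> lt t"
    and R: "\<And>t. 0 \<le> Rt t \<and> 1 + Rt t \<le> E ^ t" and E: "1 \<le> E" and d: "d \<ge> 1"
  shows "1 + lt t \<le> (E * (real d)\<^sup>2) ^ t * E ^ (2 * t * t)"
proof (induction t)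
  case (Suc t)
  have R1: "(1 + Rt t)\<^sup>2 \<le> (E ^ t)\<^sup>2" using R[of t] by (intro power_mono) auto
  have "1 + lt (Suc t) \<le> E * (real d)\<^sup>2 * (1 + Rt t)\<^sup>2 * (1 + lt t)" using lS(1)[of t] by linarith
  also have "\<dots> \<le> E * (real d)\<^sup>2 * (E ^ t)\<^sup>2 * ((E * (real d)\<^sup>2) ^ t * E ^ (2 * t * t))"
    using E R1 Suc lS(2)[of t] by (intro mult_mono mult_left_mono mult_nonneg_nonneg) auto
  also have "\<dots> = (E * (real d)\<^sup>2) ^ Suc t * E ^ (2 * t + 2 * t * t)"
    by (simp add: power_add power_mult[symmetric] mult_ac)
  also have "\<dots> \<le> (E * (real d)\<^sup>2) ^ Suc t * E ^ (2 * Suc t * Suc t)"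
    using E by (intro mult_left_mono power_increasing) auto
  finally show ?case .
qed (simp add: l0)

lemma power_exp_ln: "0 < x \<Longrightarrow> x ^ n = exp (real n * ln x)"
  by (simp add: exp_of_nat_mult)

text \<open>\<open>T^2\<close> is of order \<open>|ln \<epsilon>|\<close> times
  \<open>ln (1 / \<epsilon>)\<close>: one logarithm stays in the exponent and the other one goes
  into the base \<open>d / \<epsilon>\<close>.\<close>

lemma final_bounds_general:
  assumes E: "1 \<le> E" and K: "0 < K" and T: "real T \<le> K * \<bar>ln \<epsilon>\<bar>" and e: "0 < \<epsilon>" "\<epsilon> < 1/2" and d: "d \<ge> 1"
  shows "E ^ T \<le> 1 * (1 / \<epsilon>) powr (K * ln E)"
    and "(E * (real d)\<^sup>2) ^ T * E ^ (2 * T * T) \<le> 1 * (real d / \<epsilon>) powr ((2 * K + 2 * K * ln E + 2 * K\<^sup>2 * ln E) * \<bar>ln \<epsilon>\<bar>)"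
proof -
  define L where "L = \<bar>ln \<epsilon>\<bar>"
  have L: "1 \<le> 2 * L" "ln \<epsilon> = - L"
  proof -
    show "1 \<le> 2 * L" using abs_ln_ge[OF e] by (simp add: L_def)
    have "ln \<epsilon> < 0" using e by simp
    then show "ln \<epsilon> = - L" by (simp add: L_def)
  qed
  have lE: "0 \<le> ln E" using E by simp
  have T': "real T \<le> K * L" using T by (simp add: L_def)
  have "E ^ T = exp (real T * ln E)" using E by (simp add: power_exp_ln)
  also have "\<dots> \<le> exp (K * L * ln E)" using mult_right_mono[OF T' lE] by simp
  also have "\<dots> = (1 / \<epsilon>) powr (K * ln E)" using e L(2) by (simp add: powr_def ln_div mult_ac)
  finally show "E ^ T \<le> 1 * (1 / \<epsilon>) powr (K * ln E)" by simp
  have ld: "0 \<le> ln (real d)" using d by simp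
  have dp: "0 < real d" using d by simp
  have "(E * (real d)\<^sup>2) ^ T * E ^ (2 * T * T) = exp (real T * (ln E + 2 * ln (real d))) * exp (real (2 * T * T) * ln E)"
    using E dp by (simp add: power_exp_ln ln_mult ln_realpow)
  also have "\<dots> = exp (real T * ln E + 2 * real T * ln (real d) + 2 * real T * real T * ln E)"
    by (simp add: exp_add[symmetric] algebra_simps)
  also have "\<dots> \<le> exp ((2 * K + 2 * K * ln E + 2 * K\<^sup>2 * ln E) * L * (ln (real d) + L))"
  proof -
    have L0: "0 \<le> L" using L by simp
    have a1: "real T * ln E \<le> 2 * K * ln E * L * L"
    proof -
      have "real T * ln E \<le> K * L * ln E" by (rule mult_right_mono[OF T' lE])
      also have "\<dots> = (K * L * ln E) * 1" by simp
      also have "\<dots> \<le> (K * L * ln E) * (2 * L)" using K L0 lE L(1) by (intro mult_left_mono mult_nonneg_nonneg) auto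
      finally show ?thesis by (simp add: mult_ac)
    qed
    have a2: "2 * real T * ln (real d) \<le> 2 * K * L * ln (real d)"
      using mult_right_mono[OF T' ld] by (simp add: mult_ac)
    have TT: "real T * real T \<le> (K * L) * (K * L)" using T' K L0 by (intro mult_mono) auto
    have a3: "2 * real T * real T * ln E \<le> 2 * K\<^sup>2 * ln E * L * L"
      using mult_right_mono[OF TT lE] by (simp add: power2_eq_square mult_ac)
    \<comment> \<open>The nonnegative terms that complete the sum to the product with
      \<open>ln (real d) + L\<close>.\<close>
    have n: "0 \<le> (2 * K * ln E + 2 * K\<^sup>2 * ln E) * L * ln (real d)" "0 \<le> 2 * K * L * L"
      using K lE L0 ld by auto
    have "real T * ln E + 2 * real T * ln (real d) + 2 * real T * real T * ln E
        \<le> 2 * K * ln E * L * L + 2 * K * L * ln (real d) + 2 * K\<^sup>2 * ln E * L * L" using a1 a2 a3 by linarith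
    also have "\<dots> \<le> \<dots> + ((2 * K * ln E + 2 * K\<^sup>2 * ln E) * L * ln (real d) + 2 * K * L * L)" using n by linarith
    also have "\<dots> = (2 * K + 2 * K * ln E + 2 * K\<^sup>2 * ln E) * L * (ln (real d) + L)" by (simp add: algebra_simps)
    finally show ?thesis by simp
  qed
  also have "\<dots> = (real d / \<epsilon>) powr ((2 * K + 2 * K * ln E + 2 * K\<^sup>2 * ln E) * L)"
    using e dp L(2) by (simp add: powr_def ln_div)
  finally show "(E * (real d)\<^sup>2) ^ T * E ^ (2 * T * T) \<le> 1 * (real d / \<epsilon>) powr ((2 * K + 2 * K * ln E + 2 * K\<^sup>2 * ln E) * \<bar>ln \<epsilon>\<bar>)"
    by (simp add: L_def)
qed

text \<open>For \<open>d \<ge> 2\<close> the constant \<open>E\<close> is at most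
  \<open>d powr (ln E / ln 2)\<close>; for \<open>d = 1\<close> no power of \<open>d\<close> exceeds
  1.\<close>

lemma final_bounds_cos:
  assumes E: "1 \<le> E" and K: "0 < K" and T: "real T \<le> K * \<bar>ln \<epsilon>\<bar>" and d: "d \<ge> 2"
  shows "(E * (real d)\<^sup>2) ^ T \<le> real d powr (((ln E / ln 2 + 2) * K) * \<bar>ln \<epsilon>\<bar>)"
proof -
  have dp: "0 < real d" and ld: "ln 2 \<le> ln (real d)" using d by auto
  have lE: "0 \<le> ln E" using E by simp
  have l2: "(0::real) < ln 2" by simp
  have ld0: "0 \<le> ln (real d)" using ld l2 by linarith
  have "ln E = (ln E / ln 2) * ln 2" by simp
  also have "\<dots> \<le> (ln E / ln 2) * ln (real d)" using lE l2 by (intro mult_left_mono ld) auto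
  finally have a: "ln E + 2 * ln (real d) \<le> (ln E / ln 2 + 2) * ln (real d)" by (simp add: distrib_right)
  have "(E * (real d)\<^sup>2) ^ T = exp (real T * (ln E + 2 * ln (real d)))"
    using E dp by (simp add: power_exp_ln ln_mult ln_realpow)
  also have "\<dots> \<le> exp ((K * \<bar>ln \<epsilon>\<bar>) * ((ln E / ln 2 + 2) * ln (real d)))"
    using T a lE ld0 by (simp only: exp_le_cancel_iff, intro mult_mono) auto
  also have "\<dots> = real d powr (((ln E / ln 2 + 2) * K) * \<bar>ln \<epsilon>\<bar>)"
    using dp by (simp add: powr_def mult_ac)
  finally show ?thesis .
qed

lemma hyps_positive:
  assumes "Coeff d A c f amin amax cmin cmax" "Barron_Coeff \<sigma> d A c f RA Rc Rf lA lc lf"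
  shows "0 < amin \<and> 0 < cmin \<and> 0 < RA \<and> 0 < Rc \<and> 0 < Rf \<and> 0 \<le> lA \<and> 0 \<le> lc \<and> 0 \<le> lf"
  using assms by (simp add: Coeff_def Barron_Coeff_def)

lemma approximation_rate_general:
  fixes F amin amax cmin cmax RA Rc Rf lA lc lf Rm lm Rd1 Rd2 ld1 ld2 :: real
  shows "\<exists>(\<gamma>1::real) (\<gamma>2::real) (\<beta>1::real) (\<beta>2::real).
       \<forall>(d::nat) (\<sigma>::real \<Rightarrow> real) (A::vec \<Rightarrow> nat \<Rightarrow> nat \<Rightarrow> real)
        (c::vec \<Rightarrow> real) (f::vec \<Rightarrow> real) (us::vec \<Rightarrow> real).
         d \<ge> 1 \<longrightarrow>
         Coeff d A c f amin amax cmin cmax \<longrightarrow>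
         Act \<sigma> \<longrightarrow>
         Barron_Coeff \<sigma> d A c f RA Rc Rf lA lc lf \<longrightarrow>
         Mult \<sigma> Rm lm \<longrightarrow>
         Deriv \<sigma> Rd1 Rd2 ld1 ld2 \<longrightarrow>
         Hminus1_norm d f = F \<longrightarrow>
         weak_solution d A c f us \<longrightarrow>
         (\<forall>\<epsilon>::real. 0 < \<epsilon> \<and> \<epsilon> < 1/2 \<longrightarrow>
           (\<exists>R\<ge>0. \<exists>u\<in>barron_space \<sigma> 1 (ennreal R) d (euclid d).
              R \<le> \<gamma>1 * (1 / \<epsilon>) powr \<gamma>2 \<and>
              enn2real (barron_norm \<sigma> 1 (ennreal R) d (euclid d) u)
                \<le> \<beta>1 * (real d / \<epsilon>) powr (\<beta>2 * \<bar>ln \<epsilon>\<bar>) \<and>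
              (\<lambda>x. u x - us x) \<in> H1 d \<and>
              H1_norm d (\<lambda>x. u x - us x) \<le> \<epsilon>))"
\<comment> \<open>The constants precede all hypotheses. If the numbers have the wrong signs, no data
  satisfy the hypotheses and any constants do.\<close>
proof (cases "(0 < amin \<and> 0 < cmin \<and> 0 < RA \<and> 0 < Rc \<and> 0 < Rf \<and> 0 \<le> lA \<and> 0 \<le> lc \<and> 0 \<le> lf) \<and>
    0 < Rm \<and> 0 \<le> lm \<and> 0 < Rd1 \<and> 0 \<le> ld1")
  case False
  have no: False if "Coeff d A c f amin amax cmin cmax" "Barron_Coeff \<sigma> d A c f RA Rc Rf lA lc lf" "Mult \<sigma> Rm lm" "Deriv \<sigma> Rd1 Rd2 ld1 ld2"
    for d \<sigma> A c f
    using False hyps_positive[OF that(1,2)] that(3,4) by (simp add: Mult_def Deriv_def)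
  show ?thesis
    by (rule exI[of _ 0], rule exI[of _ 0], rule exI[of _ 0], rule exI[of _ 0], intro allI impI) (rule FalseE, erule (3) no)
next
  case True
  then have pos: "0 < amin" "0 < cmin" "0 < RA" "0 < Rc" "0 < Rf" "0 \<le> lA" "0 \<le> lc" "0 \<le> lf"
     "0 < Rm" "0 \<le> lm" "0 < Rd1" "0 \<le> ld1" by auto
  define m where m_eq: "m = min amin cmin"
  define M where M_eq: "M = lip amin amax cmin cmax"
  define \<rho> where "\<rho> = sqrt (1 - m\<^sup>2 / M\<^sup>2)"
  have m: "0 < m" using pos by (simp add: m_eq)
  have mM: "m \<le> M" by (simp add: m_eq M_eq lip_def)
  have \<rho>: "0 \<le> \<rho>" "\<rho> < 1"
  proof -
    have "m\<^sup>2 \<le> M\<^sup>2" using m mM by (intro power_mono) auto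
    moreover have "M\<^sup>2 > 0" using m mM by simp
    ultimately have "m\<^sup>2 / M\<^sup>2 \<le> 1" by (simp add: divide_le_eq_1)
    then show "0 \<le> \<rho>" by (simp add: \<rho>_def)
    have "m\<^sup>2 / M\<^sup>2 > 0" using m mM by simp
    then show "\<rho> < 1" by (simp add: \<rho>_def)
  qed
  \<comment> \<open>\<open>F\<close> is an arbitrary number at this point, hence the absolute
    value.\<close>
  obtain K where K: "K > 0" "\<And>\<epsilon>. 0 < \<epsilon> \<Longrightarrow> \<epsilon> < 1/2 \<Longrightarrow> \<exists>T. \<rho> ^ T * (\<bar>F\<bar> / m) \<le> \<epsilon> \<and> real T \<le> K * \<bar>ln \<epsilon>\<bar>"
    using iteration_count[OF \<rho>, of "\<bar>F\<bar> / m"] m by auto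
  define Lm where "Lm = lm + 1" define Ld where "Ld = ld1 + 1"
  define LA where "LA = lA + 1" define Lc where "Lc = lc + 1" define Lf where "Lf = lf + 1"
  have Lpos: "1 \<le> Lm" "1 \<le> Ld" "1 \<le> LA" "1 \<le> Lc" "1 \<le> Lf" using pos by (auto simp: Lm_def Ld_def LA_def Lc_def Lf_def)
  define fR where "fR = (\<lambda>R. Rm * (Rc + R) + Rf + Rd1 * (Rm * (RA + Rd1 * R)) + R)"
  define fl where "fl = (\<lambda>(d::nat) R l. Lm * (Lc * l) + Lf + real d * (Ld * ((Rm * (RA + Rd1 * R)) * (real d * (Lm * (LA * (Ld * (R * l))))))))"
  define KR where "KR = Rm * (Rc + 1) + Rf + Rd1 * (Rm * (RA + Rd1)) + 1"
  define \<alpha> where "\<alpha> = m / M\<^sup>2"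
  define k3 where "k3 = Ld * (Rm * (RA + Rd1)) * (Lm * (LA * Ld))"
  define Kl where "Kl = \<alpha> * (Lm * Lc + Lf + k3) + 2"
  have \<alpha>: "0 \<le> \<alpha>" using m by (simp add: \<alpha>_def)
  have k3: "0 \<le> k3" unfolding k3_def using pos Lpos by (intro mult_nonneg_nonneg) auto
  \<comment> \<open>One constant for both recursions: \<open>E / 2\<close> dominates the growth
    constant \<open>KR\<close> of the radii, and \<open>E\<close> the growth constant
    \<open>Kl\<close> of the norms.\<close>
  define E where "E = 2 * KR + Kl"
  have KR1: "1 \<le> KR" unfolding KR_def using pos by simp
  have Kl2: "2 \<le> Kl" unfolding Kl_def using \<alpha> k3 Lpos by (intro order_trans[OF _ add_mono[OF mult_nonneg_nonneg order_refl]]) auto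
  have E1: "1 \<le> E" using KR1 Kl2 by (simp add: E_def)
  have K2E: "KR \<le> E / 2" using Kl2 by (simp add: E_def)
  have fl_bound: "l + \<alpha> * fl d R l \<le> E * (real d)\<^sup>2 * (1 + R)\<^sup>2 * (1 + l) - 1"
    if d: "d \<ge> 1" and R: "0 \<le> R" and l: "0 \<le> l" for d :: nat and R l
  proof -
    \<comment> \<open>A common majorant for all terms of one step, chosen so that the recursion
      becomes multiplicative in \<open>1 + l\<close>.\<close>
    define X where "X = (real d)\<^sup>2 * (1 + R)\<^sup>2 * (1 + l)"
    have d1: "1 \<le> (real d)\<^sup>2" using d by simp
    have R1: "1 \<le> (1 + R)\<^sup>2" using R by simp
    have dR: "1 \<le> (real d)\<^sup>2 * (1 + R)\<^sup>2" using mult_mono[OF d1 R1] by simp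
    have Xl: "1 + l \<le> X" unfolding X_def using mult_right_mono[OF dR, of "1 + l"] l by simp
    have t1: "Lm * (Lc * l) \<le> Lm * Lc * X" unfolding mult.assoc[symmetric] using Xl l Lpos by (intro mult_left_mono) auto
    have t2: "Lf \<le> Lf * X" using mult_left_mono[of 1 X Lf] Xl l Lpos by simp
    have t3: "real d * (Ld * ((Rm * (RA + Rd1 * R)) * (real d * (Lm * (LA * (Ld * (R * l))))))) \<le> k3 * X"
    proof -
      have "RA + Rd1 * R \<le> (RA + Rd1) * (1 + R)" using pos R by (simp add: algebra_simps)
      then have "(RA + Rd1 * R) * (R * l) \<le> ((RA + Rd1) * (1 + R)) * ((1 + R) * (1 + l))"
        using pos R l by (intro mult_mono) auto
      also have "\<dots> = (RA + Rd1) * ((1 + R)\<^sup>2 * (1 + l))" by (simp add: power2_eq_square mult_ac)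
      finally have a: "(RA + Rd1 * R) * (R * l) \<le> (RA + Rd1) * ((1 + R)\<^sup>2 * (1 + l))" .
      have "(real d * real d * Ld * Rm * Lm * LA * Ld) * ((RA + Rd1 * R) * (R * l))
          \<le> (real d * real d * Ld * Rm * Lm * LA * Ld) * ((RA + Rd1) * ((1 + R)\<^sup>2 * (1 + l)))"
        using pos Lpos by (intro mult_left_mono[OF a] mult_nonneg_nonneg) auto
      then show ?thesis unfolding k3_def X_def by (simp add: power2_eq_square mult_ac)
    qed
    have "fl d R l \<le> Lm * Lc * X + Lf * X + k3 * X" unfolding fl_def using t1 t2 t3 by linarith
    then have "\<alpha> * fl d R l \<le> \<alpha> * ((Lm * Lc + Lf + k3) * X)" using \<alpha> by (intro mult_left_mono) (auto simp: distrib_right)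
    then have "l + \<alpha> * fl d R l + 1 \<le> X + \<alpha> * ((Lm * Lc + Lf + k3) * X)" using Xl by linarith
    also have "\<dots> \<le> Kl * X" using Xl l by (simp add: Kl_def algebra_simps)
    also have "\<dots> \<le> E * X" using KR1 Xl l by (intro mult_right_mono) (auto simp: E_def)
    finally show ?thesis by (simp add: X_def mult.assoc)
  qed
  have fRm: "R \<le> fR R" if "0 \<le> R" for R
  proof -
    have "0 \<le> Rm * (Rc + R)" "0 \<le> Rd1 * (Rm * (RA + Rd1 * R))" using pos that by (intro mult_nonneg_nonneg add_nonneg_nonneg; simp)+
    then show ?thesis using pos by (simp add: fR_def)
  qed
  define Rt where "Rt = rec_nat (0::real) (\<lambda>_. fR)"
  have Rt: "Rt 0 = 0" "Rt (Suc t) = fR (Rt t)" for t by (simp_all add: Rt_def)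
  have gR: "0 \<le> Rt t \<and> 1 + Rt t \<le> (2 * (E / 2)) ^ t" for t
  proof (rule growth_radius[of Rt Rm Rc Rf Rd1 RA])
    show "Rt (Suc t) = Rm * (Rc + Rt t) + Rf + Rd1 * (Rm * (RA + Rd1 * Rt t)) + Rt t" for t
      unfolding Rt(2) fR_def ..
    show "Rm * (Rc + 1) + Rf + Rd1 * (Rm * (RA + Rd1)) + 1 \<le> E / 2" using K2E unfolding KR_def .
  qed (use pos in \<open>simp_all add: Rt(1)\<close>)
  show ?thesis
  proof (rule exI[of _ 1], rule exI[of _ "K * ln E"], rule exI[of _ 1],
      rule exI[of _ "2 * K + 2 * K * ln E + 2 * K\<^sup>2 * ln E"], intro allI impI)
    fix d \<sigma> A c f us \<epsilon>
    assume d: "(d::nat) \<ge> 1" and co: "Coeff d A c f amin amax cmin cmax" and act: "Act \<sigma>"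
      and bc: "Barron_Coeff \<sigma> d A c f RA Rc Rf lA lc lf" and mu: "Mult \<sigma> Rm lm" and de: "Deriv \<sigma> Rd1 Rd2 ld1 ld2"
      and F: "Hminus1_norm d f = F" and sol: "weak_solution d A c f us" and e': "0 < \<epsilon> \<and> \<epsilon> < (1/2::real)"
    note e = conjunct1[OF e'] conjunct2[OF e']
    interpret barron_elliptic \<sigma> Rm "lm + 1" Rd1 "ld1 + 1" d A c f us amin amax cmin cmax RA Rc Rf "lA + 1" "lc + 1" "lf + 1"
      by (rule barron_elliptic_intro[OF barron_act_general[OF act mu de] co bc sol d])
    have mm: "elliptic.m amin cmin = m" "elliptic.M amin amax cmin cmax = M" 
      by (simp_all add: m_eq M_eq lip_def m_def M_def)
    have rr: "barron_elliptic.rho amin amax cmin cmax = \<rho>" by (simp add: rho_def \<rho>_def mm)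
    define lt where "lt = rec_nat (0::real) (\<lambda>t l. l + \<alpha> * fl d (Rt t) l)"
    have lt: "lt 0 = 0" "lt (Suc t) = lt t + \<alpha> * fl d (Rt t) (lt t)" for t by (simp_all add: lt_def)
    have stp: "\<exists>v. bar \<sigma> d (fR R) v (fl d R l) \<and> (\<forall>x\<in>euclid d. v x - (\<Sum>i<d. partial i (partial i v) x) = rhs u x)"
      if "bar \<sigma> d R u l" for R l u
      using general_step[OF that d] pos unfolding fR_def fl_def Lm_def Ld_def LA_def Lc_def Lf_def by auto
    have it: "\<exists>u. bar \<sigma> d (Rt t) u (lt t) \<and> u \<in> L2 d \<and> (\<forall>i<d. partial i u \<in> L2 d) \<and>
      H1_norm d (\<lambda>x. u x - us x) \<le> rho ^ t * (Hminus1_norm d f / local.m)" for t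
      by (rule iteration[where fR = fR and fl = "fl d" and Rt = Rt and lt = lt, OF stp fRm Rt lt(1)]) (simp_all add: lt(2) \<alpha>_def mm)
    have l0: "0 \<le> lt t" for t using it[of t] bar_l_nonneg by blast
    have gl: "1 + lt t \<le> (E * (real d)\<^sup>2) ^ t * E ^ (2 * t * t)" for t
    proof (rule growth_norm[where lt = lt and Rt = Rt])
      show "lt (Suc t) \<le> E * (real d)\<^sup>2 * (1 + Rt t)\<^sup>2 * (1 + lt t) - 1" for t
        unfolding lt(2) using gR[of t] by (intro fl_bound[OF d _ l0]) auto
      show "0 \<le> Rt t \<and> 1 + Rt t \<le> E ^ t" for t using gR[of t] by simp
    qed (rule lt(1) l0 E1 d)+
    obtain T where T: "\<rho> ^ T * (\<bar>F\<bar> / m) \<le> \<epsilon>" "real T \<le> K * \<bar>ln \<epsilon>\<bar>" using K(2)[OF e] by blast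
    obtain u where u: "bar \<sigma> d (Rt T) u (lt T)" "u \<in> L2 d" "\<And>i. i < d \<Longrightarrow> partial i u \<in> L2 d"
      and err: "H1_norm d (\<lambda>x. u x - us x) \<le> rho ^ T * (Hminus1_norm d f / local.m)" using it[of T] by blast
    have "F / m \<le> \<bar>F\<bar> / m" using m by (simp add: divide_right_mono)
    then have "rho ^ T * (Hminus1_norm d f / local.m) \<le> \<rho> ^ T * (\<bar>F\<bar> / m)"
      unfolding rr mm F using \<rho> by (intro mult_left_mono) auto
    then have err': "H1_norm d (\<lambda>x. u x - us x) \<le> \<epsilon>" using err T(1) by linarith
    note fb = final_bounds_general[OF E1 K(1) T(2) e d]
    show "\<exists>R\<ge>0. \<exists>u\<in>barron_space \<sigma> 1 (ennreal R) d (euclid d).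
              R \<le> 1 * (1 / \<epsilon>) powr (K * ln E) \<and>
              enn2real (barron_norm \<sigma> 1 (ennreal R) d (euclid d) u)
                \<le> 1 * (real d / \<epsilon>) powr ((2 * K + 2 * K * ln E + 2 * K\<^sup>2 * ln E) * \<bar>ln \<epsilon>\<bar>) \<and>
              (\<lambda>x. u x - us x) \<in> H1 d \<and> H1_norm d (\<lambda>x. u x - us x) \<le> \<epsilon>"
    proof (rule conclude[OF u(1) _ _ H1_rep_H1[OF error_H1[OF u]] err'])
      show "Rt T \<le> 1 * (1 / \<epsilon>) powr (K * ln E)" using gR[of T] fb(1) by simp
      show "lt T \<le> 1 * (real d / \<epsilon>) powr ((2 * K + 2 * K * ln E + 2 * K\<^sup>2 * ln E) * \<bar>ln \<epsilon>\<bar>)"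
        using gl[of T] fb(2) by linarith
    qed
  qed
qed

lemma nsq_add:
  assumes "H1_rep d e p" "H1_rep d e' p'"
  shows "nsq d (\<lambda>x. e x + e' x) (\<lambda>i x. p i x + p' i x) \<le> 2 * nsq d e p + 2 * nsq d e' p'"
proof -
  have s2: "(r + s)\<^sup>2 \<le> 2 * r\<^sup>2 + 2 * s\<^sup>2" for r s :: real
    using sum_squares_bound[of r s] by (simp add: power2_sum)
  have rep: "H1_rep d (\<lambda>x. e x + e' x) (\<lambda>i x. p i x + p' i x)" using H1_rep_lin[OF assms, of 1] by simp
  have "nsq d (\<lambda>x. e x + e' x) (\<lambda>i x. p i x + p' i x)
      \<le> (\<integral>x. 2 * ((e x)\<^sup>2 + (\<Sum>i<d. (p i x)\<^sup>2)) + 2 * ((e' x)\<^sup>2 + (\<Sum>i<d. (p' i x)\<^sup>2)) \<partial>leb d)"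
    unfolding nsq_def
  proof (rule integral_mono[OF H1_rep_integrable[OF rep]])
    show "integrable (leb d) (\<lambda>x. 2 * ((e x)\<^sup>2 + (\<Sum>i<d. (p i x)\<^sup>2)) + 2 * ((e' x)\<^sup>2 + (\<Sum>i<d. (p' i x)\<^sup>2)))"
      by (intro Bochner_Integration.integrable_add integrable_mult_right H1_rep_integrable assms)
    fix x
    have "(\<Sum>i<d. (p i x + p' i x)\<^sup>2) \<le> (\<Sum>i<d. 2 * (p i x)\<^sup>2 + 2 * (p' i x)\<^sup>2)" by (intro sum_mono s2)
    then show "(e x + e' x)\<^sup>2 + (\<Sum>i<d. (p i x + p' i x)\<^sup>2) \<le> 2 * ((e x)\<^sup>2 + (\<Sum>i<d. (p i x)\<^sup>2)) + 2 * ((e' x)\<^sup>2 + (\<Sum>i<d. (p' i x)\<^sup>2))"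
      using s2[of "e x" "e' x"] by (simp add: sum.distrib sum_distrib_left[symmetric])
  qed
  also have "\<dots> = 2 * nsq d e p + 2 * nsq d e' p'"
    unfolding nsq_def
    by (simp only: Bochner_Integration.integral_add[OF integrable_mult_right[OF H1_rep_integrable[OF assms(1)], of 2]
          integrable_mult_right[OF H1_rep_integrable[OF assms(2)], of 2]] integral_mult_right_zero)
  finally show ?thesis .
qed

lemma approximation_rate_cos:
  fixes F amin amax cmin cmax RA Rc Rf lA lc lf :: real
  shows "\<exists>(\<gamma>1'::real) (\<beta>1'::real) (\<beta>2'::real).
       \<forall>(d::nat) (\<sigma>::real \<Rightarrow> real) (A::vec \<Rightarrow> nat \<Rightarrow> nat \<Rightarrow> real)
        (c::vec \<Rightarrow> real) (f::vec \<Rightarrow> real) (us::vec \<Rightarrow> real)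
        (Rm::real) (lm::real) (Rd1::real) (Rd2::real) (ld1::real) (ld2::real).
         d \<ge> 1 \<longrightarrow>
         Coeff d A c f amin amax cmin cmax \<longrightarrow>
         Act \<sigma> \<longrightarrow>
         Barron_Coeff \<sigma> d A c f RA Rc Rf lA lc lf \<longrightarrow>
         Mult \<sigma> Rm lm \<longrightarrow>
         Deriv \<sigma> Rd1 Rd2 ld1 ld2 \<longrightarrow>
         Hminus1_norm d f = F \<longrightarrow>
         weak_solution d A c f us \<longrightarrow>
         \<sigma> = cos \<longrightarrow>
         (\<forall>\<epsilon>::real. 0 < \<epsilon> \<and> \<epsilon> < 1/2 \<longrightarrow>
           (\<exists>R\<ge>0. \<exists>u\<in>barron_space \<sigma> 1 (ennreal R) d (euclid d).
              R \<le> \<gamma>1' * \<bar>ln \<epsilon>\<bar> \<and>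
              enn2real (barron_norm \<sigma> 1 (ennreal R) d (euclid d) u)
                \<le> \<beta>1' * real d powr (\<beta>2' * \<bar>ln \<epsilon>\<bar>) \<and>
              (\<lambda>x. u x - us x) \<in> H1 d \<and>
              H1_norm d (\<lambda>x. u x - us x) \<le> \<epsilon>))"
proof (cases "0 < amin \<and> 0 < cmin \<and> 0 < RA \<and> 0 < Rc \<and> 0 < Rf \<and> 0 \<le> lA \<and> 0 \<le> lc \<and> 0 \<le> lf")
  case False
  have no: False if "Coeff d A c f amin amax cmin cmax" "Barron_Coeff \<sigma> d A c f RA Rc Rf lA lc lf" for d \<sigma> A c f
    using False hyps_positive[OF that] by simp
  show ?thesis
    by (rule exI[of _ 0], rule exI[of _ 0], rule exI[of _ 0], intro allI impI) (rule FalseE, erule (1) no)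
next
  case True
  then have pos: "0 < amin" "0 < cmin" "0 < RA" "0 < Rc" "0 < Rf" "0 \<le> lA" "0 \<le> lc" "0 \<le> lf" by auto
  define m where m_eq: "m = min amin cmin"
  define M where M_eq: "M = lip amin amax cmin cmax"
  define \<rho> where "\<rho> = sqrt (1 - m\<^sup>2 / M\<^sup>2)"
  have m: "0 < m" using pos by (simp add: m_eq)
  have mM: "m \<le> M" by (simp add: m_eq M_eq lip_def)
  have \<rho>: "0 \<le> \<rho>" "\<rho> < 1"
  proof -
    have "m\<^sup>2 \<le> M\<^sup>2" using m mM by (intro power_mono) auto
    moreover have "M\<^sup>2 > 0" using m mM by simp
    ultimately have "m\<^sup>2 / M\<^sup>2 \<le> 1" by (simp add: divide_le_eq_1)
    then show "0 \<le> \<rho>" by (simp add: \<rho>_def)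
    have "m\<^sup>2 / M\<^sup>2 > 0" using m mM by simp
    then show "\<rho> < 1" by (simp add: \<rho>_def)
  qed
  define B where "B = \<bar>F\<bar> / m"
  have B0: "0 \<le> B" using m by (simp add: B_def)
  \<comment> \<open>With \<open>2 * B\<close> in place of \<open>B\<close> the iterate comes within
    \<open>\<epsilon> / 2\<close> of \<open>us\<close>; the other half is reserved for the taper in
    dimension 1.\<close>
  obtain K where K: "K > 0" "\<And>\<epsilon>. 0 < \<epsilon> \<Longrightarrow> \<epsilon> < 1/2 \<Longrightarrow> \<exists>T. \<rho> ^ T * (2 * B) \<le> \<epsilon> \<and> real T \<le> K * \<bar>ln \<epsilon>\<bar>"
    using iteration_count[OF \<rho>, of "2 * B"] B0 by auto
  define LA where "LA = lA + 1" define Lc where "Lc = lc + 1" define Lf where "Lf = lf + 1"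
  have Lpos: "1 \<le> LA" "1 \<le> Lc" "1 \<le> Lf" using pos by (auto simp: LA_def Lc_def Lf_def)
  define Sg where "Sg = RA + Rc + Rf"
  have Sg: "0 \<le> Sg" using pos by (simp add: Sg_def)
  define fl where "fl = (\<lambda>(d::nat) (R::real) l. Lc * l + Lf + real d * (real d * ((1 + RA) * (LA * l))))"
  define \<alpha> where "\<alpha> = m / M\<^sup>2"
  have \<alpha>: "0 \<le> \<alpha>" using m by (simp add: \<alpha>_def)
  define E where "E = \<alpha> * (Lc + Lf + (1 + RA) * LA) + 1"
  have E1: "1 \<le> E" unfolding E_def using \<alpha> pos Lpos by simp
  have fl_bound: "1 + (l + \<alpha> * fl d R l) \<le> E * (real d)\<^sup>2 * (1 + l)"
    if d: "d \<ge> 1" and l: "0 \<le> l" for d :: nat and R l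
  proof -
    define X where "X = (real d)\<^sup>2 * (1 + l)"
    have d1: "1 \<le> (real d)\<^sup>2" using d by simp
    have Xl: "1 + l \<le> X" unfolding X_def using mult_right_mono[OF d1, of "1 + l"] l by simp
    have t1: "Lc * l \<le> Lc * X" using Xl l Lpos by (intro mult_left_mono) auto
    have t2: "Lf \<le> Lf * X" using mult_left_mono[of 1 X Lf] Xl l Lpos by simp
    have "((1 + RA) * LA * (real d)\<^sup>2) * l \<le> ((1 + RA) * LA * (real d)\<^sup>2) * (1 + l)"
      using pos Lpos by (intro mult_left_mono mult_nonneg_nonneg) auto
    then have t3: "real d * (real d * ((1 + RA) * (LA * l))) \<le> (1 + RA) * LA * X"
      by (simp add: X_def power2_eq_square mult_ac)
    have "fl d R l \<le> (Lc + Lf + (1 + RA) * LA) * X" unfolding fl_def distrib_right[of _ _ X] using t1 t2 t3 by linarith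
    then have "\<alpha> * fl d R l \<le> \<alpha> * ((Lc + Lf + (1 + RA) * LA) * X)" using \<alpha> by (rule mult_left_mono)
    then have "1 + (l + \<alpha> * fl d R l) \<le> X + \<alpha> * ((Lc + Lf + (1 + RA) * LA) * X)" using Xl by linarith
    also have "\<dots> = E * X" by (simp add: E_def algebra_simps)
    finally show ?thesis by (simp add: X_def mult.assoc)
  qed
  define Rt where "Rt = (\<lambda>t::nat. real t * Sg)"
  have Rt: "Rt 0 = 0" "Rt (Suc t) = Rt t + Sg" for t by (simp_all add: Rt_def algebra_simps)
  define W where "W = (\<integral>\<xi>. wt1 1 \<xi> \<partial>lborel)"
  have W0: "0 \<le> W" unfolding W_def by (intro integral_nonneg_AE AE_I2) (simp add: less_imp_le wt1_pos)
  show ?thesis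
  \<comment> \<open>The summand 2 in the first constant absorbs the increase of the radius by 1
    under tapering. The second constant bounds \<open>W\<close> plus the squared H1 norm of the
    tapered iterate, since \<open>us\<close> has norm at most \<open>B\<close> and
    \<open>\<epsilon> \<le> 1\<close>.\<close>
  proof (rule exI[of _ "K * Sg + 2"], rule exI[of _ "W + 2 * B\<^sup>2 + 2"], rule exI[of _ "(ln E / ln 2 + 2) * K"], intro allI impI)
    fix d \<sigma> A c f us \<epsilon> Rm lm Rd1 Rd2 ld1 ld2
    assume d: "(d::nat) \<ge> 1" and co: "Coeff d A c f amin amax cmin cmax"
      and bc': "Barron_Coeff \<sigma> d A c f RA Rc Rf lA lc lf"
      and F: "Hminus1_norm d f = F" and sol: "weak_solution d A c f us" and \<sigma>: "\<sigma> = cos"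
      and e': "0 < \<epsilon> \<and> \<epsilon> < (1/2::real)"
    note e = conjunct1[OF e'] conjunct2[OF e'] and bc = bc'[unfolded \<sigma>]
    have be: "barron_elliptic cos 1 1 1 1 d A c f us amin amax cmin cmax RA Rc Rf LA Lc Lf"
      unfolding LA_def Lc_def Lf_def by (rule barron_elliptic_intro[OF barron_act_cos co bc sol d])
    interpret barron_elliptic cos 1 1 1 1 d A c f us amin amax cmin cmax RA Rc Rf LA Lc Lf by (rule be)
    have mm: "elliptic.m amin cmin = m" "elliptic.M amin amax cmin cmax = M"
      by (simp_all add: m_eq M_eq lip_def m_def M_def)
    have rr: "barron_elliptic.rho amin amax cmin cmax = \<rho>" by (simp add: rho_def \<rho>_def mm)
    define lt where "lt = rec_nat (0::real) (\<lambda>t l. l + \<alpha> * fl d (Rt t) l)"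
    have lt: "lt 0 = 0" "lt (Suc t) = lt t + \<alpha> * fl d (Rt t) (lt t)" for t by (simp_all add: lt_def)
    have stp: "\<exists>v. bar cos d (R + Sg) v (fl d R l) \<and> (\<forall>x\<in>euclid d. v x - (\<Sum>i<d. partial i (partial i v) x) = rhs u x)"
      if "bar cos d R u l" for R l u
      using cos_step[OF be that] pos Lpos unfolding Sg_def fl_def by auto
    have it: "\<exists>u. bar cos d (Rt t) u (lt t) \<and> u \<in> L2 d \<and> (\<forall>i<d. partial i u \<in> L2 d) \<and>
      H1_norm d (\<lambda>x. u x - us x) \<le> rho ^ t * (Hminus1_norm d f / local.m)" for t
      by (rule iteration[where fR = "\<lambda>R. R + Sg" and fl = "fl d" and Rt = Rt and lt = lt, OF stp _ Rt lt(1)]) (simp_all add: lt(2) \<alpha>_def mm Sg)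
    have l0: "0 \<le> lt t" for t using it[of t] bar_l_nonneg by blast
    have gl: "1 + lt t \<le> (E * (real d)\<^sup>2) ^ t" for t
    proof (induction t)
      case (Suc t)
      have "1 + lt (Suc t) \<le> E * (real d)\<^sup>2 * (1 + lt t)" unfolding lt(2) by (rule fl_bound[OF d l0])
      also have "\<dots> \<le> E * (real d)\<^sup>2 * (E * (real d)\<^sup>2) ^ t" using Suc E1 by (intro mult_left_mono) auto
      finally show ?case by simp
    qed (simp add: lt)
    obtain T where T: "\<rho> ^ T * (2 * B) \<le> \<epsilon>" "real T \<le> K * \<bar>ln \<epsilon>\<bar>" using K(2)[OF e] by blast
    obtain u where u: "bar cos d (Rt T) u (lt T)" "u \<in> L2 d" "\<And>i. i < d \<Longrightarrow> partial i u \<in> L2 d"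
      and err: "H1_norm d (\<lambda>x. u x - us x) \<le> rho ^ T * (Hminus1_norm d f / local.m)" using it[of T] by blast
    have FB: "F / m \<le> B" unfolding B_def using m by (simp add: divide_right_mono)
    then have "rho ^ T * (Hminus1_norm d f / local.m) \<le> \<rho> ^ T * B"
      unfolding rr mm F using \<rho> by (intro mult_left_mono) auto
    then have err': "H1_norm d (\<lambda>x. u x - us x) \<le> \<epsilon> / 2" using err T(1) by simp
    have RT: "Rt T \<le> K * Sg * \<bar>ln \<epsilon>\<bar>" using mult_right_mono[OF T(2) Sg] by (simp add: Rt_def mult_ac)
    have L: "1 \<le> 2 * \<bar>ln \<epsilon>\<bar>" using abs_ln_ge[OF e] by simp
    show "\<exists>R\<ge>0. \<exists>u\<in>barron_space \<sigma> 1 (ennreal R) d (euclid d).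
              R \<le> (K * Sg + 2) * \<bar>ln \<epsilon>\<bar> \<and>
              enn2real (barron_norm \<sigma> 1 (ennreal R) d (euclid d) u)
                \<le> (W + 2 * B\<^sup>2 + 2) * real d powr ((ln E / ln 2 + 2) * K * \<bar>ln \<epsilon>\<bar>) \<and>
              (\<lambda>x. u x - us x) \<in> H1 d \<and> H1_norm d (\<lambda>x. u x - us x) \<le> \<epsilon>"
    proof (cases "d = 1")
      case False
      then have d2: "d \<ge> 2" using d by simp
      note fb = final_bounds_cos[OF E1 K(1) T(2) d2]
      show ?thesis unfolding \<sigma>
      proof (rule conclude[OF u(1) _ _ H1_rep_H1[OF error_H1[OF u]]])
        show "Rt T \<le> (K * Sg + 2) * \<bar>ln \<epsilon>\<bar>" using RT by (simp add: distrib_right)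
        have "lt T \<le> 1 * real d powr ((ln E / ln 2 + 2) * K * \<bar>ln \<epsilon>\<bar>)" using gl[of T] fb by simp
        also have "\<dots> \<le> (W + 2 * B\<^sup>2 + 2) * real d powr ((ln E / ln 2 + 2) * K * \<bar>ln \<epsilon>\<bar>)"
          using W0 by (intro mult_right_mono) auto
        finally show "lt T \<le> (W + 2 * B\<^sup>2 + 2) * real d powr ((ln E / ln 2 + 2) * K * \<bar>ln \<epsilon>\<bar>)" .
        show "H1_norm d (\<lambda>x. u x - us x) \<le> \<epsilon>" using err' e by simp
      qed
    next
      \<comment> \<open>Every power of \<open>d\<close> is 1 here, so the bound \<open>E^T\<close>
        on the iterate is discarded in favour of one by the H1 norm of its tapered version, which
        stays close to that of \<open>us\<close>.\<close>
      case True
      have e2: "(\<epsilon> / 2)\<^sup>2 > 0" using e by simp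
      have uL: "partial 0 u \<in> L2 1" using u(3)[of 0] True by simp
      obtain v where v: "bar cos 1 (Rt T + 1) v (W + nsq 1 v (\<lambda>i. partial i v))"
        and vL: "v \<in> L2 1" "partial 0 v \<in> L2 1" and vu: "nsq 1 (\<lambda>x. v x - u x) (\<lambda>i x. partial i v x - partial i u x) \<le> (\<epsilon> / 2)\<^sup>2"
        using band_limited_approx[OF u(1,2)[unfolded True] uL e2] unfolding W_def by blast
      have ur: "H1_rep 1 u (\<lambda>i. partial i u)"
        using H1_rep_smooth[OF bar_smooth[OF u(1)] u(2,3)] True by simp
      have vr: "H1_rep 1 v (\<lambda>i. partial i v)"
        by (rule H1_rep_smooth[OF bar_smooth[OF v] vL(1)]) (use vL in auto)
      have vur: "H1_rep 1 (\<lambda>x. v x - u x) (\<lambda>i x. partial i v x - partial i u x)"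
        using H1_rep_lin[OF vr ur, of "-1"] by simp
      let ?w = "\<lambda>i. wpartial d i us"
      have er: "H1_rep 1 (\<lambda>x. u x - us x) (\<lambda>i x. partial i u x - ?w i x)" using error_H1[OF u] True by simp
      have sr: "H1_rep 1 us ?w" using sol_rep True by simp
      have sq: "nsq 1 w p \<le> b\<^sup>2" if "H1_rep 1 w p" "H1_norm 1 w \<le> b" for w p b
        using that(2) H1_norm_nsq[OF that(1)] nsq_nonneg[of 1 w p] by (simp add: real_sqrt_le_iff sqrt_le_D)
      have n1: "nsq 1 (\<lambda>x. u x - us x) (\<lambda>i x. partial i u x - ?w i x) \<le> (\<epsilon> / 2)\<^sup>2"
        by (rule sq[OF er]) (use err' True in simp)
      have vsr: "H1_rep 1 (\<lambda>x. v x - us x) (\<lambda>i x. partial i v x - ?w i x)"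
        using H1_rep_lin[OF vr sr, of "-1"] by simp
      \<comment> \<open>Two errors of size \<open>\<epsilon> / 2\<close> in squared form:
        \<open>2 (\<epsilon> / 2)^2 + 2 (\<epsilon> / 2)^2 = \<epsilon>^2\<close>.\<close>
      have n2: "nsq 1 (\<lambda>x. v x - us x) (\<lambda>i x. partial i v x - ?w i x) \<le> \<epsilon>\<^sup>2"
        using nsq_add[OF vur er] vu n1 by (simp add: power_divide)
      have ub: "H1_norm d us \<le> F / m" using sol_bound by (simp add: mm F)
      have n3: "nsq 1 us ?w \<le> B\<^sup>2"
        by (rule sq[OF sr]) (use ub FB True in simp)
      have n4: "nsq 1 v (\<lambda>i. partial i v) \<le> 2 * \<epsilon>\<^sup>2 + 2 * B\<^sup>2"
        using nsq_add[OF vsr sr] n2 n3 by simp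
      have "\<epsilon>\<^sup>2 \<le> 1" using e power_mono[of \<epsilon> 1 2] by simp
      with n4 have lv: "W + nsq 1 v (\<lambda>i. partial i v) \<le> W + 2 * B\<^sup>2 + 2" by linarith
      show ?thesis unfolding \<sigma>
      proof (rule conclude[where u = v])
        show "bar cos d (Rt T + 1) v (W + nsq 1 v (\<lambda>i. partial i v))" using v True by simp
        show "Rt T + 1 \<le> (K * Sg + 2) * \<bar>ln \<epsilon>\<bar>" using RT L by (simp add: distrib_right)
        show "W + nsq 1 v (\<lambda>i. partial i v) \<le> (W + 2 * B\<^sup>2 + 2) * real d powr ((ln E / ln 2 + 2) * K * \<bar>ln \<epsilon>\<bar>)"
          using lv True by simp
        show "(\<lambda>x. v x - us x) \<in> H1 d" using H1_rep_H1[OF vsr] True by simp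
        have "H1_norm 1 (\<lambda>x. v x - us x) \<le> sqrt (\<epsilon>\<^sup>2)" unfolding H1_norm_nsq[OF vsr] using n2 by (rule real_sqrt_le_mono)
        then show "H1_norm d (\<lambda>x. v x - us x) \<le> \<epsilon>" using e True by simp
      qed
    qed
  qed
qed

theorem theorem2p9:
  shows
    "(\<forall>(F::real) (amin::real) (amax::real) (cmin::real) (cmax::real)
       (RA::real) (Rc::real) (Rf::real) (lA::real) (lc::real) (lf::real)
       (Rm::real) (lm::real) (Rd1::real) (Rd2::real) (ld1::real) (ld2::real).
       \<exists>(\<gamma>1::real) (\<gamma>2::real) (\<beta>1::real) (\<beta>2::real).
       \<forall>(d::nat) (\<sigma>::real \<Rightarrow> real) (A::vec \<Rightarrow> nat \<Rightarrow> nat \<Rightarrow> real)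
        (c::vec \<Rightarrow> real) (f::vec \<Rightarrow> real) (us::vec \<Rightarrow> real).
         d \<ge> 1 \<longrightarrow>
         Coeff d A c f amin amax cmin cmax \<longrightarrow>
         Act \<sigma> \<longrightarrow>
         Barron_Coeff \<sigma> d A c f RA Rc Rf lA lc lf \<longrightarrow>
         Mult \<sigma> Rm lm \<longrightarrow>
         Deriv \<sigma> Rd1 Rd2 ld1 ld2 \<longrightarrow>
         Hminus1_norm d f = F \<longrightarrow>
         weak_solution d A c f us \<longrightarrow>
         (\<forall>\<epsilon>::real. 0 < \<epsilon> \<and> \<epsilon> < 1/2 \<longrightarrow>
           (\<exists>R\<ge>0. \<exists>u\<in>barron_space \<sigma> 1 (ennreal R) d (euclid d).
              R \<le> \<gamma>1 * (1 / \<epsilon>) powr \<gamma>2 \<and>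
              enn2real (barron_norm \<sigma> 1 (ennreal R) d (euclid d) u)
                \<le> \<beta>1 * (real d / \<epsilon>) powr (\<beta>2 * \<bar>ln \<epsilon>\<bar>) \<and>
              (\<lambda>x. u x - us x) \<in> H1 d \<and>
              H1_norm d (\<lambda>x. u x - us x) \<le> \<epsilon>)))
   \<and>
     (\<forall>(F::real) (amin::real) (amax::real) (cmin::real) (cmax::real)
       (RA::real) (Rc::real) (Rf::real) (lA::real) (lc::real) (lf::real).
       \<exists>(\<gamma>1'::real) (\<beta>1'::real) (\<beta>2'::real).
       \<forall>(d::nat) (\<sigma>::real \<Rightarrow> real) (A::vec \<Rightarrow> nat \<Rightarrow> nat \<Rightarrow> real)
        (c::vec \<Rightarrow> real) (f::vec \<Rightarrow> real) (us::vec \<Rightarrow> real)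
        (Rm::real) (lm::real) (Rd1::real) (Rd2::real) (ld1::real) (ld2::real).
         d \<ge> 1 \<longrightarrow>
         Coeff d A c f amin amax cmin cmax \<longrightarrow>
         Act \<sigma> \<longrightarrow>
         Barron_Coeff \<sigma> d A c f RA Rc Rf lA lc lf \<longrightarrow>
         Mult \<sigma> Rm lm \<longrightarrow>
         Deriv \<sigma> Rd1 Rd2 ld1 ld2 \<longrightarrow>
         Hminus1_norm d f = F \<longrightarrow>
         weak_solution d A c f us \<longrightarrow>
         \<sigma> = cos \<longrightarrow>
         (\<forall>\<epsilon>::real. 0 < \<epsilon> \<and> \<epsilon> < 1/2 \<longrightarrow>
           (\<exists>R\<ge>0. \<exists>u\<in>barron_space \<sigma> 1 (ennreal R) d (euclid d).
              R \<le> \<gamma>1' * \<bar>ln \<epsilon>\<bar> \<and>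
              enn2real (barron_norm \<sigma> 1 (ennreal R) d (euclid d) u)
                \<le> \<beta>1' * real d powr (\<beta>2' * \<bar>ln \<epsilon>\<bar>) \<and>
              (\<lambda>x. u x - us x) \<in> H1 d \<and>
              H1_norm d (\<lambda>x. u x - us x) \<le> \<epsilon>)))"
  by (intro conjI allI approximation_rate_general approximation_rate_cos)

end
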